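(* Let $T>0$, $\alpha,\beta\in[0,1]$, $\kappa>0$, $\theta\in\mathbb{R}$. Let $g:[0,1]\to[0,1]$ be a measurable function and let $\{\mu_N\}_{N\ge 1}$ be a sequence of probability measures, $\mu_N$ on $\Omega_N=\{0,1\}^{\{1,\dots,N-1\}}$, associated to $g$. Let $\{\eta_{tN^2}: t\ge 0\}$ be the symmetric simple exclusion process with reservoirs, i.e. the Markov process on $\Omega_N$ with generator $N^2\mathcal{L}_N$ (defined in the context), started from $\mu_N$, with law $\mathbb{P}_{\mu_N}$. Then, for any $t\in[0,T]$, any continuous $G:[0,1]\to\mathbb{R}$ and any $\delta>0$, $$\lim_{N\to\infty}\mathbb{P}_{\mu_N}\Big(\Big|\frac{1}{N-1}\sum_{x=1}^{N-1}G\big(\tfrac xN\big)\eta_{tN^2}(x)-\int_0^1 G(q)\rho_t(q)\,dq\Big|>\delta\Big)=0,$$ where $\rho_t(\cdot)$ is the unique weak solution, starting from $g$, of: - the heat equation with Dirichlet boundary conditions in the sense (Dir-c), if $\theta<0$; - the heat equation with Dirichlet boundary conditions in the sense (Dir-0), if $\theta\in[0,1)$; - the heat equation with Robin boundary conditions (Rob) with parameter $\kappa$, if $\theta=1$; - (Rob) with the parameter $\kappa$ in the equation replaced by $0$ (Neumann boundary conditions), if $\theta>1$.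
   Context: **Process.** $\Lambda_N=\{1,\dots,N-1\}$, $\Omega_N=\{0,1\}^{\Lambda_N}$. For $f:\Omega_N\to\mathbb{R}$, $\mathcal{L}_N=\mathcal{L}_{N,0}+\mathcal{L}_{N,b}$ with $$(\mathcal{L}_{N,0}f)(\eta)=\sum_{x=1}^{N-2}\tfrac12\big(f(\eta^{x,x+1})-f(\eta)\big),\qquad (\mathcal{L}_{N,b}f)(\eta)=\sum_{x\in\{1,N-1\}}\frac{\kappa}{N^\theta}c_x(\eta;r(x))\big(f(\eta^x)-f(\eta)\big),$$ where $r(1)=\alpha$, $r(N-1)=\beta$, $c_x(\eta;r)=\frac12[\eta(x)(1-r)+(1-\eta(x))r]$, $\eta^{x,y}$ is $\eta$ with the values at $x$ and $y$ exchanged, and $\eta^x$ is $\eta$ with $\eta(x)$ replaced by $1-\eta(x)$. **Associated measures.** $\{\mu_N\}$ is associated to a measurable profile $g:[0,1]\to[0,1]$ if for every continuous $G:[0,1]\to\mathbb{R}$ and $\delta>0$, $\lim_{N\to\infty}\mu_N\big(\eta:|\frac{1}{N-1}\sum_{x\in\Lambda_N}G(\frac xN)\eta(x)-\int_0^1G(q)g(q)dq|>\delta\big)=0$. **Function spaces.** $\mathcal{H}^1$ is the usual Sobolev space on $[0,1]$ with norm $\|f\|_{\mathcal{H}^1}^2=\|f\|_{L^2}^2+\|\partial_q f\|_{L^2}^2$ (elements identified with their continuous representatives). $L^2(0,T;\mathcal{H}^1)$ is the set of measurable $f:[0,T]\to\mathcal{H}^1$ with $\int_0^T\|f_s\|^2_{\mathcal{H}^1}ds<\infty$.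 $C^{1,2}([0,T]\times[0,1])$: functions $G_s(q)$ which are $C^1$ in time and $C^2$ in space; $C^{1,2}_0$: those with $G_s(0)=G_s(1)=0$ for all $s$; $C^{1,2}_c$: those such that for any $s$, $G_s$ has compact support included in $(0,1)$. $\Delta=\partial_q^2$. **Weak solutions** $\rho:[0,T]\times[0,1]\to[0,1]$ starting from $g$: (Dir-0) (for $\partial_t\rho=\frac12\Delta\rho$, $\rho_t(0)=\alpha$, $\rho_t(1)=\beta$): $\rho\in L^2(0,T;\mathcal{H}^1)$ and, for all $t\in[0,T]$ and $G\in C^{1,2}_0([0,T]\times[0,1])$, $$\int_0^1\rho_tG_t\,dq-\int_0^1gG_0\,dq-\int_0^t\!\int_0^1\rho_s\big(\tfrac12\Delta+\partial_s\big)G_s\,dq\,ds+\int_0^t\Big\{\tfrac\beta2\partial_qG_s(1)-\tfrac\alpha2\partial_qG_s(0)\Big\}ds=0.$$ (Dir-c) (for the same equation): $\rho\in L^2(0,T;\mathcal{H}^1)$; for all $t\in[0,T]$ and $G\in C^{1,2}_c([0,T]\times[0,1])$, $$\int_0^1\rho_tG_t\,dq-\int_0^1gG_0\,dq-\int_0^t\!\int_0^1\rho_s\big(\tfrac12\Delta+\partial_s\big)G_s\,dq\,ds=0;$$ and $\rho_t(0)=\alpha$, $\rho_t(1)=\beta$ for all $t\in(0,T]$. (Rob) (for $\partial_t\rho=\frac12\Delta\rho$, $\partial_q\rho_t(0)=\kappa(\rho_t(0)-\alpha)$, $\partial_q\rho_t(1)=\kappa(\beta-\rho_t(1))$): $\rho\in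 L^2(0,T;\mathcal{H}^1)$ and, for all $t\in[0,T]$ and $G\in C^{1,2}([0,T]\times[0,1])$, $$\int_0^1\rho_tG_t\,dq-\int_0^1gG_0\,dq-\int_0^t\!\int_0^1\rho_s\big(\tfrac12\Delta+\partial_s\big)G_s\,dq\,ds+\tfrac12\int_0^t\{\rho_s(1)\partial_qG_s(1)-\rho_s(0)\partial_qG_s(0)\}ds$$ $$-\tfrac\kappa2\int_0^t\{G_s(0)(\alpha-\rho_s(0))+G_s(1)(\beta-\rho_s(1))\}ds=0.$$ *)

theory Defs
  imports "HOL-Probability.Probability"
begin

definition sites :: "nat \<Rightarrow> nat set" where
  "sites N = {1..N - 1}"

type_synonym config = "nat \<Rightarrow> real"

text \<open>Occupation numbers are kept in the real set \<open>{0, 1}\<close> to avoid coercions.\<close>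

definition configs :: "nat \<Rightarrow> config set" where
  "configs N = sites N \<rightarrow>\<^sub>E {0, 1}"

definition exchange :: "nat \<Rightarrow> nat \<Rightarrow> config \<Rightarrow> config" where
  "exchange x y \<eta> = \<eta>(x := \<eta> y, y := \<eta> x)"

definition flip :: "nat \<Rightarrow> config \<Rightarrow> config" where
  "flip x \<eta> = \<eta>(x := 1 - \<eta> x)"

definition bulk_generator :: "nat \<Rightarrow> (config \<Rightarrow> real) \<Rightarrow> config \<Rightarrow> real" where
  "bulk_generator N f \<eta> = (\<Sum>x = 1..N - 2. 1 / 2 * (f (exchange x (x + 1) \<eta>) - f \<eta>))"

definition boundary_rate :: "nat \<Rightarrow> config \<Rightarrow> real \<Rightarrow> real" where
  "boundary_rate x \<eta> r = 1 / 2 * (\<eta> x * (1 - r) + (1 - \<eta> x) * r)"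

text \<open>The two reservoirs sit at distinct sites of \<open>sites N\<close> only if \<open>N \<ge> 3\<close>; the generator is
  used only for such \<open>N\<close>.\<close>

definition reservoir :: "real \<Rightarrow> real \<Rightarrow> nat \<Rightarrow> real" where
  "reservoir \<alpha> \<beta> x = (if x = 1 then \<alpha> else \<beta>)"

definition boundary_generator ::
  "real \<Rightarrow> real \<Rightarrow> real \<Rightarrow> real \<Rightarrow> nat \<Rightarrow> (config \<Rightarrow> real) \<Rightarrow> config \<Rightarrow> real" where
  "boundary_generator \<alpha> \<beta> \<kappa> \<theta> N f \<eta> =
    (\<Sum>x\<in>{1, N - 1}. \<kappa> / real N powr \<theta> * boundary_rate x \<eta> (reservoir \<alpha> \<beta> x)
                          * (f (flip x \<eta>) - f \<eta>))"

definition exclusion_generator ::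
  "real \<Rightarrow> real \<Rightarrow> real \<Rightarrow> real \<Rightarrow> nat \<Rightarrow> (config \<Rightarrow> real) \<Rightarrow> config \<Rightarrow> real" where
  "exclusion_generator \<alpha> \<beta> \<kappa> \<theta> N f \<eta> =
    bulk_generator N f \<eta> + boundary_generator \<alpha> \<beta> \<kappa> \<theta> N f \<eta>"

definition transition_semigroup :: "'s set \<Rightarrow> (real \<Rightarrow> 's \<Rightarrow> 's pmf) \<Rightarrow> bool" where
  "transition_semigroup S K \<longleftrightarrow>
    (\<forall>t\<ge>0. \<forall>x\<in>S. set_pmf (K t x) \<subseteq> S) \<and>
    (\<forall>x\<in>S. K 0 x = return_pmf x) \<and>
    (\<forall>s\<ge>0. \<forall>t\<ge>0. \<forall>x\<in>S. K (s + t) x = bind_pmf (K s x) (K t))"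

definition has_generator ::
  "'s set \<Rightarrow> (real \<Rightarrow> 's \<Rightarrow> 's pmf) \<Rightarrow> (('s \<Rightarrow> real) \<Rightarrow> 's \<Rightarrow> real) \<Rightarrow> bool" where
  "has_generator S K L \<longleftrightarrow>
    (\<forall>f. \<forall>x\<in>S. ((\<lambda>h. (measure_pmf.expectation (K h x) f - f x) / h) \<longlongrightarrow> L f x) (at_right 0))"

definition natural_filtration ::
  "'a measure \<Rightarrow> (real \<Rightarrow> 'a \<Rightarrow> 's) \<Rightarrow> real \<Rightarrow> 'a measure" where
  "natural_filtration M X s = sigma (space M) {X u -` A \<inter> space M | u A. 0 \<le> u \<and> u \<le> s}"

text \<open>No path regularity is required: the semigroup and the initial law determine all
  finite-dimensional distributions.\<close>

definition markov_process ::
  "'a measure \<Rightarrow> (real \<Rightarrow> 'a \<Rightarrow> 's) \<Rightarrow> 's set \<Rightarrow> (('s \<Rightarrow> real) \<Rightarrow> 's \<Rightarrow> real) \<Rightarrow> 's measure \<Rightarrow> bool"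
  where
  "markov_process M X S L \<mu> \<longleftrightarrow>
    prob_space M \<and>
    (\<forall>t\<ge>0. X t \<in> measurable M (count_space S)) \<and>
    distr M (count_space S) (X 0) = \<mu> \<and>
    (\<exists>K. transition_semigroup S K \<and> has_generator S K L \<and>
      (\<forall>s\<ge>0. \<forall>t\<ge>s. \<forall>f :: 's \<Rightarrow> real. AE \<omega> in M.
        real_cond_exp M (natural_filtration M X s) (\<lambda>\<omega>. f (X t \<omega>)) \<omega> =
          measure_pmf.expectation (K (t - s) (X s \<omega>)) f))"

definition empirical :: "nat \<Rightarrow> (real \<Rightarrow> real) \<Rightarrow> config \<Rightarrow> real" where
  "empirical N G \<eta> = 1 / (real N - 1) * (\<Sum>x\<in>sites N. G (real x / real N) * \<eta> x)"

definition associated :: "(nat \<Rightarrow> config measure) \<Rightarrow> (real \<Rightarrow> real) \<Rightarrow> bool" where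
  "associated \<mu> g \<longleftrightarrow>
    (\<forall>G \<delta>. continuous_on {0..1} G \<longrightarrow> \<delta> > 0 \<longrightarrow>
      (\<lambda>N. measure (\<mu> N) {\<eta> \<in> space (\<mu> N).
        \<bar>empirical N G \<eta> - (LINT q:{0..1}|lebesgue. G q * g q)\<bar> > \<delta>}) \<longlonglongrightarrow> 0)"

text \<open>Functions on \<open>[0,1]\<close> and \<open>[0,T] \<times> [0,1]\<close> are total functions whose values
  outside the domain are irrelevant.\<close>

definition L2 :: "(real \<Rightarrow> real) \<Rightarrow> bool" where
  "L2 u \<longleftrightarrow> u \<in> borel_measurable (lebesgue_on {0..1}) \<and>
    integrable (lebesgue_on {0..1}) (\<lambda>q. (u q)\<^sup>2)"

definition weak_derivative :: "(real \<Rightarrow> real) \<Rightarrow> (real \<Rightarrow> real) \<Rightarrow> bool" where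
  "weak_derivative u v \<longleftrightarrow> L2 v \<and>
    (\<forall>\<phi> \<phi>'. (\<forall>q. (\<phi> has_real_derivative \<phi>' q) (at q)) \<longrightarrow> continuous_on UNIV \<phi>' \<longrightarrow>
      closure {q. \<phi> q \<noteq> 0} \<subseteq> {0<..<1} \<longrightarrow>
      (LINT q:{0..1}|lebesgue. u q * \<phi>' q) = - (LINT q:{0..1}|lebesgue. v q * \<phi> q))"

text \<open>Continuity on \<open>[0,1]\<close> selects the continuous representative (and gives square
  integrability).\<close>

definition H1 :: "(real \<Rightarrow> real) set" where
  "H1 = {u. continuous_on {0..1} u \<and> (\<exists>v. weak_derivative u v)}"

definition H1_norm :: "(real \<Rightarrow> real) \<Rightarrow> real" where
  "H1_norm u = sqrt ((LINT q:{0..1}|lebesgue. (u q)\<^sup>2) +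
    (LINT q:{0..1}|lebesgue. ((SOME v. weak_derivative u v) q)\<^sup>2))"

definition H1_open :: "(real \<Rightarrow> real) set \<Rightarrow> bool" where
  "H1_open U \<longleftrightarrow> U \<subseteq> H1 \<and>
    (\<forall>u\<in>U. \<exists>r>0. \<forall>v\<in>H1. H1_norm (\<lambda>q. v q - u q) < r \<longrightarrow> v \<in> U)"

definition H1_borel :: "(real \<Rightarrow> real) measure" where
  "H1_borel = sigma H1 {U. H1_open U}"

text \<open>Elements of \<open>L2_H1 T\<close> are determined up to a null set of times, so that
  membership does not force, e.g., the initial value to lie in \<open>H1\<close>.\<close>

definition L2_H1 :: "real \<Rightarrow> (real \<Rightarrow> real \<Rightarrow> real) set" where
  "L2_H1 T = {\<rho>. \<exists>f \<in> measurable (lebesgue_on {0..T}) H1_borel.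
    (AE s in lebesgue_on {0..T}. \<forall>q\<in>{0..1}. \<rho> s q = f s q) \<and>
    integrable (lebesgue_on {0..T}) (\<lambda>s. (H1_norm (f s))\<^sup>2)}"

text \<open>\<open>C12 T G Gt Gq Gqq\<close>: \<open>G\<close> is of class \<open>C\<^sup>1\<^sup>,\<^sup>2\<close> on
  \<open>[0,T] \<times> [0,1]\<close>, with time derivative \<open>Gt\<close> and space derivatives \<open>Gq\<close>, \<open>Gqq\<close>
  (one-sided at the boundary).\<close>

definition C12 :: "real \<Rightarrow> (real \<Rightarrow> real \<Rightarrow> real) \<Rightarrow> (real \<Rightarrow> real \<Rightarrow> real) \<Rightarrow>
    (real \<Rightarrow> real \<Rightarrow> real) \<Rightarrow> (real \<Rightarrow> real \<Rightarrow> real) \<Rightarrow> bool" where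
  "C12 T G Gt Gq Gqq \<longleftrightarrow>
    (\<forall>s\<in>{0..T}. \<forall>q\<in>{0..1}.
      ((\<lambda>s. G s q) has_real_derivative Gt s q) (at s within {0..T}) \<and>
      (G s has_real_derivative Gq s q) (at q within {0..1}) \<and>
      (Gq s has_real_derivative Gqq s q) (at q within {0..1})) \<and>
    (\<forall>F\<in>{G, Gt, Gq, Gqq}. continuous_on ({0..T} \<times> {0..1}) (\<lambda>(s, q). F s q))"

definition vanishes_at_boundary :: "real \<Rightarrow> (real \<Rightarrow> real \<Rightarrow> real) \<Rightarrow> bool" where
  "vanishes_at_boundary T G \<longleftrightarrow> (\<forall>s\<in>{0..T}. G s 0 = 0 \<and> G s 1 = 0)"

definition compactly_supported :: "real \<Rightarrow> (real \<Rightarrow> real \<Rightarrow> real) \<Rightarrow> bool" where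
  "compactly_supported T G \<longleftrightarrow>
    (\<forall>s\<in>{0..T}. closure {q\<in>{0..1}. G s q \<noteq> 0} \<subseteq> {0<..<1})"

definition density_path :: "real \<Rightarrow> (real \<Rightarrow> real \<Rightarrow> real) \<Rightarrow> bool" where
  "density_path T \<rho> \<longleftrightarrow>
    (\<forall>t\<in>{0..T}. \<rho> t \<in> borel_measurable (lebesgue_on {0..1}) \<and> (\<forall>q\<in>{0..1}. \<rho> t q \<in> {0..1}))"

definition heat_terms :: "(real \<Rightarrow> real) \<Rightarrow> (real \<Rightarrow> real \<Rightarrow> real) \<Rightarrow> (real \<Rightarrow> real \<Rightarrow> real) \<Rightarrow>
    (real \<Rightarrow> real \<Rightarrow> real) \<Rightarrow> (real \<Rightarrow> real \<Rightarrow> real) \<Rightarrow> real \<Rightarrow> real" where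
  "heat_terms g \<rho> G Gt Gqq t =
    (LINT q:{0..1}|lebesgue. \<rho> t q * G t q) - (LINT q:{0..1}|lebesgue. g q * G 0 q) -
    (LINT s:{0..t}|lebesgue. (LINT q:{0..1}|lebesgue. \<rho> s q * (1 / 2 * Gqq s q + Gt s q)))"

definition weak_solution_Dir0 ::
  "real \<Rightarrow> real \<Rightarrow> real \<Rightarrow> (real \<Rightarrow> real) \<Rightarrow> (real \<Rightarrow> real \<Rightarrow> real) \<Rightarrow> bool" where
  "weak_solution_Dir0 T \<alpha> \<beta> g \<rho> \<longleftrightarrow> density_path T \<rho> \<and> \<rho> \<in> L2_H1 T \<and>
    (\<forall>t\<in>{0..T}. \<forall>G Gt Gq Gqq. C12 T G Gt Gq Gqq \<longrightarrow> vanishes_at_boundary T G \<longrightarrow>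
      heat_terms g \<rho> G Gt Gqq t +
      (LINT s:{0..t}|lebesgue. \<beta> / 2 * Gq s 1 - \<alpha> / 2 * Gq s 0) = 0)"

definition weak_solution_Dirc ::
  "real \<Rightarrow> real \<Rightarrow> real \<Rightarrow> (real \<Rightarrow> real) \<Rightarrow> (real \<Rightarrow> real \<Rightarrow> real) \<Rightarrow> bool" where
  "weak_solution_Dirc T \<alpha> \<beta> g \<rho> \<longleftrightarrow> density_path T \<rho> \<and> \<rho> \<in> L2_H1 T \<and>
    (\<forall>t\<in>{0..T}. \<forall>G Gt Gq Gqq. C12 T G Gt Gq Gqq \<longrightarrow> compactly_supported T G \<longrightarrow>
      heat_terms g \<rho> G Gt Gqq t = 0) \<and>
    (\<forall>t\<in>{0<..T}. \<rho> t 0 = \<alpha> \<and> \<rho> t 1 = \<beta>)"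

definition weak_solution_Rob ::
  "real \<Rightarrow> real \<Rightarrow> real \<Rightarrow> real \<Rightarrow> (real \<Rightarrow> real) \<Rightarrow> (real \<Rightarrow> real \<Rightarrow> real) \<Rightarrow> bool" where
  "weak_solution_Rob T \<alpha> \<beta> k g \<rho> \<longleftrightarrow> density_path T \<rho> \<and> \<rho> \<in> L2_H1 T \<and>
    (\<forall>t\<in>{0..T}. \<forall>G Gt Gq Gqq. C12 T G Gt Gq Gqq \<longrightarrow>
      heat_terms g \<rho> G Gt Gqq t +
      1 / 2 * (LINT s:{0..t}|lebesgue. \<rho> s 1 * Gq s 1 - \<rho> s 0 * Gq s 0) -
      k / 2 * (LINT s:{0..t}|lebesgue. G s 0 * (\<alpha> - \<rho> s 0) + G s 1 * (\<beta> - \<rho> s 1)) = 0)"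

definition hydrodynamic_solution ::
  "real \<Rightarrow> real \<Rightarrow> real \<Rightarrow> real \<Rightarrow> real \<Rightarrow> (real \<Rightarrow> real) \<Rightarrow> (real \<Rightarrow> real \<Rightarrow> real) \<Rightarrow> bool" where
  "hydrodynamic_solution T \<alpha> \<beta> \<kappa> \<theta> g \<rho> \<longleftrightarrow>
    (if \<theta> < 0 then weak_solution_Dirc T \<alpha> \<beta> g \<rho>
     else if \<theta> < 1 then weak_solution_Dir0 T \<alpha> \<beta> g \<rho>
     else if \<theta> = 1 then weak_solution_Rob T \<alpha> \<beta> \<kappa> g \<rho>
     else weak_solution_Rob T \<alpha> \<beta> 0 g \<rho>)"

end

theory Submission
  imports Defs "HOL-Complex_Analysis.Great_Picard" "HOL-Real_Asymp.Real_Asymp"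
begin

text \<open>
  Let \<open>\<phi>\<^sub>n\<close> be the eigenfunctions of \<open>\<Delta> / 2\<close> on \<open>[0,1]\<close> for the boundary conditions of the regime:
  \<open>a \<phi>' = b \<phi>\<close> at \<open>0\<close> and \<open>a \<phi>' = - b \<phi>\<close> at \<open>1\<close>, with \<open>(a, b) = (0, 1)\<close>, \<open>(1, \<kappa>)\<close> or \<open>(1, 0)\<close>.
  They are obtained from the spectral theorem for the Green kernel.  The generator maps linear
  functions of the configuration to affine ones, so the empirical mode
  \<open>(N - 1)\<^sup>-\<^sup>1 \<Sum>\<^sub>x \<phi>\<^sub>n(x / N) \<eta>(x)\<close> satisfies, up to a vanishing error, the linear ordinary
  differential equation of the corresponding Fourier mode of the heat equation, and, the carre du
  champ being of order \<open>1 / N\<close>, the square of the centred mode satisfies a linear differential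
  inequality with a source that tends to \<open>0\<close>.  This gives mean-square convergence of every mode,
  and density of the modes gives it for every continuous test function.  The limit is the Fourier
  series of the heat flow.

  For uniqueness, every weak solution is tested with \<open>\<phi>\<^sub>n\<close>, multiplied in the case (Dir-c) by a cutoff
  that tends to \<open>1\<close>: its modes then satisfy the same linear equations.
\<close>


subsection \<open>The spectral theorem for continuous symmetric kernels\<close>

text \<open>The obstacle is the boundary: after the acceleration the reservoirs act at rate of order
  \<open>N^(2 - \<theta>)\<close> on single sites, whose occupation is not controlled by any
  average. Test functions that satisfy the boundary condition on the lattice itself make the
  coefficients of the two boundary occupation numbers vanish in the limit, so those numbers never
  have to be estimated. Eigenfunctions do this and also close the equation of each mode, so that no
  compactness of path laws enters. For Robin conditions the eigenvalues solve a transcendental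
  equation. The abstract spectral theorem treats all three conditions at once and yields what is
  used: orthogonality, density and growth bounds in terms of the eigenvalue. The kernel inverts
  \<open>1 - \<Delta>\<close>, because \<open>\<Delta>\<close> has the constants in its kernel under
  Neumann conditions. The initial profile is only measurable and the Fourier series converges
  uniformly only away from time 0. Identities in time are therefore proved on
  \<open>[\<epsilon>, t]\<close>, and the boundary conditions are used to keep the integrands
  bounded as \<epsilon> tends to 0.\<close>

abbreviation cont01 :: "(real \<Rightarrow> real) \<Rightarrow> bool" where
  "cont01 \<equiv> continuous_on {0..1}"

text \<open>A Henstock-Kurzweil integral, used to pair continuous functions; pairings with merely
  measurable functions are written with \<open>LINT\<close>. Without integrability the value is
  0.\<close>

definition ip :: "(real \<Rightarrow> real) \<Rightarrow> (real \<Rightarrow> real) \<Rightarrow> real" where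
  "ip f g = integral {0..1} (\<lambda>x. f x * g x)"

lemma ip_integrable:
  "cont01 f \<Longrightarrow> cont01 g \<Longrightarrow> (\<lambda>x. f x * g x) integrable_on {0..1}"
  by (intro integrable_continuous_interval continuous_intros)

lemma ip_commute: "ip f g = ip g f"
  by (simp add: ip_def mult.commute)

lemma ip_cong:
  assumes "\<And>x. x \<in> {0..1} \<Longrightarrow> f x = f' x" "\<And>x. x \<in> {0..1} \<Longrightarrow> g x = g' x"
  shows "ip f g = ip f' g'"
  unfolding ip_def by (rule integral_cong) (simp add: assms)

lemma ip_add_left:
  assumes "cont01 f" "cont01 g" "cont01 h"
  shows "ip (\<lambda>x. f x + g x) h = ip f h + ip g h"
  unfolding ip_def using integral_add[OF ip_integrable[OF assms(1,3)] ip_integrable[OF assms(2,3)]]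
  by (simp add: algebra_simps)

lemma ip_diff_left:
  assumes "cont01 f" "cont01 g" "cont01 h"
  shows "ip (\<lambda>x. f x - g x) h = ip f h - ip g h"
  unfolding ip_def using integral_diff[OF ip_integrable[OF assms(1,3)] ip_integrable[OF assms(2,3)]]
  by (simp add: algebra_simps)

lemma ip_add_right:
  assumes "cont01 f" "cont01 g" "cont01 h"
  shows "ip h (\<lambda>x. f x + g x) = ip h f + ip h g"
  using ip_add_left[OF assms] by (simp add: ip_commute)

lemma ip_diff_right:
  assumes "cont01 f" "cont01 g" "cont01 h"
  shows "ip h (\<lambda>x. f x - g x) = ip h f - ip h g"
  using ip_diff_left[OF assms] by (simp add: ip_commute)

lemma ip_scale_left: "ip (\<lambda>x. c * f x) g = c * ip f g"
  unfolding ip_def by (simp add: mult.assoc)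

lemma ip_scale_right: "ip f (\<lambda>x. c * g x) = c * ip f g"
  using ip_scale_left[of c g f] by (simp add: ip_commute)

lemma ip_sum_left:
  assumes "\<And>i. i \<in> A \<Longrightarrow> cont01 (f i)" "cont01 g" "finite A"
  shows "ip (\<lambda>x. \<Sum>i\<in>A. f i x) g = (\<Sum>i\<in>A. ip (f i) g)"
  unfolding ip_def sum_distrib_right
  by (rule integral_sum) (use assms ip_integrable in auto)

lemma ip_sum_right:
  assumes "\<And>i. i \<in> A \<Longrightarrow> cont01 (f i)" "cont01 g" "finite A"
  shows "ip g (\<lambda>x. \<Sum>i\<in>A. f i x) = (\<Sum>i\<in>A. ip g (f i))"
  using ip_sum_left[OF assms] by (simp add: ip_commute)

lemma ip_nonneg: "0 \<le> ip f f"
  unfolding ip_def by (cases "(\<lambda>x. f x * f x) integrable_on {0..1}")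
    (auto intro: integral_nonneg simp: not_integrable_integral)

lemma ip_le_bound:
  assumes "cont01 f" "\<And>x. x \<in> {0..1} \<Longrightarrow> \<bar>f x\<bar> \<le> B"
  shows "ip f f \<le> B\<^sup>2"
proof -
  have "ip f f \<le> integral {0..1} (\<lambda>x::real. B\<^sup>2)"
    unfolding ip_def
  proof (rule integral_le)
    show "f x * f x \<le> B\<^sup>2" if "x \<in> {0..1}" for x
      using power_mono[OF assms(2)[OF that] abs_ge_zero, of 2] by (simp add: power2_eq_square)
  qed (use assms ip_integrable in auto)
  then show ?thesis by simp
qed

lemma ip_square_add:
  assumes "cont01 f" "cont01 g"
  shows "ip (\<lambda>x. f x + c * g x) (\<lambda>x. f x + c * g x) = ip f f + 2 * c * ip f g + c\<^sup>2 * ip g g"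
proof -
  have c: "cont01 (\<lambda>x. c * g x)" "cont01 (\<lambda>x. f x + c * g x)"
    using assms by (auto intro!: continuous_intros)
  show ?thesis
    using assms c
    by (simp add: ip_add_left ip_add_right ip_scale_left ip_scale_right ip_commute[of g f]
        power2_eq_square algebra_simps)
qed

lemma ip_square_le:
  assumes "cont01 f" "cont01 g"
  shows "ip (\<lambda>x. f x + g x) (\<lambda>x. f x + g x) \<le> 2 * ip f f + 2 * ip g g"
  using ip_square_add[OF assms, of 1] ip_square_add[OF assms, of "-1"]
    ip_nonneg[of "\<lambda>x. f x + (-1) * g x"] by simp

lemma ip_Cauchy_Schwarz:
  assumes "cont01 f" "cont01 g"
  shows "(ip f g)\<^sup>2 \<le> ip f f * ip g g"
proof -
  have q: "0 \<le> ip f f + 2 * c * ip f g + c\<^sup>2 * ip g g" for c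
    using ip_square_add[OF assms, of c] ip_nonneg by metis
  show ?thesis
  proof (cases "ip g g = 0")
    case True
    have "ip f g = 0"
    proof (rule ccontr)
      assume "ip f g \<noteq> 0"
      \<comment> \<open>This \<open>c\<close> makes the nonnegative quadratic equal to
        \<open>-1\<close>.\<close>
      then show False
        using q[of "- (ip f f + 1) / (2 * ip f g)"] True ip_nonneg[of f] by (simp add: field_simps)
    qed
    then show ?thesis using True by simp
  next
    case False
    then have p: "ip g g > 0" using ip_nonneg[of g] by simp
    have "0 \<le> ip f f - (ip f g)\<^sup>2 / ip g g"
      using q[of "- ip f g / ip g g"] p by (simp add: power2_eq_square field_simps)
    then show ?thesis using p by (simp add: field_simps)
  qed
qed

lemma ip_eq_0:
  assumes "cont01 f" "ip f f = 0" "x \<in> {0..1}"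
  shows "f x = 0"
proof -
  have "continuous_on {0..1} (\<lambda>x. f x * f x)"
    using assms by (intro continuous_intros)
  then show ?thesis
    using integral_eq_0_iff[of 0 1 "\<lambda>x. f x * f x"] assms unfolding ip_def by auto
qed

lemma cont01_bounded:
  assumes "cont01 f"
  obtains B where "B > 0" "\<And>x. x \<in> {0..1} \<Longrightarrow> \<bar>f x\<bar> \<le> B"
proof -
  have "bounded (f ` {0..1})"
    using assms by (intro compact_imp_bounded compact_continuous_image) auto
  then show ?thesis using that unfolding bounded_pos by (metis imageI real_norm_def)
qed

section \<open>Integral operators with a continuous symmetric kernel\<close>

definition iop :: "(real \<Rightarrow> real \<Rightarrow> real) \<Rightarrow> (real \<Rightarrow> real) \<Rightarrow> real \<Rightarrow> real" where
  "iop k f x = ip (k x) f"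

locale sym_kernel =
  fixes k :: "real \<Rightarrow> real \<Rightarrow> real"
  assumes kernel_continuous: "continuous_on ({0..1} \<times> {0..1}) (\<lambda>(x, y). k x y)"
    and kernel_sym: "\<And>x y. x \<in> {0..1} \<Longrightarrow> y \<in> {0..1} \<Longrightarrow> k x y = k y x"
begin

lemma kernel_section: "x \<in> {0..1} \<Longrightarrow> cont01 (k x)"
  using continuous_on_compose2[OF kernel_continuous, of "{0..1}" "\<lambda>y. (x, y)"]
  by (simp add: continuous_on_Pair image_subset_iff)

lemma kernel_bounded:
  obtains B where "B > 0" "\<And>x y. x \<in> {0..1} \<Longrightarrow> y \<in> {0..1} \<Longrightarrow> \<bar>k x y\<bar> \<le> B"
proof -
  have "bounded ((\<lambda>(x, y). k x y) ` ({0..1} \<times> {0..1}))"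
    using kernel_continuous by (intro compact_imp_bounded compact_continuous_image compact_Times) auto
  then obtain B where "B > 0" "\<forall>z \<in> {0..1} \<times> {0..1}. \<bar>(\<lambda>(x, y). k x y) z\<bar> \<le> B"
    unfolding bounded_pos by auto
  then show ?thesis using that by auto
qed

lemma iop_continuous:
  assumes "cont01 f"
  shows "cont01 (iop k f)"
proof -
  have "continuous_on ({0..1} \<times> cbox 0 1) (\<lambda>(x, y). k x y * f y)"
    using kernel_continuous assms
    by (auto simp: case_prod_beta intro!: continuous_intros continuous_on_compose2[OF assms])
  from integral_continuous_on_param[OF this] show ?thesis
    by (simp add: iop_def ip_def)
qed

text \<open>Cauchy-Schwarz in the integrated variable: mean-square control of \<open>f\<close>
  becomes pointwise control of its image. This is the source of the uniform bounds on eigenfunctions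
  and of every passage from mean-square to pointwise convergence.\<close>

lemma iop_bound:
  assumes "cont01 f" "x \<in> {0..1}" "\<And>x y. x \<in> {0..1} \<Longrightarrow> y \<in> {0..1} \<Longrightarrow> \<bar>k x y\<bar> \<le> B"
  shows "(iop k f x)\<^sup>2 \<le> B\<^sup>2 * ip f f"
proof -
  have "(iop k f x)\<^sup>2 \<le> ip (k x) (k x) * ip f f"
    unfolding iop_def by (rule ip_Cauchy_Schwarz[OF kernel_section assms(1)]) fact
  also have "\<dots> \<le> B\<^sup>2 * ip f f"
    by (intro mult_right_mono ip_nonneg ip_le_bound[OF kernel_section]) (use assms in auto)
  finally show ?thesis .
qed

lemma iop_ip_bound:
  assumes "cont01 f" "\<And>x y. x \<in> {0..1} \<Longrightarrow> y \<in> {0..1} \<Longrightarrow> \<bar>k x y\<bar> \<le> B"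
  shows "ip (iop k f) (iop k f) \<le> B\<^sup>2 * ip f f"
proof -
  have "\<bar>iop k f x\<bar> \<le> sqrt (B\<^sup>2 * ip f f)" if "x \<in> {0..1}" for x
    using iop_bound[OF assms(1) that assms(2)] real_le_rsqrt by fastforce
  from ip_le_bound[OF iop_continuous[OF assms(1)] this] show ?thesis
    by (simp add: ip_nonneg)
qed

lemma iop_symmetric:
  assumes "cont01 f" "cont01 g"
  shows "ip (iop k f) g = ip f (iop k g)"
proof -
  have c: "continuous_on (cbox (0, 0) (1, 1)) (\<lambda>(x, y). k x y * f y * g x)"
    unfolding cbox_Pair_eq using kernel_continuous
    by (auto simp: case_prod_beta intro!: continuous_intros continuous_on_compose2[OF assms(1)]
        continuous_on_compose2[OF assms(2)])
  have "ip (iop k f) g = integral {0..1} (\<lambda>x. integral {0..1} (\<lambda>y. k x y * f y * g x))"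
    by (simp add: ip_def iop_def)
  also have "\<dots> = integral {0..1} (\<lambda>y. integral {0..1} (\<lambda>x. k x y * f y * g x))"
    using integral_swap_continuous[OF c] by simp
  also have "\<dots> = integral {0..1} (\<lambda>y. f y * integral {0..1} (\<lambda>x. k y x * g x))"
  proof (rule integral_cong)
    fix y :: real assume y: "y \<in> {0..1}"
    have "integral {0..1} (\<lambda>x. k x y * f y * g x) = integral {0..1} (\<lambda>x. f y * (k y x * g x))"
      by (rule integral_cong) (use y kernel_sym in auto)
    then show "integral {0..1} (\<lambda>x. k x y * f y * g x) = f y * integral {0..1} (\<lambda>x. k y x * g x)"
      by simp
  qed
  finally show ?thesis by (simp add: ip_def iop_def)
qed

lemma iop_scale: "iop k (\<lambda>x. c * f x) x = c * iop k f x"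
  by (simp add: iop_def ip_scale_right)

lemma iop_add:
  "cont01 f \<Longrightarrow> cont01 g \<Longrightarrow> x \<in> {0..1} \<Longrightarrow> iop k (\<lambda>x. f x + g x) x = iop k f x + iop k g x"
  unfolding iop_def by (simp add: ip_add_right kernel_section)

lemma iop_diff:
  "cont01 f \<Longrightarrow> cont01 g \<Longrightarrow> x \<in> {0..1} \<Longrightarrow> iop k (\<lambda>x. f x - g x) x = iop k f x - iop k g x"
  unfolding iop_def by (simp add: ip_diff_right kernel_section)

lemma iop_uniform_limit:
  assumes "\<And>n. cont01 (F n)" "cont01 f" "uniform_limit {0..1} F f sequentially"
  shows "uniform_limit {0..1} (\<lambda>n. iop k (F n)) (iop k f) sequentially"
proof (rule uniform_limitI)
  fix e :: real assume e: "e > 0"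
  obtain B where B: "B > 0" "\<And>x y. x \<in> {0..1} \<Longrightarrow> y \<in> {0..1} \<Longrightarrow> \<bar>k x y\<bar> \<le> B"
    using kernel_bounded by blast
  have "\<forall>\<^sub>F n in sequentially. \<forall>x\<in>{0..1}. dist (F n x) (f x) < e / (2 * B)"
    using assms(3) e B by (intro uniform_limitD) auto
  then show "\<forall>\<^sub>F n in sequentially. \<forall>x\<in>{0..1}. dist (iop k (F n) x) (iop k f x) < e"
  proof eventually_elim
    case (elim n)
    show ?case
    proof
      fix x :: real assume x: "x \<in> {0..1}"
      have "(iop k (\<lambda>x. F n x - f x) x)\<^sup>2 \<le> B\<^sup>2 * ip (\<lambda>x. F n x - f x) (\<lambda>x. F n x - f x)"
        by (rule iop_bound[OF _ x B(2)]) (use assms in \<open>auto intro!: continuous_intros\<close>)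
      also have "\<dots> \<le> B\<^sup>2 * (e / (2 * B))\<^sup>2"
        by (intro mult_left_mono ip_le_bound)
          (use assms elim in \<open>auto intro!: continuous_intros simp: dist_real_def less_imp_le\<close>)
      also have "\<dots> = (e / 2)\<^sup>2" using B by (simp add: power2_eq_square)
      finally have "\<bar>iop k (\<lambda>x. F n x - f x) x\<bar> \<le> e / 2"
        using e by (simp add: abs_le_square_iff[symmetric])
      then show "dist (iop k (F n) x) (iop k f x) < e"
        using iop_diff[OF assms(1,2) x] e by (simp add: dist_real_def)
    qed
  qed
qed

text \<open>The modulus is that of the kernel, hence common to the whole mean-square unit ball. This
  supplies the equicontinuity for Arzela-Ascoli, so that the incomplete space of continuous
  functions suffices.\<close>

lemma iop_equicontinuous:
  assumes "x \<in> {0..1}" "e > 0"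
  shows "\<exists>d>0. \<forall>f y. cont01 f \<and> ip f f \<le> 1 \<and> y \<in> {0..1} \<and> \<bar>x - y\<bar> < d \<longrightarrow>
           \<bar>iop k f x - iop k f y\<bar> < e"
proof -
  have "uniformly_continuous_on ({0..1} \<times> {0..1}) (\<lambda>(x, y). k x y)"
    by (intro compact_uniformly_continuous kernel_continuous compact_Times) auto
  then obtain d where d: "d > 0" "\<And>z z'. z \<in> {0..1} \<times> {0..1} \<Longrightarrow> z' \<in> {0..1} \<times> {0..1} \<Longrightarrow> dist z' z < d
      \<Longrightarrow> dist ((\<lambda>(x, y). k x y) z') ((\<lambda>(x, y). k x y) z) < e / 2"
    unfolding uniformly_continuous_on_def using assms(2) by (metis half_gt_zero)
  have "\<bar>iop k f x - iop k f y\<bar> < e" if f: "cont01 f" "ip f f \<le> 1" and y: "y \<in> {0..1}" "\<bar>x - y\<bar> < d" for f y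
  proof -
    have c: "cont01 (\<lambda>z. k x z - k y z)"
      by (intro continuous_intros kernel_section assms y)
    have "ip (\<lambda>z. k x z - k y z) (\<lambda>z. k x z - k y z) \<le> (e / 2)\<^sup>2"
    proof (rule ip_le_bound[OF c])
      fix z :: real assume "z \<in> {0..1}"
      then show "\<bar>k x z - k y z\<bar> \<le> e / 2"
        using d(2)[of "(y, z)" "(x, z)"] assms y by (simp add: dist_Pair_Pair dist_real_def)
    qed
    then have "ip (\<lambda>z. k x z - k y z) (\<lambda>z. k x z - k y z) * ip f f \<le> (e / 2)\<^sup>2 * 1"
      using f by (intro mult_mono ip_nonneg) auto
    moreover have "iop k f x - iop k f y = ip (\<lambda>z. k x z - k y z) f"
      unfolding iop_def by (rule ip_diff_left[symmetric]) (use kernel_section assms y f in auto)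
    ultimately have "(iop k f x - iop k f y)\<^sup>2 \<le> (e / 2)\<^sup>2"
      using ip_Cauchy_Schwarz[OF c f(1)] by simp
    then show ?thesis using assms(2) by (simp add: abs_le_square_iff[symmetric])
  qed
  then show ?thesis using d(1) by blast
qed

text \<open>A maximising sequence for the operator norm is, up to a subsequence, mapped to a limit \<open>w\<close>
  with \<open>K\<^sup>2 w = \<parallel>K\<parallel>\<^sup>2 w\<close>, and \<open>K\<^sup>2 - \<parallel>K\<parallel>\<^sup>2\<close> factors. The degenerate pair
  \<open>(0, 0)\<close> stands for the end of a finite list of eigenpairs.\<close>

lemma extremal_eigenpair:
  "\<exists>\<phi> \<mu>. cont01 \<phi> \<and> (\<forall>x\<in>{0..1}. iop k \<phi> x = \<mu> * \<phi> x) \<and>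
    ((\<mu> = 0 \<and> \<phi> = (\<lambda>_. 0)) \<or> (\<mu> \<noteq> 0 \<and> ip \<phi> \<phi> = 1)) \<and>
    (\<forall>f. cont01 f \<longrightarrow> ip (iop k f) (iop k f) \<le> \<mu>\<^sup>2 * ip f f)"
proof -
  obtain B where B: "B > 0" "\<And>x y. x \<in> {0..1} \<Longrightarrow> y \<in> {0..1} \<Longrightarrow> \<bar>k x y\<bar> \<le> B"
    using kernel_bounded by blast
  define Q where "Q = {ip (iop k f) (iop k f) | f. cont01 f \<and> ip f f \<le> 1}"
  define M where "M = Sup Q"
  have Q_le: "q \<le> B\<^sup>2" if "q \<in> Q" for q
  proof -
    from that obtain f where f: "q = ip (iop k f) (iop k f)" "cont01 f" "ip f f \<le> 1"
      by (auto simp: Q_def)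
    have "q \<le> B\<^sup>2 * ip f f" using iop_ip_bound[OF f(2) B(2)] f(1) by simp
    also have "\<dots> \<le> B\<^sup>2 * 1" using f(3) by (intro mult_left_mono) auto
    finally show ?thesis by simp
  qed
  have bdd: "bdd_above Q" using Q_le by (auto simp: bdd_above_def)
  have z: "ip (\<lambda>_. 0) (\<lambda>_. 0) = 0" by (simp add: ip_def)
  have Q0: "ip (iop k (\<lambda>_. 0)) (iop k (\<lambda>_. 0)) \<in> Q" unfolding Q_def using z by auto
  then have M0: "M \<ge> 0" unfolding M_def using cSup_upper[OF _ bdd] ip_nonneg order_trans by metis
  have normle: "ip (iop k f) (iop k f) \<le> M * ip f f" if f: "cont01 f" for f
  proof (cases "ip f f = 0")
    case True
    then show ?thesis using iop_ip_bound[OF f B(2)] by simp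
  next
    case False
    then have p: "ip f f > 0" using ip_nonneg[of f] by simp
    define c where "c = 1 / sqrt (ip f f)"
    have c2: "c * c = 1 / ip f f" using p by (simp add: c_def)
    have "ip (\<lambda>x. c * f x) (\<lambda>x. c * f x) = c * c * ip f f"
      by (simp add: ip_scale_left ip_scale_right)
    then have "ip (\<lambda>x. c * f x) (\<lambda>x. c * f x) \<le> 1" using c2 p by simp
    then have "ip (iop k (\<lambda>x. c * f x)) (iop k (\<lambda>x. c * f x)) \<in> Q"
      unfolding Q_def using f by (auto intro!: continuous_intros)
    then have "ip (iop k (\<lambda>x. c * f x)) (iop k (\<lambda>x. c * f x)) \<le> M"
      unfolding M_def by (rule cSup_upper[OF _ bdd])
    moreover have "iop k (\<lambda>x. c * f x) = (\<lambda>x. c * iop k f x)" by (simp add: iop_scale fun_eq_iff)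
    ultimately have "c * c * ip (iop k f) (iop k f) \<le> M"
      by (simp add: ip_scale_left ip_scale_right)
    then show ?thesis using p c2 by (simp add: field_simps)
  qed
  show ?thesis
  proof (cases "M = 0")
    case True
    show ?thesis
      by (rule exI[of _ "\<lambda>_. 0"], rule exI[of _ 0])
        (use normle True in \<open>auto simp: iop_def ip_def\<close>)
  next
    case False
    with M0 have Mpos: "M > 0" by simp
    have "\<exists>f. cont01 f \<and> ip f f \<le> 1 \<and> ip (iop k f) (iop k f) > M - 1 / real (Suc n)" for n
    proof -
      have "M - 1 / real (Suc n) < Sup Q" unfolding M_def by simp
      then obtain q where "q \<in> Q" "M - 1 / real (Suc n) < q"
        using less_cSup_iff[OF _ bdd] Q0 by blast
      then show ?thesis unfolding Q_def by auto
    qed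
    then obtain f where f: "\<And>n. cont01 (f n)" "\<And>n. ip (f n) (f n) \<le> 1"
        "\<And>n. ip (iop k (f n)) (iop k (f n)) > M - 1 / real (Suc n)" by metis
    have bd: "\<bar>iop k (f n) x\<bar> \<le> B" if "x \<in> {0..1}" for n x
    proof -
      have "(iop k (f n) x)\<^sup>2 \<le> B\<^sup>2 * ip (f n) (f n)" by (rule iop_bound[OF f(1) that B(2)])
      also have "\<dots> \<le> B\<^sup>2 * 1" using f(2) by (intro mult_left_mono) auto
      finally show ?thesis using B by (simp add: abs_le_square_iff[symmetric])
    qed
    obtain w r where w: "cont01 w" "strict_mono (r :: nat \<Rightarrow> nat)"
      "\<And>e. 0 < e \<Longrightarrow> \<exists>N. \<forall>n x. n \<ge> N \<and> x \<in> {0..1} \<longrightarrow> norm (iop k (f (r n)) x - w x) < e"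
    proof (rule Arzela_Ascoli[of "{0..1}" "\<lambda>n. iop k (f n)" B])
      show "\<exists>d>0. \<forall>n y. y \<in> {0..1} \<and> norm (x - y) < d \<longrightarrow> norm (iop k (f n) x - iop k (f n) y) < e"
        if x: "x \<in> {0..1}" and e: "0 < e" for x e
      proof -
        obtain d where "d > 0" "\<forall>f y. cont01 f \<and> ip f f \<le> 1 \<and> y \<in> {0..1} \<and> \<bar>x - y\<bar> < d \<longrightarrow>
           \<bar>iop k f x - iop k f y\<bar> < e"
          using iop_equicontinuous[OF x e] by blast
        then show ?thesis using f by (intro exI[of _ d]) auto
      qed
    qed (use bd in auto)
    define W where "W n = iop k (f (r n))" for n
    have Wc: "cont01 (W n)" for n unfolding W_def by (intro iop_continuous f)
    have ul: "uniform_limit {0..1} W w sequentially"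
      unfolding uniform_limit_iff eventually_sequentially dist_real_def W_def
      using w(3) by (metis real_norm_def)
    have ul2: "uniform_limit {0..1} (\<lambda>n. iop k (iop k (W n))) (iop k (iop k w)) sequentially"
      by (intro iop_uniform_limit iop_continuous Wc w ul)
    have HHw: "iop k (iop k w) x = M * w x" if x: "x \<in> {0..1}" for x
    proof -
      \<comment> \<open>Expanding the square and using \<open>normle\<close>,
        \<open>K (K f) - M f\<close> has squared norm at most
        \<open>M * (M - ip (K f) (K f))\<close>, which the choice of \<open>f\<close> makes small.
        One more application of the operator turns this into smallness at the point
        \<open>x\<close>, now with \<open>W n = K f\<close> in place of \<open>f\<close>.\<close>
      have est: "(iop k (iop k (W n)) x - M * W n x)\<^sup>2 \<le> B\<^sup>2 * (M / real (Suc (r n)))" for n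
      proof -
        let ?f = "f (r n)"
        let ?g = "\<lambda>x. iop k (iop k ?f) x + (- M) * ?f x"
        have c: "cont01 (iop k (iop k ?f))" "cont01 ?f" "cont01 ?g" "cont01 (iop k ?f)"
            "cont01 (\<lambda>x. (- M) * ?f x)"
          by (auto intro!: continuous_intros iop_continuous f)
        have "ip ?g ?g = ip (iop k (iop k ?f)) (iop k (iop k ?f))
                  + 2 * (- M) * ip (iop k (iop k ?f)) ?f + (- M)\<^sup>2 * ip ?f ?f"
          by (rule ip_square_add[OF c(1,2)])
        moreover have "2 * (- M) * ip (iop k (iop k ?f)) ?f = - 2 * (M * ip (iop k ?f) (iop k ?f))"
          by (simp add: iop_symmetric[OF c(4,2)])
        moreover have "ip (iop k (iop k ?f)) (iop k (iop k ?f)) \<le> M * ip (iop k ?f) (iop k ?f)"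
          by (rule normle[OF c(4)])
        moreover have "(- M)\<^sup>2 * ip ?f ?f \<le> M\<^sup>2 * 1"
          unfolding power2_minus by (rule mult_left_mono[OF f(2)]) simp
        moreover have "M * (M - ip (iop k ?f) (iop k ?f)) = M\<^sup>2 - M * ip (iop k ?f) (iop k ?f)"
          by (simp add: algebra_simps power2_eq_square)
        ultimately have "ip ?g ?g \<le> M * (M - ip (iop k ?f) (iop k ?f))" by linarith
        also have "\<dots> \<le> M * (1 / real (Suc (r n)))"
          using f(3)[of "r n"] Mpos by (intro mult_left_mono) auto
        finally have g: "ip ?g ?g \<le> M / real (Suc (r n))" by simp
        have "iop k ?g x = iop k (iop k (iop k ?f)) x + iop k (\<lambda>x. (- M) * ?f x) x"
          by (rule iop_add[OF c(1,5) x])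
        then have "iop k ?g x = iop k (iop k (W n)) x - M * W n x"
          unfolding iop_scale W_def by simp
        then have "(iop k (iop k (W n)) x - M * W n x)\<^sup>2 \<le> B\<^sup>2 * ip ?g ?g"
          using iop_bound[OF c(3) x B(2)] by simp
        also have "\<dots> \<le> B\<^sup>2 * (M / real (Suc (r n)))" using g by (intro mult_left_mono) auto
        finally show ?thesis .
      qed
      have inv: "(\<lambda>n. inverse (real (Suc (r n)))) \<longlonglongrightarrow> 0"
        using LIMSEQ_subseq_LIMSEQ[OF LIMSEQ_inverse_real_of_nat w(2)] by (simp add: o_def)
      have "(\<lambda>n. B\<^sup>2 * (M / real (Suc (r n)))) \<longlonglongrightarrow> 0"
        using tendsto_mult_right_zero[OF inv, of "B\<^sup>2 * M"] by (simp add: field_simps)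
      then have "(\<lambda>n. (iop k (iop k (W n)) x - M * W n x)\<^sup>2) \<longlonglongrightarrow> 0"
        by (rule tendsto_sandwich[OF _ _ tendsto_const, rotated -1])
          (use est in \<open>auto intro!: always_eventually\<close>)
      moreover have "(\<lambda>n. (iop k (iop k (W n)) x - M * W n x)\<^sup>2) \<longlonglongrightarrow> (iop k (iop k w) x - M * w x)\<^sup>2"
        by (intro tendsto_intros tendsto_uniform_limitI[OF ul x] tendsto_uniform_limitI[OF ul2 x])
      ultimately show ?thesis using LIMSEQ_unique by fastforce
    qed
    \<comment> \<open>The squared norms of the images exceed \<open>M / 2\<close> eventually, which
      a uniform limit equal to 0 on the interval would contradict.\<close>
    have w_nz: "ip w w \<noteq> 0"
    proof
      assume "ip w w = 0"
      then have w0: "w x = 0" if "x \<in> {0..1}" for x using ip_eq_0[OF w(1)] that by blast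
      have "\<forall>\<^sub>F n in sequentially. \<forall>x\<in>{0..1}. dist (W n x) (w x) < sqrt (M / 2)"
        using Mpos by (intro uniform_limitD[OF ul]) auto
      moreover have "\<forall>\<^sub>F n in sequentially. 1 / real (Suc n) < M / 2"
        using Mpos order_tendstoD(2)[OF LIMSEQ_inverse_real_of_nat, of "M / 2"]
        by (simp add: inverse_eq_divide)
      ultimately have "\<forall>\<^sub>F n in sequentially. False"
      proof eventually_elim
        case (elim n)
        have "ip (W n) (W n) \<le> (sqrt (M / 2))\<^sup>2"
          using elim(1) w0 by (intro ip_le_bound Wc) (auto simp: dist_real_def less_imp_le)
        then have a: "ip (W n) (W n) \<le> M / 2" using Mpos by simp
        have "1 / real (Suc (r n)) \<le> 1 / real (Suc n)"
          using seq_suble[OF w(2), of n] by (intro divide_left_mono) auto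
        then show False using a f(3)[of "r n"] elim(2) unfolding W_def by linarith
      qed
      then show False by simp
    qed
    define m where "m = sqrt M"
    have m: "m > 0" "m\<^sup>2 = M" using Mpos by (auto simp: m_def)
    have fin: ?thesis if y: "cont01 y" "ip y y \<noteq> 0" "\<And>x. x \<in> {0..1} \<Longrightarrow> iop k y x = \<mu> * y x" "\<mu>\<^sup>2 = M"
      for y \<mu>
    proof -
      have p: "ip y y > 0" using ip_nonneg[of y] y(2) by simp
      define c where "c = 1 / sqrt (ip y y)"
      have c2: "c * c = 1 / ip y y" using p by (simp add: c_def)
      have "cont01 (\<lambda>x. c * y x)" using y(1) by (intro continuous_intros)
      moreover have "ip (\<lambda>x. c * y x) (\<lambda>x. c * y x) = 1"
        using c2 p by (simp add: ip_scale_left ip_scale_right mult.assoc[symmetric])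
      moreover have "\<mu> \<noteq> 0" using y(4) Mpos by auto
      ultimately show ?thesis
        using y(3,4) normle by (intro exI[of _ "\<lambda>x. c * y x"] exI[of _ \<mu>]) (auto simp: iop_scale)
    qed
    \<comment> \<open>With \<open>(K - m) (K + m) w = 0\<close> there are two cases: if
      \<open>(K + m) w\<close> vanishes, then \<open>w\<close> is an eigenfunction for
      \<open>- m\<close>; otherwise \<open>(K + m) w\<close> is one for \<open>m\<close>.\<close>
    let ?y = "\<lambda>x. iop k w x + m * w x"
    have yc: "cont01 ?y" by (intro continuous_intros iop_continuous w)
    show ?thesis
    proof (cases "ip ?y ?y = 0")
      case True
      have "iop k w x = (- m) * w x" if "x \<in> {0..1}" for x
        using ip_eq_0[OF yc True that] by simp
      from fin[OF w(1) w_nz this] m show ?thesis by simp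
    next
      case False
      have "iop k ?y x = m * ?y x" if x: "x \<in> {0..1}" for x
      proof -
        have "iop k ?y x = iop k (iop k w) x + iop k (\<lambda>x. m * w x) x"
          by (rule iop_add[OF _ _ x]) (auto intro!: continuous_intros iop_continuous w)
        then show ?thesis using HHw[OF x] m(2) by (simp add: iop_scale algebra_simps power2_eq_square)
      qed
      from fin[OF yc False this m(2)] show ?thesis .
    qed
  qed
qed

end

section \<open>Orthogonal families and deflation\<close>

lemma ip_orthogonal_sum:
  fixes \<phi> :: "nat \<Rightarrow> real \<Rightarrow> real"
  assumes "\<And>i. cont01 (\<phi> i)" "\<And>i j. i \<noteq> j \<Longrightarrow> ip (\<phi> i) (\<phi> j) = 0"
  shows "ip (\<lambda>x. \<Sum>i<n. a i * \<phi> i x) (\<lambda>x. \<Sum>i<n. b i * \<phi> i x) =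
    (\<Sum>i<n. a i * b i * ip (\<phi> i) (\<phi> i))"
proof -
  have c: "cont01 (\<lambda>x. c * \<phi> i x)" for c i by (intro continuous_intros assms)
  have "ip (\<lambda>x. \<Sum>i<n. a i * \<phi> i x) (\<lambda>x. \<Sum>j<n. b j * \<phi> j x) =
      (\<Sum>i<n. ip (\<lambda>x. a i * \<phi> i x) (\<lambda>x. \<Sum>j<n. b j * \<phi> j x))"
    by (intro ip_sum_left continuous_intros assms) auto
  also have "\<dots> = (\<Sum>i<n. \<Sum>j<n. a i * b j * ip (\<phi> i) (\<phi> j))"
    using ip_sum_right[where f = "\<lambda>j x. b j * \<phi> j x" and A = "{..<n}" and g = "\<lambda>x. a _ * \<phi> _ x"] c
    by (intro sum.cong refl, subst ip_sum_right)
      (auto simp: ip_scale_left ip_scale_right mult_ac sum_distrib_left)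
  also have "\<dots> = (\<Sum>i<n. \<Sum>j<n. if j = i then a i * b i * ip (\<phi> i) (\<phi> i) else 0)"
    using assms(2) by (intro sum.cong refl) auto
  finally show ?thesis by simp
qed

text \<open>Norms are only bounded by 1, since a list of eigenfunctions may contain zero
  functions.\<close>

lemma ip_Bessel:
  fixes \<phi> :: "nat \<Rightarrow> real \<Rightarrow> real"
  assumes "\<And>i. cont01 (\<phi> i)" "\<And>i j. i \<noteq> j \<Longrightarrow> ip (\<phi> i) (\<phi> j) = 0" "\<And>i. ip (\<phi> i) (\<phi> i) \<le> 1" "cont01 F"
  shows "(\<Sum>i<n. (ip (\<phi> i) F)\<^sup>2) \<le> ip F F"
proof -
  define a where "a i = ip (\<phi> i) F" for i
  let ?S = "\<lambda>x. \<Sum>i<n. a i * \<phi> i x"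
  have c: "cont01 ?S" by (intro continuous_intros assms)
  have "ip F ?S = (\<Sum>i<n. ip F (\<lambda>x. a i * \<phi> i x))"
    by (intro ip_sum_right continuous_intros assms) auto
  also have "\<dots> = (\<Sum>i<n. (a i)\<^sup>2)"
    by (intro sum.cong refl) (simp add: ip_scale_right a_def ip_commute power2_eq_square)
  finally have 1: "ip F ?S = (\<Sum>i<n. (a i)\<^sup>2)" .
  have "ip ?S ?S = (\<Sum>i<n. a i * a i * ip (\<phi> i) (\<phi> i))"
    by (rule ip_orthogonal_sum) (use assms in auto)
  also have "\<dots> \<le> (\<Sum>i<n. (a i)\<^sup>2)"
    by (intro sum_mono) (use assms(3) in \<open>auto simp: power2_eq_square intro: mult_left_le\<close>)
  finally have 2: "ip ?S ?S \<le> (\<Sum>i<n. (a i)\<^sup>2)" .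
  have "0 \<le> ip (\<lambda>x. F x + (-1) * ?S x) (\<lambda>x. F x + (-1) * ?S x)" by (rule ip_nonneg)
  also have "\<dots> = ip F F + 2 * (-1) * ip F ?S + (-1)\<^sup>2 * ip ?S ?S"
    by (rule ip_square_add[OF assms(4) c])
  finally show ?thesis using 1 2 by (simp add: a_def)
qed

text \<open>The conclusion of \<open>extremal_eigenpair\<close> as a predicate, so that the
  recursion below can choose such a pair.\<close>

definition extremal :: "(real \<Rightarrow> real \<Rightarrow> real) \<Rightarrow> (real \<Rightarrow> real) \<Rightarrow> real \<Rightarrow> bool" where
  "extremal k \<phi> \<mu> \<longleftrightarrow> cont01 \<phi> \<and> (\<forall>x\<in>{0..1}. iop k \<phi> x = \<mu> * \<phi> x) \<and>
    ((\<mu> = 0 \<and> \<phi> = (\<lambda>_. 0)) \<or> (\<mu> \<noteq> 0 \<and> ip \<phi> \<phi> = 1)) \<and>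
    (\<forall>f. cont01 f \<longrightarrow> ip (iop k f) (iop k f) \<le> \<mu>\<^sup>2 * ip f f)"

text \<open>Deflation: the spectral component of an extremal eigenpair is subtracted, so that the
  operator norm of the remainder is the modulus of the next eigenvalue. The choice is meaningful
  once the current kernel is known to be continuous and symmetric, which the next proof shows by
  induction.\<close>

fun deflated :: "(real \<Rightarrow> real \<Rightarrow> real) \<Rightarrow> nat \<Rightarrow> real \<Rightarrow> real \<Rightarrow> real" where
  "deflated k 0 = k"
| "deflated k (Suc n) =
    (let p = (SOME p. extremal (deflated k n) (fst p) (snd p))
     in (\<lambda>x y. deflated k n x y - snd p * fst p x * fst p y))"

context sym_kernel
begin

text \<open>The remainder after \<open>n\<close> terms is the operator of
  \<open>deflated k n\<close>, whose norm is at most the modulus of \<open>\<mu> n\<close>; as the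
  squares are summable, it tends to 0. The expansion is claimed only for functions in the range of
  the operator; density of that range is a separate matter.\<close>

lemma spectral_decomposition:
  obtains \<phi> :: "nat \<Rightarrow> real \<Rightarrow> real" and \<mu> :: "nat \<Rightarrow> real" where
    "\<And>n. cont01 (\<phi> n)"
    "\<And>n x. x \<in> {0..1} \<Longrightarrow> iop k (\<phi> n) x = \<mu> n * \<phi> n x"
    "\<And>n. (\<mu> n = 0 \<and> \<phi> n = (\<lambda>_. 0)) \<or> (\<mu> n \<noteq> 0 \<and> ip (\<phi> n) (\<phi> n) = 1)"
    "\<And>i j. i \<noteq> j \<Longrightarrow> ip (\<phi> i) (\<phi> j) = 0"
    "summable (\<lambda>n. (\<mu> n)\<^sup>2)"
    "\<And>f. cont01 f \<Longrightarrow>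
      (\<lambda>n. ip (\<lambda>x. iop k f x - (\<Sum>i<n. \<mu> i * ip (\<phi> i) f * \<phi> i x))
              (\<lambda>x. iop k f x - (\<Sum>i<n. \<mu> i * ip (\<phi> i) f * \<phi> i x))) \<longlonglongrightarrow> 0"
proof -
  define p where "p n = (SOME p. extremal (deflated k n) (fst p) (snd p))" for n
  define \<phi> where "\<phi> n = fst (p n)" for n
  define \<mu> where "\<mu> n = snd (p n)" for n
  have dsuc: "deflated k (Suc n) = (\<lambda>x y. deflated k n x y - \<mu> n * \<phi> n x * \<phi> n y)" for n
    by (simp add: p_def \<phi>_def \<mu>_def Let_def)
  have ex: "extremal (deflated k n) (\<phi> n) (\<mu> n)" if sk: "sym_kernel (deflated k n)" for n
  proof -
    obtain f m where "extremal (deflated k n) f m"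
      using sym_kernel.extremal_eigenpair[OF sk] unfolding extremal_def by blast
    then have "extremal (deflated k n) (fst (f, m)) (snd (f, m))" by simp
    then show ?thesis unfolding \<phi>_def \<mu>_def p_def by (rule someI)
  qed
  have sk: "sym_kernel (deflated k n)" for n
  proof (induction n)
    case 0
    show ?case by (simp add: sym_kernel_axioms)
  next
    case (Suc n)
    interpret s: sym_kernel "deflated k n" by (rule Suc)
    have c: "cont01 (\<phi> n)" using ex[OF Suc] by (simp add: extremal_def)
    show ?case
      unfolding dsuc
    proof (unfold_locales, goal_cases)
      case 1
      show ?case using s.kernel_continuous
        by (auto simp: case_prod_beta intro!: continuous_intros continuous_on_compose2[OF c])
    next
      case (2 x y)
      then show ?case using s.kernel_sym by auto
    qed
  qed
  note ex = ex[OF sk]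
  have c: "cont01 (\<phi> n)" for n using ex by (simp add: extremal_def)
  have alt: "(\<mu> n = 0 \<and> \<phi> n = (\<lambda>_. 0)) \<or> (\<mu> n \<noteq> 0 \<and> ip (\<phi> n) (\<phi> n) = 1)" for n
    using ex unfolding extremal_def by blast
  have opd: "iop (deflated k n) f x = iop k f x - (\<Sum>i<n. \<mu> i * ip (\<phi> i) f * \<phi> i x)"
    if f: "cont01 f" and x: "x \<in> {0..1}" for n f x
  proof (induction n)
    case (Suc n)
    have "iop (deflated k (Suc n)) f x = ip (\<lambda>y. deflated k n x y - (\<mu> n * \<phi> n x) * \<phi> n y) f"
      by (simp add: iop_def dsuc mult.assoc del: deflated.simps)
    also have "\<dots> = ip (deflated k n x) f - ip (\<lambda>y. (\<mu> n * \<phi> n x) * \<phi> n y) f"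
      by (intro ip_diff_left sym_kernel.kernel_section[OF sk x] continuous_intros c f)
    finally show ?case using Suc.IH by (simp add: ip_scale_left iop_def)
  qed simp
  \<comment> \<open>A deflated operator annihilates all earlier eigenfunctions. In the induction
    step this holds for \<open>n\<close> itself by construction; for \<open>i < n\<close>, symmetry
    gives \<open>\<mu> n * ip (\<phi> n) (\<phi> i) = 0\<close>, so the subtracted term does not
    contribute.\<close>
  have zero: "iop (deflated k n) (\<phi> i) x = 0" if "i < n" "x \<in> {0..1}" for n i x
    using that
  proof (induction n arbitrary: x)
    case (Suc n)
    have step: "iop (deflated k (Suc n)) (\<phi> i) x = iop (deflated k n) (\<phi> i) x - \<mu> n * ip (\<phi> n) (\<phi> i) * \<phi> n x"
      by (simp add: opd[OF c Suc.prems(2)] del: deflated.simps)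
    show ?case
    proof (cases "i = n")
      case True
      have "iop (deflated k n) (\<phi> n) x = \<mu> n * \<phi> n x"
        using ex Suc.prems(2) unfolding extremal_def by blast
      then show ?thesis using step True alt[of n] by auto
    next
      case False
      then have lt: "i < n" using Suc.prems by simp
      have "\<mu> n * ip (\<phi> n) (\<phi> i) = ip (iop (deflated k n) (\<phi> n)) (\<phi> i)"
        unfolding ip_scale_left[symmetric]
        by (rule ip_cong) (use ex in \<open>auto simp: extremal_def\<close>)
      also have "\<dots> = ip (\<phi> n) (iop (deflated k n) (\<phi> i))"
        by (rule sym_kernel.iop_symmetric[OF sk c c])
      also have "\<dots> = ip (\<phi> n) (\<lambda>_. 0)"
        by (rule ip_cong) (use Suc.IH lt in auto)
      also have "\<dots> = 0" by (simp add: ip_def)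
      finally show ?thesis using step Suc.IH[OF lt Suc.prems(2)] by simp
    qed
  qed simp
  have orth': "ip (\<phi> i) (\<phi> j) = 0" if "i < j" for i j
  proof -
    have "\<mu> j * ip (\<phi> j) (\<phi> i) = ip (iop (deflated k j) (\<phi> j)) (\<phi> i)"
      unfolding ip_scale_left[symmetric]
      by (rule ip_cong) (use ex in \<open>auto simp: extremal_def\<close>)
    also have "\<dots> = ip (\<phi> j) (iop (deflated k j) (\<phi> i))"
      by (rule sym_kernel.iop_symmetric[OF sk c c])
    also have "\<dots> = ip (\<phi> j) (\<lambda>_. 0)"
      by (rule ip_cong) (use zero that in auto)
    also have "\<dots> = 0" by (simp add: ip_def)
    finally show ?thesis using alt[of j] ip_commute[of "\<phi> i" "\<phi> j"]
      by (elim disjE) (simp_all add: ip_def)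
  qed
  have orth: "ip (\<phi> i) (\<phi> j) = 0" if "i \<noteq> j" for i j
    using orth'[of i j] orth'[of j i] that by (cases "i < j") (auto simp: ip_commute)
  have eig: "iop k (\<phi> n) x = \<mu> n * \<phi> n x" if x: "x \<in> {0..1}" for n x
  proof -
    have "\<mu> n * \<phi> n x = iop (deflated k n) (\<phi> n) x"
      using ex x unfolding extremal_def by simp
    also have "\<dots> = iop k (\<phi> n) x" using opd[OF c x] orth by simp
    finally show ?thesis by simp
  qed
  obtain B where B: "B > 0" "\<And>x y. x \<in> {0..1} \<Longrightarrow> y \<in> {0..1} \<Longrightarrow> \<bar>k x y\<bar> \<le> B"
    using kernel_bounded by blast
  have n1: "ip (\<phi> i) (\<phi> i) \<le> 1" for i using alt[of i] by (auto simp: ip_def)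
  \<comment> \<open>The Hilbert-Schmidt bound: Bessel's inequality for each section of the kernel,
    whose coefficients are \<open>\<mu> i * \<phi> i x\<close>, integrated over \<open>x\<close>. A
    zero eigenfunction has eigenvalue 0, so nothing is lost when its norm is replaced by 1.\<close>
  have "(\<Sum>i<n. (\<mu> i)\<^sup>2) \<le> B\<^sup>2" for n
  proof -
    have pt: "(\<Sum>i<n. (\<mu> i)\<^sup>2 * (\<phi> i x * \<phi> i x)) \<le> B\<^sup>2" if x: "x \<in> {0..1}" for x
    proof -
      have "(\<Sum>i<n. (ip (\<phi> i) (k x))\<^sup>2) \<le> ip (k x) (k x)"
        by (rule ip_Bessel[OF c orth n1 kernel_section[OF x]])
      also have "\<dots> \<le> B\<^sup>2" by (rule ip_le_bound[OF kernel_section[OF x]]) (use B x in auto)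
      also have "(\<Sum>i<n. (ip (\<phi> i) (k x))\<^sup>2) = (\<Sum>i<n. (\<mu> i)\<^sup>2 * (\<phi> i x * \<phi> i x))"
        using eig[OF x] unfolding iop_def
        by (intro sum.cong refl) (simp add: ip_commute[of _ "k x"] power2_eq_square mult_ac)
      finally show ?thesis .
    qed
    have "(\<Sum>i<n. (\<mu> i)\<^sup>2) = (\<Sum>i<n. (\<mu> i)\<^sup>2 * ip (\<phi> i) (\<phi> i))"
      by (intro sum.cong refl) (use alt in auto)
    also have "\<dots> = integral {0..1} (\<lambda>x. \<Sum>i<n. (\<mu> i)\<^sup>2 * (\<phi> i x * \<phi> i x))"
      unfolding ip_def
      by (subst integral_sum) (auto intro!: integrable_continuous_interval continuous_intros c)
    also have "\<dots> \<le> integral {0..1} (\<lambda>x::real. B\<^sup>2)"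
      by (rule integral_le) (use pt in \<open>auto intro!: integrable_continuous_interval continuous_intros c\<close>)
    finally show ?thesis by simp
  qed
  then have sm: "summable (\<lambda>n. (\<mu> n)\<^sup>2)"
    by (intro summableI_nonneg_bounded) auto
  have "(\<lambda>n. ip (\<lambda>x. iop k f x - (\<Sum>i<n. \<mu> i * ip (\<phi> i) f * \<phi> i x))
              (\<lambda>x. iop k f x - (\<Sum>i<n. \<mu> i * ip (\<phi> i) f * \<phi> i x))) \<longlonglongrightarrow> 0" (is "?a \<longlonglongrightarrow> 0")
    if f: "cont01 f" for f
  proof (rule tendsto_sandwich[OF _ _ tendsto_const])
    show "\<forall>\<^sub>F n in sequentially. 0 \<le> ?a n" by (simp add: ip_nonneg)
    have "?a n = ip (iop (deflated k n) f) (iop (deflated k n) f)" for n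
      by (rule ip_cong) (simp_all add: opd[OF f])
    then have "?a n \<le> (\<mu> n)\<^sup>2 * ip f f" for n using ex f unfolding extremal_def by auto
    then show "\<forall>\<^sub>F n in sequentially. ?a n \<le> (\<mu> n)\<^sup>2 * ip f f" by simp
    show "(\<lambda>n. (\<mu> n)\<^sup>2 * ip f f) \<longlonglongrightarrow> 0"
      by (rule tendsto_mult_left_zero[OF summable_LIMSEQ_zero[OF sm]])
  qed
  from that[OF c eig alt orth sm this] show thesis .
qed

end

subsection \<open>Eigenfunctions of the Laplacian with Robin or Dirichlet conditions\<close>

text \<open>The solution of \<open>u'' = u\<close> with \<open>u 0 = a\<close> and
  \<open>u' 0 = b\<close>. It satisfies the boundary condition at 0, and its reflection satisfies
  the one at 1; differentiation exchanges the two parameters.\<close>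

definition hyp :: "real \<Rightarrow> real \<Rightarrow> real \<Rightarrow> real" where
  "hyp a b q = a * cosh q + b * sinh q"

lemma hyp_derivative [derivative_intros]:
  assumes "(h has_real_derivative h') (at q within S)"
  shows "((\<lambda>q. hyp a b (h q)) has_real_derivative hyp b a (h q) * h') (at q within S)"
  unfolding hyp_def by (rule derivative_eq_intros assms refl | simp add: algebra_simps)+

lemma hyp_continuous [continuous_intros]:
  "continuous_on S h \<Longrightarrow> continuous_on S (\<lambda>q. hyp a b (h q))"
  unfolding hyp_def by (intro continuous_intros)

definition wronskian :: "real \<Rightarrow> real \<Rightarrow> real" where
  "wronskian a b = (a\<^sup>2 + b\<^sup>2) * sinh 1 + 2 * a * b * cosh 1"

text \<open>The left-hand side is the Wronskian of \<open>hyp a b\<close> and its reflection,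
  constant because \<open>u'' = u\<close> has no first-order term. The value comes from the addition
  theorems at \<open>q + (1 - q) = 1\<close>.\<close>

lemma hyp_wronskian: "hyp b a q * hyp a b (1 - q) + hyp a b q * hyp b a (1 - q) = wronskian a b"
proof -
  have s: "sinh 1 = sinh q * cosh (1 - q) + cosh q * sinh (1 - q)"
    using sinh_add[of q "1 - q"] by simp
  have c: "cosh 1 = cosh q * cosh (1 - q) + sinh q * sinh (1 - q)"
    using cosh_add[of q "1 - q"] by simp
  show ?thesis unfolding wronskian_def s c hyp_def by (simp add: algebra_simps power2_eq_square)
qed

text \<open>The Green function of \<open>1 - \<Delta>\<close> under the boundary conditions given by
  \<open>a\<close> and \<open>b\<close>. The term of order zero keeps the operator invertible in the
  Neumann case.\<close>

definition green :: "real \<Rightarrow> real \<Rightarrow> real \<Rightarrow> real \<Rightarrow> real" where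
  "green a b q r = hyp a b (min q r) * hyp a b (1 - max q r) / wronskian a b"

lemma has_real_derivative_transform:
  assumes "q \<in> S" "\<And>r. r \<in> S \<Longrightarrow> g r = f r" "(f has_real_derivative D) (at q within S)"
  shows "(g has_real_derivative D) (at q within S)"
  using has_derivative_transform[of q S g f] assms unfolding has_field_derivative_def by blast

lemma ip_by_parts:
  assumes "\<And>q. q \<in> {0..1} \<Longrightarrow> (f has_real_derivative f' q) (at q within {0..1})"
    and "\<And>q. q \<in> {0..1} \<Longrightarrow> (g has_real_derivative g' q) (at q within {0..1})"
    and "cont01 f'" "cont01 g'"
  shows "ip f' g = f 1 * g 1 - f 0 * g 0 - ip f g'"
proof -
  have c: "cont01 f" "cont01 g"
    using assms DERIV_continuous_on by blast+
  have "((\<lambda>q. f' q * g q + f q * g' q) has_integral f 1 * g 1 - f 0 * g 0) {0..1}"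
  proof (rule fundamental_theorem_of_calculus)
    fix q :: real assume "q \<in> {0..1}"
    then have "((\<lambda>q. f q * g q) has_real_derivative f' q * g q + f q * g' q) (at q within {0..1})"
      using assms(1,2) by (auto intro!: derivative_eq_intros)
    then show "((\<lambda>q. f q * g q) has_vector_derivative f' q * g q + f q * g' q) (at q within {0..1})"
      by (simp add: has_real_derivative_iff_has_vector_derivative)
  qed simp
  then have "integral {0..1} (\<lambda>q. f' q * g q + f q * g' q) = f 1 * g 1 - f 0 * g 0"
    by (rule integral_unique)
  moreover have "integral {0..1} (\<lambda>q. f' q * g q + f q * g' q) = ip f' g + ip f g'"
    unfolding ip_def by (rule integral_add) (use assms c ip_integrable in auto)
  ultimately show ?thesis by simp
qed

locale boundary_pair =
  fixes a b :: real
  assumes a_nonneg: "a \<ge> 0" and b_nonneg: "b \<ge> 0" and ab_pos: "a + b > 0"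
begin

lemma wronskian_pos: "wronskian a b > 0"
proof -
  have "a\<^sup>2 + b\<^sup>2 > 0" using ab_pos a_nonneg b_nonneg by (simp add: sum_power2_gt_zero_iff)
  then show ?thesis unfolding wronskian_def using a_nonneg b_nonneg by (intro add_pos_nonneg) auto
qed

text \<open>The dissipative sign of the boundary condition, stated without division so that it
  covers \<open>a = 0\<close>. It is applied at 1 with the derivative and at 0 with minus the
  derivative.\<close>

lemma boundary_sign: "a * d = - b * z \<Longrightarrow> z * d \<le> 0"
proof (cases "a = 0")
  case True
  assume "a * d = - b * z"
  then show "z * d \<le> 0" using True ab_pos by simp
next
  case False
  assume "a * d = - b * z"
  then have d: "d = - (b / a) * z" using False by (simp add: field_simps)
  have "0 \<le> (b / a) * z\<^sup>2" using a_nonneg b_nonneg by simp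
  moreover have "z * d = - ((b / a) * z\<^sup>2)" by (simp add: d power2_eq_square)
  ultimately show "z * d \<le> 0" by linarith
qed

definition satisfies_bc :: "(real \<Rightarrow> real) \<Rightarrow> (real \<Rightarrow> real) \<Rightarrow> bool" where
  "satisfies_bc f f' \<longleftrightarrow> a * f' 0 = b * f 0 \<and> a * f' 1 = - b * f 1"

text \<open>Integration by parts with boundary terms of a favourable sign. It gives the sign of the
  eigenvalues, uniqueness for the resolvent equation and the energy bound of the heat flow.\<close>

lemma bc_second_derivative_nonpos:
  assumes "\<And>q. q \<in> {0..1} \<Longrightarrow> (f has_real_derivative f' q) (at q within {0..1})"
    and "\<And>q. q \<in> {0..1} \<Longrightarrow> (f' has_real_derivative f'' q) (at q within {0..1})"
    and "cont01 f''" "satisfies_bc f f'"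
  shows "ip f'' f \<le> - ip f' f'"
proof -
  have "cont01 f'" using assms(2) DERIV_continuous_on by blast
  then have "ip f'' f = f' 1 * f 1 - f' 0 * f 0 - ip f' f'"
    by (intro ip_by_parts assms)
  moreover have "f 1 * f' 1 \<le> 0" "f 0 * - f' 0 \<le> 0"
    using assms(4) by (intro boundary_sign; simp add: satisfies_bc_def)+
  ultimately show ?thesis by (simp add: mult.commute)
qed

sublocale sym_kernel "green a b"
proof
  show "continuous_on ({0..1} \<times> {0..1}) (\<lambda>(x, y). green a b x y)"
    unfolding green_def case_prod_beta using wronskian_pos by (intro continuous_intros) auto
  show "green a b x y = green a b y x" for x y
    by (simp add: green_def min.commute max.commute)
qed

text \<open>Variation of constants: the integral is split at \<open>q\<close>. The contributions of
  the moving endpoint cancel in the first derivative and produce \<open>- f q\<close> through the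
  Wronskian in the second. The bound on the derivative is explicit so that it can be tracked through
  the eigenvalues.\<close>

lemma green_solves:
  assumes f: "cont01 f"
  obtains d where
    "\<And>q. q \<in> {0..1} \<Longrightarrow> (iop (green a b) f has_real_derivative d q) (at q within {0..1})"
    "\<And>q. q \<in> {0..1} \<Longrightarrow> (d has_real_derivative iop (green a b) f q - f q) (at q within {0..1})"
    "satisfies_bc (iop (green a b) f) d"
    "\<forall>q\<in>{0..1}. \<forall>B. (\<forall>r\<in>{0..1}. \<bar>f r\<bar> \<le> B) \<longrightarrow>
       \<bar>d q\<bar> \<le> 2 * (hyp a b 1 * hyp b a 1) / wronskian a b * B"
proof -
  define W where "W = wronskian a b"
  have W: "W > 0" using wronskian_pos by (simp add: W_def)
  let ?u = "\<lambda>r. hyp a b r * f r"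
  let ?v = "\<lambda>r. hyp a b (1 - r) * f r"
  have cu: "cont01 ?u" "cont01 ?v" by (intro continuous_intros f)+
  have iu: "?u integrable_on {s..t}" "?v integrable_on {s..t}" if "0 \<le> s" "t \<le> 1" for s t
    using that by (auto intro!: integrable_continuous_interval continuous_on_subset[OF cu(1)] continuous_on_subset[OF cu(2)])
  define F where "F q = integral {0..q} ?u" for q
  define J where "J q = integral {0..q} ?v" for q
  \<comment> \<open>The integral over \<open>{q..1}\<close> as a difference of integrals from 0,
    which can be differentiated in \<open>q\<close>.\<close>
  define H where "H q = J 1 - J q" for q
  have dF: "(F has_real_derivative ?u q) (at q within {0..1})" if "q \<in> {0..1}" for q
    unfolding F_def by (rule integral_has_real_derivative[OF cu(1) that])
  have dJ: "(J has_real_derivative ?v q) (at q within {0..1})" if "q \<in> {0..1}" for q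
    unfolding J_def by (rule integral_has_real_derivative[OF cu(2) that])
  have dH: "(H has_real_derivative - ?v q) (at q within {0..1})" if "q \<in> {0..1}" for q
    unfolding H_def using dJ[OF that] by (auto intro!: derivative_eq_intros)
  have H_int: "H q = integral {q..1} ?v" if "q \<in> {0..1}" for q
    unfolding H_def J_def using Henstock_Kurzweil_Integration.integral_combine[of 0 q 1 ?v] iu that by auto
  have op: "iop (green a b) f q = (hyp a b (1 - q) * F q + hyp a b q * H q) / W" if q: "q \<in> {0..1}" for q
  proof -
    have "iop (green a b) f q = integral {0..1} (\<lambda>r. green a b q r * f r)"
      by (simp add: iop_def ip_def)
    also have "\<dots> = integral {0..q} (\<lambda>r. green a b q r * f r) + integral {q..1} (\<lambda>r. green a b q r * f r)"
      using q by (intro Henstock_Kurzweil_Integration.integral_combine[symmetric] ip_integrable[OF kernel_section f]) auto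
    also have "integral {0..q} (\<lambda>r. green a b q r * f r) = integral {0..q} (\<lambda>r. hyp a b (1 - q) / W * ?u r)"
      by (rule integral_cong) (auto simp: green_def W_def)
    also have "integral {q..1} (\<lambda>r. green a b q r * f r) = integral {q..1} (\<lambda>r. hyp a b q / W * ?v r)"
      by (rule integral_cong) (auto simp: green_def W_def)
    finally show ?thesis unfolding integral_mult_right H_int[OF q] F_def by (simp add: add_divide_distrib)
  qed
  have hyp1: "((\<lambda>q. hyp c e (1 - q)) has_real_derivative - hyp e c (1 - q)) (at q within {0..1})" for c e q
    using hyp_derivative[of "\<lambda>q. 1 - q" "-1" q "{0..1}" c e] by (auto intro!: derivative_eq_intros)
  have hyp0: "(hyp c e has_real_derivative hyp e c q) (at q within {0..1})" for c e q
    using hyp_derivative[of "\<lambda>q. q" 1 q "{0..1}" c e] by auto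
  define d where "d q = (- hyp b a (1 - q) * F q + hyp b a q * H q) / W" for q
  have d1: "(iop (green a b) f has_real_derivative d q) (at q within {0..1})" if q: "q \<in> {0..1}" for q
  proof -
    have "((\<lambda>q. (hyp a b (1 - q) * F q + hyp a b q * H q) / W) has_real_derivative d q) (at q within {0..1})"
      by (rule DERIV_cong[OF DERIV_cdivide[OF DERIV_add[OF DERIV_mult[OF hyp1 dF[OF q]] DERIV_mult[OF hyp0 dH[OF q]]]]])
        (simp add: d_def algebra_simps)
    then show ?thesis
      by (rule has_real_derivative_transform[OF q, rotated]) (simp add: op)
  qed
  have d2: "(d has_real_derivative iop (green a b) f q - f q) (at q within {0..1})" if q: "q \<in> {0..1}" for q
  proof -
    \<comment> \<open>The endpoint contributions of the second differentiation add up to the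
      Wronskian times \<open>- f q\<close>.\<close>
    have "- hyp b a (1 - q) * ?u q - hyp b a q * ?v q = - W * f q"
      unfolding W_def by (subst hyp_wronskian[of b a q, symmetric]) (simp add: algebra_simps)
    then have *: "hyp a b (1 - q) * F q + ?u q * - hyp b a (1 - q) + (hyp a b q * H q + (- ?v q) * hyp b a q)
        = hyp a b (1 - q) * F q + hyp a b q * H q - W * f q"
      by (simp add: algebra_simps)
    show ?thesis
      unfolding d_def op[OF q]
      by (rule DERIV_cong[OF DERIV_cdivide[OF DERIV_add[OF DERIV_mult[OF DERIV_minus[OF hyp1] dF[OF q]] DERIV_mult[OF hyp0 dH[OF q]]]]])
        (unfold minus_minus *, simp add: W[THEN less_imp_neq, symmetric] diff_divide_distrib)
  qed
  have F0: "F 0 = 0" and H1: "H 1 = 0" by (simp_all add: F_def H_def)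
  have bc: "satisfies_bc (iop (green a b) f) d"
    unfolding satisfies_bc_def d_def by (simp add: op F0 H1 hyp_def)
  have mono: "hyp c d q \<le> hyp c d 1" "0 \<le> hyp c d q" if "0 \<le> c" "0 \<le> d" "q \<in> {0..1}" for c d q
    unfolding hyp_def using that
    by (auto intro!: add_mono mult_left_mono add_nonneg_nonneg mult_nonneg_nonneg simp: cosh_real_nonneg_le_iff)
  note m = mono[OF a_nonneg b_nonneg] mono[OF b_nonneg a_nonneg]
  have bd: "\<bar>d q\<bar> \<le> 2 * (hyp a b 1 * hyp b a 1) / wronskian a b * B"
    if q: "q \<in> {0..1}" and B: "\<And>r. r \<in> {0..1} \<Longrightarrow> \<bar>f r\<bar> \<le> B" for q B
  proof -
    have B0: "B \<ge> 0" using B[of 0] by simp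
    have ib: "\<bar>integral {s..t} h\<bar> \<le> hyp a b 1 * B"
      if "0 \<le> s" "s \<le> t" "t \<le> 1" "cont01 h" "\<And>r. r \<in> {0..1} \<Longrightarrow> \<bar>h r\<bar> \<le> hyp a b 1 * B" for s t h
    proof -
      have "norm (integral {s..t} h) \<le> hyp a b 1 * B * (t - s)"
        by (rule integral_bound) (use that in \<open>auto intro: continuous_on_subset\<close>)
      also have "\<dots> \<le> hyp a b 1 * B * 1"
        using that B0 m(2)[of 1] by (intro mult_left_mono) auto
      finally show ?thesis by simp
    qed
    have ub: "\<bar>?u r\<bar> \<le> hyp a b 1 * B" "\<bar>?v r\<bar> \<le> hyp a b 1 * B" if r: "r \<in> {0..1}" for r
    proof -
      have r': "1 - r \<in> {0..1}" using r by auto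
      show "\<bar>?u r\<bar> \<le> hyp a b 1 * B" unfolding abs_mult
        by (rule mult_mono) (use m(1,2)[OF r] m(2)[of 1] B[OF r] in auto)
      show "\<bar>?v r\<bar> \<le> hyp a b 1 * B" unfolding abs_mult
        by (rule mult_mono) (use m(1,2)[OF r'] m(2)[of 1] B[OF r] in auto)
    qed
    have FH: "\<bar>F q\<bar> \<le> hyp a b 1 * B" "\<bar>H q\<bar> \<le> hyp a b 1 * B"
      unfolding F_def H_int[OF q] using q by (intro ib cu ub; simp)+
    have q': "1 - q \<in> {0..1}" using q by auto
    have "\<bar>- hyp b a (1 - q) * F q\<bar> \<le> hyp b a 1 * (hyp a b 1 * B)"
      unfolding abs_mult by (rule mult_mono) (use m(3,4)[OF q'] m(4)[of 1] FH in auto)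
    moreover have "\<bar>hyp b a q * H q\<bar> \<le> hyp b a 1 * (hyp a b 1 * B)"
      unfolding abs_mult by (rule mult_mono) (use m(3,4)[OF q] m(4)[of 1] FH in auto)
    moreover have "2 * (hyp a b 1 * hyp b a 1) * B = hyp b a 1 * (hyp a b 1 * B) + hyp b a 1 * (hyp a b 1 * B)"
      by simp
    ultimately have "\<bar>- hyp b a (1 - q) * F q + hyp b a q * H q\<bar> \<le> 2 * (hyp a b 1 * hyp b a 1) * B"
      by linarith
    then have "\<bar>- hyp b a (1 - q) * F q + hyp b a q * H q\<bar> / W \<le> 2 * (hyp a b 1 * hyp b a 1) * B / W"
      using W by (intro divide_right_mono) auto
    then show ?thesis unfolding d_def W_def[symmetric] using W by (simp add: abs_divide)
  qed
  show thesis by (rule that[OF d1 d2 bc]) (use bd in auto)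
qed

text \<open>Both sides solve the same boundary value problem. Their difference satisfies
  \<open>z'' = z\<close> and the homogeneous conditions, so \<open>ip z z \<le> - ip z' z'\<close>
  forces it to vanish. Its use is to put smooth functions with the right boundary behaviour into the
  range of the operator.\<close>

lemma green_inverts:
  assumes w: "\<And>q. q \<in> {0..1} \<Longrightarrow> (w has_real_derivative w' q) (at q within {0..1})"
    "\<And>q. q \<in> {0..1} \<Longrightarrow> (w' has_real_derivative w'' q) (at q within {0..1})"
    "cont01 w''" "satisfies_bc w w'" and x: "x \<in> {0..1}"
  shows "iop (green a b) (\<lambda>q. w q - w'' q) x = w x"
proof -
  define f where "f q = w q - w'' q" for q
  have cw: "cont01 w" using w(1) DERIV_continuous_on by blast
  have f: "cont01 f" unfolding f_def by (intro continuous_intros cw w)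
  obtain d where d:
    "\<And>q. q \<in> {0..1} \<Longrightarrow> (iop (green a b) f has_real_derivative d q) (at q within {0..1})"
    "\<And>q. q \<in> {0..1} \<Longrightarrow> (d has_real_derivative iop (green a b) f q - f q) (at q within {0..1})"
    "satisfies_bc (iop (green a b) f) d"
    by (rule green_solves[OF f]) (rule that)
  define z where "z q = iop (green a b) f q - w q" for q
  define z' where "z' q = d q - w' q" for q
  have z1: "(z has_real_derivative z' q) (at q within {0..1})" if "q \<in> {0..1}" for q
    unfolding z_def z'_def using that by (intro derivative_intros d w)
  have z2: "(z' has_real_derivative z q) (at q within {0..1})" if "q \<in> {0..1}" for q
  proof -
    have "(z' has_real_derivative (iop (green a b) f q - f q) - w'' q) (at q within {0..1})"
      unfolding z'_def using that by (intro derivative_intros d w)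
    then show ?thesis by (simp add: f_def z_def)
  qed
  have cz: "cont01 z" using z1 DERIV_continuous_on by blast
  have "satisfies_bc z z'"
    using d(3) w(4) by (auto simp: satisfies_bc_def z_def z'_def algebra_simps)
  from bc_second_derivative_nonpos[OF z1 z2 cz this] have "ip z z = 0"
    using ip_nonneg[of z] ip_nonneg[of z'] by simp
  from ip_eq_0[OF cz this x] show ?thesis by (simp add: z_def f_def[abs_def])
qed

end

text \<open>The endpoints, where \<open>s\<close> may have modulus 1, form a null set; dominated
  convergence is applied on the open interval.\<close>

lemma ip_power_tendsto_0:
  assumes "cont01 f" "cont01 s" "\<And>q. q \<in> {0..1} \<Longrightarrow> \<bar>s q\<bar> \<le> 1" "\<And>q. 0 < q \<Longrightarrow> q < 1 \<Longrightarrow> \<bar>s q\<bar> < 1"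
  shows "(\<lambda>m. ip (\<lambda>q. f q * s q ^ m) (\<lambda>q. f q * s q ^ m)) \<longlonglongrightarrow> 0"
proof -
  obtain B where B: "B > 0" "\<And>x. x \<in> {0..1} \<Longrightarrow> \<bar>f x\<bar> \<le> B" using cont01_bounded[OF assms(1)] by blast
  have "(\<lambda>m. integral {0<..<1} (\<lambda>q. (f q * s q ^ m) * (f q * s q ^ m))) \<longlonglongrightarrow> integral {0<..<1} (\<lambda>q::real. 0::real)"
  proof (rule dominated_convergence(2))
    show "(\<lambda>q. (f q * s q ^ m) * (f q * s q ^ m)) integrable_on {0<..<1}" for m
      unfolding integrable_on_open_interval_real
      by (intro integrable_continuous_interval continuous_intros assms)
    show "(\<lambda>q::real. B * B) integrable_on {0<..<1}"
      unfolding integrable_on_open_interval_real by (intro integrable_continuous_interval continuous_intros)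
    show "norm ((f q * s q ^ m) * (f q * s q ^ m)) \<le> B * B" if "q \<in> {0<..<1}" for m q
    proof -
      have "\<bar>f q * s q ^ m\<bar> \<le> B * 1"
        unfolding abs_mult power_abs using that B(1) B(2)[of q] assms(3)[of q]
        by (intro mult_mono power_le_one) auto
      then have "\<bar>f q * s q ^ m\<bar> * \<bar>f q * s q ^ m\<bar> \<le> B * B" using B by (intro mult_mono) auto
      then show ?thesis by (simp add: abs_mult)
    qed
    show "(\<lambda>m. (f q * s q ^ m) * (f q * s q ^ m)) \<longlonglongrightarrow> 0" if "q \<in> {0<..<1}" for q
    proof -
      have sq: "(\<lambda>m. s q ^ m) \<longlonglongrightarrow> 0" by (rule LIMSEQ_abs_realpow_zero2) (use assms(4) that in auto)
      then have "(\<lambda>m. f q * s q ^ m) \<longlonglongrightarrow> f q * 0" by (rule tendsto_mult[OF tendsto_const])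
      have "(\<lambda>m. (f q * s q ^ m) * (f q * s q ^ m)) \<longlonglongrightarrow> (f q * 0) * (f q * 0)" by (rule tendsto_mult[OF tendsto_mult[OF tendsto_const sq] tendsto_mult[OF tendsto_const sq]])
      then show ?thesis by simp
    qed
  qed
  then show ?thesis by (simp add: ip_def integral_open_interval_real)
qed

text \<open>The \<open>n\<close>-th mode \<open>e\<^sup>-\<^sup>\<lambda>\<^sup>t \<phi>\<close> solves \<open>\<partial>\<^sub>t\<rho> = \<rho>'' / 2\<close>; some \<open>\<phi> n\<close> may be
  identically \<open>0\<close>.\<close>

locale heat_basis = boundary_pair a b for a b :: real +
  fixes \<phi> \<phi>' :: "nat \<Rightarrow> real \<Rightarrow> real" and lam :: "nat \<Rightarrow> real" and C :: real
  assumes phi_derivative: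
      "\<And>n q. q \<in> {0..1} \<Longrightarrow> (\<phi> n has_real_derivative \<phi>' n q) (at q within {0..1})"
    and phi'_derivative:
      "\<And>n q. q \<in> {0..1} \<Longrightarrow> (\<phi>' n has_real_derivative - 2 * lam n * \<phi> n q) (at q within {0..1})"
    and phi_bc: "\<And>n. satisfies_bc (\<phi> n) (\<phi>' n)"
    and lam_nonneg: "\<And>n. lam n \<ge> 0"
    and lam_summable: "summable (\<lambda>n. 1 / (1 + 2 * lam n)\<^sup>2)"
    and phi_bound: "\<And>n q. q \<in> {0..1} \<Longrightarrow> \<bar>\<phi> n q\<bar> \<le> C * (1 + 2 * lam n)"
    and phi'_bound: "\<And>n q. q \<in> {0..1} \<Longrightarrow> \<bar>\<phi>' n q\<bar> \<le> C * (1 + 2 * lam n)\<^sup>2"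
    and phi_orthogonal: "\<And>i j. i \<noteq> j \<Longrightarrow> ip (\<phi> i) (\<phi> j) = 0"
    and phi_norm: "\<And>n. \<phi> n = (\<lambda>_. 0) \<or> ip (\<phi> n) (\<phi> n) = 1"
    and phi_dense: "\<And>G e. cont01 G \<Longrightarrow> e > 0 \<Longrightarrow>
      \<exists>n c. ip (\<lambda>x. G x - (\<Sum>i<n. c i * \<phi> i x)) (\<lambda>x. G x - (\<Sum>i<n. c i * \<phi> i x)) < e"

text \<open>An eigenfunction of the resolvent for \<open>\<mu>\<close> satisfies
  \<open>\<phi>'' = (1 - 1 / \<mu>) \<phi>\<close>, so \<open>1 + 2 * lam = 1 / \<mu>\<close>, and
  square summability of the \<open>\<mu> n\<close> becomes \<open>lam_summable\<close>. Writing
  \<phi> as its image divided by \<open>\<mu>\<close> costs one factor \<open>1 + 2 * lam\<close> in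
  the uniform bound; the derivative costs a second one.\<close>

lemma (in boundary_pair) heat_basis_exists: "\<exists>\<phi> \<phi>' lam C. heat_basis a b \<phi> \<phi>' lam C"
proof -
  obtain \<phi> \<mu> where
    c: "\<And>n. cont01 (\<phi> n)" and
    eig: "\<And>n x. x \<in> {0..1} \<Longrightarrow> iop (green a b) (\<phi> n) x = \<mu> n * \<phi> n x" and
    alt: "\<And>n. (\<mu> n = 0 \<and> \<phi> n = (\<lambda>_. 0)) \<or> (\<mu> n \<noteq> 0 \<and> ip (\<phi> n) (\<phi> n) = 1)" and
    orth: "\<And>i j::nat. i \<noteq> j \<Longrightarrow> ip (\<phi> i) (\<phi> j) = 0" and
    sm: "summable (\<lambda>n. (\<mu> n)\<^sup>2)" and
    lim: "\<And>f. cont01 f \<Longrightarrow>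
      (\<lambda>n. ip (\<lambda>x. iop (green a b) f x - (\<Sum>i<n. \<mu> i * ip (\<phi> i) f * \<phi> i x))
              (\<lambda>x. iop (green a b) f x - (\<Sum>i<n. \<mu> i * ip (\<phi> i) f * \<phi> i x))) \<longlonglongrightarrow> 0"
    by (rule spectral_decomposition) (rule that)
  obtain B where B: "B > 0" "\<And>x y. x \<in> {0..1} \<Longrightarrow> y \<in> {0..1} \<Longrightarrow> \<bar>green a b x y\<bar> \<le> B"
    using kernel_bounded by blast
  define E where "E = 2 * (hyp a b 1 * hyp b a 1) / wronskian a b"
  have hypnn: "hyp c d 1 \<ge> 0" if "0 \<le> c" "0 \<le> d" for c d using that by (simp add: hyp_def)
  have E: "E \<ge> 0" unfolding E_def using wronskian_pos hypnn a_nonneg b_nonneg by (intro divide_nonneg_pos mult_nonneg_nonneg) auto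
  \<comment> \<open>A zero eigenfunction satisfies its equation for every \<open>lam\<close>; the
    value \<open>n\<close> keeps the series in \<open>lam_summable\<close> convergent.\<close>
  define lam where "lam n = (if \<mu> n = 0 then real n else (1 / \<mu> n - 1) / 2)" for n
  define C where "C = max B (E * B)"
  have mode: "\<exists>\<phi>'. (\<forall>q\<in>{0..1}. (\<phi> n has_real_derivative \<phi>' q) (at q within {0..1}) \<and>
       (\<phi>' has_real_derivative - 2 * lam n * \<phi> n q) (at q within {0..1}) \<and>
       \<bar>\<phi> n q\<bar> \<le> C * (1 + 2 * lam n) \<and> \<bar>\<phi>' q\<bar> \<le> C * (1 + 2 * lam n)\<^sup>2) \<and>
       satisfies_bc (\<phi> n) \<phi>' \<and> lam n \<ge> 0" for n
  proof (cases "\<mu> n = 0")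
    case True
    then have "\<phi> n = (\<lambda>_. 0)" using alt by auto
    moreover have "C \<ge> 0" using B by (simp add: C_def)
    ultimately show ?thesis
      using True by (intro exI[of _ "\<lambda>_. 0"]) (simp add: satisfies_bc_def lam_def)
  next
    case False
    define m where "m = \<mu> n"
    have m: "m \<noteq> 0" using False by (simp add: m_def)
    have one: "1 + 2 * lam n = 1 / m" using False by (simp add: lam_def m_def field_simps)
    obtain d where d:
      "\<And>q. q \<in> {0..1} \<Longrightarrow> (iop (green a b) (\<phi> n) has_real_derivative d q) (at q within {0..1})"
      "\<And>q. q \<in> {0..1} \<Longrightarrow> (d has_real_derivative iop (green a b) (\<phi> n) q - \<phi> n q) (at q within {0..1})"
      "satisfies_bc (iop (green a b) (\<phi> n)) d"
      "\<forall>q\<in>{0..1}. \<forall>B. (\<forall>r\<in>{0..1}. \<bar>\<phi> n r\<bar> \<le> B) \<longrightarrow> \<bar>d q\<bar> \<le> E * B"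
      by (rule green_solves[OF c[of n], folded E_def]) (rule that)
    define p where "p q = d q / m" for q
    have phi: "\<phi> n q = iop (green a b) (\<phi> n) q / m" if "q \<in> {0..1}" for q
      using eig[OF that, of n] m by (simp add: m_def)
    have p1: "(\<phi> n has_real_derivative p q) (at q within {0..1})" if q: "q \<in> {0..1}" for q
    proof -
      have "((\<lambda>q. iop (green a b) (\<phi> n) q / m) has_real_derivative p q) (at q within {0..1})"
        unfolding p_def by (rule DERIV_cdivide[OF d(1)[OF q]])
      then show ?thesis by (rule has_real_derivative_transform[OF q, rotated]) (simp add: phi)
    qed
    have p2: "(p has_real_derivative - 2 * lam n * \<phi> n q) (at q within {0..1})" if q: "q \<in> {0..1}" for q
    proof -
      have "(p has_real_derivative (iop (green a b) (\<phi> n) q - \<phi> n q) / m) (at q within {0..1})"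
        unfolding p_def by (rule DERIV_cdivide[OF d(2)[OF q]])
      moreover have "(iop (green a b) (\<phi> n) q - \<phi> n q) / m = \<phi> n q - (1 + 2 * lam n) * \<phi> n q"
        unfolding one using phi[OF q] m by (simp add: diff_divide_distrib)
      ultimately show ?thesis by (simp add: algebra_simps)
    qed
    have bc: "satisfies_bc (\<phi> n) p"
      using d(3) m by (simp add: satisfies_bc_def p_def phi[of 0] phi[of 1] field_simps)
    \<comment> \<open>The sign of \<open>lam\<close> comes from the quadratic form; positivity of
      the eigenvalue \<open>m\<close> follows from it.\<close>
    have "ip (\<lambda>q. - 2 * lam n * \<phi> n q) (\<phi> n) \<le> - ip p p"
      by (rule bc_second_derivative_nonpos[OF p1 p2 _ bc]) (auto intro!: continuous_intros c)
    then have "- 2 * lam n * ip (\<phi> n) (\<phi> n) \<le> 0"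
      unfolding ip_scale_left using ip_nonneg[of p] by linarith
    then have lam0: "lam n \<ge> 0" using alt[of n] False by simp
    then have mpos: "m > 0" using one by (metis add_pos_nonneg mult_nonneg_nonneg zero_le_numeral zero_less_divide_1_iff zero_less_one)
    have b1: "\<bar>\<phi> n q\<bar> \<le> B * (1 + 2 * lam n)" if q: "q \<in> {0..1}" for q
    proof -
      have "(iop (green a b) (\<phi> n) q)\<^sup>2 \<le> B\<^sup>2 * ip (\<phi> n) (\<phi> n)" by (rule iop_bound[OF c q B(2)])
      then have "\<bar>iop (green a b) (\<phi> n) q\<bar> \<le> B"
        using alt[of n] False B by (simp add: abs_le_square_iff[symmetric])
      then show ?thesis unfolding phi[OF q] one using mpos by (simp add: divide_right_mono)
    qed
    have lp: "1 + 2 * lam n \<ge> 0" using lam0 by simp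
    have b2: "\<bar>p q\<bar> \<le> E * B * (1 + 2 * lam n)\<^sup>2" if q: "q \<in> {0..1}" for q
    proof -
      have "\<bar>d q\<bar> \<le> E * (B * (1 + 2 * lam n))" using d(4) q b1 by blast
      then have "\<bar>d q\<bar> / m \<le> E * (B * (1 + 2 * lam n)) / m" using mpos by (simp add: divide_right_mono)
      then show ?thesis using mpos by (simp add: p_def one power2_eq_square)
    qed
    have BC: "B \<le> C" "E * B \<le> C" by (auto simp: C_def)
    have "\<bar>\<phi> n q\<bar> \<le> C * (1 + 2 * lam n)" "\<bar>p q\<bar> \<le> C * (1 + 2 * lam n)\<^sup>2" if q: "q \<in> {0..1}" for q
      using b1[OF q] b2[OF q] mult_right_mono[OF BC(1) lp] mult_right_mono[OF BC(2), of "(1 + 2 * lam n)\<^sup>2"]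
      by (auto intro: order_trans)
    then show ?thesis using p1 p2 bc lam0 by (intro exI[of _ p]) auto
  qed
  then obtain \<phi>' where \<phi>': "\<And>n. (\<forall>q\<in>{0..1}. (\<phi> n has_real_derivative \<phi>' n q) (at q within {0..1}) \<and>
       (\<phi>' n has_real_derivative - 2 * lam n * \<phi> n q) (at q within {0..1}) \<and>
       \<bar>\<phi> n q\<bar> \<le> C * (1 + 2 * lam n) \<and> \<bar>\<phi>' n q\<bar> \<le> C * (1 + 2 * lam n)\<^sup>2) \<and>
       satisfies_bc (\<phi> n) (\<phi>' n) \<and> lam n \<ge> 0" by metis
  have "heat_basis a b \<phi> \<phi>' lam C"
  proof (unfold_locales, goal_cases)
    case (5 )
    have le: "1 / (1 + 2 * lam n)\<^sup>2 \<le> (\<mu> n)\<^sup>2 + inverse ((real (Suc n))\<^sup>2)" for n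
    proof (cases "\<mu> n = 0")
      case True
      then have "real (Suc n) \<le> 1 + 2 * lam n" by (simp add: lam_def)
      then have "(real (Suc n))\<^sup>2 \<le> (1 + 2 * lam n)\<^sup>2" by (intro power_mono) auto
      then show ?thesis using True by (simp add: divide_inverse le_imp_inverse_le)
    next
      case False
      then have "1 + 2 * lam n = 1 / \<mu> n" by (simp add: lam_def field_simps)
      then show ?thesis by (simp add: power_divide)
    qed
    have "summable (\<lambda>n. (\<mu> n)\<^sup>2 + inverse ((real (Suc n))\<^sup>2))"
      using inverse_power_summable[of 2, where 'a = real] summable_Suc_iff[of "\<lambda>n. inverse ((real n)\<^sup>2)"]
      by (intro summable_add sm) simp
    then show ?case
      by (rule summable_comparison_test'[where N = 0]) (use le in auto)
  next
    case (8 i j)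
    then show ?case by (rule orth)
  next
    case (9 n)
    show ?case using alt by auto
  next
    \<comment> \<open>Density of the span: \<open>G\<close> is approximated by a polynomial
      \<open>p\<close>, then \<open>p\<close> by a polynomial \<open>w\<close> that vanishes with
      its derivative at both ends. Such a \<open>w\<close> meets every boundary condition, hence
      equals the image of \<open>w - w''\<close>, whose eigenfunction expansion converges. The three
      errors, each at most \<open>e / 16\<close>, enter with weights 4, 4 and 2.\<close>
    case (10 G e)
    obtain p where p: "real_polynomial_function p" "\<And>x. x \<in> {0..1} \<Longrightarrow> \<bar>G x - p x\<bar> < sqrt (e / 16)"
      using Stone_Weierstrass_real_polynomial_function[of "{0..1}" G "sqrt (e / 16)"] 10 by auto
    \<comment> \<open>\<open>s\<close> is 1 at both ends and of modulus below 1 inside, so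
      \<open>1 - s ^ m\<close> tends to 1 inside. The square makes \<open>1 - s ^ m\<close> vanish
      to second order at the ends.\<close>
    define s where "s q = 1 - (4 * q * (1 - q))\<^sup>2" for q :: real
    have pc: "cont01 p" using p(1) by (simp add: continuous_on_polymonial_function real_polynomial_function_eq)
    have quarter: "4 * q * (1 - q) \<le> 1" for q :: real
      using zero_le_power2[of "2 * q - 1"] by (simp add: power2_eq_square algebra_simps)
    have s1: "\<bar>s q\<bar> \<le> 1" if "q \<in> {0..1}" for q
      using quarter[of q] that power_mono[OF quarter[of q], of 2] by (auto simp: s_def abs_le_iff)
    have s2: "\<bar>s q\<bar> < 1" if "0 < q" "q < 1" for q
    proof -
      have "0 < (4 * q * (1 - q))\<^sup>2" using that by simp
      moreover have "(4 * q * (1 - q))\<^sup>2 \<le> 1" using quarter[of q] that power_mono[OF quarter[of q], of 2] by auto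
      ultimately show ?thesis by (simp add: s_def)
    qed
    have sc: "cont01 s" unfolding s_def by (intro continuous_intros)
    have "\<forall>\<^sub>F m in sequentially. ip (\<lambda>q. p q * s q ^ m) (\<lambda>q. p q * s q ^ m) < e / 16"
      by (rule order_tendstoD(2)[OF ip_power_tendsto_0[OF pc sc s1 s2]]) (use 10 in auto)
    then obtain m where m: "ip (\<lambda>q. p q * s q ^ m) (\<lambda>q. p q * s q ^ m) < e / 16"
      by (meson eventually_happens trivial_limit_sequentially)
    define w where "w q = p q * (1 - s q ^ m)" for q
    have "real_polynomial_function (\<lambda>q::real. q)"
      by (intro real_polynomial_function.intros(1) bounded_linear_ident)
    then have "real_polynomial_function w"
      unfolding w_def s_def
      by (intro real_polynomial_function.intros(2-4) p real_polynomial_function_diff real_polynomial_function_power)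
    then obtain w' where w': "real_polynomial_function w'" "\<And>q. (w has_real_derivative w' q) (at q)"
      using has_real_derivative_polynomial_function[of w] by auto
    obtain w'' where w'': "real_polynomial_function w''" "\<And>q. (w' has_real_derivative w'' q) (at q)"
      using has_real_derivative_polynomial_function[OF w'(1)] by auto
    obtain p' where p': "\<And>q. (p has_real_derivative p' q) (at q)"
      using has_real_derivative_polynomial_function[OF p(1)] by auto
    have "w' q = 0 \<and> w q = 0" if "q = 0 \<or> q = 1" for q
    proof -
      have "(w has_real_derivative 0) (at q)"
        unfolding w_def s_def using that
        by (auto intro!: derivative_eq_intros p')
      then show ?thesis using DERIV_unique[OF w'(2)] that by (auto simp: w_def s_def)
    qed
    then have bc: "satisfies_bc w w'" by (simp add: satisfies_bc_def)
    define h where "h q = w q - w'' q" for q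
    have wc: "cont01 w" "cont01 w''"
      using w'(2) w'' by (auto intro: DERIV_continuous_on has_field_derivative_at_within continuous_on_polymonial_function simp: real_polynomial_function_eq)
    have hc: "cont01 h" unfolding h_def by (intro continuous_intros wc)
    have Kh: "iop (green a b) h x = w x" if "x \<in> {0..1}" for x
      unfolding h_def by (rule green_inverts[OF _ _ wc(2) bc that]) (use w' w'' has_field_derivative_at_within in blast)+
    define S where "S n x = (\<Sum>i<n. \<mu> i * ip (\<phi> i) h * \<phi> i x)" for n x
    have Sc: "cont01 (S n)" for n unfolding S_def by (intro continuous_intros c)
    have "\<forall>\<^sub>F n in sequentially. ip (\<lambda>x. iop (green a b) h x - S n x) (\<lambda>x. iop (green a b) h x - S n x) < e / 16"
      unfolding S_def by (rule order_tendstoD(2)[OF lim[OF hc]]) (use 10 in auto)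
    then obtain n where n: "ip (\<lambda>x. iop (green a b) h x - S n x) (\<lambda>x. iop (green a b) h x - S n x) < e / 16"
      by (meson eventually_happens trivial_limit_sequentially)
    have "ip (\<lambda>x. iop (green a b) h x - S n x) (\<lambda>x. iop (green a b) h x - S n x) = ip (\<lambda>x. w x - S n x) (\<lambda>x. w x - S n x)"
      by (rule ip_cong) (simp_all add: Kh)
    with n have n: "ip (\<lambda>x. w x - S n x) (\<lambda>x. w x - S n x) < e / 16" by simp
    have Gp: "ip (\<lambda>x. G x - p x) (\<lambda>x. G x - p x) \<le> (sqrt (e / 16))\<^sup>2"
      by (rule ip_le_bound) (use 10 pc p(2) in \<open>auto intro!: continuous_intros less_imp_le\<close>)
    have c1: "cont01 (\<lambda>x. G x - p x)" "cont01 (\<lambda>x. p x * s x ^ m)" "cont01 (\<lambda>x. w x - S n x)"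
      "cont01 (\<lambda>x. (G x - p x) + p x * s x ^ m)"
      by (intro continuous_intros 10 pc sc wc Sc)+
    have "(\<lambda>x. G x - S n x) = (\<lambda>x. ((G x - p x) + p x * s x ^ m) + (w x - S n x))"
      by (simp add: w_def algebra_simps fun_eq_iff)
    then have "ip (\<lambda>x. G x - S n x) (\<lambda>x. G x - S n x) \<le>
       2 * (2 * ip (\<lambda>x. G x - p x) (\<lambda>x. G x - p x) + 2 * ip (\<lambda>x. p x * s x ^ m) (\<lambda>x. p x * s x ^ m))
       + 2 * ip (\<lambda>x. w x - S n x) (\<lambda>x. w x - S n x)"
      using ip_square_le[OF c1(4,3)] ip_square_le[OF c1(1,2)] by simp
    also have "\<dots> < e" using Gp m n 10 by simp
    finally show ?case unfolding S_def
      by (intro exI[of _ n] exI[of _ "\<lambda>i. \<mu> i * ip (\<phi> i) h"]) (simp add: mult.assoc)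
  qed (use \<phi>' in auto)
  then show ?thesis by blast
qed

subsection \<open>Continuous-time Markov chains on a finite state space\<close>

lemma pmf_expectation_finite:
  fixes f :: "'s \<Rightarrow> real"
  assumes "finite S" "set_pmf p \<subseteq> S"
  shows "measure_pmf.expectation p f = (\<Sum>y\<in>S. pmf p y * f y)"
  using integral_measure_pmf[OF assms(1), of p f] assms(2) by auto

lemma pmf_expectation_bound:
  fixes f :: "'s \<Rightarrow> real"
  assumes "finite S" "set_pmf p \<subseteq> S"
  shows "\<bar>measure_pmf.expectation p f\<bar> \<le> (\<Sum>y\<in>S. \<bar>f y\<bar>)"
proof -
  have "\<bar>\<Sum>y\<in>S. pmf p y * f y\<bar> \<le> (\<Sum>y\<in>S. \<bar>pmf p y * f y\<bar>)" by (rule sum_abs)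
  also have "\<dots> \<le> (\<Sum>y\<in>S. 1 * \<bar>f y\<bar>)"
    unfolding abs_mult by (intro sum_mono mult_right_mono) (auto simp: pmf_le_1)
  finally show ?thesis by (simp add: pmf_expectation_finite[OF assms])
qed

locale finite_semigroup =
  fixes S :: "'s set" and K :: "real \<Rightarrow> 's \<Rightarrow> 's pmf" and L :: "('s \<Rightarrow> real) \<Rightarrow> 's \<Rightarrow> real"
  assumes finite_S: "finite S" and semigroup: "transition_semigroup S K"
    and generator: "has_generator S K L"
begin

definition P :: "real \<Rightarrow> ('s \<Rightarrow> real) \<Rightarrow> 's \<Rightarrow> real" where
  "P t f x = measure_pmf.expectation (K t x) f"

lemma K_support: "t \<ge> 0 \<Longrightarrow> x \<in> S \<Longrightarrow> set_pmf (K t x) \<subseteq> S"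
  using semigroup by (simp add: transition_semigroup_def)

lemma P_sum: "t \<ge> 0 \<Longrightarrow> x \<in> S \<Longrightarrow> P t f x = (\<Sum>y\<in>S. pmf (K t x) y * f y)"
  unfolding P_def by (rule pmf_expectation_finite[OF finite_S K_support])

lemma P_bound: "t \<ge> 0 \<Longrightarrow> x \<in> S \<Longrightarrow> \<bar>P t f x\<bar> \<le> (\<Sum>y\<in>S. \<bar>f y\<bar>)"
  unfolding P_def by (rule pmf_expectation_bound[OF finite_S K_support])

lemma P_add:
  assumes "s \<ge> 0" "t \<ge> 0" "x \<in> S"
  shows "P (s + t) f x = P s (P t f) x"
proof -
  have "K (s + t) x = bind_pmf (K s x) (K t)"
    using semigroup assms by (simp add: transition_semigroup_def)
  then have "P (s + t) f x = (\<Sum>a\<in>S. pmf (K s x) a *\<^sub>R P t f a)"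
    unfolding P_def
    by (simp only:) (rule pmf_expectation_bind, use finite_S assms finite_subset[OF K_support] in \<open>auto intro: K_support[THEN subsetD]\<close>)
  then show ?thesis using assms by (simp add: P_sum[of s x])
qed

lemma P_diff: "t \<ge> 0 \<Longrightarrow> x \<in> S \<Longrightarrow> P t (\<lambda>y. f y - g y) x = P t f x - P t g x"
  by (simp add: P_sum right_diff_distrib sum_subtractf)

lemma P_scale: "t \<ge> 0 \<Longrightarrow> x \<in> S \<Longrightarrow> P t (\<lambda>y. f y / c) x = P t f x / c"
  by (simp add: P_sum sum_divide_distrib)

lemma P_quotient:
  "x \<in> S \<Longrightarrow> ((\<lambda>h. (P h f x - f x) / h) \<longlongrightarrow> L f x) (at_right 0)"
  using generator by (simp add: has_generator_def P_def)

lemma P_right_continuous: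
  assumes "x \<in> S"
  shows "((\<lambda>h. P h f x - f x) \<longlongrightarrow> 0) (at_right 0)"
proof -
  have "((\<lambda>h. h * ((P h f x - f x) / h)) \<longlongrightarrow> 0 * L f x) (at_right 0)"
    by (intro tendsto_mult P_quotient assms tendsto_ident_at)
  moreover have "\<forall>\<^sub>F h in at_right 0. h * ((P h f x - f x) / h) = P h f x - f x"
    by (auto simp: eventually_at_filter)
  ultimately show ?thesis by (simp add: tendsto_cong)
qed

text \<open>Only the right derivative at \<open>0\<close> is given; writing both difference quotients at \<open>t\<close> as
  \<open>P m ((P h f - f) / h)\<close> with \<open>m = min s t\<close> yields the two-sided derivative.\<close>

lemma P_derivative:
  assumes t: "t \<ge> 0" and x: "x \<in> S"
  shows "((\<lambda>t. P t f x) has_real_derivative P t (L f) x) (at t within {0..})"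
proof -
  \<comment> \<open>An error bound depending only on the distance of the two times: both sums run
    over the whole finite state space, and the semigroup at any time is bounded by such a sum. The
    first sum is the error of the quotient at time 0; the second pays for \<open>min s t\<close> in
    place of \<open>t\<close>.\<close>
  define Q where "Q h = (\<Sum>y\<in>S. \<bar>(P h f y - f y) / h - L f y\<bar>) + (\<Sum>y\<in>S. \<bar>P h (L f) y - L f y\<bar>)" for h
  have "((\<lambda>h. \<bar>(P h f y - f y) / h - L f y\<bar>) \<longlongrightarrow> \<bar>L f y - L f y\<bar>) (at_right 0)" if "y \<in> S" for y
    by (intro tendsto_intros P_quotient that)
  moreover have "((\<lambda>h. \<bar>P h (L f) y - L f y\<bar>) \<longlongrightarrow> \<bar>0\<bar>) (at_right 0)" if "y \<in> S" for y
    by (intro tendsto_rabs P_right_continuous that)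
  ultimately have "(Q \<longlongrightarrow> (\<Sum>y\<in>S. 0) + (\<Sum>y\<in>S. 0)) (at_right 0)"
    unfolding Q_def by (intro tendsto_add tendsto_sum) auto
  then have Q0: "(Q \<longlongrightarrow> 0) (at_right 0)" by simp
  have bound: "\<bar>(P s f x - P t f x) / (s - t) - P t (L f) x\<bar> \<le> Q \<bar>s - t\<bar>" if s: "s \<ge> 0" "s \<noteq> t" for s
  proof -
    define m h where "m = min s t" and "h = \<bar>s - t\<bar>"
    have m: "m \<ge> 0" "h > 0" using s t by (auto simp: m_def h_def)
    have "(P s f x - P t f x) / (s - t) = (P (m + h) f x - P m f x) / h"
      using s by (auto simp: m_def h_def min_def abs_if field_simps)
    also have "\<dots> = P m (\<lambda>y. (P h f y - f y) / h) x"
      using m x by (simp add: P_add P_scale P_diff)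
    finally have 1: "(P s f x - P t f x) / (s - t) = P m (\<lambda>y. (P h f y - f y) / h) x" .
    have 2: "\<bar>P m (L f) x - P t (L f) x\<bar> \<le> (\<Sum>y\<in>S. \<bar>P h (L f) y - L f y\<bar>)"
    proof (cases "s \<le> t")
      case True
      then have "P t (L f) x = P (m + h) (L f) x" by (simp add: m_def h_def)
      then have "\<bar>P m (L f) x - P t (L f) x\<bar> = \<bar>P m (\<lambda>y. P h (L f) y - L f y) x\<bar>"
        using m x by (simp add: P_add P_diff)
      then show ?thesis using P_bound[OF m(1) x] by metis
    next
      case False
      then show ?thesis by (simp add: m_def sum_nonneg)
    qed
    have "\<bar>P m (\<lambda>y. (P h f y - f y) / h) x - P m (L f) x\<bar> = \<bar>P m (\<lambda>y. (P h f y - f y) / h - L f y) x\<bar>"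
      using m x by (simp add: P_diff)
    also have "\<dots> \<le> (\<Sum>y\<in>S. \<bar>(P h f y - f y) / h - L f y\<bar>)" by (rule P_bound[OF m(1) x])
    finally show ?thesis using 1 2 unfolding Q_def h_def[symmetric] by linarith
  qed
  have "filterlim (\<lambda>s. \<bar>s - t\<bar>) (at_right 0) (at t within {0..})"
  proof -
    have "((\<lambda>s. \<bar>s - t\<bar>) \<longlongrightarrow> \<bar>t - t\<bar>) (at t within {0..})" by (intro tendsto_intros)
    then show ?thesis
      unfolding filterlim_at by (auto simp: eventually_at_filter)
  qed
  from filterlim_compose[OF Q0 this] have "((\<lambda>s. Q \<bar>s - t\<bar>) \<longlongrightarrow> 0) (at t within {0..})" .
  then have "((\<lambda>s. (P s f x - P t f x) / (s - t) - P t (L f) x) \<longlongrightarrow> 0) (at t within {0..})"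
    by (rule Lim_null_comparison[rotated]) (use bound in \<open>auto simp: eventually_at_filter\<close>)
  then have "((\<lambda>s. (P s f x - P t f x) / (s - t)) \<longlongrightarrow> P t (L f) x) (at t within {0..})"
    using Lim_null by blast
  then show ?thesis by (simp add: has_field_derivative_iff)
qed

end

lemma markov_process_integrable:
  fixes f :: "'s \<Rightarrow> real"
  assumes "markov_process M X S L \<mu>" "finite S" "t \<ge> 0"
  shows "integrable M (\<lambda>\<omega>. f (X t \<omega>))"
proof -
  interpret prob_space M using assms by (simp add: markov_process_def)
  have X: "X t \<in> measurable M (count_space S)" using assms by (simp add: markov_process_def)
  have "(\<lambda>\<omega>. f (X t \<omega>)) \<in> borel_measurable M"
    by (rule measurable_compose[OF X]) simp
  moreover have "norm (f (X t \<omega>)) \<le> (\<Sum>y\<in>S. \<bar>f y\<bar>)" if "\<omega> \<in> space M" for \<omega>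
    using measurable_space[OF X that] assms(2) member_le_sum[of "X t \<omega>" S "\<lambda>y. \<bar>f y\<bar>"] by auto
  ultimately show ?thesis by (intro integrable_const_bound) auto
qed

text \<open>Kolmogorov's equation for expectations. Conditioning at time 0 makes the expectation a
  finite combination of the functions \<open>P t f y\<close> with constant weights, and
  \<open>P_derivative\<close> applies to each of them.\<close>

lemma markov_process_expectation_derivative:
  fixes f :: "'s \<Rightarrow> real"
  assumes mp: "markov_process M X S L \<mu>" and fin: "finite S" and t: "t \<ge> 0"
  shows "((\<lambda>t. \<integral>\<omega>. f (X t \<omega>) \<partial>M) has_real_derivative (\<integral>\<omega>. L f (X t \<omega>) \<partial>M)) (at t within {0..})"
proof -
  interpret prob_space M using mp by (simp add: markov_process_def)
  have X: "\<And>t. t \<ge> 0 \<Longrightarrow> X t \<in> measurable M (count_space S)" using mp by (simp add: markov_process_def)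
  obtain K where K: "transition_semigroup S K" "has_generator S K L"
    "\<And>t f. t \<ge> 0 \<Longrightarrow> AE \<omega> in M. real_cond_exp M (natural_filtration M X 0) (\<lambda>\<omega>. f (X t \<omega>)) \<omega> =
          measure_pmf.expectation (K (t - 0) (X 0 \<omega>)) f"
    using mp unfolding markov_process_def by blast
  interpret finite_semigroup S K L by unfold_locales (use fin K in auto)
  have sub: "{X u -` A \<inter> space M | u A. 0 \<le> u \<and> u \<le> 0} \<subseteq> sets M"
  proof safe
    fix u :: real and A assume "0 \<le> u" "u \<le> 0"
    \<comment> \<open>\<open>A\<close> is an arbitrary set of states; intersecting it with
      \<open>S\<close> makes the measurability of \<open>X 0\<close> applicable.\<close>
    then have "X 0 -` (A \<inter> S) \<inter> space M \<in> sets M" "u = 0"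
      using measurable_sets[OF X[of 0], of "A \<inter> S"] by auto
    moreover have "X 0 -` (A \<inter> S) \<inter> space M = X 0 -` A \<inter> space M"
      using measurable_space[OF X[of 0]] by auto
    ultimately show "X u -` A \<inter> space M \<in> sets M" by simp
  qed
  have "subalgebra M (natural_filtration M X 0)"
    unfolding subalgebra_def natural_filtration_def
  proof (intro conjI)
    have "{X u -` A \<inter> space M | u A. 0 \<le> u \<and> u \<le> 0} \<subseteq> Pow (space M)"
      using sub sets.space_closed by (rule subset_trans)
    then show "sets (sigma (space M) {X u -` A \<inter> space M | u A. 0 \<le> u \<and> u \<le> 0}) \<subseteq> sets M"
      using sets.sigma_sets_subset[OF sub] by (simp only: sets_measure_of)
  qed (simp add: space_measure_of_conv)
  then interpret fs: finite_measure_subalgebra M "natural_filtration M X 0"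
    by unfold_locales
  \<comment> \<open>The initial law, as weights on the states.\<close>
  define c where "c y = (\<integral>\<omega>. (if X 0 \<omega> = y then 1 else 0 :: real) \<partial>M)" for y
  have int0: "integrable M (\<lambda>\<omega>. f (X t \<omega>))" if "t \<ge> 0" for f :: "'s \<Rightarrow> real" and t
    by (rule markov_process_integrable[OF mp fin that])
  have E: "(\<integral>\<omega>. f (X t \<omega>) \<partial>M) = (\<Sum>y\<in>S. P t f y * c y)" if t: "t \<ge> 0" for f t
  proof -
    have "(\<integral>\<omega>. f (X t \<omega>) \<partial>M) = (\<integral>\<omega>. real_cond_exp M (natural_filtration M X 0) (\<lambda>\<omega>. f (X t \<omega>)) \<omega> \<partial>M)"
      using fs.real_cond_exp_int(2)[OF int0[OF t]] by simp
    also have "\<dots> = (\<integral>\<omega>. P t f (X 0 \<omega>) \<partial>M)"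
      by (rule integral_cong_AE)
        (use K(3)[OF t] int0[of 0] in \<open>auto simp: P_def intro: borel_measurable_integrable\<close>)
    also have "\<dots> = (\<integral>\<omega>. (\<Sum>y\<in>S. P t f y * (if X 0 \<omega> = y then 1 else 0)) \<partial>M)"
    proof (rule Bochner_Integration.integral_cong[OF refl])
      fix \<omega> assume "\<omega> \<in> space M"
      then have "X 0 \<omega> \<in> S" using measurable_space[OF X[of 0]] by auto
      then show "P t f (X 0 \<omega>) = (\<Sum>y\<in>S. P t f y * (if X 0 \<omega> = y then 1 else 0))"
        using fin by (simp add: if_distrib[of "\<lambda>z. _ * z"] sum.delta' cong: if_cong)
    qed
    also have "\<dots> = (\<Sum>y\<in>S. P t f y * c y)"
      unfolding c_def using int0[of 0 "\<lambda>z. if z = _ then 1 else 0"] by (subst Bochner_Integration.integral_sum) auto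
    finally show ?thesis .
  qed
  have "((\<lambda>t. \<Sum>y\<in>S. P t f y * c y) has_real_derivative (\<Sum>y\<in>S. P t (L f) y * c y)) (at t within {0..})"
    by (intro DERIV_sum DERIV_cmult_right P_derivative t)
  then show ?thesis
    unfolding E[OF t] by (rule has_field_derivative_transform_within[where d = 1]) (use t E in auto)
qed

subsection \<open>The generator on linear and quadratic functions of the configuration\<close>

text \<open>Coefficients are indexed by sites instead of being read off at \<open>x / N\<close>,
  since the lattice modes below are sampled on a different grid and carry a correction.\<close>

definition linear_density :: "nat \<Rightarrow> (nat \<Rightarrow> real) \<Rightarrow> config \<Rightarrow> real" where
  "linear_density N F \<xi> = 1 / (real N - 1) * (\<Sum>x\<in>sites N. F x * \<xi> x)"

lemma empirical_eq_linear_density: "empirical N G = linear_density N (\<lambda>x. G (real x / real N))"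
  by (simp add: empirical_def linear_density_def fun_eq_iff)

lemma finite_sites [simp]: "finite (sites N)"
  by (simp add: sites_def)

lemma finite_configs: "finite (configs N)"
  unfolding configs_def by (intro finite_PiE) auto

lemma configs_values: "\<xi> \<in> configs N \<Longrightarrow> x \<in> sites N \<Longrightarrow> \<xi> x = 0 \<or> \<xi> x = 1"
  unfolding configs_def by (auto simp: PiE_def Pi_def)

lemma linear_density_bound:
  assumes "N \<ge> 3" "\<xi> \<in> configs N" "\<And>x. x \<in> sites N \<Longrightarrow> \<bar>F x\<bar> \<le> B"
  shows "\<bar>linear_density N F \<xi>\<bar> \<le> B"
proof -
  have "\<bar>\<Sum>x\<in>sites N. F x * \<xi> x\<bar> \<le> (\<Sum>x\<in>sites N. B)"
  proof (rule order_trans[OF sum_abs sum_mono])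
    fix x assume "x \<in> sites N"
    then show "\<bar>F x * \<xi> x\<bar> \<le> B"
      using assms(3)[of x] configs_values[OF assms(2), of x] by (auto simp: abs_mult)
  qed
  also have "\<dots> = (real N - 1) * B" using assms(1) by (simp add: sites_def)
  finally show ?thesis using assms(1) unfolding linear_density_def
    by (simp add: abs_mult field_simps)
qed

lemma linear_density_diff:
  "linear_density N F \<xi> - linear_density N G \<xi> = linear_density N (\<lambda>x. F x - G x) \<xi>"
  by (simp add: linear_density_def left_diff_distrib sum_subtractf right_diff_distrib)

lemma linear_density_exchange:
  assumes "N \<ge> 3" "x \<in> {1..N - 2}"
  shows "linear_density N F (exchange x (x + 1) \<xi>) - linear_density N F \<xi> =
    1 / (real N - 1) * ((F (x + 1) - F x) * (\<xi> x - \<xi> (x + 1)))"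
proof -
  have x: "x \<in> sites N" "Suc x \<in> sites N - {x}" using assms by (auto simp: sites_def)
  have "(\<Sum>y\<in>sites N. F y * exchange x (x + 1) \<xi> y) - (\<Sum>y\<in>sites N. F y * \<xi> y) =
      (\<Sum>y\<in>sites N. F y * (exchange x (x + 1) \<xi> y - \<xi> y))"
    by (simp add: right_diff_distrib sum_subtractf)
  also have "\<dots> = F x * (\<xi> (x + 1) - \<xi> x) + (\<Sum>y\<in>sites N - {x}. F y * (exchange x (x + 1) \<xi> y - \<xi> y))"
    using x by (subst sum.remove[of _ x]) (auto simp: exchange_def)
  also have "(\<Sum>y\<in>sites N - {x}. F y * (exchange x (x + 1) \<xi> y - \<xi> y)) = F (x + 1) * (\<xi> x - \<xi> (x + 1))"
    using x by (subst sum.remove[of _ "Suc x"]) (auto simp: exchange_def intro!: sum.neutral)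
  also have "F x * (\<xi> (x + 1) - \<xi> x) + F (x + 1) * (\<xi> x - \<xi> (x + 1)) = (F (x + 1) - F x) * (\<xi> x - \<xi> (x + 1))"
    by (simp add: algebra_simps)
  finally show ?thesis unfolding linear_density_def
    by (simp only: right_diff_distrib[symmetric])
qed

lemma linear_density_flip:
  assumes "x \<in> sites N"
  shows "linear_density N F (flip x \<xi>) - linear_density N F \<xi> =
    1 / (real N - 1) * (F x * (1 - 2 * \<xi> x))"
proof -
  have "(\<Sum>y\<in>sites N. F y * flip x \<xi> y) - (\<Sum>y\<in>sites N. F y * \<xi> y) =
      (\<Sum>y\<in>sites N. F y * (flip x \<xi> y - \<xi> y))"
    by (simp add: right_diff_distrib sum_subtractf)
  also have "\<dots> = F x * (1 - 2 * \<xi> x)"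
    using assms by (subst sum.remove[of _ x]) (auto simp: flip_def algebra_simps intro!: sum.neutral)
  finally show ?thesis unfolding linear_density_def
    by (simp only: right_diff_distrib[symmetric])
qed

text \<open>Rates times squared jumps, which is the defect of the generator in the product rule for
  squares. Since a jump changes a density by order \<open>1 / N\<close> at most, this is the
  quantity that makes fluctuations vanish.\<close>

definition carre_du_champ :: "real \<Rightarrow> real \<Rightarrow> real \<Rightarrow> real \<Rightarrow> nat \<Rightarrow> (config \<Rightarrow> real) \<Rightarrow> config \<Rightarrow> real" where
  "carre_du_champ \<alpha> \<beta> \<kappa> \<theta> N f \<xi> =
    (\<Sum>x = 1..N - 2. 1 / 2 * (f (exchange x (x + 1) \<xi>) - f \<xi>)\<^sup>2) +
    (\<Sum>x\<in>{1, N - 1}. \<kappa> / real N powr \<theta> * boundary_rate x \<xi> (reservoir \<alpha> \<beta> x) * (f (flip x \<xi>) - f \<xi>)\<^sup>2)"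

lemma exclusion_generator_square:
  "exclusion_generator \<alpha> \<beta> \<kappa> \<theta> N (\<lambda>\<xi>. (f \<xi>)\<^sup>2) \<xi> =
    2 * f \<xi> * exclusion_generator \<alpha> \<beta> \<kappa> \<theta> N f \<xi> + carre_du_champ \<alpha> \<beta> \<kappa> \<theta> N f \<xi>"
proof -
  have e: "u\<^sup>2 - v\<^sup>2 = 2 * v * (u - v) + (u - v)\<^sup>2" for u v :: real
    by (simp add: power2_eq_square algebra_simps)
  show ?thesis
    unfolding exclusion_generator_def bulk_generator_def boundary_generator_def carre_du_champ_def e
    by (simp only: distrib_left sum.distrib sum_distrib_left mult_ac)
qed

text \<open>The product of the flip rate and the jump is quadratic in the occupation number, but on
  \<open>{0, 1}\<close> it reduces to \<open>(r - \<xi> x) / 2\<close>. This makes the equations of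
  the modes closed.\<close>

lemma exclusion_generator_linear:
  assumes "N \<ge> 3" "\<xi> \<in> configs N"
  shows "exclusion_generator \<alpha> \<beta> \<kappa> \<theta> N (linear_density N F) \<xi> = 1 / (2 * (real N - 1)) *
    ((\<Sum>x = 1..N - 2. (F (x + 1) - F x) * (\<xi> x - \<xi> (x + 1))) +
     \<kappa> / real N powr \<theta> * (F 1 * (\<alpha> - \<xi> 1) + F (N - 1) * (\<beta> - \<xi> (N - 1))))"
proof -
  have s: "1 \<in> sites N" "N - 1 \<in> sites N" using assms by (auto simp: sites_def)
  \<comment> \<open>The two reservoirs sit at different sites, so the sum over
    \<open>{1, N - 1}\<close> has two terms.\<close>
  have ne: "Suc 0 \<noteq> N - Suc 0" using assms by auto
  have rate: "boundary_rate x \<xi> r * (F x * (1 - 2 * \<xi> x)) = F x * (r - \<xi> x) / 2" if "x \<in> sites N" for x r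
    using configs_values[OF assms(2) that] by (auto simp: boundary_rate_def)
  have bulk: "bulk_generator N (linear_density N F) \<xi> =
      (\<Sum>x = 1..N - 2. 1 / (2 * (real N - 1)) * ((F (x + 1) - F x) * (\<xi> x - \<xi> (x + 1))))"
    unfolding bulk_generator_def
    by (intro sum.cong refl) (simp only: linear_density_exchange[OF assms(1)], simp)
  have bd: "\<kappa> / real N powr \<theta> * boundary_rate x \<xi> r * (linear_density N F (flip x \<xi>) - linear_density N F \<xi>)
     = 1 / (2 * (real N - 1)) * (\<kappa> / real N powr \<theta> * (F x * (r - \<xi> x)))" if "x \<in> sites N" for x r
  proof -
    have "\<kappa> / real N powr \<theta> * boundary_rate x \<xi> r * (linear_density N F (flip x \<xi>) - linear_density N F \<xi>)
      = \<kappa> / real N powr \<theta> / (real N - 1) * (boundary_rate x \<xi> r * (F x * (1 - 2 * \<xi> x)))"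
      unfolding linear_density_flip[OF that] by simp
    then show ?thesis unfolding rate[OF that] by simp
  qed
  show ?thesis
    unfolding exclusion_generator_def bulk boundary_generator_def
    using ne s bd[OF s(1), of \<alpha>] bd[OF s(2), of \<beta>]
    by (simp add: reservoir_def sum_divide_distrib distrib_left add_divide_distrib)
qed

text \<open>Summation by parts. The terms left at the two ends are discrete normal derivatives, to
  be balanced against the reservoirs.\<close>

lemma gradient_sum_by_parts:
  fixes F \<xi> :: "nat \<Rightarrow> real"
  assumes "n \<ge> 1"
  shows "(\<Sum>x = 1..n. (F (x + 1) - F x) * (\<xi> x - \<xi> (x + 1))) =
    (\<Sum>x = 2..n. (F (x + 1) - 2 * F x + F (x - 1)) * \<xi> x) +
    (F 2 - F 1) * \<xi> 1 - (F (n + 1) - F n) * \<xi> (n + 1)"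
  using assms
proof (induction n rule: dec_induct)
  case base
  show ?case by (simp add: algebra_simps numeral_2_eq_2)
next
  case (step n)
  have e2: "(\<Sum>x = 2..Suc n. (F (x + 1) - 2 * F x + F (x - 1)) * \<xi> x) =
    (\<Sum>x = 2..n. (F (x + 1) - 2 * F x + F (x - 1)) * \<xi> x) + (F (Suc n + 1) - 2 * F (n + 1) + F n) * \<xi> (n + 1)"
    using step by simp
  have gen: "s + (f2 - f1) * x1 - (fa - f0) * xa + (fb - fa) * (xa - xb)
      = s + (fb - 2 * fa + f0) * xa + (f2 - f1) * x1 - (fb - fa) * xb" for s f2 f1 f0 fa fb x1 xa xb :: real
    by (simp add: algebra_simps)
  have "(\<Sum>x = 1..Suc n. (F (x + 1) - F x) * (\<xi> x - \<xi> (x + 1))) =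
    (\<Sum>x = 1..n. (F (x + 1) - F x) * (\<xi> x - \<xi> (x + 1))) +
    (F (Suc n + 1) - F (n + 1)) * (\<xi> (n + 1) - \<xi> (Suc n + 1))"
    by simp
  also note step.IH
  also note gen
  also note e2[symmetric]
  finally show ?case by simp
qed

lemma abs_le_add3:
  "x = a + b + c \<Longrightarrow> \<bar>a\<bar> \<le> d \<Longrightarrow> \<bar>b\<bar> \<le> e \<Longrightarrow> \<bar>c\<bar> \<le> f \<Longrightarrow> \<bar>x\<bar> \<le> d + e + f" for x :: real
  by linarith

text \<open>The algebra of the next lemma with sums as atoms: \<open>n2\<close> stands for the
  square of \<open>N\<close>, \<open>c\<close> for \<open>1 / (N - 1)\<close>, \<open>k\<close> for
  the reservoir strength, \<open>S1\<close> and \<open>S0\<close> for the inner sums of the discrete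
  Laplacian and of \<open>F\<close>. The right-hand side collects the coefficients of the occupation
  numbers.\<close>

lemma generator_identity:
  fixes n2 c k l \<alpha> \<beta> :: real
  shows "n2 * (c / 2 * (S1 + (f2 - f1) * x1 - (fn - fm) * xn + k * (f1 * (\<alpha> - x1) + fn * (\<beta> - xn))))
    + l * (c * (f1 * x1 + fn * xn + S0)) - n2 * c / 2 * k * (\<alpha> * f1 + \<beta> * fn)
    = c * (n2 / 2 * S1 + l * S0) + (n2 * c / 2 * (f2 - f1 - k * f1) + l * f1 * c) * x1
      + (n2 * c / 2 * (- (fn - fm) - k * fn) + l * fn * c) * xn"
  by (simp add: field_simps)

text \<open>After the terms are sorted by occupation number, an inner site carries the discrete
  eigenvalue equation, a boundary site a discrete Robin condition, and the reservoir densities leave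
  a constant. As occupation numbers are at most 1, bounds on the coefficients are enough. The inner
  errors are averaged over the sites, the boundary ones are not.\<close>

lemma generator_linear_error:
  assumes N: "N \<ge> 3" and \<xi>: "\<xi> \<in> configs N"
    and bulk: "\<And>x. x \<in> {2..N - 2} \<Longrightarrow>
      \<bar>(real N)\<^sup>2 / 2 * (F (x + 1) - 2 * F x + F (x - 1)) + l * F x\<bar> \<le> e1" and "e1 \<ge> 0"
    and left: "\<bar>(real N)\<^sup>2 / (2 * (real N - 1)) * (F 2 - F 1 - \<kappa> / real N powr \<theta> * F 1) + l * F 1 / (real N - 1)\<bar> \<le> e2"
    and right: "\<bar>(real N)\<^sup>2 / (2 * (real N - 1)) * (- (F (N - 1) - F (N - 2)) - \<kappa> / real N powr \<theta> * F (N - 1))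
      + l * F (N - 1) / (real N - 1)\<bar> \<le> e3"
  shows "\<bar>(real N)\<^sup>2 * exclusion_generator \<alpha> \<beta> \<kappa> \<theta> N (linear_density N F) \<xi> + l * linear_density N F \<xi>
    - (real N)\<^sup>2 / (2 * (real N - 1)) * (\<kappa> / real N powr \<theta>) * (\<alpha> * F 1 + \<beta> * F (N - 1))\<bar> \<le> e1 + e2 + e3"
proof -
  let ?M = "real N - 1" and ?k = "\<kappa> / real N powr \<theta>"
  let ?D = "\<lambda>x. F (x + 1) - 2 * F x + F (x - 1)"
  have M: "?M > 0" using N by simp
  have N2: "N - 2 + 1 = N - 1" and n1: "1 \<le> N - 2" using N by simp_all
  have "sites N = insert 1 (insert (N - 1) {2..N - 2})" using N by (auto simp: sites_def)
  moreover have "1 \<notin> insert (N - 1) {2..N - 2}" "N - 1 \<notin> {2..N - 2}" using N by auto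
  ultimately have sum: "(\<Sum>x\<in>sites N. F x * \<xi> x) = F 1 * \<xi> 1 + F (N - 1) * \<xi> (N - 1) + (\<Sum>x = 2..N - 2. F x * \<xi> x)"
    by (simp only: sum.insert finite_insert finite_atLeastAtMost add.assoc simp_thms)
  have "(real N)\<^sup>2 * exclusion_generator \<alpha> \<beta> \<kappa> \<theta> N (linear_density N F) \<xi> + l * linear_density N F \<xi>
    - (real N)\<^sup>2 / (2 * ?M) * ?k * (\<alpha> * F 1 + \<beta> * F (N - 1))
    = 1 / ?M * (\<Sum>x = 2..N - 2. ((real N)\<^sup>2 / 2 * ?D x + l * F x) * \<xi> x)
      + ((real N)\<^sup>2 / (2 * ?M) * (F 2 - F 1 - ?k * F 1) + l * F 1 / ?M) * \<xi> 1
      + ((real N)\<^sup>2 / (2 * ?M) * (- (F (N - 1) - F (N - 2)) - ?k * F (N - 1)) + l * F (N - 1) / ?M) * \<xi> (N - 1)"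
  proof -
    have S: "(\<Sum>x = 2..N - 2. ((real N)\<^sup>2 / 2 * ?D x + l * F x) * \<xi> x) =
      (real N)\<^sup>2 / 2 * (\<Sum>x = 2..N - 2. ?D x * \<xi> x) + l * (\<Sum>x = 2..N - 2. F x * \<xi> x)"
      unfolding sum_distrib_left sum.distrib[symmetric] by (intro sum.cong refl) algebra
    define k where "k = ?k"
    define c where "c = 1 / ?M"
    have c2: "1 / (2 * ?M) = c / 2" "(real N)\<^sup>2 / (2 * ?M) = (real N)\<^sup>2 * c / 2" "z / ?M = z * c" for z
      by (simp_all add: c_def)
    show ?thesis
      unfolding exclusion_generator_linear[OF N \<xi>] linear_density_def sum S k_def[symmetric]
      unfolding gradient_sum_by_parts[OF n1, of F \<xi>] N2 c2
      by (simp only: mult_1_left) (rule generator_identity)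
  qed
  moreover have "\<bar>1 / ?M * (\<Sum>x = 2..N - 2. ((real N)\<^sup>2 / 2 * ?D x + l * F x) * \<xi> x)\<bar> \<le> e1"
  proof -
    have "\<bar>\<Sum>x = 2..N - 2. ((real N)\<^sup>2 / 2 * ?D x + l * F x) * \<xi> x\<bar> \<le> (\<Sum>x = 2..N - 2. e1)"
    proof (rule order_trans[OF sum_abs sum_mono])
      fix x assume x: "x \<in> {2..N - 2}"
      then have "x \<in> sites N" by (auto simp: sites_def)
      then show "\<bar>((real N)\<^sup>2 / 2 * ?D x + l * F x) * \<xi> x\<bar> \<le> e1"
        using bulk[OF x] \<open>e1 \<ge> 0\<close> configs_values[OF \<xi>, of x] by (auto simp: abs_mult)
    qed
    also have "\<dots> \<le> ?M * e1" using N \<open>e1 \<ge> 0\<close> by (auto intro!: mult_right_mono)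
    finally show ?thesis using M by (simp add: abs_mult field_simps)
  qed
  moreover have "\<bar>c * \<xi> x\<bar> \<le> e" if "\<bar>c\<bar> \<le> e" "x \<in> sites N" for c e x
    using that configs_values[OF \<xi>, of x] by (auto simp: abs_mult)
  from this[OF left] this[OF right] have
    "\<bar>((real N)\<^sup>2 / (2 * ?M) * (F 2 - F 1 - ?k * F 1) + l * F 1 / ?M) * \<xi> 1\<bar> \<le> e2"
    "\<bar>((real N)\<^sup>2 / (2 * ?M) * (- (F (N - 1) - F (N - 2)) - ?k * F (N - 1)) + l * F (N - 1) / ?M) * \<xi> (N - 1)\<bar> \<le> e3"
    using N by (auto simp: sites_def)
  ultimately show ?thesis by (rule abs_le_add3)
qed

text \<open>Multiplied by \<open>N^2\<close> and with \<open>d\<close> of order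
  \<open>1 / N\<close>, the bulk part is of order \<open>1 / N\<close>, while the boundary part is
  of order \<open>N^(- \<theta>)\<close> times the squared boundary values. For \<theta> \<le> 0 the
  latter is small only because the lattice mode nearly vanishes at the boundary.\<close>

lemma carre_du_champ_linear_bound:
  assumes N: "N \<ge> 3" and \<xi>: "\<xi> \<in> configs N" and \<kappa>: "\<kappa> > 0"
    and \<alpha>: "\<alpha> \<in> {0..1}" and \<beta>: "\<beta> \<in> {0..1}"
    and F: "\<And>x. x \<in> {1..N - 2} \<Longrightarrow> \<bar>F (x + 1) - F x\<bar> \<le> d"
  shows "carre_du_champ \<alpha> \<beta> \<kappa> \<theta> N (linear_density N F) \<xi> \<le>
    1 / (real N - 1) * d\<^sup>2 + 1 / (real N - 1)\<^sup>2 * (\<kappa> / real N powr \<theta>) * ((F 1)\<^sup>2 + (F (N - 1))\<^sup>2)"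
proof -
  let ?M = "real N - 1" and ?k = "\<kappa> / real N powr \<theta>"
  have M: "?M > 0" using N by simp
  have ne: "Suc 0 \<noteq> N - Suc 0" using N by auto
  have s: "1 \<in> sites N" "N - 1 \<in> sites N" using N by (auto simp: sites_def)
  have "(\<Sum>x = 1..N - 2. 1 / 2 * (linear_density N F (exchange x (x + 1) \<xi>) - linear_density N F \<xi>)\<^sup>2)
      \<le> (\<Sum>x = 1..N - 2. (1 / ?M)\<^sup>2 * d\<^sup>2)"
  proof (rule sum_mono)
    fix x assume x: "x \<in> {1..N - 2}"
    then have "x \<in> sites N" "x + 1 \<in> sites N" by (auto simp: sites_def)
    then have "\<bar>\<xi> x - \<xi> (x + 1)\<bar> \<le> 1" using configs_values[OF \<xi>, of x] configs_values[OF \<xi>, of "x + 1"] by auto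
    then have "\<bar>(F (x + 1) - F x) * (\<xi> x - \<xi> (x + 1))\<bar> \<le> d * 1"
      unfolding abs_mult using F[OF x] by (intro mult_mono) auto
    then have "\<bar>(F (x + 1) - F x) * (\<xi> x - \<xi> (x + 1))\<bar>\<^sup>2 \<le> d\<^sup>2" by (intro power_mono) auto
    then have "(1 / ?M)\<^sup>2 * ((F (x + 1) - F x) * (\<xi> x - \<xi> (x + 1)))\<^sup>2 \<le> (1 / ?M)\<^sup>2 * d\<^sup>2"
      by (intro mult_left_mono) auto
    moreover have "0 \<le> (1 / ?M)\<^sup>2 * ((F (x + 1) - F x) * (\<xi> x - \<xi> (x + 1)))\<^sup>2" by simp
    ultimately show "1 / 2 * (linear_density N F (exchange x (x + 1) \<xi>) - linear_density N F \<xi>)\<^sup>2 \<le> (1 / ?M)\<^sup>2 * d\<^sup>2"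
      unfolding linear_density_exchange[OF N x] power_mult_distrib[of "1 / ?M"] by linarith
  qed
  also have "\<dots> \<le> 1 / ?M * d\<^sup>2"
  proof -
    have "real (N - 2) / ?M \<le> 1" using N by simp
    then have "real (N - 2) / ?M * (1 / ?M * d\<^sup>2) \<le> 1 * (1 / ?M * d\<^sup>2)" using M by (intro mult_right_mono) auto
    then show ?thesis by (simp add: power2_eq_square)
  qed
  finally have bulk: "(\<Sum>x = 1..N - 2. 1 / 2 * (linear_density N F (exchange x (x + 1) \<xi>) - linear_density N F \<xi>)\<^sup>2) \<le> 1 / ?M * d\<^sup>2" .
  have bd: "?k * boundary_rate x \<xi> r * (linear_density N F (flip x \<xi>) - linear_density N F \<xi>)\<^sup>2 \<le> 1 / ?M\<^sup>2 * ?k * (F x)\<^sup>2"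
    if x: "x \<in> sites N" and r: "r \<in> {0..1}" for x r
  proof -
    have "boundary_rate x \<xi> r * (1 - 2 * \<xi> x)\<^sup>2 \<le> 1"
      using configs_values[OF \<xi> x] r by (auto simp: boundary_rate_def)
    then have "1 / ?M\<^sup>2 * ?k * (F x)\<^sup>2 * (boundary_rate x \<xi> r * (1 - 2 * \<xi> x)\<^sup>2) \<le> 1 / ?M\<^sup>2 * ?k * (F x)\<^sup>2 * 1"
      using \<kappa> by (intro mult_left_mono) auto
    moreover have "?k * boundary_rate x \<xi> r * (linear_density N F (flip x \<xi>) - linear_density N F \<xi>)\<^sup>2
        = 1 / ?M\<^sup>2 * ?k * (F x)\<^sup>2 * (boundary_rate x \<xi> r * (1 - 2 * \<xi> x)\<^sup>2)"
      unfolding linear_density_flip[OF x] power_mult_distrib power_one_over by algebra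
    ultimately show ?thesis by simp
  qed
  have "(\<Sum>x\<in>{1, N - 1}. ?k * boundary_rate x \<xi> (reservoir \<alpha> \<beta> x) * (linear_density N F (flip x \<xi>) - linear_density N F \<xi>)\<^sup>2)
     \<le> 1 / ?M\<^sup>2 * ?k * ((F 1)\<^sup>2 + (F (N - 1))\<^sup>2)"
  proof -
    have two: "(\<Sum>x\<in>{1, N - 1}. h x) = h 1 + h (N - 1)" for h :: "nat \<Rightarrow> real" using ne by simp
    have res: "reservoir \<alpha> \<beta> 1 = \<alpha>" "reservoir \<alpha> \<beta> (N - 1) = \<beta>" using ne by (auto simp: reservoir_def)
    show ?thesis unfolding two res distrib_left by (rule add_mono[OF bd[OF s(1) \<alpha>] bd[OF s(2) \<beta>]])
  qed
  with bulk show ?thesis unfolding carre_du_champ_def by linarith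
qed

subsection \<open>Discretised eigenfunctions\<close>

context heat_basis
begin

lemma phi_continuous: "cont01 (\<phi> n)"
  by (rule DERIV_continuous_on) (rule phi_derivative)

lemma phi'_continuous: "cont01 (\<phi>' n)"
  by (rule DERIV_continuous_on) (rule phi'_derivative)

definition lip :: "nat \<Rightarrow> real" where
  "lip n = C * (1 + 2 * lam n)\<^sup>2"

lemma lip_nonneg: "lip n \<ge> 0"
  using phi'_bound[of 0 n] by (simp add: lip_def)

lemma phi_lipschitz:
  assumes "p \<in> {0..1}" "q \<in> {0..1}"
  shows "\<bar>\<phi> n p - \<phi> n q\<bar> \<le> lip n * \<bar>p - q\<bar>"
  using field_differentiable_bound[of "{0..1}" "\<phi> n" "\<phi>' n" "lip n" p q] assms phi_derivative phi'_bound
  by (simp add: lip_def)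

text \<open>In place of a Taylor formula with one-sided derivatives at the ends, the error is viewed
  as a function of the step that vanishes at 0 together with its first derivative. Its second
  derivative is at most \<open>4 * lam n * lip n * h\<close> by the Lipschitz bound, and the mean
  value inequality is applied twice.\<close>

lemma phi_second_difference:
  assumes h: "0 \<le> h" "0 \<le> q - h" "q + h \<le> 1"
  shows "\<bar>\<phi> n (q + h) - 2 * \<phi> n q + \<phi> n (q - h) + 2 * lam n * h\<^sup>2 * \<phi> n q\<bar> \<le> 4 * lam n * lip n * h ^ 3"
proof -
  have chain: "((\<lambda>s. f (q + c * s)) has_real_derivative f' (q + c * s) * c) (at s within {0..h})"
    if "\<And>q. q \<in> {0..1} \<Longrightarrow> (f has_real_derivative f' q) (at q within {0..1})" "s \<in> {0..h}" "c = 1 \<or> c = -1" for f f' s c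
  proof -
    have "(\<lambda>s. q + c * s) ` {0..h} \<subseteq> {0..1}" using h that(3) by auto
    moreover have "q + c * s \<in> {0..1}" using h that(2,3) by auto
    ultimately have "(f has_real_derivative f' (q + c * s)) (at (q + c * s) within (\<lambda>s. q + c * s) ` {0..h})"
      using that(1) DERIV_subset by blast
    moreover have "((\<lambda>s. q + c * s) has_real_derivative c) (at s within {0..h})"
      by (auto intro!: derivative_eq_intros)
    ultimately show ?thesis using DERIV_image_chain[of f _ "\<lambda>s. q + c * s" s "{0..h}" c] by (simp add: o_def)
  qed
  define \<psi> where "\<psi> s = \<phi> n (q + 1 * s) + \<phi> n (q + (-1) * s) - 2 * \<phi> n q + 2 * lam n * s\<^sup>2 * \<phi> n q" for s
  define \<tau> where "\<tau> s = \<phi>' n (q + 1 * s) * 1 + \<phi>' n (q + (-1) * s) * (-1) + 4 * lam n * s * \<phi> n q" for s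
  define \<xi> where "\<xi> s = - 2 * lam n * \<phi> n (q + 1 * s) * 1 * 1 + (- 2 * lam n * \<phi> n (q + (-1) * s)) * (-1) * (-1)
     + 4 * lam n * \<phi> n q" for s
  have d1: "(\<psi> has_real_derivative \<tau> s) (at s within {0..h})" if s: "s \<in> {0..h}" for s
  proof -
    have p: "((\<lambda>s. \<phi> n (q + 1 * s)) has_real_derivative \<phi>' n (q + 1 * s) * 1) (at s within {0..h})"
      by (rule chain[OF phi_derivative s]) auto
    have m: "((\<lambda>s. \<phi> n (q + (-1) * s)) has_real_derivative \<phi>' n (q + (-1) * s) * (-1)) (at s within {0..h})"
      by (rule chain[OF phi_derivative s]) auto
    have t: "((\<lambda>s. 2 * lam n * s\<^sup>2 * \<phi> n q) has_real_derivative 4 * lam n * s * \<phi> n q) (at s within {0..h})"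
      by (auto intro!: derivative_eq_intros)
    show ?thesis unfolding \<psi>_def \<tau>_def
      by (rule DERIV_cong[OF DERIV_add[OF DERIV_diff[OF DERIV_add[OF p m] DERIV_const] t]]) simp
  qed
  have d2: "(\<tau> has_real_derivative \<xi> s) (at s within {0..h})" if s: "s \<in> {0..h}" for s
  proof -
    have p: "((\<lambda>s. \<phi>' n (q + 1 * s)) has_real_derivative - 2 * lam n * \<phi> n (q + 1 * s) * 1) (at s within {0..h})"
      by (rule chain[OF phi'_derivative s]) auto
    have m: "((\<lambda>s. \<phi>' n (q + (-1) * s)) has_real_derivative - 2 * lam n * \<phi> n (q + (-1) * s) * (-1)) (at s within {0..h})"
      by (rule chain[OF phi'_derivative s]) auto
    have t: "((\<lambda>s. 4 * lam n * s * \<phi> n q) has_real_derivative 4 * lam n * \<phi> n q) (at s within {0..h})"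
      by (auto intro!: derivative_eq_intros)
    show ?thesis unfolding \<xi>_def \<tau>_def
      by (rule DERIV_add[OF DERIV_add[OF DERIV_cmult_right[OF p] DERIV_cmult_right[OF m]] t])
  qed
  have b2: "norm (\<xi> s) \<le> 4 * lam n * lip n * h" if s: "s \<in> {0..h}" for s
  proof -
    have "\<bar>\<phi> n (q + s) - \<phi> n q\<bar> \<le> lip n * h" "\<bar>\<phi> n (q - s) - \<phi> n q\<bar> \<le> lip n * h"
      using phi_lipschitz[of "q + s" q n] phi_lipschitz[of "q - s" q n] s h
        mult_left_mono[of s h "lip n"] lip_nonneg[of n] by auto
    then have "\<bar>(\<phi> n (q + s) - \<phi> n q) + (\<phi> n (q - s) - \<phi> n q)\<bar> \<le> 2 * (lip n * h)" by linarith
    then have "2 * lam n * \<bar>(\<phi> n (q + s) - \<phi> n q) + (\<phi> n (q - s) - \<phi> n q)\<bar> \<le> 2 * lam n * (2 * (lip n * h))"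
      using lam_nonneg[of n] by (intro mult_left_mono) auto
    moreover have "\<xi> s = - (2 * lam n * ((\<phi> n (q + s) - \<phi> n q) + (\<phi> n (q - s) - \<phi> n q)))"
      unfolding \<xi>_def by (simp add: algebra_simps)
    ultimately show ?thesis using lam_nonneg[of n] by (simp add: abs_mult)
  qed
  have hh: "0 \<in> {0..h}" "h \<in> {0..h}" using h by auto
  have b1: "norm (\<tau> s) \<le> 4 * lam n * lip n * h * h" if s: "s \<in> {0..h}" for s
  proof -
    have "norm (\<tau> s - \<tau> 0) \<le> 4 * lam n * lip n * h * norm (s - 0)"
      by (rule field_differentiable_bound[OF _ d2 b2]) (use s hh in auto)
    also have "\<dots> \<le> 4 * lam n * lip n * h * h"
      using s h lam_nonneg[of n] lip_nonneg[of n] by (intro mult_left_mono mult_nonneg_nonneg) auto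
    finally show ?thesis by (simp add: \<tau>_def)
  qed
  have "norm (\<psi> h - \<psi> 0) \<le> 4 * lam n * lip n * h * h * norm (h - 0)"
    by (rule field_differentiable_bound[OF _ d1 b1]) (use hh in auto)
  then show ?thesis using h by (simp add: \<psi>_def power3_eq_cube algebra_simps)
qed

text \<open>The sites are stretched so that 1 and \<open>N - 1\<close> fall exactly on the endpoints
  0 and 1, where the boundary condition of the mode holds. The spacing becomes
  \<open>1 / (N - 2)\<close>.\<close>

definition grid :: "nat \<Rightarrow> nat \<Rightarrow> real" where
  "grid N x = (real x - 1) / (real N - 2)"

text \<open>The correction is affine in the grid point, hence invisible to the discrete Laplacian,
  and takes the values \<open>d0 N\<close> and \<open>d1 N\<close> at the two ends.\<close>

definition corrected :: "nat \<Rightarrow> (nat \<Rightarrow> real) \<Rightarrow> (nat \<Rightarrow> real) \<Rightarrow> nat \<Rightarrow> nat \<Rightarrow> real" where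
  "corrected n d0 d1 N x = \<phi> n (grid N x) + d0 N * (1 - grid N x) + d1 N * grid N x"

lemma phi_difference_quotient:
  assumes "filterlim h (at_right 0) F"
  shows "((\<lambda>x. (\<phi> n (h x) - \<phi> n 0) / h x) \<longlongrightarrow> \<phi>' n 0) F"
    and "((\<lambda>x. (\<phi> n 1 - \<phi> n (1 - h x)) / h x) \<longlongrightarrow> \<phi>' n 1) F"
proof -
  have D: "(\<phi> n has_real_derivative \<phi>' n 0) (at 0 within {0..1})"
    "(\<phi> n has_real_derivative \<phi>' n 1) (at 1 within {0..1})"
    by (auto intro: phi_derivative)
  have diff_flip: "(a - b) / (1 - r - 1) = (b - a) / r" for a b r :: real
    by (cases "r = 0") (simp_all add: field_simps)
  have h0: "(h \<longlongrightarrow> 0) F" "\<forall>\<^sub>F x in F. 0 < h x"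
    using assms unfolding filterlim_at by (auto elim: eventually_mono)
  have h1: "\<forall>\<^sub>F x in F. h x < 1" using order_tendstoD(2)[OF h0(1), of 1] by simp
  have "filterlim h (at 0 within {0..1}) F"
    unfolding filterlim_at using h0(1) eventually_conj[OF h0(2) h1] by (auto elim!: eventually_mono)
  from filterlim_compose[OF D(1)[unfolded has_field_derivative_iff] this]
  show "((\<lambda>x. (\<phi> n (h x) - \<phi> n 0) / h x) \<longlongrightarrow> \<phi>' n 0) F" by simp
  have "((\<lambda>x. 1 - h x) \<longlongrightarrow> 1 - 0) F" by (intro tendsto_intros h0)
  then have "filterlim (\<lambda>x. 1 - h x) (at 1 within {0..1}) F"
    unfolding filterlim_at using eventually_conj[OF h0(2) h1] by (auto elim!: eventually_mono)
  from filterlim_compose[OF D(2)[unfolded has_field_derivative_iff] this]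
  show "((\<lambda>x. (\<phi> n 1 - \<phi> n (1 - h x)) / h x) \<longlongrightarrow> \<phi>' n 1) F"
    unfolding diff_flip .
qed

text \<open>The last two assumptions are the discrete boundary conditions. The coefficient at site 1
  behaves like half the difference of \<open>\<phi>' n 0\<close> and
  \<open>\<kappa> * N powr (1 - \<theta>) * F 1\<close>, so it vanishes in the limit although each
  part of it may come from a large rate. The same assumptions give the constant left by the
  reservoirs one limit in all regimes.\<close>

lemma corrected_generator:
  fixes \<alpha> \<beta> \<kappa> \<theta> :: real
  assumes \<kappa>: "\<kappa> > 0" and \<alpha>: "\<alpha> \<in> {0..1}" and \<beta>: "\<beta> \<in> {0..1}"
    and d: "d0 \<longlonglongrightarrow> 0" "d1 \<longlonglongrightarrow> 0"
    and l: "(\<lambda>N. \<kappa> * real N powr (1 - \<theta>) * (\<phi> n 0 + d0 N)) \<longlonglongrightarrow> \<phi>' n 0"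
    and r: "(\<lambda>N. \<kappa> * real N powr (1 - \<theta>) * (\<phi> n 1 + d1 N)) \<longlonglongrightarrow> - \<phi>' n 1"
  obtains e c where "e \<longlonglongrightarrow> 0" "c \<longlonglongrightarrow> 1 / 2 * (\<alpha> * \<phi>' n 0 - \<beta> * \<phi>' n 1)"
    "\<And>N \<xi>. N \<ge> 3 \<Longrightarrow> \<xi> \<in> configs N \<Longrightarrow>
      \<bar>(real N)\<^sup>2 * exclusion_generator \<alpha> \<beta> \<kappa> \<theta> N (linear_density N (corrected n d0 d1 N)) \<xi>
        + lam n * linear_density N (corrected n d0 d1 N) \<xi> - c N\<bar> \<le> e N"
    "\<And>N \<xi>. N \<ge> 3 \<Longrightarrow> \<xi> \<in> configs N \<Longrightarrow>
      (real N)\<^sup>2 * carre_du_champ \<alpha> \<beta> \<kappa> \<theta> N (linear_density N (corrected n d0 d1 N)) \<xi> \<le> e N"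
    "\<And>N x. N \<ge> 3 \<Longrightarrow> x \<in> sites N \<Longrightarrow> \<bar>corrected n d0 d1 N x - \<phi> n (real x / real N)\<bar> \<le> e N"
proof -
  define h where "h N = 1 / (real N - 2)" for N :: nat
  define M where "M = C * (1 + 2 * lam n)"
  have M: "\<bar>\<phi> n q\<bar> \<le> M" if "q \<in> {0..1}" for q using phi_bound[OF that] by (simp add: M_def)
  \<comment> \<open>Three inner errors: the second difference, the spacing
    \<open>1 / (N - 2)\<close> in place of \<open>1 / N\<close>, and the eigenvalue term applied to
    the correction.\<close>
  define e1 where "e1 N = 2 * lam n * lip n * ((real N)\<^sup>2 * h N ^ 3) + lam n * M * \<bar>1 - (real N)\<^sup>2 * (h N)\<^sup>2\<bar>
    + lam n * (\<bar>d0 N\<bar> + \<bar>d1 N\<bar>)" for N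
  define e2 where "e2 N = \<bar>(real N)\<^sup>2 / (2 * (real N - 1)) * (\<phi> n (h N) - \<phi> n 0 + (d1 N - d0 N) * h N
    - \<kappa> / real N powr \<theta> * (\<phi> n 0 + d0 N)) + lam n * (\<phi> n 0 + d0 N) / (real N - 1)\<bar>" for N
  define e3 where "e3 N = \<bar>(real N)\<^sup>2 / (2 * (real N - 1)) * (- (\<phi> n 1 - \<phi> n (1 - h N) + (d1 N - d0 N) * h N)
    - \<kappa> / real N powr \<theta> * (\<phi> n 1 + d1 N)) + lam n * (\<phi> n 1 + d1 N) / (real N - 1)\<bar>" for N
  define e4 where "e4 N = (real N)\<^sup>2 * (1 / (real N - 1) * ((lip n + \<bar>d0 N\<bar> + \<bar>d1 N\<bar>) * h N)\<^sup>2
    + 1 / (real N - 1)\<^sup>2 * (\<kappa> / real N powr \<theta>) * ((\<phi> n 0 + d0 N)\<^sup>2 + (\<phi> n 1 + d1 N)\<^sup>2))" for N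
  define e5 where "e5 N = lip n * (1 / real N) + \<bar>d0 N\<bar> + \<bar>d1 N\<bar>" for N
  define c where "c N = (real N)\<^sup>2 / (2 * (real N - 1)) * (\<kappa> / real N powr \<theta>) * (\<alpha> * (\<phi> n 0 + d0 N) + \<beta> * (\<phi> n 1 + d1 N))" for N
  have hlim: "filterlim h (at_right 0) sequentially" unfolding h_def by real_asymp
  have pw: "\<forall>\<^sub>F N in sequentially. \<kappa> / real N powr \<theta> = \<kappa> * real N powr (1 - \<theta>) / real N"
    using eventually_gt_at_top[of 0] by eventually_elim (simp add: powr_diff field_simps)
  have t1: "(\<lambda>N. (real N)\<^sup>2 / (2 * (real N - 1)) * h N) \<longlonglongrightarrow> 1 / 2" unfolding h_def by real_asymp
  have t2: "(\<lambda>N. (real N)\<^sup>2 / (2 * (real N - 1)) / real N) \<longlonglongrightarrow> 1 / 2" by real_asymp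
  have t3: "(\<lambda>N. 1 / (real N - 1)) \<longlonglongrightarrow> 0" by real_asymp
  have t4: "(\<lambda>N. (real N)\<^sup>2 * h N ^ 3) \<longlonglongrightarrow> 0" unfolding h_def by real_asymp
  have t5: "(\<lambda>N. (real N)\<^sup>2 * (h N)\<^sup>2) \<longlonglongrightarrow> 1" unfolding h_def by real_asymp
  have t6: "(\<lambda>N. (real N)\<^sup>2 * (1 / (real N - 1)) * (h N)\<^sup>2) \<longlonglongrightarrow> 0" unfolding h_def by real_asymp
  have t7: "(\<lambda>N. (real N)\<^sup>2 * (1 / (real N - 1)\<^sup>2) / real N) \<longlonglongrightarrow> 0" by real_asymp
  have t8: "(\<lambda>N. 1 / real N) \<longlonglongrightarrow> 0" by real_asymp
  have id1: "A * r * (x / r + y) - A * k + z * (1 / m) = A * (x + y * r - k) + z / m" if "r \<noteq> 0" for A r x y k z m :: real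
    using that by (simp add: algebra_simps)
  have id2: "A * r * (- (x / r + y)) - A * k + z * (1 / m) = A * (- (x + y * r) - k) + z / m" if "r \<noteq> 0" for A r x y k z m :: real
    using that by (simp add: algebra_simps)
  have id3: "A * (1 / m) * r\<^sup>2 * L\<^sup>2 + A * (1 / m') / k * (x * y * y + x * z * z)
      = A * (1 / m * (L * r)\<^sup>2 + 1 / m' * (x / k) * (y\<^sup>2 + z\<^sup>2))" for A m r L k m' x y z :: real
    by (simp add: power2_eq_square algebra_simps add_divide_distrib)
  have id4: "(u + d * (1 - (q + r)) + c * (q + r)) - 2 * (v + d * (1 - q) + c * q) + (w + d * (1 - (q - r)) + c * (q - r))
      = u - 2 * v + w" for u v w d c q r :: real
    by (simp add: algebra_simps)
  have id5: "A / 2 * D + L * (p + y + z) = A / 2 * (D + 2 * L * r * p) + L * (1 - A * r) * p + L * (y + z)"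
    for A D L p y z r :: real
    by (simp add: algebra_simps)
  have id6: "u * (A * (k * x)) + v * (A * (k * y)) = A * k * (u * x + v * y)" for A k u v x y :: real
    by (simp add: algebra_simps)
  note ad = tendsto_rabs_zero[OF d(1)] tendsto_rabs_zero[OF d(2)]
  have kl: "(\<lambda>N. (real N)\<^sup>2 / (2 * (real N - 1)) * (\<kappa> / real N powr \<theta> * (\<phi> n 0 + d0 N))) \<longlonglongrightarrow> 1 / 2 * \<phi>' n 0"
    by (rule Lim_transform_eventually[OF tendsto_mult[OF t2 l]], rule eventually_mono[OF pw], simp only:) simp
  have kr: "(\<lambda>N. (real N)\<^sup>2 / (2 * (real N - 1)) * (\<kappa> / real N powr \<theta> * (\<phi> n 1 + d1 N))) \<longlonglongrightarrow> 1 / 2 * - \<phi>' n 1"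
    by (rule Lim_transform_eventually[OF tendsto_mult[OF t2 r]], rule eventually_mono[OF pw], simp only:) simp
  have hpos: "\<forall>\<^sub>F N in sequentially. h N \<noteq> 0"
    using eventually_gt_at_top[of 2] by eventually_elim (simp add: h_def)
  have "e1 \<longlonglongrightarrow> 2 * lam n * lip n * 0 + lam n * M * \<bar>1 - 1\<bar> + lam n * (0 + 0)"
    unfolding e1_def by (intro tendsto_intros t4 t5 ad)
  then have e1: "e1 \<longlonglongrightarrow> 0" by simp
  have "(\<lambda>N. (real N)\<^sup>2 / (2 * (real N - 1)) * h N * ((\<phi> n (h N) - \<phi> n 0) / h N + (d1 N - d0 N))
      - (real N)\<^sup>2 / (2 * (real N - 1)) * (\<kappa> / real N powr \<theta> * (\<phi> n 0 + d0 N))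
      + lam n * (\<phi> n 0 + d0 N) * (1 / (real N - 1))) \<longlonglongrightarrow>
      1 / 2 * (\<phi>' n 0 + (0 - 0)) - 1 / 2 * \<phi>' n 0 + lam n * (\<phi> n 0 + 0) * 0"
    by (intro tendsto_intros t1 kl t3 d phi_difference_quotient hlim)
  then have "(\<lambda>N. \<bar>(real N)\<^sup>2 / (2 * (real N - 1)) * h N * ((\<phi> n (h N) - \<phi> n 0) / h N + (d1 N - d0 N))
      - (real N)\<^sup>2 / (2 * (real N - 1)) * (\<kappa> / real N powr \<theta> * (\<phi> n 0 + d0 N))
      + lam n * (\<phi> n 0 + d0 N) * (1 / (real N - 1))\<bar>) \<longlonglongrightarrow> 0"
    by (intro tendsto_rabs_zero) simp
  then have e2: "e2 \<longlonglongrightarrow> 0"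
    by (rule Lim_transform_eventually) (rule eventually_mono[OF hpos], unfold e2_def, subst id1, assumption, rule refl)
  have "(\<lambda>N. (real N)\<^sup>2 / (2 * (real N - 1)) * h N * (- ((\<phi> n 1 - \<phi> n (1 - h N)) / h N + (d1 N - d0 N)))
      - (real N)\<^sup>2 / (2 * (real N - 1)) * (\<kappa> / real N powr \<theta> * (\<phi> n 1 + d1 N))
      + lam n * (\<phi> n 1 + d1 N) * (1 / (real N - 1))) \<longlonglongrightarrow>
      1 / 2 * (- (\<phi>' n 1 + (0 - 0))) - 1 / 2 * - \<phi>' n 1 + lam n * (\<phi> n 1 + 0) * 0"
    by (intro tendsto_intros t1 kr t3 d phi_difference_quotient hlim)
  then have "(\<lambda>N. \<bar>(real N)\<^sup>2 / (2 * (real N - 1)) * h N * (- ((\<phi> n 1 - \<phi> n (1 - h N)) / h N + (d1 N - d0 N)))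
      - (real N)\<^sup>2 / (2 * (real N - 1)) * (\<kappa> / real N powr \<theta> * (\<phi> n 1 + d1 N))
      + lam n * (\<phi> n 1 + d1 N) * (1 / (real N - 1))\<bar>) \<longlonglongrightarrow> 0"
    by (intro tendsto_rabs_zero) simp
  then have e3: "e3 \<longlonglongrightarrow> 0"
    by (rule Lim_transform_eventually) (rule eventually_mono[OF hpos], unfold e3_def, subst id2, assumption, rule refl)
  have "(\<lambda>N. (real N)\<^sup>2 * (1 / (real N - 1)) * (h N)\<^sup>2 * (lip n + \<bar>d0 N\<bar> + \<bar>d1 N\<bar>)\<^sup>2
      + (real N)\<^sup>2 * (1 / (real N - 1)\<^sup>2) / real N *
        ((\<kappa> * real N powr (1 - \<theta>) * (\<phi> n 0 + d0 N)) * (\<phi> n 0 + d0 N)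
         + (\<kappa> * real N powr (1 - \<theta>) * (\<phi> n 1 + d1 N)) * (\<phi> n 1 + d1 N))) \<longlonglongrightarrow>
      0 * (lip n + 0 + 0)\<^sup>2 + 0 * (\<phi>' n 0 * (\<phi> n 0 + 0) + - \<phi>' n 1 * (\<phi> n 1 + 0))"
    by (intro tendsto_intros t6 t7 ad d l r)
  then have "(\<lambda>N. (real N)\<^sup>2 * (1 / (real N - 1)) * (h N)\<^sup>2 * (lip n + \<bar>d0 N\<bar> + \<bar>d1 N\<bar>)\<^sup>2
      + (real N)\<^sup>2 * (1 / (real N - 1)\<^sup>2) / real N *
        ((\<kappa> * real N powr (1 - \<theta>) * (\<phi> n 0 + d0 N)) * (\<phi> n 0 + d0 N)
         + (\<kappa> * real N powr (1 - \<theta>) * (\<phi> n 1 + d1 N)) * (\<phi> n 1 + d1 N))) \<longlonglongrightarrow> 0" by simp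
  then have e4: "e4 \<longlonglongrightarrow> 0"
    by (rule Lim_transform_eventually) (rule eventually_mono[OF pw], unfold e4_def, simp only:, subst id3, rule refl)
  have "e5 \<longlonglongrightarrow> lip n * 0 + 0 + 0"
    unfolding e5_def by (intro tendsto_intros t8 ad)
  then have e5: "e5 \<longlonglongrightarrow> 0" by simp
  have "(\<lambda>N. \<alpha> * ((real N)\<^sup>2 / (2 * (real N - 1)) * (\<kappa> / real N powr \<theta> * (\<phi> n 0 + d0 N)))
      + \<beta> * ((real N)\<^sup>2 / (2 * (real N - 1)) * (\<kappa> / real N powr \<theta> * (\<phi> n 1 + d1 N)))) \<longlonglongrightarrow>
      \<alpha> * (1 / 2 * \<phi>' n 0) + \<beta> * (1 / 2 * - \<phi>' n 1)"
    by (intro tendsto_intros kl kr)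
  then have "(\<lambda>N. \<alpha> * ((real N)\<^sup>2 / (2 * (real N - 1)) * (\<kappa> / real N powr \<theta> * (\<phi> n 0 + d0 N)))
      + \<beta> * ((real N)\<^sup>2 / (2 * (real N - 1)) * (\<kappa> / real N powr \<theta> * (\<phi> n 1 + d1 N)))) \<longlonglongrightarrow>
      1 / 2 * (\<alpha> * \<phi>' n 0 - \<beta> * \<phi>' n 1)" by (simp add: algebra_simps)
  moreover have "(\<lambda>N. \<alpha> * ((real N)\<^sup>2 / (2 * (real N - 1)) * (\<kappa> / real N powr \<theta> * (\<phi> n 0 + d0 N)))
      + \<beta> * ((real N)\<^sup>2 / (2 * (real N - 1)) * (\<kappa> / real N powr \<theta> * (\<phi> n 1 + d1 N)))) = c"
    unfolding c_def id6 ..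
  ultimately have c: "c \<longlonglongrightarrow> 1 / 2 * (\<alpha> * \<phi>' n 0 - \<beta> * \<phi>' n 1)" by simp
  \<comment> \<open>One sequence for all three bounds; the absolute value makes every summand
    nonnegative, so that each bound follows from its own part.\<close>
  define e where "e N = (e1 N + e2 N + e3 N) + \<bar>e4 N\<bar> + e5 N" for N
  have "e \<longlonglongrightarrow> (0 + 0 + 0) + \<bar>0\<bar> + 0" unfolding e_def by (intro tendsto_intros e1 e2 e3 e4 e5)
  then have e: "e \<longlonglongrightarrow> 0" by simp
  have M0: "M \<ge> 0" using M[of 0] by simp
  have nn: "e1 N \<ge> 0" "e2 N \<ge> 0" "e3 N \<ge> 0" "e5 N \<ge> 0" if "N \<ge> 3" for N
    unfolding e1_def e2_def e3_def e5_def using lam_nonneg[of n] lip_nonneg[of n] M0 that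
    by (auto intro!: add_nonneg_nonneg mult_nonneg_nonneg simp: h_def)
  let ?F = "corrected n d0 d1"
  have hN: "h N > 0" "h N \<le> 1" if "N \<ge> 3" for N using that by (auto simp: h_def)
  have grid01: "grid N x \<in> {0..1}" if "N \<ge> 3" "x \<in> sites N" for N x
    using that by (auto simp: grid_def sites_def field_simps of_nat_diff)
  have grid_add: "grid N (x + 1) = grid N x + h N" for N x
    by (simp add: grid_def h_def add_divide_distrib[symmetric])
  have grid_diff: "grid N (x - 1) = grid N x - h N" if "x \<ge> 1" for N x
    using that by (simp add: grid_def h_def diff_divide_distrib[symmetric])
  have g1: "grid N 1 = 0" "grid N 2 = h N" for N by (simp_all add: grid_def h_def)
  have gN: "grid N (N - 1) = 1" "grid N (N - 2) = 1 - h N" if "N \<ge> 3" for N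
    using that by (simp_all add: grid_def h_def of_nat_diff field_simps)
  have F1: "?F N 1 = \<phi> n 0 + d0 N" "?F N 2 = \<phi> n (h N) + d0 N * (1 - h N) + d1 N * h N" for N
    unfolding corrected_def g1 by simp_all
  have FN: "?F N (N - 1) = \<phi> n 1 + d1 N" "?F N (N - 2) = \<phi> n (1 - h N) + d0 N * h N + d1 N * (1 - h N)" if "N \<ge> 3" for N
    unfolding corrected_def gN[OF that] by simp_all
  show thesis
  proof (rule that[OF e c])
    fix N :: nat and \<xi> :: config
    assume N: "N \<ge> 3" and \<xi>: "\<xi> \<in> configs N"
    have c_eq: "c N = (real N)\<^sup>2 / (2 * (real N - 1)) * (\<kappa> / real N powr \<theta>) * (\<alpha> * ?F N 1 + \<beta> * ?F N (N - 1))"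
      unfolding c_def F1 FN[OF N] ..
    have "\<bar>(real N)\<^sup>2 * exclusion_generator \<alpha> \<beta> \<kappa> \<theta> N (linear_density N (?F N)) \<xi>
        + lam n * linear_density N (?F N) \<xi> - c N\<bar> \<le> e1 N + e2 N + e3 N"
      unfolding c_eq
    proof (rule generator_linear_error[OF N \<xi> _ nn(1)[OF N]])
      fix x assume x: "x \<in> {2..N - 2}"
      then have xs: "x \<in> sites N" "x + 1 \<in> sites N" "x - 1 \<in> sites N" and x1: "x \<ge> 1" by (auto simp: sites_def)
      let ?q = "grid N x" and ?h = "h N"
      have q: "?q \<in> {0..1}" by (rule grid01[OF N xs(1)])
      have qh: "0 \<le> ?q - ?h" "?q + ?h \<le> 1"
        using grid01[OF N xs(2)] grid01[OF N xs(3)] unfolding grid_add grid_diff[OF x1] by auto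
      define D where "D = \<phi> n (?q + ?h) - 2 * \<phi> n ?q + \<phi> n (?q - ?h)"
      have FD: "?F N (x + 1) - 2 * ?F N x + ?F N (x - 1) = D"
        unfolding corrected_def grid_add grid_diff[OF x1] D_def by (rule id4)
      have D: "\<bar>D + 2 * lam n * ?h\<^sup>2 * \<phi> n ?q\<bar> \<le> 4 * lam n * lip n * ?h ^ 3"
        unfolding D_def using phi_second_difference[of ?h ?q n] qh hN[OF N] by simp
      have "\<bar>(real N)\<^sup>2 / 2 * (D + 2 * lam n * ?h\<^sup>2 * \<phi> n ?q)\<bar> \<le> (real N)\<^sup>2 / 2 * (4 * lam n * lip n * ?h ^ 3)"
        unfolding abs_mult by (rule mult_mono) (use D in auto)
      moreover have "\<bar>lam n * (1 - (real N)\<^sup>2 * ?h\<^sup>2) * \<phi> n ?q\<bar> \<le> lam n * \<bar>1 - (real N)\<^sup>2 * ?h\<^sup>2\<bar> * M"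
        unfolding abs_mult using M[OF q] lam_nonneg[of n] by (intro mult_mono) auto
      moreover have "\<bar>lam n * (d0 N * (1 - ?q) + d1 N * ?q)\<bar> \<le> lam n * (\<bar>d0 N\<bar> + \<bar>d1 N\<bar>)"
      proof -
        have "\<bar>d0 N * (1 - ?q)\<bar> \<le> \<bar>d0 N\<bar>" "\<bar>d1 N * ?q\<bar> \<le> \<bar>d1 N\<bar>"
          unfolding abs_mult using q by (auto intro!: mult_left_le)
        then have "\<bar>d0 N * (1 - ?q) + d1 N * ?q\<bar> \<le> \<bar>d0 N\<bar> + \<bar>d1 N\<bar>" by linarith
        then show ?thesis unfolding abs_mult using lam_nonneg[of n] by (intro mult_mono) auto
      qed
      moreover have "(real N)\<^sup>2 / 2 * D + lam n * ?F N x =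
        (real N)\<^sup>2 / 2 * (D + 2 * lam n * ?h\<^sup>2 * \<phi> n ?q) + lam n * (1 - (real N)\<^sup>2 * ?h\<^sup>2) * \<phi> n ?q
        + lam n * (d0 N * (1 - ?q) + d1 N * ?q)"
        unfolding corrected_def by (rule id5)
      ultimately have "\<bar>(real N)\<^sup>2 / 2 * D + lam n * ?F N x\<bar> \<le> (real N)\<^sup>2 / 2 * (4 * lam n * lip n * ?h ^ 3)
        + lam n * \<bar>1 - (real N)\<^sup>2 * ?h\<^sup>2\<bar> * M + lam n * (\<bar>d0 N\<bar> + \<bar>d1 N\<bar>)"
        by (intro abs_le_add3)
      also have "\<dots> = e1 N" unfolding e1_def by simp
      finally show "\<bar>(real N)\<^sup>2 / 2 * (?F N (x + 1) - 2 * ?F N x + ?F N (x - 1)) + lam n * ?F N x\<bar> \<le> e1 N"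
        unfolding FD .
    next
      have eq: "?F N 2 - ?F N 1 = \<phi> n (h N) - \<phi> n 0 + (d1 N - d0 N) * h N"
        unfolding F1 by (simp add: algebra_simps)
      show "\<bar>(real N)\<^sup>2 / (2 * (real N - 1)) * (?F N 2 - ?F N 1 - \<kappa> / real N powr \<theta> * ?F N 1) + lam n * ?F N 1 / (real N - 1)\<bar> \<le> e2 N"
        unfolding eq unfolding e2_def F1(1) by (rule order.refl)
      have eq: "?F N (N - 1) - ?F N (N - 2) = \<phi> n 1 - \<phi> n (1 - h N) + (d1 N - d0 N) * h N"
        unfolding FN[OF N] by (simp add: algebra_simps)
      show "\<bar>(real N)\<^sup>2 / (2 * (real N - 1)) * (- (?F N (N - 1) - ?F N (N - 2)) - \<kappa> / real N powr \<theta> * ?F N (N - 1))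
        + lam n * ?F N (N - 1) / (real N - 1)\<bar> \<le> e3 N"
        unfolding eq unfolding e3_def FN(1)[OF N] by (rule order.refl)
    qed
    then show "\<bar>(real N)\<^sup>2 * exclusion_generator \<alpha> \<beta> \<kappa> \<theta> N (linear_density N (?F N)) \<xi>
        + lam n * linear_density N (?F N) \<xi> - c N\<bar> \<le> e N"
      unfolding e_def using nn[OF N] by linarith
    have dF: "\<bar>?F N (x + 1) - ?F N x\<bar> \<le> (lip n + \<bar>d0 N\<bar> + \<bar>d1 N\<bar>) * h N" if x: "x \<in> {1..N - 2}" for x
    proof -
      have xs: "x \<in> sites N" "x + 1 \<in> sites N" using x N by (auto simp: sites_def)
      have "\<bar>\<phi> n (grid N (x + 1)) - \<phi> n (grid N x)\<bar> \<le> lip n * h N"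
        using phi_lipschitz[OF grid01[OF N xs(2)] grid01[OF N xs(1)], of n] hN[OF N] unfolding grid_add by simp
      moreover have "\<bar>- d0 N * h N\<bar> \<le> \<bar>d0 N\<bar> * h N" "\<bar>d1 N * h N\<bar> \<le> \<bar>d1 N\<bar> * h N"
        using hN[OF N] by (auto simp: abs_mult)
      moreover have "?F N (x + 1) - ?F N x = (\<phi> n (grid N (x + 1)) - \<phi> n (grid N x)) + - d0 N * h N + d1 N * h N"
        unfolding corrected_def grid_add by (simp add: algebra_simps)
      ultimately show ?thesis unfolding distrib_right by (intro abs_le_add3)
    qed
    have "(real N)\<^sup>2 * carre_du_champ \<alpha> \<beta> \<kappa> \<theta> N (linear_density N (?F N)) \<xi> \<le> e4 N"
      unfolding e4_def F1(1)[symmetric] FN(1)[OF N, symmetric]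
      by (rule mult_left_mono, rule carre_du_champ_linear_bound[OF N \<xi> \<kappa> \<alpha> \<beta>], erule dF) simp
    then show "(real N)\<^sup>2 * carre_du_champ \<alpha> \<beta> \<kappa> \<theta> N (linear_density N (?F N)) \<xi> \<le> e N"
      unfolding e_def using nn[OF N] by linarith
  next
    fix N x :: nat assume N: "N \<ge> 3" and x: "x \<in> sites N"
    have xN: "real x / real N \<in> {0..1}" using x by (auto simp: sites_def field_simps)
    note q = grid01[OF N x]
    \<comment> \<open>The two grids agree at the centre and differ most at the end sites, by exactly
      \<open>1 / N\<close>.\<close>
    have "grid N x - real x / real N = (2 * real x - real N) / (real N * (real N - 2))"
      using N by (simp add: grid_def field_simps)
    moreover have "\<bar>2 * real x - real N\<bar> \<le> real N - 2" using x by (auto simp: sites_def abs_le_iff)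
    moreover have "\<bar>(2 * real x - real N) / (real N * (real N - 2))\<bar> = \<bar>2 * real x - real N\<bar> / (real N * (real N - 2))"
      using N by (simp add: abs_divide abs_mult)
    ultimately have "\<bar>grid N x - real x / real N\<bar> \<le> (real N - 2) / (real N * (real N - 2))"
      using N divide_right_mono[of "\<bar>2 * real x - real N\<bar>" "real N - 2" "real N * (real N - 2)"] by simp
    also have "\<dots> = 1 / real N" using N by simp
    finally have "\<bar>grid N x - real x / real N\<bar> \<le> 1 / real N" .
    then have "\<bar>\<phi> n (grid N x) - \<phi> n (real x / real N)\<bar> \<le> lip n * (1 / real N)"
      using phi_lipschitz[OF q xN, of n] mult_left_mono[OF _ lip_nonneg[of n]] by (meson order_trans)
    moreover have "\<bar>d0 N * (1 - grid N x)\<bar> \<le> \<bar>d0 N\<bar>" "\<bar>d1 N * grid N x\<bar> \<le> \<bar>d1 N\<bar>"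
      unfolding abs_mult using q by (auto intro!: mult_left_le)
    ultimately have "\<bar>?F N x - \<phi> n (real x / real N)\<bar> \<le> e5 N"
      unfolding corrected_def e5_def by linarith
    then show "\<bar>?F N x - \<phi> n (real x / real N)\<bar> \<le> e N" unfolding e_def using nn[OF N] by linarith
  qed
qed

end

subsection \<open>Mean-square convergence of the Fourier modes\<close>

lemma LINT_continuous:
  fixes f :: "real \<Rightarrow> real"
  shows "continuous_on {s..t} f \<Longrightarrow> (LINT q:{s..t}|lebesgue. f q) = integral {s..t} f"
  by (intro set_lebesgue_integral_eq_integral absolutely_integrable_continuous_real)

lemma bounded_measurable_absolutely_integrable:
  fixes f :: "real \<Rightarrow> real"
  assumes "f \<in> borel_measurable (lebesgue_on {s..t})" "\<And>q. q \<in> {s..t} \<Longrightarrow> \<bar>f q\<bar> \<le> R"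
  shows "set_integrable lebesgue {s..t} f"
  by (rule measurable_bounded_by_integrable_imp_absolutely_integrable[OF assms(1), of "\<lambda>_. R"])
    (use assms in auto)

lemma cont01_measurable: "cont01 f \<Longrightarrow> f \<in> borel_measurable (lebesgue_on {0..1})"
  by (rule continuous_imp_measurable_on_sets_lebesgue) auto

lemma times_continuous_absolutely_integrable:
  assumes "\<rho> \<in> borel_measurable (lebesgue_on {0..1})" "\<And>q. q \<in> {0..1} \<Longrightarrow> \<bar>\<rho> q\<bar> \<le> R" "cont01 h"
  shows "set_integrable lebesgue {0..1} (\<lambda>q. h q * \<rho> q)"
proof -
  obtain B where B: "B > 0" "\<And>x. x \<in> {0..1} \<Longrightarrow> \<bar>h x\<bar> \<le> B" using cont01_bounded[OF assms(3)] by blast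
  show ?thesis
  proof (rule bounded_measurable_absolutely_integrable)
    show "(\<lambda>q. h q * \<rho> q) \<in> borel_measurable (lebesgue_on {0..1})"
      by (intro borel_measurable_times cont01_measurable assms)
    show "\<bar>h q * \<rho> q\<bar> \<le> B * R" if "q \<in> {0..1}" for q
      unfolding abs_mult using assms(2)[OF that] B(1) B(2)[OF that] by (intro mult_mono) auto
  qed
qed

text \<open>Since \<rho> is only measurable, the integrand is first dominated by \<open>R\<close>
  times the modulus of \<open>h\<close>; Cauchy-Schwarz is then applied to continuous functions. The
  bound extends statements about modes to all continuous test functions.\<close>

lemma LINT_times_bound:
  assumes "\<rho> \<in> borel_measurable (lebesgue_on {0..1})" "\<And>q. q \<in> {0..1} \<Longrightarrow> \<bar>\<rho> q\<bar> \<le> R" "cont01 h"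
  shows "(LINT q:{0..1}|lebesgue. h q * \<rho> q)\<^sup>2 \<le> R\<^sup>2 * ip h h"
proof -
  note i = times_continuous_absolutely_integrable[OF assms]
  have R: "R \<ge> 0" using assms(2)[of 0] by auto
  have c: "cont01 (\<lambda>q. \<bar>h q\<bar>)" "cont01 (\<lambda>q. R * \<bar>h q\<bar>)" "cont01 (\<lambda>q. 1)"
    by (intro continuous_intros assms)+
  have "\<bar>LINT q:{0..1}|lebesgue. h q * \<rho> q\<bar> = norm (integral {0..1} (\<lambda>q. h q * \<rho> q))"
    using set_lebesgue_integral_eq_integral(2)[OF i] by simp
  also have "\<dots> \<le> integral {0..1} (\<lambda>q. R * \<bar>h q\<bar>)"
  proof (rule integral_norm_bound_integral)
    show "norm (h q * \<rho> q) \<le> R * \<bar>h q\<bar>" if "q \<in> {0..1}" for q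
      using mult_right_mono[OF assms(2)[OF that] abs_ge_zero[of "h q"]] by (simp add: abs_mult mult.commute)
  qed (use i c(2) in \<open>auto intro: set_lebesgue_integral_eq_integral integrable_continuous_interval\<close>)
  also have "\<dots> = R * ip (\<lambda>q. \<bar>h q\<bar>) (\<lambda>q. 1)" by (simp add: ip_def)
  finally have "\<bar>LINT q:{0..1}|lebesgue. h q * \<rho> q\<bar>\<^sup>2 \<le> (R * ip (\<lambda>q. \<bar>h q\<bar>) (\<lambda>q. 1))\<^sup>2"
    by (intro power_mono) auto
  also have "\<dots> = R\<^sup>2 * (ip (\<lambda>q. \<bar>h q\<bar>) (\<lambda>q. 1))\<^sup>2" by (simp add: power_mult_distrib)
  also have "\<dots> \<le> R\<^sup>2 * (ip (\<lambda>q. \<bar>h q\<bar>) (\<lambda>q. \<bar>h q\<bar>) * ip (\<lambda>q. 1) (\<lambda>q. 1))"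
    by (intro mult_left_mono ip_Cauchy_Schwarz c) auto
  also have "\<dots> = R\<^sup>2 * ip h h" by (simp add: ip_def)
  finally show ?thesis by simp
qed

lemma riemann_sum_tendsto:
  assumes f: "cont01 f"
  shows "(\<lambda>N. 1 / (real N - 1) * (\<Sum>x\<in>sites N. f (real x / real N))) \<longlonglongrightarrow> integral {0..1} f"
proof -
  obtain B where B: "B > 0" "\<And>x. x \<in> {0..1} \<Longrightarrow> \<bar>f x\<bar> \<le> B" using cont01_bounded[OF f] by blast
  define S where "S N = 1 / real N * (\<Sum>x = 1..N. f (real x / real N))" for N
  have "S \<longlonglongrightarrow> integral {0..1} f"
  proof (rule LIMSEQ_I)
    fix e :: real assume e: "e > 0"
    have "uniformly_continuous_on {0..1} f" using f by (intro compact_uniformly_continuous) auto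
    then obtain d where d: "d > 0" "\<And>x y. x \<in> {0..1} \<Longrightarrow> y \<in> {0..1} \<Longrightarrow> dist y x < d \<Longrightarrow> dist (f y) (f x) < e / 2"
      unfolding uniformly_continuous_on_def using e by (metis half_gt_zero)
    obtain N0 where N0: "1 / d < real N0" using reals_Archimedean2 by blast
    have "norm (S N - integral {0..1} f) < e" if N: "N \<ge> max 1 N0" for N
    proof -
      have Np: "real N > 0" using N by simp
      have sub: "{real x / real N .. real (Suc x) / real N} \<subseteq> {0..1}" if "x < N" for x
        using that Np by (auto simp: field_simps intro: order_trans)
      have "1 / real N < d"
      proof -
        have "1 / d < real N" using N N0 by simp
        then show ?thesis using d(1) Np by (simp add: field_simps)
      qed
      have int: "f integrable_on {s..t}" if "0 \<le> s" "t \<le> 1" for s t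
        using that by (auto intro!: integrable_continuous_interval continuous_on_subset[OF f])
      have split: "integral {0..real k / real N} f = (\<Sum>x<k. integral {real x / real N .. real (Suc x) / real N} f)" if "k \<le> N" for k
        using that
      proof (induction k)
        case (Suc k)
        have "integral {0..real (Suc k) / real N} f = integral {0..real k / real N} f + integral {real k / real N .. real (Suc k) / real N} f"
          using Suc.prems Np by (intro Henstock_Kurzweil_Integration.integral_combine[symmetric] int) (auto simp: field_simps)
        then show ?case using Suc by simp
      qed simp
      have "\<bar>1 / real N * f (real (Suc x) / real N) - integral {real x / real N .. real (Suc x) / real N} f\<bar> \<le> 1 / real N * (e / 2)"
        if x: "x < N" for x
      proof -
        let ?I = "{real x / real N .. real (Suc x) / real N}"
        let ?p = "real (Suc x) / real N"
        have le: "real x / real N \<le> ?p" using Np by (simp add: divide_right_mono)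
        have fi: "f integrable_on ?I" using sub[OF x] le by (intro int) auto
        have len: "?p - real x / real N = 1 / real N" by (simp add: diff_divide_distrib[symmetric])
        have "norm (integral ?I (\<lambda>q. f q - f ?p)) \<le> e / 2 * (?p - real x / real N)"
        proof (rule integral_bound[OF le])
          show "continuous_on ?I (\<lambda>q. f q - f ?p)"
            by (intro continuous_intros continuous_on_subset[OF f sub[OF x]])
          fix q assume q: "q \<in> ?I"
          have "dist ?p q < d" using q len \<open>1 / real N < d\<close> by (auto simp: dist_real_def)
          moreover have "?p \<in> ?I" using le by auto
          ultimately have "dist (f ?p) (f q) < e / 2" using d(2)[of q ?p] sub[OF x] q by blast
          then show "norm (f q - f ?p) \<le> e / 2" by (simp add: dist_real_def abs_minus_commute)
        qed
        moreover have "integral ?I (\<lambda>q. f q - f ?p) = integral ?I f - (?p - real x / real N) * f ?p"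
          using fi le by (subst integral_diff) auto
        ultimately show ?thesis unfolding len by (simp add: abs_minus_commute)
      qed
      then have "\<bar>(\<Sum>x<N. 1 / real N * f (real (Suc x) / real N) - integral {real x / real N .. real (Suc x) / real N} f)\<bar> \<le> (\<Sum>x<N. 1 / real N * (e / 2))"
        by (intro order_trans[OF sum_abs sum_mono]) auto
      moreover have "(\<Sum>x<N. 1 / real N * (e / 2)) = e / 2" using Np by simp
      moreover have "S N = (\<Sum>x<N. 1 / real N * f (real (Suc x) / real N))"
        unfolding S_def sum_distrib_left by (rule sum.reindex_bij_witness[of _ Suc "\<lambda>x. x - 1"]) auto
      moreover have "integral {0..1} f = (\<Sum>x<N. integral {real x / real N .. real (Suc x) / real N} f)"
        using split[of N] Np by simp
      ultimately have "\<bar>S N - integral {0..1} f\<bar> \<le> e / 2" by (simp add: sum_subtractf)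
      then show ?thesis using e by simp
    qed
    then show "\<exists>no. \<forall>N\<ge>no. norm (S N - integral {0..1} f) < e" by blast
  qed
  \<comment> \<open>Passage from \<open>N\<close> points with weight \<open>1 / N\<close> to the
    \<open>N - 1\<close> sites with weight \<open>1 / (N - 1)\<close>: the normalisation changes and
    the endpoint value \<open>f 1\<close> is removed.\<close>
  moreover have "(\<lambda>N. real N / (real N - 1)) \<longlonglongrightarrow> 1" "(\<lambda>N. 1 / (real N - 1)) \<longlonglongrightarrow> 0" by real_asymp+
  ultimately have "(\<lambda>N. real N / (real N - 1) * S N - 1 / (real N - 1) * f 1) \<longlonglongrightarrow> 1 * integral {0..1} f - 0 * f 1"
    by (intro tendsto_intros)
  then have lim: "(\<lambda>N. real N / (real N - 1) * S N - 1 / (real N - 1) * f 1) \<longlonglongrightarrow> integral {0..1} f" by simp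
  show ?thesis
  proof (rule Lim_transform_eventually[OF lim], rule eventually_mono[OF eventually_ge_at_top[of 3]])
    fix N :: nat assume N: "N \<ge> 3"
    have id: "n / m * (1 / n * (p + s)) - 1 / m * p = 1 / m * s" if "n \<noteq> 0" for n m p s :: real
      using that by (simp add: algebra_simps add_divide_distrib)
    have "{1..N} = insert N (sites N)" "N \<notin> sites N" using N by (auto simp: sites_def)
    then have "(\<Sum>x = 1..N. f (real x / real N)) = f 1 + (\<Sum>x\<in>sites N. f (real x / real N))"
      using N by simp
    then show "real N / (real N - 1) * S N - 1 / (real N - 1) * f 1 = 1 / (real N - 1) * (\<Sum>x\<in>sites N. f (real x / real N))"
      unfolding S_def by (simp only:) (rule id, use N in simp)
  qed
qed

text \<open>The particle counterpart of \<open>LINT_times_bound\<close>, valid for every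
  configuration because occupation numbers are at most 1. It controls the part of a test function
  that is not captured by finitely many modes.\<close>

lemma linear_density_square_le:
  assumes "N \<ge> 3" "\<xi> \<in> configs N"
  shows "(linear_density N F \<xi>)\<^sup>2 \<le> 1 / (real N - 1) * (\<Sum>x\<in>sites N. (F x)\<^sup>2)"
proof -
  have N: "real N - 1 > 0" using assms by simp
  have "(\<Sum>x\<in>sites N. F x * \<xi> x)\<^sup>2 \<le> (\<Sum>x\<in>sites N. (F x)\<^sup>2) * (\<Sum>x\<in>sites N. (\<xi> x)\<^sup>2)"
    by (rule Cauchy_Schwarz_ineq_sum)
  also have "\<dots> \<le> (\<Sum>x\<in>sites N. (F x)\<^sup>2) * (\<Sum>x\<in>sites N. 1)"
    using configs_values[OF assms(2)] by (intro mult_left_mono sum_mono sum_nonneg) fastforce+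
  also have "\<dots> = (\<Sum>x\<in>sites N. (F x)\<^sup>2) * (real N - 1)" using assms(1) by (simp add: sites_def)
  finally have "(1 / (real N - 1))\<^sup>2 * (\<Sum>x\<in>sites N. F x * \<xi> x)\<^sup>2 \<le>
      (1 / (real N - 1))\<^sup>2 * ((\<Sum>x\<in>sites N. (F x)\<^sup>2) * (real N - 1))"
    by (rule mult_left_mono) simp
  also have "\<dots> = 1 / (real N - 1) * (\<Sum>x\<in>sites N. (F x)\<^sup>2)"
    using N by (simp add: power2_eq_square)
  finally show ?thesis unfolding linear_density_def power_mult_distrib .
qed

text \<open>The drift of \<open>(f - y)\<^sup>2\<close> when \<open>f\<close> has drift
  \<open>r - l * f + c\<close> and \<open>y\<close> solves \<open>y' = - l * y + c'\<close>. The
  eigenvalue only contributes damping; what remains is the error times the deviation, and the carre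
  du champ.\<close>

lemma square_drift:
  fixes f y :: real
  assumes "Lf2 = 2 * f * Lf + \<Gamma>" "Lf = r - l * f + c"
  shows "Lf2 - (2 * (- l * y + c') * f + Lf * (2 * y)) + 2 * (y * (- l * y + c'))
    = - (2 * l * (f - y)\<^sup>2) + 2 * ((f - y) * (r + (c - c'))) + \<Gamma>"
  unfolding assms by (simp add: power2_eq_square algebra_simps)

locale hydrodynamic_limit = heat_basis a b \<phi> \<phi>' lam C
  for a b :: real and \<phi> \<phi>' :: "nat \<Rightarrow> real \<Rightarrow> real" and lam :: "nat \<Rightarrow> real" and C :: real +
  fixes \<alpha> \<beta> \<kappa> \<theta> :: real and g :: "real \<Rightarrow> real" and \<mu> :: "nat \<Rightarrow> config measure"
    and M :: "nat \<Rightarrow> 'a measure" and \<eta> :: "nat \<Rightarrow> real \<Rightarrow> 'a \<Rightarrow> config"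
  assumes alpha: "\<alpha> \<in> {0..1}" and beta: "\<beta> \<in> {0..1}" and kappa: "\<kappa> > 0"
    and boundary_regime: "(\<theta> < 1 \<and> a = 0 \<and> b = 1) \<or> (\<theta> = 1 \<and> a = 1 \<and> b = \<kappa>) \<or> (\<theta> > 1 \<and> a = 1 \<and> b = 0)"
    and g_measurable: "g \<in> borel_measurable (lebesgue_on {0..1})" and g_range: "g \<in> {0..1} \<rightarrow> {0..1}"
    and mu_sets: "\<And>N. N \<ge> 1 \<Longrightarrow> sets (\<mu> N) = sets (count_space (configs N))"
    and mu_associated: "associated \<mu> g"
    and process: "\<And>N. N \<ge> 3 \<Longrightarrow> markov_process (M N) (\<eta> N) (configs N)
           (\<lambda>f \<xi>. (real N)\<^sup>2 * exclusion_generator \<alpha> \<beta> \<kappa> \<theta> N f \<xi>) (\<mu> N)"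
begin

text \<open>For \<open>\<theta> < 1\<close> the mode vanishes at the boundary; the linear correction restores the discrete
  boundary condition \<open>N (F 2 - F 1) \<approx> \<kappa> N\<^sup>1\<^sup>-\<^sup>\<theta> F 1\<close> and is small because \<open>N\<^sup>\<theta>\<^sup>-\<^sup>1 \<longrightarrow> 0\<close>.\<close>

lemma boundary_correction:
  obtains d0 d1 where "d0 \<longlonglongrightarrow> 0" "d1 \<longlonglongrightarrow> 0"
    "(\<lambda>N. \<kappa> * real N powr (1 - \<theta>) * (\<phi> n 0 + d0 N)) \<longlonglongrightarrow> \<phi>' n 0"
    "(\<lambda>N. \<kappa> * real N powr (1 - \<theta>) * (\<phi> n 1 + d1 N)) \<longlonglongrightarrow> - \<phi>' n 1"
proof -
  have bc: "a * \<phi>' n 0 = b * \<phi> n 0" "a * \<phi>' n 1 = - b * \<phi> n 1"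
    using phi_bc[of n] by (auto simp: satisfies_bc_def)
  consider "\<theta> < 1" "a = 0" "b = 1" | "\<theta> = 1" "a = 1" "b = \<kappa>" | "\<theta> > 1" "a = 1" "b = 0"
    using boundary_regime by blast
  then show thesis
  proof cases
    case 1
    have p: "(\<lambda>N. real N powr (\<theta> - 1)) \<longlonglongrightarrow> 0" using 1 by real_asymp
    have small: "(\<lambda>N. c * real N powr (\<theta> - 1)) \<longlonglongrightarrow> 0" for c :: real
      using tendsto_mult_right_zero[OF p, of c] .
    have eq: "\<forall>\<^sub>F N in sequentially. c = \<kappa> * real N powr (1 - \<theta>) * (0 + c / \<kappa> * real N powr (\<theta> - 1))" for c
      using eventually_gt_at_top[of 0]
    proof eventually_elim
      case (elim N)
      then have "real N powr (1 - \<theta>) * real N powr (\<theta> - 1) = 1" by (simp add: powr_add[symmetric])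
      then show ?case using kappa by simp
    qed
    have z: "\<phi> n 0 = 0" "\<phi> n 1 = 0" using bc 1 by auto
    show thesis
      by (rule that[of "\<lambda>N. \<phi>' n 0 / \<kappa> * real N powr (\<theta> - 1)" "\<lambda>N. (- \<phi>' n 1) / \<kappa> * real N powr (\<theta> - 1)"])
        (unfold z, (rule small Lim_transform_eventually[OF tendsto_const eq])+)
  next
    \<comment> \<open>The power of \<open>N\<close> is 1 and the Robin condition of the mode already
      is the discrete one.\<close>
    case 2
    have "\<forall>\<^sub>F N in sequentially. c = \<kappa> * real N powr (1 - \<theta>) * (d + 0)" if "c = \<kappa> * d" for c d
      using eventually_gt_at_top[of 0] by eventually_elim (use 2 that in simp)
    then show thesis using bc 2
      by (intro that[of "\<lambda>_. 0" "\<lambda>_. 0"] Lim_transform_eventually[OF tendsto_const]) auto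
  next
    \<comment> \<open>The reservoirs fade as \<open>N\<close> grows, in agreement with the Neumann
      condition \<open>\<phi>' n = 0\<close> at both ends.\<close>
    case 3
    have p: "(\<lambda>N. real N powr (1 - \<theta>)) \<longlonglongrightarrow> 0" using 3 by real_asymp
    have "(\<lambda>N. \<kappa> * real N powr (1 - \<theta>) * (c + 0)) \<longlonglongrightarrow> \<kappa> * 0 * (c + 0)" for c
      by (intro tendsto_intros p)
    then show thesis using bc 3 by (intro that[of "\<lambda>_. 0" "\<lambda>_. 0"]) auto
  qed
qed

lemma process_prob_space: "N \<ge> 3 \<Longrightarrow> prob_space (M N)"
  using process by (simp add: markov_process_def)

lemma process_configs: "N \<ge> 3 \<Longrightarrow> t \<ge> 0 \<Longrightarrow> \<omega> \<in> space (M N) \<Longrightarrow> \<eta> N t \<omega> \<in> configs N"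
  using process[of N] measurable_space[of "\<eta> N t" "M N" "count_space (configs N)"]
  by (simp add: markov_process_def)

lemma process_integrable:
  fixes f :: "config \<Rightarrow> real"
  shows "N \<ge> 3 \<Longrightarrow> t \<ge> 0 \<Longrightarrow> integrable (M N) (\<lambda>\<omega>. f (\<eta> N t \<omega>))"
  by (rule markov_process_integrable[OF process finite_configs])

lemma process_integral_mono:
  fixes f h :: "config \<Rightarrow> real"
  assumes "N \<ge> 3" "t \<ge> 0" "\<And>\<xi>. \<xi> \<in> configs N \<Longrightarrow> f \<xi> \<le> h \<xi>"
  shows "(\<integral>\<omega>. f (\<eta> N t \<omega>) \<partial>M N) \<le> (\<integral>\<omega>. h (\<eta> N t \<omega>) \<partial>M N)"
  by (rule integral_mono) (use assms process_integrable process_configs in auto)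

lemma process_integral_const: "N \<ge> 3 \<Longrightarrow> (\<integral>\<omega>. c \<partial>M N) = (c :: real)"
  using prob_space.prob_space[OF process_prob_space, of N] by simp

definition mean_square :: "real \<Rightarrow> (real \<Rightarrow> real) \<Rightarrow> real \<Rightarrow> nat \<Rightarrow> real" where
  "mean_square t G l N = (\<integral>\<omega>. (empirical N G (\<eta> N t \<omega>) - l)\<^sup>2 \<partial>M N)"

lemma mean_square_nonneg: "mean_square t G l N \<ge> 0"
  unfolding mean_square_def by simp

lemma empirical_bound:
  assumes "N \<ge> 3" "\<xi> \<in> configs N" "\<And>q. q \<in> {0..1} \<Longrightarrow> \<bar>G q\<bar> \<le> B"
  shows "\<bar>empirical N G \<xi>\<bar> \<le> B"
  unfolding empirical_eq_linear_density
  by (rule linear_density_bound[OF assms(1,2)], rule assms(3)) (auto simp: sites_def field_simps)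

text \<open>Convergence in probability becomes convergence in mean square because empirical
  densities are bounded by the supremum of the modulus of \<open>G\<close>.\<close>

lemma initial_mean_square:
  assumes G: "cont01 G"
  shows "mean_square 0 G (LINT q:{0..1}|lebesgue. G q * g q) \<longlonglongrightarrow> 0"
proof -
  let ?l = "LINT q:{0..1}|lebesgue. G q * g q"
  obtain B where B: "B > 0" "\<And>x. x \<in> {0..1} \<Longrightarrow> \<bar>G x\<bar> \<le> B" using cont01_bounded[OF G] by blast
  define P where "P \<delta> N = measure (\<mu> N) {\<xi> \<in> space (\<mu> N). \<bar>empirical N G \<xi> - ?l\<bar> > \<delta>}" for \<delta> N
  have P: "P \<delta> \<longlonglongrightarrow> 0" if "\<delta> > 0" for \<delta>
    using mu_associated G that unfolding associated_def P_def by auto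
  have bound: "mean_square 0 G ?l N \<le> \<delta>\<^sup>2 + (B + \<bar>?l\<bar>)\<^sup>2 * P \<delta> N" if N: "N \<ge> 3" for N \<delta>
  proof -
    interpret prob_space "M N" by (rule process_prob_space[OF N])
    note proc = process[OF N, unfolded markov_process_def, THEN conjunct2]
    have X: "\<eta> N 0 \<in> measurable (M N) (count_space (configs N))"
      using proc[THEN conjunct1, rule_format, of 0] by simp
    have dist: "distr (M N) (count_space (configs N)) (\<eta> N 0) = \<mu> N"
      by (rule proc[THEN conjunct2, THEN conjunct1])
    have sp: "space (\<mu> N) = configs N" using sets_eq_imp_space_eq[OF mu_sets[of N]] N by simp
    let ?A = "{\<xi> \<in> configs N. \<bar>empirical N G \<xi> - ?l\<bar> > \<delta>}"
    have PA: "P \<delta> N = measure (M N) (\<eta> N 0 -` ?A \<inter> space (M N))"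
    proof -
      have "P \<delta> N = measure (\<mu> N) ?A" unfolding P_def sp ..
      also have "\<dots> = measure (distr (M N) (count_space (configs N)) (\<eta> N 0)) ?A" by (simp only: dist)
      also have "\<dots> = measure (M N) (\<eta> N 0 -` ?A \<inter> space (M N))" by (rule measure_distr[OF X]) auto
      finally show ?thesis .
    qed
    have "mean_square 0 G ?l N \<le> (\<integral>\<omega>. \<delta>\<^sup>2 + (B + \<bar>?l\<bar>)\<^sup>2 * indicator ?A (\<eta> N 0 \<omega>) \<partial>M N)"
      unfolding mean_square_def
    proof (rule process_integral_mono[OF N])
      fix \<xi> assume \<xi>: "\<xi> \<in> configs N"
      have "\<bar>empirical N G \<xi>\<bar> \<le> B" by (rule empirical_bound[OF N \<xi>]) (rule B(2))
      then have "\<bar>empirical N G \<xi> - ?l\<bar> \<le> B + \<bar>?l\<bar>" by linarith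
      then have "\<bar>empirical N G \<xi> - ?l\<bar>\<^sup>2 \<le> (B + \<bar>?l\<bar>)\<^sup>2" by (intro power_mono) auto
      moreover have "\<bar>empirical N G \<xi> - ?l\<bar>\<^sup>2 \<le> \<delta>\<^sup>2" if "\<bar>empirical N G \<xi> - ?l\<bar> \<le> \<delta>"
        using that by (intro power_mono) auto
      ultimately show "(empirical N G \<xi> - ?l)\<^sup>2 \<le> \<delta>\<^sup>2 + (B + \<bar>?l\<bar>)\<^sup>2 * indicator ?A \<xi>"
        using \<xi> by (cases "\<bar>empirical N G \<xi> - ?l\<bar> \<le> \<delta>") (auto simp: not_le intro: add_increasing)
    qed simp
    also have "\<dots> = \<delta>\<^sup>2 + (B + \<bar>?l\<bar>)\<^sup>2 * (\<integral>\<omega>. indicator ?A (\<eta> N 0 \<omega>) \<partial>M N)"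
      using process_integrable[OF N, of 0 "indicator ?A"] prob_space by simp
    also have "(\<integral>\<omega>. indicator ?A (\<eta> N 0 \<omega>) \<partial>M N) = (\<integral>\<omega>. indicator (\<eta> N 0 -` ?A \<inter> space (M N)) \<omega> \<partial>M N)"
      by (rule Bochner_Integration.integral_cong[OF refl]) (auto simp: indicator_def)
    also have "\<dots> = P \<delta> N" unfolding PA by simp
    finally show ?thesis .
  qed
  show ?thesis
  proof (rule LIMSEQ_I)
    fix e :: real assume e: "e > 0"
    define \<delta> where "\<delta> = sqrt (e / 2)"
    have \<delta>: "\<delta> > 0" "\<delta>\<^sup>2 = e / 2" using e by (auto simp: \<delta>_def)
    have "(\<lambda>N. (B + \<bar>?l\<bar>)\<^sup>2 * P \<delta> N) \<longlonglongrightarrow> 0" by (rule tendsto_mult_right_zero[OF P[OF \<delta>(1)]])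
    then have "\<forall>\<^sub>F N in sequentially. (B + \<bar>?l\<bar>)\<^sup>2 * P \<delta> N < e / 2" using e by (intro order_tendstoD) auto
    then have "\<forall>\<^sub>F N in sequentially. norm (mean_square 0 G ?l N - 0) < e"
      using eventually_ge_at_top[of 3]
      by eventually_elim (use bound[of _ \<delta>] \<delta>(2) mean_square_nonneg in \<open>fastforce simp: abs_of_nonneg\<close>)
    then show "\<exists>no. \<forall>N\<ge>no. norm (mean_square 0 G ?l N - 0) < e" by (simp add: eventually_sequentially)
  qed
qed

text \<open>The damping has the good sign, so the mean-square deviation of the corrected mode grows
  at most linearly in time with slope \<open>err N\<close>, and no Gronwall factor appears. The
  dynamics is studied for the corrected mode, the start and the conclusion for the empirical one;
  they differ by at most \<open>e N\<close> on every configuration.\<close>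

lemma mode_mean_square:
  assumes y: "\<And>s. s \<ge> 0 \<Longrightarrow> (y has_real_derivative - lam n * y s + 1 / 2 * (\<alpha> * \<phi>' n 0 - \<beta> * \<phi>' n 1)) (at s within {0..})"
    and y0: "y 0 = (LINT q:{0..1}|lebesgue. \<phi> n q * g q)" and t: "t \<ge> 0"
  shows "mean_square t (\<phi> n) (y t) \<longlonglongrightarrow> 0"
proof -
  define cc where "cc = 1 / 2 * (\<alpha> * \<phi>' n 0 - \<beta> * \<phi>' n 1)"
  obtain d0 d1 where d: "d0 \<longlonglongrightarrow> 0" "d1 \<longlonglongrightarrow> 0"
    "(\<lambda>N. \<kappa> * real N powr (1 - \<theta>) * (\<phi> n 0 + d0 N)) \<longlonglongrightarrow> \<phi>' n 0"
    "(\<lambda>N. \<kappa> * real N powr (1 - \<theta>) * (\<phi> n 1 + d1 N)) \<longlonglongrightarrow> - \<phi>' n 1"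
    by (rule boundary_correction)
  let ?\<Phi> = "\<lambda>N. linear_density N (corrected n d0 d1 N)"
  obtain e c where e: "e \<longlonglongrightarrow> 0" and c: "c \<longlonglongrightarrow> cc"
    and gen: "\<And>N \<xi>. N \<ge> 3 \<Longrightarrow> \<xi> \<in> configs N \<Longrightarrow>
      \<bar>(real N)\<^sup>2 * exclusion_generator \<alpha> \<beta> \<kappa> \<theta> N (?\<Phi> N) \<xi> + lam n * ?\<Phi> N \<xi> - c N\<bar> \<le> e N"
    and cdc: "\<And>N \<xi>. N \<ge> 3 \<Longrightarrow> \<xi> \<in> configs N \<Longrightarrow> (real N)\<^sup>2 * carre_du_champ \<alpha> \<beta> \<kappa> \<theta> N (?\<Phi> N) \<xi> \<le> e N"
    and close: "\<And>N x. N \<ge> 3 \<Longrightarrow> x \<in> sites N \<Longrightarrow> \<bar>corrected n d0 d1 N x - \<phi> n (real x / real N)\<bar> \<le> e N"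
    by (rule corrected_generator[OF kappa alpha beta d, folded cc_def]) (rule that)
  have close': "(?\<Phi> N \<xi> - empirical N (\<phi> n) \<xi>)\<^sup>2 \<le> (e N)\<^sup>2" if N: "N \<ge> 3" and \<xi>: "\<xi> \<in> configs N" for N \<xi>
  proof -
    have "\<bar>?\<Phi> N \<xi> - empirical N (\<phi> n) \<xi>\<bar> \<le> e N"
      unfolding empirical_eq_linear_density linear_density_diff
      by (rule linear_density_bound[OF N \<xi> close[OF N]])
    then have "\<bar>?\<Phi> N \<xi> - empirical N (\<phi> n) \<xi>\<bar>\<^sup>2 \<le> (e N)\<^sup>2" by (intro power_mono) auto
    then show ?thesis by simp
  qed
  obtain A where A: "A > 0" "\<And>x. x \<in> {0..1} \<Longrightarrow> \<bar>\<phi> n x\<bar> \<le> A" using cont01_bounded[OF phi_continuous] by blast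
  have yc: "continuous_on {0..} y" by (rule DERIV_continuous_on) (use y in auto)
  have "bounded (y ` {0..t})"
    by (intro compact_imp_bounded compact_continuous_image continuous_on_subset[OF yc]) auto
  then obtain Y where "\<forall>s\<in>{0..t}. \<bar>y s\<bar> \<le> Y" unfolding bounded_iff by auto
  note Y = this[rule_format]
  define D where "D N s = (\<integral>\<omega>. (?\<Phi> N (\<eta> N s \<omega>) - y s)\<^sup>2 \<partial>M N)" for N s
  \<comment> \<open>The first factor bounds the deviation itself on \<open>[0, t]\<close>, the
    second its drift error including the convergence of the constant; the last term is the carre du
    champ.\<close>
  define err where "err N = 2 * (A + e N + Y) * (e N + \<bar>c N - cc\<bar>) + e N" for N
  have "err \<longlonglongrightarrow> 2 * (A + 0 + Y) * (0 + \<bar>cc - cc\<bar>) + 0"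
    unfolding err_def by (intro tendsto_intros e c)
  then have err: "err \<longlonglongrightarrow> 0" by simp
  have growth: "D N t \<le> D N 0 + err N * t" if N: "N \<ge> 3" for N
  proof -
    interpret prob_space "M N" by (rule process_prob_space[OF N])
    let ?L = "\<lambda>f \<xi>. (real N)\<^sup>2 * exclusion_generator \<alpha> \<beta> \<kappa> \<theta> N f \<xi>"
    note int = process_integrable[OF N]
    have Ds: "D N s = (\<integral>\<omega>. (?\<Phi> N (\<eta> N s \<omega>))\<^sup>2 \<partial>M N) - 2 * y s * (\<integral>\<omega>. ?\<Phi> N (\<eta> N s \<omega>) \<partial>M N) + (y s)\<^sup>2" if s: "s \<ge> 0" for s
    proof -
      have "D N s = (\<integral>\<omega>. (?\<Phi> N (\<eta> N s \<omega>))\<^sup>2 - 2 * y s * ?\<Phi> N (\<eta> N s \<omega>) + (y s)\<^sup>2 \<partial>M N)"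
        unfolding D_def by (rule Bochner_Integration.integral_cong[OF refl]) (simp add: power2_eq_square algebra_simps)
      also have "\<dots> = (\<integral>\<omega>. (?\<Phi> N (\<eta> N s \<omega>))\<^sup>2 \<partial>M N) - 2 * y s * (\<integral>\<omega>. ?\<Phi> N (\<eta> N s \<omega>) \<partial>M N) + (y s)\<^sup>2"
        using int[OF s, of "?\<Phi> N"] int[OF s, of "\<lambda>\<xi>. (?\<Phi> N \<xi>)\<^sup>2"] prob_space by simp
      finally show ?thesis .
    qed
    define D' where "D' s = (\<integral>\<omega>. ?L (\<lambda>\<xi>. (?\<Phi> N \<xi>)\<^sup>2) (\<eta> N s \<omega>) \<partial>M N)
        - (2 * (- lam n * y s + cc) * (\<integral>\<omega>. ?\<Phi> N (\<eta> N s \<omega>) \<partial>M N) + (\<integral>\<omega>. ?L (?\<Phi> N) (\<eta> N s \<omega>) \<partial>M N) * (2 * y s))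
        + 2 * (y s * (- lam n * y s + cc))" for s
    have deriv: "(D N has_real_derivative D' s) (at s within {0..})" if s: "s \<ge> 0" for s
    proof -
      note d1 = markov_process_expectation_derivative[OF process[OF N] finite_configs s]
      have dy2: "((\<lambda>s. 2 * y s) has_real_derivative 2 * (- lam n * y s + cc)) (at s within {0..})"
        by (rule DERIV_cmult) (use y[OF s] in \<open>simp add: cc_def\<close>)
      have dyy: "((\<lambda>s. (y s)\<^sup>2) has_real_derivative 2 * (y s * (- lam n * y s + cc))) (at s within {0..})"
        using y[OF s] unfolding cc_def[symmetric] by (auto intro!: derivative_eq_intros)
      have "((\<lambda>s. (\<integral>\<omega>. (?\<Phi> N (\<eta> N s \<omega>))\<^sup>2 \<partial>M N) - 2 * y s * (\<integral>\<omega>. ?\<Phi> N (\<eta> N s \<omega>) \<partial>M N) + (y s)\<^sup>2)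
          has_real_derivative D' s) (at s within {0..})"
        unfolding D'_def
        by (rule DERIV_add[OF DERIV_diff[OF d1[of "\<lambda>\<xi>. (?\<Phi> N \<xi>)\<^sup>2"] DERIV_mult[OF dy2 d1[of "?\<Phi> N"]]] dyy])
      then show ?thesis
        by (rule has_real_derivative_transform[rotated 2]) (use s Ds in auto)
    qed
    have D'_le: "D' s \<le> err N" if s: "s \<in> {0..t}" for s
    proof -
      have s0: "s \<ge> 0" using s by simp
      let ?y' = "- lam n * y s + cc"
      have "D' s = (\<integral>\<omega>. ?L (\<lambda>\<xi>. (?\<Phi> N \<xi>)\<^sup>2) (\<eta> N s \<omega>) - (2 * ?y' * ?\<Phi> N (\<eta> N s \<omega>) + ?L (?\<Phi> N) (\<eta> N s \<omega>) * (2 * y s))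
        + 2 * (y s * ?y') \<partial>M N)"
        unfolding D'_def using int[OF s0, of "?\<Phi> N"] int[OF s0, of "?L (?\<Phi> N)"] int[OF s0, of "?L (\<lambda>\<xi>. (?\<Phi> N \<xi>)\<^sup>2)"] prob_space
        by simp
      also have "\<dots> \<le> (\<integral>\<omega>. err N \<partial>M N)"
      proof (rule process_integral_mono[OF N s0, where h = "\<lambda>_. err N"])
        fix \<xi> assume \<xi>: "\<xi> \<in> configs N"
        define X where "X = ?\<Phi> N \<xi> - y s"
        define r where "r = ?L (?\<Phi> N) \<xi> + lam n * ?\<Phi> N \<xi> - c N"
        define \<Gamma> where "\<Gamma> = (real N)\<^sup>2 * carre_du_champ \<alpha> \<beta> \<kappa> \<theta> N (?\<Phi> N) \<xi>"
        have r: "\<bar>r\<bar> \<le> e N" and \<Gamma>: "\<Gamma> \<le> e N" using gen[OF N \<xi>] cdc[OF N \<xi>] by (simp_all add: r_def \<Gamma>_def)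
        have "\<bar>?\<Phi> N \<xi>\<bar> \<le> A + e N"
        proof (rule linear_density_bound[OF N \<xi>])
          fix x assume x: "x \<in> sites N"
          then have "real x / real N \<in> {0..1}" by (auto simp: sites_def field_simps)
          from A(2)[OF this] close[OF N x] show "\<bar>corrected n d0 d1 N x\<bar> \<le> A + e N" by linarith
        qed
        then have X: "\<bar>X\<bar> \<le> A + e N + Y" unfolding X_def using Y[OF s] by linarith
        have "?L (\<lambda>\<xi>. (?\<Phi> N \<xi>)\<^sup>2) \<xi> = 2 * ?\<Phi> N \<xi> * ?L (?\<Phi> N) \<xi> + \<Gamma>"
          unfolding exclusion_generator_square \<Gamma>_def by (simp add: algebra_simps)
        moreover have "?L (?\<Phi> N) \<xi> = r - lam n * ?\<Phi> N \<xi> + c N" by (simp add: r_def)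
        ultimately have "?L (\<lambda>\<xi>. (?\<Phi> N \<xi>)\<^sup>2) \<xi> - (2 * ?y' * ?\<Phi> N \<xi> + ?L (?\<Phi> N) \<xi> * (2 * y s)) + 2 * (y s * ?y')
          = - (2 * lam n * X\<^sup>2) + 2 * (X * (r + (c N - cc))) + \<Gamma>"
          unfolding X_def by (rule square_drift)
        moreover have "X * (r + (c N - cc)) \<le> (A + e N + Y) * (e N + \<bar>c N - cc\<bar>)"
        proof -
          have "\<bar>X * (r + (c N - cc))\<bar> \<le> (A + e N + Y) * (e N + \<bar>c N - cc\<bar>)"
            unfolding abs_mult using X r by (intro mult_mono) auto
          then show ?thesis by linarith
        qed
        moreover have "0 \<le> 2 * lam n * X\<^sup>2" using lam_nonneg by simp
        ultimately show "?L (\<lambda>\<xi>. (?\<Phi> N \<xi>)\<^sup>2) \<xi> - (2 * ?y' * ?\<Phi> N \<xi> + ?L (?\<Phi> N) \<xi> * (2 * y s)) + 2 * (y s * ?y') \<le> err N"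
          unfolding err_def using \<Gamma> by (simp only: mult.assoc)
      qed
      also have "\<dots> = err N" by (rule process_integral_const[OF N])
      finally show ?thesis .
    qed
    have "D N t - err N * t \<le> D N 0 - err N * 0"
    proof (rule DERIV_nonpos_imp_decreasing_open[OF t])
      fix s assume s: "0 < s" "s < t"
      have "at s within {0..} = at s" using s by (intro at_within_interior) auto
      then have "(D N has_real_derivative D' s) (at s)" using deriv[of s] s by simp
      then have "((\<lambda>s. D N s - err N * s) has_real_derivative D' s - err N) (at s)"
        by (auto intro!: derivative_eq_intros)
      then show "\<exists>y. ((\<lambda>s. D N s - err N * s) has_real_derivative y) (at s) \<and> y \<le> 0"
        using D'_le[of s] s by auto
    next
      have "continuous_on {0..} (D N)" by (rule DERIV_continuous_on) (use deriv in auto)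
      then show "continuous_on {0..t} (\<lambda>s. D N s - err N * s)"
        by (intro continuous_intros) (auto elim: continuous_on_subset)
    qed
    then show ?thesis by simp
  qed
  have ms_le: "D N s \<le> 2 * (e N)\<^sup>2 + 2 * mean_square s (\<phi> n) (y s) N"
    "mean_square s (\<phi> n) (y s) N \<le> 2 * (e N)\<^sup>2 + 2 * D N s" if N: "N \<ge> 3" and s: "s \<ge> 0" for N s
  proof -
    interpret prob_space "M N" by (rule process_prob_space[OF N])
    have sq: "(u + v)\<^sup>2 \<le> 2 * u\<^sup>2 + 2 * v\<^sup>2" for u v :: real
      using zero_le_power2[of "u - v"] by (simp add: power2_eq_square algebra_simps)
    have "D N s \<le> (\<integral>\<omega>. 2 * (e N)\<^sup>2 + 2 * (empirical N (\<phi> n) (\<eta> N s \<omega>) - y s)\<^sup>2 \<partial>M N)"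
      unfolding D_def
    proof (rule process_integral_mono[OF N s])
      fix \<xi> assume \<xi>: "\<xi> \<in> configs N"
      show "(?\<Phi> N \<xi> - y s)\<^sup>2 \<le> 2 * (e N)\<^sup>2 + 2 * (empirical N (\<phi> n) \<xi> - y s)\<^sup>2"
        using sq[of "?\<Phi> N \<xi> - empirical N (\<phi> n) \<xi>" "empirical N (\<phi> n) \<xi> - y s"] close'[OF N \<xi>] by simp
    qed
    then show "D N s \<le> 2 * (e N)\<^sup>2 + 2 * mean_square s (\<phi> n) (y s) N"
      using process_integrable[OF N s, of "\<lambda>\<xi>. (empirical N (\<phi> n) \<xi> - y s)\<^sup>2"] prob_space by (simp add: mean_square_def)
    have "mean_square s (\<phi> n) (y s) N \<le> (\<integral>\<omega>. 2 * (e N)\<^sup>2 + 2 * (?\<Phi> N (\<eta> N s \<omega>) - y s)\<^sup>2 \<partial>M N)"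
      unfolding mean_square_def
    proof (rule process_integral_mono[OF N s])
      fix \<xi> assume \<xi>: "\<xi> \<in> configs N"
      show "(empirical N (\<phi> n) \<xi> - y s)\<^sup>2 \<le> 2 * (e N)\<^sup>2 + 2 * (?\<Phi> N \<xi> - y s)\<^sup>2"
        using sq[of "empirical N (\<phi> n) \<xi> - ?\<Phi> N \<xi>" "?\<Phi> N \<xi> - y s"] close'[OF N \<xi>] by (simp add: power2_commute)
    qed
    then show "mean_square s (\<phi> n) (y s) N \<le> 2 * (e N)\<^sup>2 + 2 * D N s"
      using process_integrable[OF N s, of "\<lambda>\<xi>. (?\<Phi> N \<xi> - y s)\<^sup>2"] prob_space by (simp add: D_def)
  qed
  have "(\<lambda>N. 2 * (e N)\<^sup>2 + 2 * (2 * (e N)\<^sup>2 + 2 * mean_square 0 (\<phi> n) (y 0) N + err N * t)) \<longlonglongrightarrow>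
    2 * 0\<^sup>2 + 2 * (2 * 0\<^sup>2 + 2 * 0 + 0 * t)"
    unfolding y0 by (intro tendsto_intros e err initial_mean_square phi_continuous)
  then have lim: "(\<lambda>N. 2 * (e N)\<^sup>2 + 2 * (2 * (e N)\<^sup>2 + 2 * mean_square 0 (\<phi> n) (y 0) N + err N * t)) \<longlonglongrightarrow> 0" by simp
  show ?thesis
  proof (rule tendsto_sandwich[OF _ _ tendsto_const lim])
    show "\<forall>\<^sub>F N in sequentially. mean_square t (\<phi> n) (y t) N \<le> 2 * (e N)\<^sup>2 + 2 * (2 * (e N)\<^sup>2 + 2 * mean_square 0 (\<phi> n) (y 0) N + err N * t)"
      using eventually_ge_at_top[of 3]
      by eventually_elim (use ms_le(2)[OF _ t] ms_le(1)[of _ 0] growth in fastforce)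
  qed (simp add: mean_square_nonneg)
qed

text \<open>\<open>G\<close> is split into finitely many modes and a remainder \<open>H\<close>
  small in mean square. The remainder is bounded on the particle side by a Riemann sum of its square
  and on the limit side by \<open>LINT_times_bound\<close>, both uniformly over
  configurations.\<close>

lemma mean_square_tendsto:
  assumes G: "cont01 G" and t: "t \<ge> 0"
    and \<rho>: "\<rho> \<in> borel_measurable (lebesgue_on {0..1})" "\<And>q. q \<in> {0..1} \<Longrightarrow> \<bar>\<rho> q\<bar> \<le> R"
    and modes: "\<And>n. mean_square t (\<phi> n) (LINT q:{0..1}|lebesgue. \<phi> n q * \<rho> q) \<longlonglongrightarrow> 0"
  shows "mean_square t G (LINT q:{0..1}|lebesgue. G q * \<rho> q) \<longlonglongrightarrow> 0"
proof (rule LIMSEQ_I)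
  fix e :: real assume e: "e > 0"
  define l where "l h = (LINT q:{0..1}|lebesgue. h q * \<rho> q)" for h
  \<comment> \<open>The limit of the bound \<open>U\<close> is
    \<open>3 * (1 + R\<^sup>2) * ip H H\<close>; half of the admissible value is kept so that the
    final inequality is strict.\<close>
  define e' where "e' = e / (6 * (1 + R\<^sup>2))"
  have R1: "1 + R\<^sup>2 > 0" by (simp add: add_pos_nonneg)
  have e': "e' > 0" using e R1 by (simp add: e'_def)
  obtain n c where nc: "ip (\<lambda>x. G x - (\<Sum>i<n. c i * \<phi> i x)) (\<lambda>x. G x - (\<Sum>i<n. c i * \<phi> i x)) < e'"
    using phi_dense[OF G e'] by blast
  define H where "H x = G x - (\<Sum>i<n. c i * \<phi> i x)" for x
  have Hc: "cont01 H" unfolding H_def by (intro continuous_intros G phi_continuous)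
  have ipH: "ip H H < e'" using nc by (simp add: H_def[abs_def])
  have "l G = l H + (\<Sum>i<n. c i * l (\<phi> i))"
  proof -
    have i: "set_integrable lebesgue {0..1} (\<lambda>q. h q * \<rho> q)" if "cont01 h" for h
      by (rule times_continuous_absolutely_integrable[OF \<rho> that])
    have "l G = (LINT q:{0..1}|lebesgue. H q * \<rho> q + (\<Sum>i<n. c i * (\<phi> i q * \<rho> q)))"
      unfolding l_def H_def by (simp add: left_diff_distrib sum_distrib_right mult.assoc)
    also have "\<dots> = l H + (LINT q:{0..1}|lebesgue. (\<Sum>i<n. c i * (\<phi> i q * \<rho> q)))"
      unfolding l_def
    proof (rule set_integral_add(2)[OF i[OF Hc]])
      have "set_integrable lebesgue {0..1} (\<lambda>q. (\<Sum>i<n. c i * \<phi> i q) * \<rho> q)"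
        by (intro i continuous_intros phi_continuous)
      then show "set_integrable lebesgue {0..1} (\<lambda>q. \<Sum>i<n. c i * (\<phi> i q * \<rho> q))"
        by (simp add: sum_distrib_right mult.assoc)
    qed
    also have "(LINT q:{0..1}|lebesgue. (\<Sum>i<n. c i * (\<phi> i q * \<rho> q))) = (\<Sum>i<n. c i * l (\<phi> i))"
    proof -
      have "integrable lebesgue (\<lambda>q. c i * (indicator {0..1} q *\<^sub>R (\<phi> i q * \<rho> q)))" for i
        using i[OF phi_continuous, of i] unfolding set_integrable_def by (intro integrable_mult_right) auto
      then show ?thesis
        unfolding l_def set_lebesgue_integral_def scaleR_sum_right
        by (simp add: mult.left_commute)
    qed
    finally show ?thesis .
  qed
  note l_split = this
  have emp: "empirical N G \<xi> = empirical N H \<xi> + (\<Sum>i<n. c i * empirical N (\<phi> i) \<xi>)" for N \<xi>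
  proof -
    have "(\<Sum>i<n. c i * empirical N (\<phi> i) \<xi>) = 1 / (real N - 1) * (\<Sum>x\<in>sites N. (\<Sum>i<n. c i * \<phi> i (real x / real N)) * \<xi> x)"
      unfolding empirical_def sum_distrib_left sum_distrib_right
      by (subst sum.swap) (simp add: mult_ac)
    then show ?thesis unfolding empirical_def H_def
      by (simp add: distrib_left[symmetric] left_diff_distrib sum_subtractf right_diff_distrib)
  qed
  define U where "U N = 3 * (1 / (real N - 1) * (\<Sum>x\<in>sites N. H (real x / real N) * H (real x / real N)))
      + 3 * (real n * (\<Sum>i<n. (c i)\<^sup>2 * mean_square t (\<phi> i) (l (\<phi> i)) N)) + 3 * (R\<^sup>2 * ip H H)" for N
  have bound: "mean_square t G (l G) N \<le> U N" if N: "N \<ge> 3" for N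
  proof -
    interpret prob_space "M N" by (rule process_prob_space[OF N])
    have sq3: "x\<^sup>2 \<le> 3 * p + 3 * q + 3 * r" if "x = u + v + w" "u\<^sup>2 \<le> p" "v\<^sup>2 \<le> q" "w\<^sup>2 \<le> r" for x u v w p q r :: real
    proof -
      have "(u + v + w)\<^sup>2 \<le> 3 * u\<^sup>2 + 3 * v\<^sup>2 + 3 * w\<^sup>2"
        using zero_le_power2[of "u - v"] zero_le_power2[of "v - w"] zero_le_power2[of "u - w"]
        by (simp add: power2_eq_square algebra_simps)
      then show ?thesis using that by simp
    qed
    let ?h = "\<lambda>\<xi>. 3 * (1 / (real N - 1) * (\<Sum>x\<in>sites N. H (real x / real N) * H (real x / real N)))
      + 3 * (real n * (\<Sum>i<n. (c i)\<^sup>2 * (empirical N (\<phi> i) \<xi> - l (\<phi> i))\<^sup>2)) + 3 * (R\<^sup>2 * ip H H)"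
    have "mean_square t G (l G) N \<le> (\<integral>\<omega>. ?h (\<eta> N t \<omega>) \<partial>M N)"
      unfolding mean_square_def
    proof (rule process_integral_mono[OF N t])
      fix \<xi> assume \<xi>: "\<xi> \<in> configs N"
      have "(\<Sum>i<n. c i * (empirical N (\<phi> i) \<xi> - l (\<phi> i)))\<^sup>2 \<le> (\<Sum>i<n. 1\<^sup>2) * (\<Sum>i<n. (c i * (empirical N (\<phi> i) \<xi> - l (\<phi> i)))\<^sup>2)"
        using Cauchy_Schwarz_ineq_sum[of "\<lambda>_. 1" "\<lambda>i. c i * (empirical N (\<phi> i) \<xi> - l (\<phi> i))" "{..<n}"] by simp
      then have 1: "(\<Sum>i<n. c i * (empirical N (\<phi> i) \<xi> - l (\<phi> i)))\<^sup>2 \<le> real n * (\<Sum>i<n. (c i)\<^sup>2 * (empirical N (\<phi> i) \<xi> - l (\<phi> i))\<^sup>2)"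
        by (simp add: power_mult_distrib)
      have 2: "(empirical N H \<xi>)\<^sup>2 \<le> 1 / (real N - 1) * (\<Sum>x\<in>sites N. H (real x / real N) * H (real x / real N))"
        using linear_density_square_le[OF N \<xi>, of "\<lambda>x. H (real x / real N)"]
        unfolding empirical_eq_linear_density power2_eq_square .
      have 3: "(- l H)\<^sup>2 \<le> R\<^sup>2 * ip H H" unfolding l_def power2_minus by (rule LINT_times_bound[OF \<rho> Hc])
      have "empirical N G \<xi> - l G = empirical N H \<xi> + (\<Sum>i<n. c i * (empirical N (\<phi> i) \<xi> - l (\<phi> i))) + (- l H)"
        unfolding l_split emp by (simp add: right_diff_distrib sum_subtractf)
      then show "(empirical N G \<xi> - l G)\<^sup>2 \<le> ?h \<xi>"
        by (rule sq3[OF _ 2 1 3])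
    qed
    also have "\<dots> = U N"
      unfolding U_def mean_square_def
      using process_integrable[OF N t, of "\<lambda>\<xi>. (c _)\<^sup>2 * (empirical N (\<phi> _) \<xi> - l (\<phi> _))\<^sup>2"]
        process_integrable[OF N t, of "\<lambda>\<xi>. \<Sum>i<n. (c i)\<^sup>2 * (empirical N (\<phi> i) \<xi> - l (\<phi> i))\<^sup>2"] prob_space
      by (simp add: Bochner_Integration.integral_sum)
    finally show ?thesis .
  qed
  have "U \<longlonglongrightarrow> 3 * integral {0..1} (\<lambda>q. H q * H q) + 3 * (real n * (\<Sum>i<n. (c i)\<^sup>2 * 0)) + 3 * (R\<^sup>2 * ip H H)"
    unfolding U_def using modes
    by (intro tendsto_intros riemann_sum_tendsto continuous_intros Hc) (simp add: l_def)
  then have U: "U \<longlonglongrightarrow> 3 * (1 + R\<^sup>2) * ip H H" by (simp add: ip_def algebra_simps)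
  have "3 * (1 + R\<^sup>2) * ip H H < 3 * (1 + R\<^sup>2) * (2 * e')"
    using ipH R1 e' by (intro mult_strict_left_mono) auto
  also have "\<dots> = e"
  proof -
    have "3 * r * (2 * (e / (6 * r))) = e" if "r > 0" for r using that by simp
    from this[OF R1] show ?thesis unfolding e'_def .
  qed
  finally have "\<forall>\<^sub>F N in sequentially. U N < e" by (rule order_tendstoD(2)[OF U])
  then have "\<forall>\<^sub>F N in sequentially. norm (mean_square t G (l G) N - 0) < e"
    using eventually_ge_at_top[of 3]
    by eventually_elim (use bound mean_square_nonneg in \<open>fastforce simp: abs_of_nonneg\<close>)
  then show "\<exists>no. \<forall>N\<ge>no. norm (mean_square t G (LINT q:{0..1}|lebesgue. G q * \<rho> q) N - 0) < e"
    by (simp add: eventually_sequentially l_def)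
qed

lemma mean_square_imp_probability:
  assumes "mean_square t G l \<longlonglongrightarrow> 0" "t \<ge> 0" "\<delta> > 0"
  shows "(\<lambda>N. measure (M N) {\<omega> \<in> space (M N). \<bar>empirical N G (\<eta> N t \<omega>) - l\<bar> > \<delta>}) \<longlonglongrightarrow> 0"
proof (rule tendsto_sandwich[OF _ _ tendsto_const])
  have "(\<lambda>N. mean_square t G l N / \<delta>\<^sup>2) \<longlonglongrightarrow> 0 / \<delta>\<^sup>2" using assms by (intro tendsto_intros) auto
  then show "(\<lambda>N. mean_square t G l N / \<delta>\<^sup>2) \<longlonglongrightarrow> 0" by simp
  show "\<forall>\<^sub>F N in sequentially. measure (M N) {\<omega> \<in> space (M N). \<bar>empirical N G (\<eta> N t \<omega>) - l\<bar> > \<delta>} \<le> mean_square t G l N / \<delta>\<^sup>2"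
    using eventually_ge_at_top[of 3]
  proof eventually_elim
    case (elim N)
    interpret prob_space "M N" by (rule process_prob_space[OF elim])
    have i: "integrable (M N) (\<lambda>\<omega>. (empirical N G (\<eta> N t \<omega>) - l)\<^sup>2)"
      by (rule process_integrable[OF elim assms(2)])
    have m: "(\<lambda>\<omega>. empirical N G (\<eta> N t \<omega>)) \<in> borel_measurable (M N)"
      by (rule borel_measurable_integrable[OF process_integrable[OF elim assms(2)]])
    have "measure (M N) {\<omega> \<in> space (M N). \<bar>empirical N G (\<eta> N t \<omega>) - l\<bar> > \<delta>}
        \<le> measure (M N) {\<omega> \<in> space (M N). (empirical N G (\<eta> N t \<omega>) - l)\<^sup>2 \<ge> \<delta>\<^sup>2}"
    proof (rule finite_measure_mono)
      have "\<delta>\<^sup>2 \<le> x\<^sup>2" if "\<delta> < \<bar>x\<bar>" for x :: real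
        using power_mono[of \<delta> "\<bar>x\<bar>" 2] that assms(3) by simp
      then show "{\<omega> \<in> space (M N). \<bar>empirical N G (\<eta> N t \<omega>) - l\<bar> > \<delta>} \<subseteq> {\<omega> \<in> space (M N). (empirical N G (\<eta> N t \<omega>) - l)\<^sup>2 \<ge> \<delta>\<^sup>2}"
        by auto
      show "{\<omega> \<in> space (M N). (empirical N G (\<eta> N t \<omega>) - l)\<^sup>2 \<ge> \<delta>\<^sup>2} \<in> events"
        by (rule borel_measurable_le[OF borel_measurable_const borel_measurable_integrable[OF i]])
    qed
    also have "\<dots> \<le> mean_square t G l N / \<delta>\<^sup>2"
      unfolding mean_square_def by (rule integral_Markov_inequality_measure[OF i, of "{}"]) (use assms(3) in auto)
    finally show ?case .
  qed
qed simp

end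

subsection \<open>The limiting density\<close>

lemma LINT_sum_times:
  fixes c :: "nat \<Rightarrow> real"
  assumes "\<rho> \<in> borel_measurable (lebesgue_on {0..1})" "\<And>q. q \<in> {0..1} \<Longrightarrow> \<bar>\<rho> q\<bar> \<le> R"
    "\<And>i. cont01 (h i)"
  shows "(LINT q:{0..1}|lebesgue. (\<Sum>i<n. c i * h i q) * \<rho> q) = (\<Sum>i<n. c i * (LINT q:{0..1}|lebesgue. h i q * \<rho> q))"
proof -
  have i: "integrable lebesgue (\<lambda>q. c i * (indicator {0..1} q * (h i q * \<rho> q)))" for i
    using times_continuous_absolutely_integrable[OF assms] unfolding set_integrable_def
    by (intro integrable_mult_right) auto
  have "(LINT q:{0..1}|lebesgue. (\<Sum>i<n. c i * h i q) * \<rho> q) = (\<integral>q. (\<Sum>i<n. c i * (indicator {0..1} q * (h i q * \<rho> q))) \<partial>lebesgue)"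
    unfolding set_lebesgue_integral_def
    by (rule Bochner_Integration.integral_cong) (simp_all add: sum_distrib_left sum_distrib_right mult_ac)
  also have "\<dots> = (\<Sum>i<n. \<integral>q. c i * (indicator {0..1} q * (h i q * \<rho> q)) \<partial>lebesgue)"
    by (rule Bochner_Integration.integral_sum) (rule i)
  finally show ?thesis unfolding set_lebesgue_integral_def by simp
qed

lemma LINT_times_continuous: "cont01 f \<Longrightarrow> cont01 h \<Longrightarrow> (LINT q:{0..1}|lebesgue. f q * h q) = ip f h"
  unfolding ip_def by (intro LINT_continuous continuous_intros)

lemma ip_tendsto:
  assumes "uniform_limit {0..1} F f sequentially" "\<And>n. cont01 (F n)" "cont01 h"
  shows "(\<lambda>n. ip (F n) h) \<longlonglongrightarrow> ip f h"
proof -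
  have fc: "cont01 f" using uniform_limit_theorem[OF always_eventually assms(1)] assms(2) by auto
  have "bounded (h ` {0..1})" by (intro compact_imp_bounded compact_continuous_image assms) auto
  moreover have "bounded (f ` {0..1})" by (intro compact_imp_bounded compact_continuous_image fc) auto
  ultimately have "uniform_limit {0..1} (\<lambda>n q. F n q * h q) (\<lambda>q. f q * h q) sequentially"
    by (intro uniform_lim_mult assms uniform_limit_const)
  moreover have "\<And>n. cont01 (\<lambda>q. F n q * h q)" by (intro continuous_intros assms)
  ultimately obtain I J where "\<And>n. ((\<lambda>q. F n q * h q) has_integral I n) {0..1}" "((\<lambda>q. f q * h q) has_integral J) {0..1}" "I \<longlonglongrightarrow> J"
    by (rule uniform_limit_integral) auto
  then have "I = (\<lambda>n. ip (F n) h)" "J = ip f h" unfolding ip_def by (auto intro!: integral_unique[symmetric])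
  with \<open>I \<longlonglongrightarrow> J\<close> show ?thesis by simp
qed

locale heat_flow = heat_basis a b \<phi> \<phi>' lam C
  for a b :: real and \<phi> \<phi>' :: "nat \<Rightarrow> real \<Rightarrow> real" and lam :: "nat \<Rightarrow> real" and C :: real +
  fixes \<alpha> \<beta> :: real and g :: "real \<Rightarrow> real"
  assumes initial_measurable: "g \<in> borel_measurable (lebesgue_on {0..1})" and initial_range: "g \<in> {0..1} \<rightarrow> {0..1}"
begin

text \<open>The affine equilibrium profile, whose subtraction makes the boundary conditions
  homogeneous. For \<open>a = 0\<close> it joins \<alpha> to \<beta>; for \<open>b = 0\<close> it is
  the constant midway between them.\<close>

definition slope :: real where "slope = b * (\<beta> - \<alpha>) / (2 * a + b)"
definition intercept :: real where "intercept = \<alpha> + a * (\<beta> - \<alpha>) / (2 * a + b)"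
definition stationary :: "real \<Rightarrow> real" where "stationary q = intercept + slope * q"

lemma stationary_bc: "a * slope = b * (intercept - \<alpha>)" "a * slope = b * (\<beta> - (intercept + slope))"
proof -
  have d: "2 * a + b \<noteq> 0" using ab_pos a_nonneg by linarith
  show "a * slope = b * (intercept - \<alpha>)" by (simp add: slope_def intercept_def)
  have "\<beta> - (intercept + slope) = (\<beta> - \<alpha>) - (a + b) * (\<beta> - \<alpha>) / (2 * a + b)"
    by (simp add: slope_def intercept_def add_divide_distrib distrib_right)
  also have "\<dots> = a * (\<beta> - \<alpha>) / (2 * a + b)" using d by (simp add: field_simps)
  finally show "a * slope = b * (\<beta> - (intercept + slope))" by (simp add: slope_def)
qed

lemma stationary_continuous: "continuous_on S stationary"
  unfolding stationary_def by (intro continuous_intros)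

lemma stationary_derivative: "(stationary has_real_derivative slope) (at q within S)"
  unfolding stationary_def by (auto intro!: derivative_eq_intros)

definition coef :: "nat \<Rightarrow> real" where
  "coef n = (LINT q:{0..1}|lebesgue. \<phi> n q * (g q - stationary q))"

definition coef_bound :: real where "coef_bound = 1 + \<bar>intercept\<bar> + \<bar>slope\<bar>"

lemma coef_bound_pos: "coef_bound > 0"
  by (simp add: coef_bound_def)

lemma initial_bound: "q \<in> {0..1} \<Longrightarrow> \<bar>g q\<bar> \<le> 1"
  using initial_range by (auto simp: Pi_def)

lemma deviation_measurable: "(\<lambda>q. g q - stationary q) \<in> borel_measurable (lebesgue_on {0..1})"
  by (intro borel_measurable_diff initial_measurable cont01_measurable stationary_continuous)

lemma deviation_bound: "q \<in> {0..1} \<Longrightarrow> \<bar>g q - stationary q\<bar> \<le> coef_bound"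
proof -
  assume q: "q \<in> {0..1}"
  have "\<bar>slope * q\<bar> \<le> \<bar>slope\<bar>" using q by (simp add: abs_mult mult_left_le)
  then show ?thesis using initial_bound[OF q] unfolding stationary_def coef_bound_def by linarith
qed

text \<open>Bessel's inequality for a function that is only bounded and measurable: paired with its
  own partial Fourier sum, the deviation gives \<open>E\<close>, and \<open>LINT_times_bound\<close>
  yields \<open>E\<^sup>2 \<le> coef_bound\<^sup>2 * E\<close>.\<close>

lemma coef_square_sum: "(\<Sum>i<n. (coef i)\<^sup>2) \<le> coef_bound\<^sup>2"
proof -
  let ?S = "\<lambda>q. \<Sum>i<n. coef i * \<phi> i q"
  define E where "E = (\<Sum>i<n. (coef i)\<^sup>2)"
  have E0: "E \<ge> 0" unfolding E_def by (intro sum_nonneg) auto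
  have Sc: "cont01 ?S" by (intro continuous_intros phi_continuous)
  have "(LINT q:{0..1}|lebesgue. ?S q * (g q - stationary q)) = (\<Sum>i<n. coef i * (LINT q:{0..1}|lebesgue. \<phi> i q * (g q - stationary q)))"
    by (rule LINT_sum_times[OF deviation_measurable deviation_bound phi_continuous])
  also have "\<dots> = E" by (simp add: E_def coef_def[symmetric] power2_eq_square)
  finally have "(LINT q:{0..1}|lebesgue. ?S q * (g q - stationary q)) = E" .
  moreover have "ip ?S ?S \<le> E"
  proof -
    have "ip ?S ?S = (\<Sum>i<n. coef i * coef i * ip (\<phi> i) (\<phi> i))"
      by (rule ip_orthogonal_sum[OF phi_continuous phi_orthogonal])
    also have "\<dots> \<le> E" unfolding E_def
    proof (rule sum_mono)
      fix i
      have "ip (\<phi> i) (\<phi> i) \<le> 1" using phi_norm[of i] by (auto simp: ip_def)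
      then show "coef i * coef i * ip (\<phi> i) (\<phi> i) \<le> (coef i)\<^sup>2"
        unfolding power2_eq_square by (intro mult_left_le) auto
    qed
    finally show ?thesis .
  qed
  ultimately have "E\<^sup>2 \<le> coef_bound\<^sup>2 * E"
    using LINT_times_bound[OF deviation_measurable deviation_bound Sc] mult_left_mono[of "ip ?S ?S" E "coef_bound\<^sup>2"] by simp
  then show ?thesis unfolding E_def[symmetric] using E0 by (cases "E = 0") (auto simp: power2_eq_square)
qed

lemma coef_le: "\<bar>coef n\<bar> \<le> coef_bound"
proof -
  have "(coef n)\<^sup>2 \<le> (\<Sum>i<Suc n. (coef i)\<^sup>2)" by (simp add: sum_nonneg)
  also have "\<dots> \<le> coef_bound\<^sup>2" by (rule coef_square_sum)
  finally show ?thesis using coef_bound_pos abs_le_square_iff[of "coef n" coef_bound] by simp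
qed

lemma coef_square_summable: "summable (\<lambda>i. (coef i)\<^sup>2)"
  by (rule summableI_nonneg_bounded[OF _ coef_square_sum]) auto

text \<open>The fourth power is what the derivative series requires: two factors absorb the growth
  of \<open>\<phi>'\<close>, the other two leave the summable weight of
  \<open>lam_summable\<close>.\<close>

lemma exp_decay:
  assumes "\<epsilon> > 0"
  obtains B where "B > 0" "\<And>i s. s \<ge> \<epsilon> \<Longrightarrow> exp (- lam i * s) \<le> B / (1 + 2 * lam i) ^ 4"
proof -
  \<comment> \<open>Chosen for the inequality \<open>(1 + x / 4) ^ 4 \<le> exp x\<close> at
    \<open>x = lam i * s\<close>: with \<open>m \<le> 1\<close> and
    \<open>m \<le> \<epsilon> / 8\<close> the base dominates
    \<open>m * (1 + 2 * lam i)\<close>.\<close>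
  define m where "m = min 1 (\<epsilon> / 8)"
  have m: "m > 0" "m \<le> 1" "m \<le> \<epsilon> / 8" using assms by (auto simp: m_def)
  have "exp (- lam i * s) \<le> (1 / m ^ 4) / (1 + 2 * lam i) ^ 4" if s: "s \<ge> \<epsilon>" for i s
  proof -
    have l: "lam i \<ge> 0" by (rule lam_nonneg)
    have "m * (1 + 2 * lam i) \<le> 1 + lam i * s / real 4"
    proof -
      have "m * (2 * lam i) \<le> \<epsilon> / 8 * (2 * lam i)" using m l by (intro mult_right_mono) auto
      also have "\<dots> \<le> s / 8 * (2 * lam i)" using s l by (intro mult_right_mono) auto
      finally show ?thesis using m by (simp add: algebra_simps)
    qed
    then have "(m * (1 + 2 * lam i)) ^ 4 \<le> (1 + lam i * s / real 4) ^ 4"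
      using m l by (intro power_mono mult_nonneg_nonneg) auto
    also have "\<dots> \<le> exp (lam i * s)"
    proof (rule exp_ge_one_plus_x_over_n_power_n)
      have "0 \<le> lam i * s" using l s assms by simp
      then show "- real 4 \<le> lam i * s" by simp
    qed simp
    finally have le: "m ^ 4 * (1 + 2 * lam i) ^ 4 \<le> exp (lam i * s)" by (simp add: power_mult_distrib)
    have pos: "0 < m ^ 4 * (1 + 2 * lam i) ^ 4" using m l by simp
    have "exp (- lam i * s) = 1 / exp (lam i * s)" by (simp add: exp_minus inverse_eq_divide)
    also have "\<dots> \<le> 1 / (m ^ 4 * (1 + 2 * lam i) ^ 4)" using le pos by (intro divide_left_mono mult_pos_pos) auto
    finally show ?thesis by simp
  qed
  then show thesis using m by (intro that[of "1 / m ^ 4"]) auto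
qed

definition partial :: "nat \<Rightarrow> real \<Rightarrow> real \<Rightarrow> real" where
  "partial n s q = stationary q + (\<Sum>i<n. coef i * exp (- lam i * s) * \<phi> i q)"
definition partial' :: "nat \<Rightarrow> real \<Rightarrow> real \<Rightarrow> real" where
  "partial' n s q = slope + (\<Sum>i<n. coef i * exp (- lam i * s) * \<phi>' i q)"
text \<open>Meaningful for positive times, where the decay of the exponentials dominates the growth
  of the modes. At time 0 the series need not converge pointwise to \<open>g\<close>.\<close>

definition flow :: "real \<Rightarrow> real \<Rightarrow> real" where
  "flow s q = stationary q + (\<Sum>i. coef i * exp (- lam i * s) * \<phi> i q)"
definition flow' :: "real \<Rightarrow> real \<Rightarrow> real" where
  "flow' s q = slope + (\<Sum>i. coef i * exp (- lam i * s) * \<phi>' i q)"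

lemma partial_uniform_limit:
  assumes "\<epsilon> > 0"
  shows "uniform_limit ({\<epsilon>..} \<times> {0..1}) (\<lambda>n (s, q). partial n s q) (\<lambda>(s, q). flow s q) sequentially"
    and "uniform_limit ({\<epsilon>..} \<times> {0..1}) (\<lambda>n (s, q). partial' n s q) (\<lambda>(s, q). flow' s q) sequentially"
proof -
  obtain B where B: "B > 0" "\<And>i s. s \<ge> \<epsilon> \<Longrightarrow> exp (- lam i * s) \<le> B / (1 + 2 * lam i) ^ 4"
    using exp_decay[OF assms] by blast
  define K where "K = coef_bound * B * C"
  have summand: "\<bar>coef i * exp (- lam i * s) * v\<bar> \<le> K * (1 / (1 + 2 * lam i)\<^sup>2)"
    if "s \<ge> \<epsilon>" "\<bar>v\<bar> \<le> C * (1 + 2 * lam i)\<^sup>2" for i s v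
  proof -
    have w: "1 + 2 * lam i > 0" using lam_nonneg[of i] by simp
    have "\<bar>coef i * exp (- lam i * s) * v\<bar> \<le> coef_bound * (B / (1 + 2 * lam i) ^ 4) * (C * (1 + 2 * lam i)\<^sup>2)"
      unfolding abs_mult using coef_le[of i] B(2)[OF that(1), of i] that(2) coef_bound_pos B(1) w
      by (intro mult_mono mult_nonneg_nonneg) auto
    also have "\<dots> = K * (1 / (1 + 2 * lam i)\<^sup>2)"
    proof -
      have "1 / w ^ 4 * w\<^sup>2 = 1 / w\<^sup>2" if "w > 0" for w :: real
        using that by (simp add: power4_eq_xxxx power2_eq_square)
      from this[OF w] have "1 / (1 + 2 * lam i) ^ 4 * (1 + 2 * lam i)\<^sup>2 = 1 / (1 + 2 * lam i)\<^sup>2" .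
      moreover have "coef_bound * (B / z) * (C * y) = coef_bound * B * C * (1 / z * y)" for z y by simp
      ultimately show ?thesis unfolding K_def by metis
    qed
    finally show ?thesis .
  qed
  have C0: "C \<ge> 0"
  proof -
    have "0 \<le> C * (1 + 2 * lam 0)" using phi_bound[of 0 0] by (auto intro: order_trans[OF abs_ge_zero])
    then show ?thesis using lam_nonneg[of 0] by (simp add: zero_le_mult_iff)
  qed
  have b1: "\<bar>\<phi> i q\<bar> \<le> C * (1 + 2 * lam i)\<^sup>2" if "q \<in> {0..1}" for i q
  proof -
    have "C * (1 + 2 * lam i) \<le> C * (1 + 2 * lam i)\<^sup>2"
      using C0 lam_nonneg[of i] by (intro mult_left_mono) (auto simp: power2_eq_square)
    then show ?thesis using phi_bound[OF that, of i] by linarith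
  qed
  have sm: "summable (\<lambda>i. K * (1 / (1 + 2 * lam i)\<^sup>2))" by (rule summable_mult[OF lam_summable])
  have "uniform_limit ({\<epsilon>..} \<times> {0..1}) (\<lambda>n z. \<Sum>i<n. coef i * exp (- lam i * fst z) * \<phi> i (snd z))
     (\<lambda>z. \<Sum>i. coef i * exp (- lam i * fst z) * \<phi> i (snd z)) sequentially"
    by (rule Weierstrass_m_test[OF _ sm]) (use summand b1 in auto)
  from uniform_limit_add[OF uniform_limit_const[where c = "\<lambda>z. stationary (snd z)"] this]
  show "uniform_limit ({\<epsilon>..} \<times> {0..1}) (\<lambda>n (s, q). partial n s q) (\<lambda>(s, q). flow s q) sequentially"
    by (simp add: partial_def flow_def case_prod_beta')
  have "uniform_limit ({\<epsilon>..} \<times> {0..1}) (\<lambda>n z. \<Sum>i<n. coef i * exp (- lam i * fst z) * \<phi>' i (snd z))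
     (\<lambda>z. \<Sum>i. coef i * exp (- lam i * fst z) * \<phi>' i (snd z)) sequentially"
    by (rule Weierstrass_m_test[OF _ sm]) (use summand phi'_bound in auto)
  from uniform_limit_add[OF uniform_limit_const[where c = "\<lambda>z. slope"] this]
  show "uniform_limit ({\<epsilon>..} \<times> {0..1}) (\<lambda>n (s, q). partial' n s q) (\<lambda>(s, q). flow' s q) sequentially"
    by (simp add: partial'_def flow'_def case_prod_beta')
qed

lemma partial_continuous:
  "continuous_on (UNIV \<times> {0..1}) (\<lambda>(s, q). partial n s q)"
  "continuous_on (UNIV \<times> {0..1}) (\<lambda>(s, q). partial' n s q)"
  unfolding partial_def partial'_def case_prod_beta
  by (auto intro!: continuous_intros continuous_on_compose2[OF phi_continuous]
      continuous_on_compose2[OF phi'_continuous] continuous_on_compose2[OF stationary_continuous[of UNIV]])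

lemma flow_continuous:
  assumes "\<epsilon> > 0"
  shows "continuous_on ({\<epsilon>..} \<times> {0..1}) (\<lambda>(s, q). flow s q)"
    and "continuous_on ({\<epsilon>..} \<times> {0..1}) (\<lambda>(s, q). flow' s q)"
proof -
  have c: "continuous_on ({\<epsilon>..} \<times> {0..1}) (\<lambda>(s, q). partial n s q)"
    "continuous_on ({\<epsilon>..} \<times> {0..1}) (\<lambda>(s, q). partial' n s q)" for n
    by (rule continuous_on_subset[OF partial_continuous(1)], blast)
      (rule continuous_on_subset[OF partial_continuous(2)], blast)
  show "continuous_on ({\<epsilon>..} \<times> {0..1}) (\<lambda>(s, q). flow s q)"
    by (rule uniform_limit_theorem[OF always_eventually partial_uniform_limit(1)[OF assms]]) (use c in auto)
  show "continuous_on ({\<epsilon>..} \<times> {0..1}) (\<lambda>(s, q). flow' s q)"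
    by (rule uniform_limit_theorem[OF always_eventually partial_uniform_limit(2)[OF assms]]) (use c in auto)
qed

lemma partial_section_uniform_limit:
  assumes "s > 0"
  shows "uniform_limit {0..1} (\<lambda>n. partial n s) (flow s) sequentially"
    and "uniform_limit {0..1} (\<lambda>n. partial' n s) (flow' s) sequentially"
  using uniform_limit_compose'[OF partial_uniform_limit(1)[OF assms], of "Pair s" "{0..1}"]
    uniform_limit_compose'[OF partial_uniform_limit(2)[OF assms], of "Pair s" "{0..1}"]
  by (simp_all add: Pi_def)

lemma partial_section_continuous: "cont01 (partial n s)" "cont01 (partial' n s)"
  unfolding partial_def partial'_def
  by (intro continuous_intros phi_continuous phi'_continuous stationary_continuous)+

lemma flow_section_continuous:
  assumes "s > 0"
  shows "cont01 (flow s)" "cont01 (flow' s)"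
  using uniform_limit_theorem[OF always_eventually partial_section_uniform_limit(1)[OF assms]]
    uniform_limit_theorem[OF always_eventually partial_section_uniform_limit(2)[OF assms]]
    partial_section_continuous by auto

lemma partial_derivative:
  "q \<in> {0..1} \<Longrightarrow> (partial n s has_real_derivative partial' n s q) (at q within {0..1})"
  unfolding partial_def partial'_def
  by (intro DERIV_add stationary_derivative DERIV_sum DERIV_cmult phi_derivative)

text \<open>The uniform limit is taken in the integrated form of the fundamental theorem, and the
  result is differentiated afterwards.\<close>

lemma flow_derivative:
  assumes s: "s > 0" and q: "q \<in> {0..1}"
  shows "(flow s has_real_derivative flow' s q) (at q within {0..1})"
proof -
  have eq: "flow s r = flow s 0 + integral {0..r} (flow' s)" if r: "r \<in> {0..1}" for r
  proof -
    have sub: "{0..r} \<subseteq> {0..1}" using r by auto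
    have ul: "uniform_limit {0..r} (\<lambda>n. partial' n s) (flow' s) sequentially"
      by (rule uniform_limit_on_subset[OF partial_section_uniform_limit(2)[OF s] sub])
    have cs: "continuous_on {0..r} (partial' n s)" for n
      by (rule continuous_on_subset[OF partial_section_continuous(2) sub])
    obtain I J where I: "\<And>n. (partial' n s has_integral I n) {0..r}" "(flow' s has_integral J) {0..r}" "I \<longlonglongrightarrow> J"
      by (rule uniform_limit_integral[OF ul cs]) auto
    have hi: "(partial' n s has_integral partial n s r - partial n s 0) {0..r}" for n
    proof (rule fundamental_theorem_of_calculus)
      fix x assume "x \<in> {0..r}"
      then have "(partial n s has_real_derivative partial' n s x) (at x within {0..r})"
        using partial_derivative sub DERIV_subset by blast
      then show "(partial n s has_vector_derivative partial' n s x) (at x within {0..r})"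
        by (simp add: has_real_derivative_iff_has_vector_derivative)
    qed (use r in auto)
    have I_eq: "I = (\<lambda>n. partial n s r - partial n s 0)"
      by (rule ext, rule has_integral_unique[OF I(1) hi])
    have "(\<lambda>n. partial n s r) \<longlonglongrightarrow> flow s r" "(\<lambda>n. partial n s 0) \<longlonglongrightarrow> flow s 0"
      by (rule tendsto_uniform_limitI[OF partial_section_uniform_limit(1)[OF s]], use r in simp)+
    then have "I \<longlonglongrightarrow> flow s r - flow s 0" unfolding I_eq by (rule tendsto_diff)
    then have "J = flow s r - flow s 0" using I(3) LIMSEQ_unique by blast
    then show ?thesis using I(2) by (simp add: integral_unique)
  qed
  have "((\<lambda>r. flow s 0 + integral {0..r} (flow' s)) has_real_derivative 0 + flow' s q) (at q within {0..1})"
    by (intro DERIV_add DERIV_const integral_has_real_derivative flow_section_continuous s q)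
  then have "((\<lambda>r. flow s 0 + integral {0..r} (flow' s)) has_real_derivative flow' s q) (at q within {0..1})" by simp
  then show ?thesis by (rule has_real_derivative_transform[OF q, rotated]) (rule eq)
qed

lemma flow_bc:
  assumes s: "s > 0"
  shows "a * flow' s 0 = b * (flow s 0 - \<alpha>)" "a * flow' s 1 = b * (\<beta> - flow s 1)"
proof -
  note lims = tendsto_uniform_limitI[OF partial_section_uniform_limit(1)[OF s]]
    tendsto_uniform_limitI[OF partial_section_uniform_limit(2)[OF s]]
  have bc: "a * \<phi>' i 0 = b * \<phi> i 0" "a * \<phi>' i 1 = - b * \<phi> i 1" for i
    using phi_bc[of i] by (auto simp: satisfies_bc_def)
  have p: "a * partial' n s 0 = b * (partial n s 0 - \<alpha>)" "a * partial' n s 1 = b * (\<beta> - partial n s 1)" for n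
  proof -
    have "a * (\<Sum>i<n. coef i * exp (- lam i * s) * \<phi>' i 0) = b * (\<Sum>i<n. coef i * exp (- lam i * s) * \<phi> i 0)"
      unfolding sum_distrib_left
    proof (rule sum.cong[OF refl])
      fix i
      have "a * (coef i * exp (- lam i * s) * \<phi>' i 0) = coef i * exp (- lam i * s) * (a * \<phi>' i 0)" by simp
      then show "a * (coef i * exp (- lam i * s) * \<phi>' i 0) = b * (coef i * exp (- lam i * s) * \<phi> i 0)"
        unfolding bc by simp
    qed
    then show "a * partial' n s 0 = b * (partial n s 0 - \<alpha>)"
      using stationary_bc(1) unfolding partial_def partial'_def stationary_def by (simp add: algebra_simps)
    have "a * (\<Sum>i<n. coef i * exp (- lam i * s) * \<phi>' i 1) = - b * (\<Sum>i<n. coef i * exp (- lam i * s) * \<phi> i 1)"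
      unfolding sum_distrib_left
    proof (rule sum.cong[OF refl])
      fix i
      have "a * (coef i * exp (- lam i * s) * \<phi>' i 1) = coef i * exp (- lam i * s) * (a * \<phi>' i 1)" by simp
      then show "a * (coef i * exp (- lam i * s) * \<phi>' i 1) = - b * (coef i * exp (- lam i * s) * \<phi> i 1)"
        unfolding bc by simp
    qed
    then show "a * partial' n s 1 = b * (\<beta> - partial n s 1)"
      using stationary_bc(2) unfolding partial_def partial'_def stationary_def by (simp add: algebra_simps)
  qed
  have "(\<lambda>n. a * partial' n s 0) \<longlonglongrightarrow> a * flow' s 0" "(\<lambda>n. b * (partial n s 0 - \<alpha>)) \<longlonglongrightarrow> b * (flow s 0 - \<alpha>)"
    "(\<lambda>n. a * partial' n s 1) \<longlonglongrightarrow> a * flow' s 1" "(\<lambda>n. b * (\<beta> - partial n s 1)) \<longlonglongrightarrow> b * (\<beta> - flow s 1)"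
    by (intro tendsto_intros lims; simp)+
  then show "a * flow' s 0 = b * (flow s 0 - \<alpha>)" "a * flow' s 1 = b * (\<beta> - flow s 1)"
    unfolding p using LIMSEQ_unique by blast+
qed

definition mode :: "nat \<Rightarrow> real \<Rightarrow> real" where
  "mode n s = exp (- lam n * s) * coef n + ip (\<phi> n) stationary"

lemma mode_flow:
  assumes s: "s > 0"
  shows "(LINT q:{0..1}|lebesgue. \<phi> n q * flow s q) = mode n s"
proof -
  \<comment> \<open>A zero mode is not normalised, but then its coefficient is 0.\<close>
  have cn: "coef n * ip (\<phi> n) (\<phi> n) = coef n"
    using phi_norm[of n] by (auto simp: coef_def)
  have "ip (partial m s) (\<phi> n) = mode n s" if m: "m > n" for m
  proof -
    have "ip (partial m s) (\<phi> n) = ip stationary (\<phi> n) + ip (\<lambda>q. \<Sum>i<m. coef i * exp (- lam i * s) * \<phi> i q) (\<phi> n)"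
      unfolding partial_def by (intro ip_add_left continuous_intros stationary_continuous phi_continuous)
    also have "ip (\<lambda>q. \<Sum>i<m. coef i * exp (- lam i * s) * \<phi> i q) (\<phi> n) = (\<Sum>i<m. ip (\<lambda>q. coef i * exp (- lam i * s) * \<phi> i q) (\<phi> n))"
      by (intro ip_sum_left continuous_intros phi_continuous) auto
    also have "\<dots> = (\<Sum>i<m. if i = n then coef n * exp (- lam n * s) * ip (\<phi> n) (\<phi> n) else 0)"
      by (intro sum.cong refl) (auto simp: ip_scale_left phi_orthogonal)
    also have "\<dots> = exp (- lam n * s) * (coef n * ip (\<phi> n) (\<phi> n))" using m by simp
    finally show ?thesis unfolding mode_def cn by (simp add: ip_commute)
  qed
  then have "\<forall>\<^sub>F m in sequentially. mode n s = ip (partial m s) (\<phi> n)"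
    by (intro eventually_mono[OF eventually_gt_at_top[of n]]) simp
  then have "(\<lambda>m. ip (partial m s) (\<phi> n)) \<longlonglongrightarrow> mode n s"
    by (rule Lim_transform_eventually[OF tendsto_const])
  moreover have "(\<lambda>m. ip (partial m s) (\<phi> n)) \<longlonglongrightarrow> ip (flow s) (\<phi> n)"
    by (rule ip_tendsto[OF partial_section_uniform_limit(1)[OF s] partial_section_continuous(1) phi_continuous])
  ultimately have "ip (flow s) (\<phi> n) = mode n s" using LIMSEQ_unique by blast
  then show ?thesis
    using LINT_times_continuous[OF phi_continuous flow_section_continuous(1)[OF s]] by (simp add: ip_commute)
qed

lemma mode_initial: "mode n 0 = (LINT q:{0..1}|lebesgue. \<phi> n q * g q)"
proof -
  have "coef n = (LINT q:{0..1}|lebesgue. \<phi> n q * g q - \<phi> n q * stationary q)"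
    unfolding coef_def by (simp add: right_diff_distrib)
  also have "\<dots> = (LINT q:{0..1}|lebesgue. \<phi> n q * g q) - (LINT q:{0..1}|lebesgue. \<phi> n q * stationary q)"
    by (intro set_integral_diff(2) times_continuous_absolutely_integrable[OF initial_measurable initial_bound phi_continuous]
        absolutely_integrable_continuous_real continuous_intros phi_continuous stationary_continuous)
  finally show ?thesis
    unfolding mode_def LINT_times_continuous[OF phi_continuous stationary_continuous] by simp
qed

text \<open>Two integrations by parts against the equilibrium profile. As profile and mode satisfy
  boundary conditions with the same \<open>a\<close> and \<open>b\<close>, all boundary terms reduce
  to \<open>\<alpha> * \<phi>' n 0\<close> and \<open>\<beta> * \<phi>' n 1\<close>. The source
  agrees with the constant in \<open>corrected_generator\<close>.\<close>

lemma mode_ode: "(mode n has_real_derivative - lam n * mode n s + 1 / 2 * (\<alpha> * \<phi>' n 0 - \<beta> * \<phi>' n 1)) (at s within S)"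
proof -
  have c2: "cont01 (\<lambda>q. - 2 * lam n * \<phi> n q)" by (intro continuous_intros phi_continuous)
  have i1: "ip (\<lambda>q. - 2 * lam n * \<phi> n q) stationary = \<phi>' n 1 * stationary 1 - \<phi>' n 0 * stationary 0 - ip (\<phi>' n) (\<lambda>q. slope)"
    by (rule ip_by_parts[OF phi'_derivative stationary_derivative c2 continuous_on_const])
  have i2: "ip (\<phi>' n) (\<lambda>q. slope) = \<phi> n 1 * slope - \<phi> n 0 * slope - ip (\<phi> n) (\<lambda>q. 0)"
    by (rule ip_by_parts[OF phi_derivative DERIV_const phi'_continuous continuous_on_const])
  have z: "ip (\<phi> n) (\<lambda>q. 0) = 0" by (simp add: ip_def)
  have bc: "a * \<phi>' n 0 = b * \<phi> n 0" "a * \<phi>' n 1 = - b * \<phi> n 1"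
    using phi_bc[of n] by (auto simp: satisfies_bc_def)
  have b0: "(intercept - \<alpha>) * \<phi>' n 0 = slope * \<phi> n 0" and b1: "(intercept + slope - \<beta>) * \<phi>' n 1 = slope * \<phi> n 1"
  proof -
    show "(intercept - \<alpha>) * \<phi>' n 0 = slope * \<phi> n 0"
    proof (cases "a = 0")
      case True
      then have "b \<noteq> 0" using ab_pos by simp
      then show ?thesis using True bc stationary_bc by simp
    next
      case False
      have "a * ((intercept - \<alpha>) * \<phi>' n 0) = (intercept - \<alpha>) * (a * \<phi>' n 0)" by simp
      also have "\<dots> = (b * (intercept - \<alpha>)) * \<phi> n 0" unfolding bc by simp
      also have "\<dots> = a * (slope * \<phi> n 0)" unfolding stationary_bc(1)[symmetric] by simp
      finally show ?thesis using False by simp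
    qed
    show "(intercept + slope - \<beta>) * \<phi>' n 1 = slope * \<phi> n 1"
    proof (cases "a = 0")
      case True
      then have "b \<noteq> 0" using ab_pos by simp
      then show ?thesis using True bc stationary_bc by simp
    next
      case False
      have "a * ((intercept + slope - \<beta>) * \<phi>' n 1) = (intercept + slope - \<beta>) * (a * \<phi>' n 1)" by simp
      also have "\<dots> = (b * (\<beta> - (intercept + slope))) * \<phi> n 1" unfolding bc by (simp add: algebra_simps)
      also have "\<dots> = a * (slope * \<phi> n 1)" unfolding stationary_bc(2)[symmetric] by simp
      finally show ?thesis using False by simp
    qed
  qed
  have "- 2 * lam n * ip (\<phi> n) stationary = \<phi>' n 1 * (intercept + slope) - \<phi>' n 0 * intercept - (\<phi> n 1 * slope - \<phi> n 0 * slope)"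
    using i1[unfolded ip_scale_left] i2 z by (simp add: stationary_def)
  then have st: "lam n * ip (\<phi> n) stationary = 1 / 2 * (\<alpha> * \<phi>' n 0 - \<beta> * \<phi>' n 1)"
    using b0 b1 by (simp add: algebra_simps)
  have "(mode n has_real_derivative - lam n * exp (- lam n * s) * coef n) (at s within S)"
    unfolding mode_def by (auto intro!: derivative_eq_intros)
  moreover have "- lam n * exp (- lam n * s) * coef n = - lam n * mode n s + 1 / 2 * (\<alpha> * \<phi>' n 0 - \<beta> * \<phi>' n 1)"
    unfolding st[symmetric] mode_def by (simp add: algebra_simps)
  ultimately show ?thesis by simp
qed

text \<open>At time 0 the value is \<open>g\<close> itself, as the weak formulations
  prescribe.\<close>

definition solution :: "real \<Rightarrow> real \<Rightarrow> real" where
  "solution s = (if s > 0 then flow s else g)"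

lemma solution_measurable: "solution s \<in> borel_measurable (lebesgue_on {0..1})"
  using initial_measurable cont01_measurable[OF flow_section_continuous(1)] by (simp add: solution_def)

lemma mode_solution: "s \<ge> 0 \<Longrightarrow> (LINT q:{0..1}|lebesgue. \<phi> n q * solution s q) = mode n s"
  using mode_flow[of s n] mode_initial[of n] by (cases "s = 0") (auto simp: solution_def)

end

sublocale hydrodynamic_limit \<subseteq> heat_flow a b \<phi> \<phi>' lam C \<alpha> \<beta> g
  by unfold_locales (rule g_measurable, rule g_range)

section \<open>Convergence to the limiting density, and its range\<close>

context hydrodynamic_limit
begin

theorem empirical_mean_square:
  assumes "cont01 G" "t \<ge> 0"
  shows "mean_square t G (LINT q:{0..1}|lebesgue. G q * solution t q) \<longlonglongrightarrow> 0"
proof -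
  obtain R where R: "\<And>q. q \<in> {0..1} \<Longrightarrow> \<bar>solution t q\<bar> \<le> R"
  proof (cases "t > 0")
    case True
    then show ?thesis using that cont01_bounded[OF flow_section_continuous(1)[OF True]] by (metis solution_def)
  next
    case False
    then show ?thesis using that initial_bound by (auto simp: solution_def)
  qed
  show ?thesis
  proof (rule mean_square_tendsto[OF assms solution_measurable R])
    show "mean_square t (\<phi> n) (LINT q:{0..1}|lebesgue. \<phi> n q * solution t q) \<longlonglongrightarrow> 0" for n
      unfolding mode_solution[OF assms(2)]
      by (rule mode_mean_square[OF mode_ode mode_initial assms(2)])
  qed
qed

text \<open>For a nonnegative test function the empirical density lies between 0 and the Riemann sum
  of \<open>G\<close>. A limit outside the closed range would keep the mean-square deviation above a
  positive constant.\<close>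

lemma limit_between:
  assumes G: "cont01 G" "\<And>q. q \<in> {0..1} \<Longrightarrow> G q \<ge> 0" and t: "t \<ge> 0" and l: "mean_square t G l \<longlonglongrightarrow> 0"
  shows "0 \<le> l" "l \<le> integral {0..1} G"
proof -
  define r where "r N = 1 / (real N - 1) * (\<Sum>x\<in>sites N. G (real x / real N))" for N
  have r: "r \<longlonglongrightarrow> integral {0..1} G" unfolding r_def by (rule riemann_sum_tendsto[OF G(1)])
  have emp: "0 \<le> empirical N G \<xi>" "empirical N G \<xi> \<le> r N" if N: "N \<ge> 3" and \<xi>: "\<xi> \<in> configs N" for N \<xi>
  proof -
    have Gx: "G (real x / real N) \<ge> 0" if "x \<in> sites N" for x
      using that by (intro G) (auto simp: sites_def field_simps)
    then have x: "0 \<le> G (real x / real N) * \<xi> x" "G (real x / real N) * \<xi> x \<le> G (real x / real N)" if "x \<in> sites N" for x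
      using configs_values[OF \<xi> that] that by auto
    show "0 \<le> empirical N G \<xi>"
      unfolding empirical_def using N x(1) by (intro mult_nonneg_nonneg[OF _ sum_nonneg]) auto
    show "empirical N G \<xi> \<le> r N"
      unfolding empirical_def r_def using N x(2) by (intro mult_left_mono sum_mono) auto
  qed
  have lower: "c\<^sup>2 \<le> mean_square t G l N" if N: "N \<ge> 3" and c: "\<And>\<xi>. \<xi> \<in> configs N \<Longrightarrow> c\<^sup>2 \<le> (empirical N G \<xi> - l)\<^sup>2" for N c
  proof -
    have "(\<integral>\<omega>. c\<^sup>2 \<partial>M N) \<le> mean_square t G l N"
      unfolding mean_square_def by (rule process_integral_mono[OF N t, where f = "\<lambda>_. c\<^sup>2"]) (rule c)
    then show ?thesis by (simp only: process_integral_const[OF N])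
  qed
  have contr: False if "c > 0" "\<forall>\<^sub>F N in sequentially. c\<^sup>2 \<le> mean_square t G l N" for c
  proof -
    have "\<forall>\<^sub>F N in sequentially. mean_square t G l N < c\<^sup>2" using that(1) by (intro order_tendstoD(2)[OF l]) auto
    with that(2) have "\<forall>\<^sub>F N in sequentially. False" by eventually_elim simp
    then show False by simp
  qed
  show "0 \<le> l"
  proof (rule ccontr)
    assume "\<not> 0 \<le> l"
    have "\<forall>\<^sub>F N in sequentially. (- l)\<^sup>2 \<le> mean_square t G l N"
      using eventually_ge_at_top[of 3]
    proof eventually_elim
      case (elim N)
      show ?case
      proof (rule lower[OF elim])
        fix \<xi> assume "\<xi> \<in> configs N"
        then show "(- l)\<^sup>2 \<le> (empirical N G \<xi> - l)\<^sup>2" using emp(1)[OF elim] \<open>\<not> 0 \<le> l\<close> by (intro power_mono) auto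
      qed
    qed
    then show False using contr[of "- l"] \<open>\<not> 0 \<le> l\<close> by simp
  qed
  show "l \<le> integral {0..1} G"
  proof (rule ccontr)
    assume n: "\<not> l \<le> integral {0..1} G"
    define c where "c = (l - integral {0..1} G) / 2"
    have c: "c > 0" using n by (simp add: c_def)
    have "\<forall>\<^sub>F N in sequentially. r N < integral {0..1} G + c" using c by (intro order_tendstoD(2)[OF r]) auto
    then have "\<forall>\<^sub>F N in sequentially. c\<^sup>2 \<le> mean_square t G l N"
      using eventually_ge_at_top[of 3]
    proof eventually_elim
      case (elim N)
      show ?case
      proof (rule lower[OF elim(2)])
        fix \<xi> assume "\<xi> \<in> configs N"
        then have "empirical N G \<xi> \<le> r N" by (rule emp(2)[OF elim(2)])
        moreover have "l = integral {0..1} G + 2 * c" by (simp add: c_def field_simps)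
        ultimately have "c \<le> l - empirical N G \<xi>" using elim(1) by linarith
        then have "c\<^sup>2 \<le> (l - empirical N G \<xi>)\<^sup>2" using c by (intro power_mono) auto
        then show "c\<^sup>2 \<le> (empirical N G \<xi> - l)\<^sup>2" by (simp add: power2_commute)
      qed
    qed
    then show False using contr c by blast
  qed
qed

text \<open>The range of the solution is inherited from the occupation numbers, which replaces a maximum
  principle.\<close>

lemma solution_range:
  assumes t: "t \<ge> 0" and q: "q \<in> {0..1}"
  shows "solution t q \<in> {0..1}"
proof (cases "t > 0")
  case False
  then show ?thesis using q initial_range by (auto simp: solution_def Pi_def)
next
  case True
  let ?u = "flow t"
  have uc: "cont01 ?u" by (rule flow_section_continuous(1)[OF True])
  have lim: "mean_square t G (ip G ?u) \<longlonglongrightarrow> 0" if "cont01 G" for G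
    using empirical_mean_square[OF that t] True LINT_times_continuous[OF that uc] by (simp add: solution_def)
  \<comment> \<open>For the negative part of the flow, nonnegativity of the limit reads
    \<open>- ip G G \<ge> 0\<close>, so \<open>G\<close> vanishes. Below, the excess over 1 plays
    the same role with the upper bound.\<close>
  define G where "G r = max 0 (- ?u r)" for r
  have Gc: "cont01 G" unfolding G_def by (intro continuous_intros uc)
  have "0 \<le> ip G ?u" by (rule limit_between(1)[OF Gc _ t lim[OF Gc]]) (simp add: G_def)
  also have "ip G ?u = ip G (\<lambda>r. (-1) * G r)"
  proof -
    have "G r * ?u r = G r * ((-1) * G r)" for r by (cases "?u r \<ge> 0") (simp_all add: G_def max_def)
    then show ?thesis by (simp only: ip_def)
  qed
  also have "\<dots> = (-1) * ip G G" by (rule ip_scale_right)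
  finally have "ip G G = 0" using ip_nonneg[of G] by linarith
  from ip_eq_0[OF Gc this q] have "G q = 0" .
  moreover have "- ?u q \<le> G q" by (simp add: G_def)
  ultimately have lo: "0 \<le> ?u q" by linarith
  define H where "H r = max 0 (?u r - 1)" for r
  have Hc: "cont01 H" unfolding H_def by (intro continuous_intros uc)
  have "ip H ?u \<le> integral {0..1} H" by (rule limit_between(2)[OF Hc _ t lim[OF Hc]]) (simp add: H_def)
  also have "integral {0..1} H = ip H (\<lambda>_. 1)" by (simp add: ip_def)
  finally have "ip H (\<lambda>r. ?u r - 1) \<le> 0" using ip_diff_right[OF uc continuous_on_const Hc, of 1] by simp
  also have "ip H (\<lambda>r. ?u r - 1) = ip H H"
  proof -
    have "H r * (?u r - 1) = H r * H r" for r by (cases "?u r \<le> 1") (simp_all add: H_def max_def)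
    then show ?thesis by (simp only: ip_def)
  qed
  finally have "ip H H = 0" using ip_nonneg[of H] by linarith
  from ip_eq_0[OF Hc this q] have "H q = 0" .
  moreover have "?u q - 1 \<le> H q" by (simp add: H_def)
  ultimately have "?u q \<le> 1" by linarith
  with lo show ?thesis using True by (simp add: solution_def)
qed

end

subsection \<open>Weak formulations for the limiting density\<close>

lemma ip_continuous_param:
  assumes "continuous_on (S \<times> {0..1}) (\<lambda>(s, q). u s q)" "continuous_on (S \<times> {0..1}) (\<lambda>(s, q). h s q)"
  shows "continuous_on S (\<lambda>s. ip (u s) (h s))"
proof -
  have "continuous_on (S \<times> cbox 0 1) (\<lambda>(s, q). u s q * h s q)"
    using continuous_on_mult[OF assms] by (simp add: case_prod_beta')
  from integral_continuous_on_param[OF this] show ?thesis by (simp add: ip_def)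
qed

lemma continuous_on_section:
  assumes "continuous_on (S \<times> {0..1}) (\<lambda>(s, q). u s q)"
  shows "s \<in> S \<Longrightarrow> cont01 (u s)" "q \<in> {0..1} \<Longrightarrow> continuous_on S (\<lambda>s. u s q)"
  using continuous_on_compose2[OF assms, of "{0..1}" "Pair s"] continuous_on_compose2[OF assms, of S "\<lambda>s. (s, q)"]
  by (auto simp: continuous_on_Pair image_subset_iff)

lemma ip_uniform_limit:
  assumes u: "uniform_limit (S \<times> {0..1}) (\<lambda>n (s, q). u n s q) (\<lambda>(s, q). v s q) sequentially"
    and c: "\<And>n s. s \<in> S \<Longrightarrow> cont01 (u n s)" "\<And>s. s \<in> S \<Longrightarrow> cont01 (v s)" "\<And>s. s \<in> S \<Longrightarrow> cont01 (h s)"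
    and K: "\<And>s q. s \<in> S \<Longrightarrow> q \<in> {0..1} \<Longrightarrow> \<bar>h s q\<bar> \<le> K"
  shows "uniform_limit S (\<lambda>n s. ip (u n s) (h s)) (\<lambda>s. ip (v s) (h s)) sequentially"
proof (cases "S = {}")
  case False
  then have K0: "K \<ge> 0" using K[of _ 0] by (metis abs_ge_zero all_not_in_conv atLeastAtMost_iff order_refl order_trans zero_le_one)
  show ?thesis
  proof (rule uniform_limitI)
    fix e :: real assume e: "e > 0"
    \<comment> \<open>\<open>K + 1\<close> is positive even if \<open>K\<close> is 0.\<close>
    define d where "d = e / (2 * (K + 1))"
    have d: "d > 0" using e K0 by (simp add: d_def)
    show "\<forall>\<^sub>F n in sequentially. \<forall>s\<in>S. dist (ip (u n s) (h s)) (ip (v s) (h s)) < e"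
      using uniform_limitD[OF u d]
    proof eventually_elim
      case (elim n)
      show ?case
      proof
        fix s assume s: "s \<in> S"
        have cd: "cont01 (\<lambda>q. u n s q - v s q)" by (intro continuous_intros c s)
        have "ip (\<lambda>q. u n s q - v s q) (\<lambda>q. u n s q - v s q) \<le> d\<^sup>2"
          by (rule ip_le_bound[OF cd]) (use elim s in \<open>auto simp: dist_real_def less_imp_le\<close>)
        moreover have "ip (h s) (h s) \<le> K\<^sup>2" by (rule ip_le_bound[OF c(3)[OF s] K[OF s]])
        ultimately have "ip (\<lambda>q. u n s q - v s q) (\<lambda>q. u n s q - v s q) * ip (h s) (h s) \<le> d\<^sup>2 * K\<^sup>2"
          by (intro mult_mono ip_nonneg) auto
        then have "(ip (\<lambda>q. u n s q - v s q) (h s))\<^sup>2 \<le> (d * K)\<^sup>2"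
          using ip_Cauchy_Schwarz[OF cd c(3)[OF s]] by (simp add: power_mult_distrib)
        then have "\<bar>ip (\<lambda>q. u n s q - v s q) (h s)\<bar> \<le> d * K"
          using d K0 by (simp add: abs_le_square_iff[symmetric])
        also have "d * K < e"
        proof -
          have "d * K \<le> d * (K + 1)" using d by (intro mult_left_mono) auto
          also have "\<dots> = e / 2"
          proof -
            have "e / (2 * k) * k = e / 2" if "k > 0" for k using that by simp
            from this[of "K + 1"] K0 show ?thesis unfolding d_def by linarith
          qed
          finally show ?thesis using e by simp
        qed
        finally show "dist (ip (u n s) (h s)) (ip (v s) (h s)) < e"
          using ip_diff_left[OF c(1)[OF s] c(2)[OF s] c(3)[OF s]] by (simp add: dist_real_def)
      qed
    qed
  qed
qed simp

text \<open>Integrands built from the limiting density are continuous for positive times but may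
  jump at 0, where the flow is replaced by \<open>g\<close>. Boundedness and the removal of one
  point still give integrability.\<close>

lemma bounded_continuous_integrable:
  fixes X :: "real \<Rightarrow> real"
  assumes c: "\<And>\<epsilon>. 0 < \<epsilon> \<Longrightarrow> continuous_on {\<epsilon>..t} X" and K: "\<And>s. s \<in> {0..t} \<Longrightarrow> \<bar>X s\<bar> \<le> K"
  shows "set_integrable lebesgue {0..t} X"
proof -
  have "continuous_on {0<..t} X"
    unfolding continuous_on_eq_continuous_within
  proof
    fix s assume s: "s \<in> {0<..t}"
    have "continuous (at s within {s / 2..t}) X"
      by (rule c[unfolded continuous_on_eq_continuous_within, rule_format]) (use s in auto)
    moreover have "at s within {s / 2..t} = at s within {0<..t}"
      using s by (intro at_within_nhd[of _ "{s / 2<..}"]) auto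
    ultimately show "continuous (at s within {0<..t}) X" by simp
  qed
  then have m: "X \<in> borel_measurable (lebesgue_on {0<..t})"
    by (intro continuous_imp_measurable_on_sets_lebesgue) auto
  have "set_integrable lebesgue {0<..t} X"
  proof (rule measurable_bounded_by_integrable_imp_absolutely_integrable[OF m, of "\<lambda>_. K"])
    show "(\<lambda>_. K) integrable_on {0<..t}"
      by (rule integrable_spike_set[of _ "{0..t}"]) (auto intro: negligible_subset[of "{0}"])
  qed (use K in auto)
  then show ?thesis
    by (rule absolutely_integrable_spike_set) (auto intro: negligible_subset[of "{0}"])
qed

text \<open>The initial layer contributes at most \<open>K * \<epsilon> k\<close>. This is how
  identities valid on \<open>[\<epsilon>, t]\<close> are extended to time 0.\<close>

lemma integral_tendsto_LINT:
  fixes X :: "real \<Rightarrow> real"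
  assumes i: "set_integrable lebesgue {0..t} X" and K: "\<And>s. s \<in> {0..t} \<Longrightarrow> \<bar>X s\<bar> \<le> K"
    and e: "\<And>k. 0 < \<epsilon> k" "\<And>k. \<epsilon> k \<le> t" "\<epsilon> \<longlonglongrightarrow> 0"
  shows "(\<lambda>k. integral {\<epsilon> k..t} X) \<longlonglongrightarrow> (LINT s:{0..t}|lebesgue. X s)"
proof -
  have iX: "X integrable_on {0..t}" and L: "(LINT s:{0..t}|lebesgue. X s) = integral {0..t} X"
    using set_lebesgue_integral_eq_integral[OF i] by auto
  have bnd: "\<bar>integral {\<epsilon> k..t} X - integral {0..t} X\<bar> \<le> K * \<epsilon> k" for k
  proof -
    have "integral {0..\<epsilon> k} X + integral {\<epsilon> k..t} X = integral {0..t} X"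
      using e(1,2)[of k] by (intro Henstock_Kurzweil_Integration.integral_combine iX) auto
    moreover have "norm (integral {0..\<epsilon> k} X) \<le> integral {0..\<epsilon> k} (\<lambda>_. K)"
      by (rule integral_norm_bound_integral) (use e(1,2)[of k] K integrable_on_subinterval[OF iX, of 0 "\<epsilon> k"] in auto)
    ultimately show ?thesis using e(1)[of k] by (simp add: mult.commute)
  qed
  have "(\<lambda>k. integral {\<epsilon> k..t} X - integral {0..t} X) \<longlonglongrightarrow> 0"
    by (rule Lim_null_comparison[OF _ tendsto_mult_right_zero[OF e(3), of K]]) (simp add: bnd)
  then show ?thesis unfolding L by (rule LIM_zero_cancel)
qed

section \<open>Green's identity for separated solutions and for their sums\<close>

locale test_function =
  fixes T :: real and G Gt Gq Gqq :: "real \<Rightarrow> real \<Rightarrow> real"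
  assumes C12: "C12 T G Gt Gq Gqq"
begin

lemma test_derivatives:
  assumes "s \<in> {0..T}" "q \<in> {0..1}"
  shows "((\<lambda>s. G s q) has_real_derivative Gt s q) (at s within {0..T})"
    and "(G s has_real_derivative Gq s q) (at q within {0..1})"
    and "(Gq s has_real_derivative Gqq s q) (at q within {0..1})"
  using C12 assms unfolding C12_def by blast+

lemma test_continuous:
  "continuous_on ({0..T} \<times> {0..1}) (\<lambda>(s, q). G s q)" "continuous_on ({0..T} \<times> {0..1}) (\<lambda>(s, q). Gt s q)"
  "continuous_on ({0..T} \<times> {0..1}) (\<lambda>(s, q). Gq s q)" "continuous_on ({0..T} \<times> {0..1}) (\<lambda>(s, q). Gqq s q)"
  using C12 unfolding C12_def by auto

definition source :: "real \<Rightarrow> real \<Rightarrow> real" where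
  "source s q = 1 / 2 * Gqq s q + Gt s q"

lemma source_continuous: "continuous_on ({0..T} \<times> {0..1}) (\<lambda>(s, q). source s q)"
  using continuous_on_add[OF continuous_on_mult[OF continuous_on_const[of _ "1 / 2"] test_continuous(4)] test_continuous(2)]
  by (simp add: source_def case_prod_beta')

lemma test_bounded:
  obtains B where "B > 0" "\<And>s q. s \<in> {0..T} \<Longrightarrow> q \<in> {0..1} \<Longrightarrow>
    \<bar>G s q\<bar> \<le> B \<and> \<bar>Gq s q\<bar> \<le> B \<and> \<bar>source s q\<bar> \<le> B"
proof -
  have bd: "\<exists>B. \<forall>z \<in> {0..T} \<times> {0..1}. \<bar>(\<lambda>(s, q). F s q) z\<bar> \<le> B"
    if "continuous_on ({0..T} \<times> {0..1}) (\<lambda>(s, q). F s q)" for F :: "real \<Rightarrow> real \<Rightarrow> real"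
  proof -
    have "bounded ((\<lambda>(s, q). F s q) ` ({0..T} \<times> {0..1}))"
      by (intro compact_imp_bounded compact_continuous_image that compact_Times) auto
    then show ?thesis unfolding bounded_iff by auto
  qed
  obtain B1 where B1: "\<forall>z \<in> {0..T} \<times> {0..1}. \<bar>(\<lambda>(s, q). G s q) z\<bar> \<le> B1" using bd[OF test_continuous(1)] by blast
  obtain B2 where B2: "\<forall>z \<in> {0..T} \<times> {0..1}. \<bar>(\<lambda>(s, q). Gq s q) z\<bar> \<le> B2" using bd[OF test_continuous(3)] by blast
  obtain B3 where B3: "\<forall>z \<in> {0..T} \<times> {0..1}. \<bar>(\<lambda>(s, q). source s q) z\<bar> \<le> B3" using bd[OF source_continuous] by blast
  show thesis
  proof (rule that[of "\<bar>B1\<bar> + \<bar>B2\<bar> + \<bar>B3\<bar> + 1"])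
    fix s q assume "s \<in> {0..T}" "q \<in> {0..1::real}"
    then have "\<bar>G s q\<bar> \<le> B1" "\<bar>Gq s q\<bar> \<le> B2" "\<bar>source s q\<bar> \<le> B3" using B1 B2 B3 by auto
    then show "\<bar>G s q\<bar> \<le> \<bar>B1\<bar> + \<bar>B2\<bar> + \<bar>B3\<bar> + 1 \<and> \<bar>Gq s q\<bar> \<le> \<bar>B1\<bar> + \<bar>B2\<bar> + \<bar>B3\<bar> + 1 \<and> \<bar>source s q\<bar> \<le> \<bar>B1\<bar> + \<bar>B2\<bar> + \<bar>B3\<bar> + 1"
      by linarith
  qed auto
qed

text \<open>The boundary term of Green's identity for the operator \<open>\<Delta> / 2\<close>, for
  a function \<open>u\<close> with derivative \<open>u'\<close> against the test function at time
  \<open>s\<close>.\<close>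

definition flux :: "(real \<Rightarrow> real) \<Rightarrow> (real \<Rightarrow> real) \<Rightarrow> real \<Rightarrow> real" where
  "flux u u' s = 1 / 2 * (u' 1 * G s 1 - u 1 * Gq s 1 - u' 0 * G s 0 + u 0 * Gq s 0)"

text \<open>The decay rate gives \<open>- l * f\<close>, which is half of \<open>f''\<close>; two
  integrations by parts move the second derivative to the test function and leave the flux.\<close>

lemma mode_weak_derivative:
  assumes f: "\<And>q. q \<in> {0..1} \<Longrightarrow> (f has_real_derivative f' q) (at q within {0..1})"
    "\<And>q. q \<in> {0..1} \<Longrightarrow> (f' has_real_derivative - 2 * l * f q) (at q within {0..1})"
    and s: "s \<in> {0..T}"
  shows "((\<lambda>s. c * exp (- l * s) * ip f (G s)) has_real_derivative
    c * exp (- l * s) * (ip f (source s) + flux f f' s)) (at s within {0..T})"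
proof -
  have fc: "cont01 f" "cont01 f'" by (rule DERIV_continuous_on, erule f)+
  note sec = continuous_on_section(1)[OF test_continuous(1)] continuous_on_section(1)[OF test_continuous(2)]
    continuous_on_section(1)[OF test_continuous(3)] continuous_on_section(1)[OF test_continuous(4)]
  have fT: "continuous_on ({0..T} \<times> {0..1}) (\<lambda>z. f (snd z))"
    by (rule continuous_on_compose2[OF fc(1)]) (auto intro!: continuous_intros)
  have "((\<lambda>s. integral (cbox 0 1) (\<lambda>q. f q * G s q)) has_real_derivative integral (cbox 0 1) (\<lambda>q. f q * Gt s q)) (at s within {0..T})"
  proof (rule leibniz_rule_field_derivative)
    show "((\<lambda>s. f q * G s q) has_real_derivative f q * Gt s q) (at s within {0..T})" if "s \<in> {0..T}" "q \<in> cbox 0 1" for s q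
      using that by (intro DERIV_cmult test_derivatives) auto
    show "(\<lambda>q. f q * G s q) integrable_on cbox 0 1" if "s \<in> {0..T}" for s
      using ip_integrable[OF fc(1) sec(1)[OF that]] by simp
    show "continuous_on ({0..T} \<times> cbox 0 1) (\<lambda>(s, q). f q * Gt s q)"
      using continuous_on_mult[OF fT test_continuous(2)] by (simp add: case_prod_beta')
  qed (use s in auto)
  then have K: "((\<lambda>s. ip f (G s)) has_real_derivative ip f (Gt s)) (at s within {0..T})" by (simp add: ip_def)
  have E: "((\<lambda>s. c * exp (- l * s)) has_real_derivative c * (exp (- l * s) * - l)) (at s within {0..T})"
    by (auto intro!: derivative_eq_intros)
  have "- 2 * l * ip f (G s) = ip (\<lambda>q. - 2 * l * f q) (G s)" by (simp only: ip_scale_left)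
  also have "\<dots> = f' 1 * G s 1 - f' 0 * G s 0 - ip f' (Gq s)"
    by (rule ip_by_parts[OF f(2) test_derivatives(2)[OF s]]) (auto intro!: continuous_intros fc sec(3) s)
  also have "ip f' (Gq s) = f 1 * Gq s 1 - f 0 * Gq s 0 - ip f (Gqq s)"
    by (rule ip_by_parts[OF f(1) test_derivatives(3)[OF s] fc(2) sec(4)[OF s]])
  finally have parts: "- l * ip f (G s) = flux f f' s + 1 / 2 * ip f (Gqq s)"
    unfolding flux_def by (simp add: field_simps)
  have src: "ip f (source s) = 1 / 2 * ip f (Gqq s) + ip f (Gt s)"
  proof -
    have "ip f (\<lambda>q. 1 / 2 * Gqq s q + Gt s q) = ip f (\<lambda>q. 1 / 2 * Gqq s q) + ip f (Gt s)"
      by (intro ip_add_right continuous_intros fc sec s)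
    then show ?thesis unfolding ip_scale_right by (simp add: source_def[abs_def])
  qed
  show ?thesis
  proof (rule DERIV_cong[OF DERIV_mult[OF E K]])
    have "c * (exp (- l * s) * - l) * ip f (G s) = c * exp (- l * s) * (- l * ip f (G s))" by simp
    then show "c * (exp (- l * s) * - l) * ip f (G s) + ip f (Gt s) * (c * exp (- l * s)) = c * exp (- l * s) * (ip f (source s) + flux f f' s)"
      unfolding parts src by (simp add: algebra_simps)
  qed
qed

end

locale tested_flow = heat_flow a b \<phi> \<phi>' lam C \<alpha> \<beta> g + test_function T G Gt Gq Gqq
  for a b :: real and \<phi> \<phi>' :: "nat \<Rightarrow> real \<Rightarrow> real" and lam :: "nat \<Rightarrow> real" and C :: real
    and \<alpha> \<beta> :: real and g :: "real \<Rightarrow> real" and T :: real and G Gt Gq Gqq :: "real \<Rightarrow> real \<Rightarrow> real"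
begin

lemma partial_weak_derivative:
  assumes s: "s \<in> {0..T}"
  shows "((\<lambda>s. ip (partial n s) (G s)) has_real_derivative
    ip (partial n s) (source s) + flux (partial n s) (partial' n s) s) (at s within {0..T})"
proof (induction n)
  case 0
  \<comment> \<open>The affine profile is a mode with eigenvalue 0.\<close>
  have "((\<lambda>s. 1 * exp (- 0 * s) * ip stationary (G s)) has_real_derivative
      1 * exp (- 0 * s) * (ip stationary (source s) + flux stationary (\<lambda>_. slope) s)) (at s within {0..T})"
    by (rule mode_weak_derivative[OF stationary_derivative _ s]) simp
  then show ?case by (simp add: partial_def[abs_def] partial'_def[abs_def])
next
  case (Suc n)
  have Gc: "cont01 (G r)" if "r \<in> {0..T}" for r by (rule continuous_on_section(1)[OF test_continuous(1) that])
  have sc: "cont01 (source s)" by (rule continuous_on_section(1)[OF source_continuous s])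
  have step: "partial (Suc n) r = (\<lambda>q. partial n r q + coef n * exp (- lam n * r) * \<phi> n q)" for r
    by (simp add: partial_def fun_eq_iff)
  have step': "partial' (Suc n) r = (\<lambda>q. partial' n r q + coef n * exp (- lam n * r) * \<phi>' n q)" for r
    by (simp add: partial'_def fun_eq_iff)
  have ip_step: "ip (partial (Suc n) r) h = ip (partial n r) h + coef n * exp (- lam n * r) * ip (\<phi> n) h" if "cont01 h" for r h
    unfolding step by (subst ip_add_left) (auto intro!: continuous_intros partial_section_continuous phi_continuous that simp: ip_scale_left)
  have flux_step: "flux (partial (Suc n) s) (partial' (Suc n) s) s = flux (partial n s) (partial' n s) s
      + coef n * exp (- lam n * s) * flux (\<phi> n) (\<phi>' n) s"
    unfolding step step' flux_def by (simp add: algebra_simps)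
  have "((\<lambda>s. ip (partial n s) (G s) + coef n * exp (- lam n * s) * ip (\<phi> n) (G s)) has_real_derivative
     (ip (partial n s) (source s) + flux (partial n s) (partial' n s) s) +
     coef n * exp (- lam n * s) * (ip (\<phi> n) (source s) + flux (\<phi> n) (\<phi>' n) s)) (at s within {0..T})"
    by (rule DERIV_add[OF Suc.IH mode_weak_derivative[OF phi_derivative phi'_derivative s]])
  moreover have "(ip (partial n s) (source s) + flux (partial n s) (partial' n s) s) +
     coef n * exp (- lam n * s) * (ip (\<phi> n) (source s) + flux (\<phi> n) (\<phi>' n) s)
     = ip (partial (Suc n) s) (source s) + flux (partial (Suc n) s) (partial' (Suc n) s) s"
    unfolding ip_step[OF sc] flux_step by (simp add: algebra_simps)
  ultimately have "((\<lambda>s. ip (partial n s) (G s) + coef n * exp (- lam n * s) * ip (\<phi> n) (G s)) has_real_derivative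
     ip (partial (Suc n) s) (source s) + flux (partial (Suc n) s) (partial' (Suc n) s) s) (at s within {0..T})"
    by (simp only:)
  then show ?case
    by (rule has_real_derivative_transform[OF s, rotated]) (rule ip_step[OF Gc])
qed

text \<open>The identity for partial sums is integrated in time before the limit. A positive
  \<open>\<epsilon>\<close> is essential: the flux contains the derivative series, which converges
  uniformly only away from time 0.\<close>

lemma flow_weak_identity:
  assumes e: "0 < \<epsilon>" "\<epsilon> \<le> t" "t \<le> T"
  shows "ip (flow t) (G t) - ip (flow \<epsilon>) (G \<epsilon>) =
    integral {\<epsilon>..t} (\<lambda>s. ip (flow s) (source s) + flux (flow s) (flow' s) s)"
    and "continuous_on {\<epsilon>..t} (\<lambda>s. ip (flow s) (source s))"
    and "continuous_on {\<epsilon>..t} (\<lambda>s. flux (flow s) (flow' s) s)"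
proof -
  have sub: "{\<epsilon>..t} \<times> {0..1} \<subseteq> {0..T} \<times> {0..1::real}" "{\<epsilon>..t} \<times> {0..1} \<subseteq> {\<epsilon>..} \<times> {0..1::real}"
    "{\<epsilon>..t} \<times> {0..1} \<subseteq> UNIV \<times> {0..1::real}" "{\<epsilon>..t} \<subseteq> {0..T}" "{\<epsilon>..t} \<subseteq> {\<epsilon>..}"
    using e by auto
  have tc: "continuous_on ({\<epsilon>..t} \<times> {0..1}) (\<lambda>(s, q). source s q)" "continuous_on ({\<epsilon>..t} \<times> {0..1}) (\<lambda>(s, q). G s q)"
    "continuous_on ({\<epsilon>..t} \<times> {0..1}) (\<lambda>(s, q). Gq s q)"
    by (intro continuous_on_subset[OF _ sub(1)] source_continuous test_continuous)+
  have fc: "continuous_on ({\<epsilon>..t} \<times> {0..1}) (\<lambda>(s, q). flow s q)" "continuous_on ({\<epsilon>..t} \<times> {0..1}) (\<lambda>(s, q). flow' s q)"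
    by (intro continuous_on_subset[OF _ sub(2)] flow_continuous e)+
  have pc: "continuous_on ({\<epsilon>..t} \<times> {0..1}) (\<lambda>(s, q). partial n s q)" "continuous_on ({\<epsilon>..t} \<times> {0..1}) (\<lambda>(s, q). partial' n s q)" for n
    by (intro continuous_on_subset[OF _ sub(3)] partial_continuous)+
  note sec = continuous_on_section(2)
  have z1: "(0::real) \<in> {0..1}" "(1::real) \<in> {0..1}" by auto
  have flux_cont: "continuous_on {\<epsilon>..t} (\<lambda>s. flux (u s) (u' s) s)"
    if "continuous_on ({\<epsilon>..t} \<times> {0..1}) (\<lambda>(s, q). u s q)" "continuous_on ({\<epsilon>..t} \<times> {0..1}) (\<lambda>(s, q). u' s q)" for u u'
    unfolding flux_def by (intro continuous_intros sec[OF that(1)] sec[OF that(2)] sec[OF tc(2)] sec[OF tc(3)] z1)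
  show c1: "continuous_on {\<epsilon>..t} (\<lambda>s. ip (flow s) (source s))" by (rule ip_continuous_param[OF fc(1) tc(1)])
  show c2: "continuous_on {\<epsilon>..t} (\<lambda>s. flux (flow s) (flow' s) s)" by (rule flux_cont[OF fc])
  define R where "R n s = ip (partial n s) (source s) + flux (partial n s) (partial' n s) s" for n s
  have Rc: "continuous_on {\<epsilon>..t} (R n)" for n
    unfolding R_def by (intro continuous_intros ip_continuous_param flux_cont pc tc)
  have ul: "uniform_limit ({\<epsilon>..t} \<times> {0..1}) (\<lambda>n (s, q). partial n s q) (\<lambda>(s, q). flow s q) sequentially"
    "uniform_limit ({\<epsilon>..t} \<times> {0..1}) (\<lambda>n (s, q). partial' n s q) (\<lambda>(s, q). flow' s q) sequentially"
    by (rule uniform_limit_on_subset[OF partial_uniform_limit(1)[OF e(1)] sub(2)])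
      (rule uniform_limit_on_subset[OF partial_uniform_limit(2)[OF e(1)] sub(2)])
  have bd: "bounded (h ` {\<epsilon>..t})" if "continuous_on {\<epsilon>..t} h" for h :: "real \<Rightarrow> real"
    by (intro compact_imp_bounded compact_continuous_image that) auto
  have trace: "uniform_limit {\<epsilon>..t} (\<lambda>n s. u n s q * h s) (\<lambda>s. v s q * h s) sequentially"
    if "uniform_limit ({\<epsilon>..t} \<times> {0..1}) (\<lambda>n (s, q). u n s q) (\<lambda>(s, q). v s q) sequentially"
      "continuous_on ({\<epsilon>..t} \<times> {0..1}) (\<lambda>(s, q). v s q)" "continuous_on {\<epsilon>..t} h" "q \<in> {0..1}"
    for u :: "nat \<Rightarrow> real \<Rightarrow> real \<Rightarrow> real" and v :: "real \<Rightarrow> real \<Rightarrow> real" and h q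
  proof -
    have "uniform_limit {\<epsilon>..t} (\<lambda>n s. u n s q) (\<lambda>s. v s q) sequentially"
      using uniform_limit_compose'[OF that(1), of "\<lambda>s. (s, q)" "{\<epsilon>..t}"] that(4) by (simp add: Pi_def)
    then show ?thesis
      by (intro uniform_lim_mult uniform_limit_const bd that(3) sec[OF that(2)] that(4))
  qed
  note tG = sec[OF tc(2)] note tGq = sec[OF tc(3)]
  obtain K where K: "\<And>s q. s \<in> {0..T} \<Longrightarrow> q \<in> {0..1} \<Longrightarrow> \<bar>G s q\<bar> \<le> K \<and> \<bar>Gq s q\<bar> \<le> K \<and> \<bar>source s q\<bar> \<le> K"
    using test_bounded by metis
  have "uniform_limit {\<epsilon>..t} (\<lambda>n s. ip (partial n s) (source s)) (\<lambda>s. ip (flow s) (source s)) sequentially"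
  proof (rule ip_uniform_limit[OF ul(1)])
    show "\<bar>source s q\<bar> \<le> K" if "s \<in> {\<epsilon>..t}" "q \<in> {0..1}" for s q using K that sub(4) by blast
  qed (use continuous_on_section(1)[OF fc(1)] continuous_on_section(1)[OF tc(1)] partial_section_continuous in auto)
  moreover have "uniform_limit {\<epsilon>..t} (\<lambda>n s. flux (partial n s) (partial' n s) s) (\<lambda>s. flux (flow s) (flow' s) s) sequentially"
  proof -
    have "uniform_limit {\<epsilon>..t}
      (\<lambda>n s. partial' n s 1 * G s 1 - partial n s 1 * Gq s 1 - partial' n s 0 * G s 0 + partial n s 0 * Gq s 0)
      (\<lambda>s. flow' s 1 * G s 1 - flow s 1 * Gq s 1 - flow' s 0 * G s 0 + flow s 0 * Gq s 0) sequentially"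
      by (intro uniform_limit_add uniform_limit_minus trace ul fc tG tGq z1)
    from bounded_linear.uniform_limit[OF bounded_linear_mult_right[of "1 / 2"] this]
    show ?thesis by (simp only: flux_def)
  qed
  ultimately have "uniform_limit {\<epsilon>..t} R (\<lambda>s. ip (flow s) (source s) + flux (flow s) (flow' s) s) sequentially"
    unfolding R_def by (rule uniform_limit_add)
  then obtain I J where I: "\<And>n. (R n has_integral I n) {\<epsilon>..t}"
    "((\<lambda>s. ip (flow s) (source s) + flux (flow s) (flow' s) s) has_integral J) {\<epsilon>..t}" "I \<longlonglongrightarrow> J"
    by (rule uniform_limit_integral[OF _ Rc]) auto
  have hi: "(R n has_integral ip (partial n t) (G t) - ip (partial n \<epsilon>) (G \<epsilon>)) {\<epsilon>..t}" for n
  proof (rule fundamental_theorem_of_calculus[OF e(2)])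
    fix s assume "s \<in> {\<epsilon>..t}"
    then have "((\<lambda>s. ip (partial n s) (G s)) has_real_derivative R n s) (at s within {\<epsilon>..t})"
      unfolding R_def using partial_weak_derivative[of s n] sub(4) by (blast intro: DERIV_subset)
    then show "((\<lambda>s. ip (partial n s) (G s)) has_vector_derivative R n s) (at s within {\<epsilon>..t})"
      by (simp add: has_real_derivative_iff_has_vector_derivative)
  qed
  have I_eq: "I = (\<lambda>n. ip (partial n t) (G t) - ip (partial n \<epsilon>) (G \<epsilon>))"
    by (rule ext, rule has_integral_unique[OF I(1) hi])
  have tT: "t \<in> {0..T}" "\<epsilon> \<in> {0..T}" using e by auto
  have "I \<longlonglongrightarrow> ip (flow t) (G t) - ip (flow \<epsilon>) (G \<epsilon>)"
    unfolding I_eq using e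
    by (intro tendsto_diff ip_tendsto partial_section_uniform_limit partial_section_continuous
        continuous_on_section(1)[OF test_continuous(1)] tT) auto
  then have "J = ip (flow t) (G t) - ip (flow \<epsilon>) (G \<epsilon>)" by (rule LIMSEQ_unique[OF I(3)])
  then show "ip (flow t) (G t) - ip (flow \<epsilon>) (G \<epsilon>) =
    integral {\<epsilon>..t} (\<lambda>s. ip (flow s) (source s) + flux (flow s) (flow' s) s)"
    using integral_unique[OF I(2)] by simp
qed

end

context heat_flow
begin

text \<open>The initial value is attained weakly. Each mode is continuous at time 0, and the
  remainder after finitely many modes is small uniformly in time because the solution takes values
  in \<open>[0, 1]\<close>.\<close>

lemma flow_initial_limit:
  assumes range: "\<And>s q. s \<ge> 0 \<Longrightarrow> q \<in> {0..1} \<Longrightarrow> solution s q \<in> {0..1}"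
    and h: "cont01 h" and e: "\<And>k. 0 < \<epsilon> k" "\<epsilon> \<longlonglongrightarrow> 0"
  shows "(\<lambda>k. ip h (flow (\<epsilon> k))) \<longlonglongrightarrow> (LINT q:{0..1}|lebesgue. h q * g q)"
proof -
  define l where "l s u = (LINT q:{0..1}|lebesgue. u q * solution s q)" for s u
  have bd: "\<bar>solution s q\<bar> \<le> 1" if "s \<ge> 0" "q \<in> {0..1}" for s q using range[OF that] by auto
  have "(\<lambda>k. l (\<epsilon> k) h) \<longlonglongrightarrow> l 0 h"
  proof (rule LIMSEQ_I)
    fix r :: real assume r: "r > 0"
    have "(r / 4)\<^sup>2 > 0" using r by simp
    then obtain n c where nc: "ip (\<lambda>x. h x - (\<Sum>i<n. c i * \<phi> i x)) (\<lambda>x. h x - (\<Sum>i<n. c i * \<phi> i x)) < (r / 4)\<^sup>2"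
      using phi_dense[OF h] by blast
    define H where "H x = h x - (\<Sum>i<n. c i * \<phi> i x)" for x
    have Hc: "cont01 H" unfolding H_def by (intro continuous_intros h phi_continuous)
    have split: "l s h = l s H + (\<Sum>i<n. c i * mode i s)" if s: "s \<ge> 0" for s
    proof -
      have tc: "set_integrable lebesgue {0..1} (\<lambda>q. u q * solution s q)" if "cont01 u" for u
        by (rule times_continuous_absolutely_integrable[OF solution_measurable bd[OF s] that])
      have Sc: "cont01 (\<lambda>q. \<Sum>i<n. c i * \<phi> i q)" by (intro continuous_intros phi_continuous)
      have "l s h = (LINT q:{0..1}|lebesgue. H q * solution s q + (\<Sum>i<n. c i * \<phi> i q) * solution s q)"
        unfolding l_def H_def by (simp add: algebra_simps)
      also have "\<dots> = l s H + (LINT q:{0..1}|lebesgue. (\<Sum>i<n. c i * \<phi> i q) * solution s q)"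
        unfolding l_def by (rule set_integral_add(2)[OF tc[OF Hc] tc[OF Sc]])
      also have "(LINT q:{0..1}|lebesgue. (\<Sum>i<n. c i * \<phi> i q) * solution s q) = (\<Sum>i<n. c i * (LINT q:{0..1}|lebesgue. \<phi> i q * solution s q))"
        by (rule LINT_sum_times[OF solution_measurable bd[OF s] phi_continuous])
      finally show ?thesis by (simp add: mode_solution[OF s])
    qed
    have small: "\<bar>l s H\<bar> \<le> r / 4" if s: "s \<ge> 0" for s
    proof -
      have "(l s H)\<^sup>2 \<le> 1\<^sup>2 * ip H H" unfolding l_def by (rule LINT_times_bound[OF solution_measurable bd[OF s] Hc])
      then have "(l s H)\<^sup>2 \<le> (r / 4)\<^sup>2" using nc by (simp add: H_def[abs_def])
      then show ?thesis using r by (simp add: abs_le_square_iff[symmetric])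
    qed
    have mc: "continuous_on UNIV (mode i)" for i by (rule DERIV_continuous_on) (rule mode_ode)
    have "(\<lambda>k. mode i (\<epsilon> k)) \<longlonglongrightarrow> mode i 0" for i
      using continuous_on_tendsto_compose[OF mc[of i] e(2)] by simp
    then have "(\<lambda>k. \<Sum>i<n. c i * mode i (\<epsilon> k)) \<longlonglongrightarrow> (\<Sum>i<n. c i * mode i 0)" by (intro tendsto_intros)
    then obtain k0 where k0: "\<And>k. k \<ge> k0 \<Longrightarrow> \<bar>(\<Sum>i<n. c i * mode i (\<epsilon> k)) - (\<Sum>i<n. c i * mode i 0)\<bar> < r / 4"
      using LIMSEQ_D[of _ _ "r / 4"] r by fastforce
    have "norm (l (\<epsilon> k) h - l 0 h) < r" if "k \<ge> k0" for k
    proof -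
      have ek: "0 \<le> \<epsilon> k" using e(1)[of k] by simp
      show ?thesis
        unfolding real_norm_def split[OF ek] split[OF order_refl]
        using k0[OF that] small[OF ek] small[OF order_refl] r by linarith
    qed
    then show "\<exists>no. \<forall>k\<ge>no. norm (l (\<epsilon> k) h - l 0 h) < r" by blast
  qed
  moreover have "l (\<epsilon> k) h = ip h (flow (\<epsilon> k))" for k
    unfolding l_def using e(1)[of k] LINT_times_continuous[OF h flow_section_continuous(1)] by (simp add: solution_def)
  ultimately show ?thesis by (simp add: l_def solution_def)
qed

end

context tested_flow
begin

text \<open>The flux contains boundary derivatives of the flow, for which no bound near time 0 is
  available. \<open>Y\<close> is a form of the flux from which the boundary conditions have removed
  these derivatives; it is bounded, so the limit \<open>\<epsilon> \<longrightarrow> 0\<close> is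
  permitted.\<close>

lemma solution_weak_identity:
  assumes range: "\<And>s q. s \<ge> 0 \<Longrightarrow> q \<in> {0..1} \<Longrightarrow> solution s q \<in> {0..1}"
    and t: "t \<in> {0..T}"
    and Y: "\<And>s. s \<in> {0<..t} \<Longrightarrow> Y s = flux (flow s) (flow' s) s" "\<And>s. s \<in> {0..t} \<Longrightarrow> \<bar>Y s\<bar> \<le> K"
  shows "heat_terms g solution G Gt Gqq t = (LINT s:{0..t}|lebesgue. Y s)"
proof (cases "t = 0")
  case True
  have "(LINT s:{0..0::real}|lebesgue. F s) = 0" for F :: "real \<Rightarrow> real"
  proof -
    have "set_integrable lebesgue {0..0::real} F"
      by (rule bounded_measurable_absolutely_integrable[where R = "\<bar>F 0\<bar>"]) (auto intro!: continuous_imp_measurable_on_sets_lebesgue)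
    then show ?thesis using set_lebesgue_integral_eq_integral(2)[of "{0..0}" F] by simp
  qed
  then show ?thesis using True by (simp add: heat_terms_def solution_def)
next
  case False
  then have t0: "t > 0" "t \<le> T" using t by auto
  obtain B where B: "B > 0" "\<And>s q. s \<in> {0..T} \<Longrightarrow> q \<in> {0..1} \<Longrightarrow> \<bar>G s q\<bar> \<le> B \<and> \<bar>Gq s q\<bar> \<le> B \<and> \<bar>source s q\<bar> \<le> B"
    using test_bounded by metis
  have bd: "\<bar>solution s q\<bar> \<le> 1" if "s \<ge> 0" "q \<in> {0..1}" for s q using range[OF that] by auto
  define X where "X s = (LINT q:{0..1}|lebesgue. solution s q * source s q)" for s
  have X_flow: "X s = ip (flow s) (source s)" if "s \<in> {0<..t}" for s
    unfolding X_def using that t0 LINT_times_continuous[OF flow_section_continuous(1) continuous_on_section(1)[OF source_continuous]]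
    by (simp add: solution_def)
  have Xb: "\<bar>X s\<bar> \<le> B" if s: "s \<in> {0..t}" for s
  proof -
    have s': "s \<ge> 0" "s \<in> {0..T}" using s t0 by auto
    have sc: "cont01 (source s)" by (rule continuous_on_section(1)[OF source_continuous s'(2)])
    have "(X s)\<^sup>2 \<le> 1\<^sup>2 * ip (source s) (source s)"
      unfolding X_def using LINT_times_bound[OF solution_measurable bd[OF s'(1)] sc] by (simp add: mult.commute)
    also have "\<dots> \<le> B\<^sup>2" using ip_le_bound[OF sc, of B] B(2)[OF s'(2)] by simp
    finally show ?thesis using B(1) by (simp add: abs_le_square_iff[symmetric])
  qed
  have cX: "continuous_on {\<epsilon>..t} X" and cY: "continuous_on {\<epsilon>..t} Y" if "0 < \<epsilon>" for \<epsilon>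
  proof -
    have "continuous_on {\<epsilon>..t} X \<and> continuous_on {\<epsilon>..t} Y"
    proof (cases "\<epsilon> \<le> t")
      case True
      have "continuous_on {\<epsilon>..t} X"
        by (rule continuous_on_eq[OF flow_weak_identity(2)[OF that True t0(2)]]) (use that in \<open>simp add: X_flow\<close>)
      moreover have "continuous_on {\<epsilon>..t} Y"
        by (rule continuous_on_eq[OF flow_weak_identity(3)[OF that True t0(2)]]) (use that in \<open>simp add: Y(1)\<close>)
      ultimately show ?thesis ..
    qed simp
    then show "continuous_on {\<epsilon>..t} X" "continuous_on {\<epsilon>..t} Y" by auto
  qed
  note iX = bounded_continuous_integrable[OF cX Xb]
  note iY = bounded_continuous_integrable[OF cY Y(2)]
  have iXY: "set_integrable lebesgue {0..t} (\<lambda>s. X s + Y s)" by (rule set_integral_add(1)[OF iX iY])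
  define \<epsilon> where "\<epsilon> k = t / real (Suc k)" for k
  have e: "0 < \<epsilon> k" "\<epsilon> k \<le> t" for k using t0 by (auto simp: \<epsilon>_def field_simps)
  have e0: "\<epsilon> \<longlonglongrightarrow> 0"
  proof -
    have "(\<lambda>k. t * inverse (real (Suc k))) \<longlonglongrightarrow> t * 0" by (intro tendsto_mult tendsto_const LIMSEQ_inverse_real_of_nat)
    then show ?thesis unfolding \<epsilon>_def[abs_def] divide_inverse by simp
  qed
  have "(\<lambda>k. integral {\<epsilon> k..t} (\<lambda>s. X s + Y s)) \<longlonglongrightarrow> (LINT s:{0..t}|lebesgue. X s + Y s)"
  proof (rule integral_tendsto_LINT[OF iXY _ e e0])
    show "\<bar>X s + Y s\<bar> \<le> B + K" if "s \<in> {0..t}" for s using Xb[OF that] Y(2)[OF that] by linarith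
  qed
  moreover have "integral {\<epsilon> k..t} (\<lambda>s. X s + Y s) = ip (flow t) (G t) - ip (flow (\<epsilon> k)) (G (\<epsilon> k))" for k
    unfolding flow_weak_identity(1)[OF e t0(2)]
    by (rule integral_cong) (use e(1)[of k] in \<open>auto simp: X_flow Y(1)\<close>)
  moreover have "(\<lambda>k. ip (flow t) (G t) - ip (flow (\<epsilon> k)) (G (\<epsilon> k))) \<longlonglongrightarrow> ip (flow t) (G t) - (LINT q:{0..1}|lebesgue. g q * G 0 q)"
  proof (intro tendsto_diff tendsto_const)
    have T0: "0 \<in> {0..T}" using t0 by auto
    have Gc: "cont01 (G s)" if "s \<in> {0..T}" for s by (rule continuous_on_section(1)[OF test_continuous(1) that])
    have eT: "\<epsilon> k \<in> {0..T}" for k using e[of k] t0 by auto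
    have l1: "(\<lambda>k. ip (G 0) (flow (\<epsilon> k))) \<longlonglongrightarrow> (LINT q:{0..1}|lebesgue. G 0 q * g q)"
      by (rule flow_initial_limit[OF range Gc[OF T0] e(1) e0])
    \<comment> \<open>\<open>flow_initial_limit\<close> covers a fixed test function; the moving
      part \<open>G s - G 0\<close> tends to 0 in mean square while the flow stays in
      \<open>[0, 1]\<close>.\<close>
    define D where "D s q = G s q - G 0 q" for s q
    have Dc: "continuous_on ({0..T} \<times> {0..1}) (\<lambda>(s, q). D s q)"
      unfolding D_def case_prod_beta'
      using test_continuous(1) by (auto simp: case_prod_beta' intro!: continuous_intros continuous_on_compose2[OF Gc[OF T0]])
    have "continuous_on {0..T} (\<lambda>s. ip (D s) (D s))" by (rule ip_continuous_param[OF Dc Dc])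
    then have "(\<lambda>k. ip (D (\<epsilon> k)) (D (\<epsilon> k))) \<longlonglongrightarrow> ip (D 0) (D 0)"
      by (rule continuous_on_tendsto_compose[OF _ e0 T0]) (use eT in auto)
    then have D0: "(\<lambda>k. ip (D (\<epsilon> k)) (D (\<epsilon> k))) \<longlonglongrightarrow> 0" by (simp add: D_def ip_def)
    have Dk: "cont01 (D (\<epsilon> k))" for k by (rule continuous_on_section(1)[OF Dc eT])
    have fk: "cont01 (flow (\<epsilon> k))" for k by (rule flow_section_continuous(1)[OF e(1)])
    have "(ip (D (\<epsilon> k)) (flow (\<epsilon> k)))\<^sup>2 \<le> ip (D (\<epsilon> k)) (D (\<epsilon> k))" for k
    proof -
      have "ip (flow (\<epsilon> k)) (flow (\<epsilon> k)) \<le> 1\<^sup>2"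
        using bd[of "\<epsilon> k"] e(1)[of k] by (intro ip_le_bound fk) (auto simp: solution_def)
      then have "ip (D (\<epsilon> k)) (D (\<epsilon> k)) * ip (flow (\<epsilon> k)) (flow (\<epsilon> k)) \<le> ip (D (\<epsilon> k)) (D (\<epsilon> k)) * 1"
        by (intro mult_left_mono ip_nonneg) auto
      then show ?thesis using ip_Cauchy_Schwarz[OF Dk[of k] fk[of k]] by linarith
    qed
    then have "(\<lambda>k. (ip (D (\<epsilon> k)) (flow (\<epsilon> k)))\<^sup>2) \<longlonglongrightarrow> 0"
      by (intro tendsto_sandwich[OF _ _ tendsto_const D0]) auto
    then have l2: "(\<lambda>k. ip (D (\<epsilon> k)) (flow (\<epsilon> k))) \<longlonglongrightarrow> 0" by simp
    have "ip (D (\<epsilon> k)) (flow (\<epsilon> k)) + ip (G 0) (flow (\<epsilon> k)) = ip (flow (\<epsilon> k)) (G (\<epsilon> k))" for k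
      unfolding D_def using ip_diff_left[OF Gc[OF eT] Gc[OF T0] fk] by (simp add: ip_commute)
    then show "(\<lambda>k. ip (flow (\<epsilon> k)) (G (\<epsilon> k))) \<longlonglongrightarrow> (LINT q:{0..1}|lebesgue. g q * G 0 q)"
      using tendsto_add[OF l2 l1] by (simp add: mult.commute)
  qed
  ultimately have "(LINT s:{0..t}|lebesgue. X s + Y s) = ip (flow t) (G t) - (LINT q:{0..1}|lebesgue. g q * G 0 q)"
    using LIMSEQ_unique by fastforce
  moreover have "(LINT s:{0..t}|lebesgue. X s + Y s) = (LINT s:{0..t}|lebesgue. X s) + (LINT s:{0..t}|lebesgue. Y s)"
    by (rule set_integral_add(2)[OF iX iY])
  moreover have "(LINT q:{0..1}|lebesgue. solution t q * G t q) = ip (flow t) (G t)"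
    using t0 LINT_times_continuous[OF flow_section_continuous(1)[OF t0(1)] continuous_on_section(1)[OF test_continuous(1), of t]] t
    by (simp add: solution_def)
  ultimately show ?thesis unfolding heat_terms_def X_def source_def by simp
qed

lemma boundary_value_integrable:
  assumes range: "\<And>s q. s \<ge> 0 \<Longrightarrow> q \<in> {0..1} \<Longrightarrow> solution s q \<in> {0..1}"
    and t: "t \<in> {0..T}" and q: "q \<in> {0..1}" and F: "F = G \<or> F = Gq"
  shows "set_integrable lebesgue {0..t} (\<lambda>s. solution s q * F s q)" "set_integrable lebesgue {0..t} (\<lambda>s. F s q)"
    "\<exists>B. \<forall>s\<in>{0..t}. \<bar>F s q\<bar> \<le> B"
proof -
  obtain B where B: "B > 0" "\<And>s q. s \<in> {0..T} \<Longrightarrow> q \<in> {0..1} \<Longrightarrow> \<bar>G s q\<bar> \<le> B \<and> \<bar>Gq s q\<bar> \<le> B \<and> \<bar>source s q\<bar> \<le> B"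
    using test_bounded by metis
  have Fb: "\<bar>F s q\<bar> \<le> B" if "s \<in> {0..t}" for s using B(2)[of s q] that t q F by auto
  then show "\<exists>B. \<forall>s\<in>{0..t}. \<bar>F s q\<bar> \<le> B" by blast
  have "continuous_on ({0..T} \<times> {0..1}) (\<lambda>(s, q). F s q)" using F test_continuous by auto
  then have "continuous_on {0..T} (\<lambda>s. F s q)" by (rule continuous_on_section(2)) (rule q)
  then have Fc: "continuous_on {0..t} (\<lambda>s. F s q)" by (rule continuous_on_subset) (use t in auto)
  then show "set_integrable lebesgue {0..t} (\<lambda>s. F s q)" by (rule absolutely_integrable_continuous_real)
  show "set_integrable lebesgue {0..t} (\<lambda>s. solution s q * F s q)"
  proof (rule bounded_continuous_integrable)
    fix \<epsilon> :: real assume e: "0 < \<epsilon>"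
    have "continuous_on {\<epsilon>..t} (\<lambda>s. flow s q)"
      using continuous_on_section(2)[OF flow_continuous(1)[OF e] q] by (rule continuous_on_subset) auto
    then have "continuous_on {\<epsilon>..t} (\<lambda>s. flow s q * F s q)"
      using e by (intro continuous_on_mult continuous_on_subset[OF Fc]) auto
    then show "continuous_on {\<epsilon>..t} (\<lambda>s. solution s q * F s q)"
      by (rule continuous_on_eq) (use e in \<open>auto simp: solution_def\<close>)
  next
    fix s assume s: "s \<in> {0..t}"
    have "\<bar>solution s q\<bar> \<le> 1" using range[of s q] s q by auto
    then have "\<bar>solution s q\<bar> * \<bar>F s q\<bar> \<le> 1 * B" using Fb[OF s] by (intro mult_mono) auto
    then show "\<bar>solution s q * F s q\<bar> \<le> B" by (simp add: abs_mult)
  qed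
qed

text \<open>With \<open>a = 1\<close> the boundary derivatives of the flow equal \<open>b\<close>
  times boundary values, which turns the flux into the two boundary integrals of the Robin
  formulation, with bounded integrands.\<close>

lemma solution_weak_Rob:
  assumes range: "\<And>s q. s \<ge> 0 \<Longrightarrow> q \<in> {0..1} \<Longrightarrow> solution s q \<in> {0..1}"
    and t: "t \<in> {0..T}" and ab: "a = 1"
  shows "heat_terms g solution G Gt Gqq t +
      1 / 2 * (LINT s:{0..t}|lebesgue. solution s 1 * Gq s 1 - solution s 0 * Gq s 0) -
      b / 2 * (LINT s:{0..t}|lebesgue. G s 0 * (\<alpha> - solution s 0) + G s 1 * (\<beta> - solution s 1)) = 0"
proof -
  have z1: "(0::real) \<in> {0..1}" "(1::real) \<in> {0..1}" by auto
  note bi = boundary_value_integrable[OF range t]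
  define Y1 where "Y1 s = solution s 1 * Gq s 1 - solution s 0 * Gq s 0" for s
  define Y2 where "Y2 s = G s 0 * (\<alpha> - solution s 0) + G s 1 * (\<beta> - solution s 1)" for s
  have i1: "set_integrable lebesgue {0..t} Y1"
    unfolding Y1_def by (intro set_integral_diff(1) bi(1) z1) auto
  have "set_integrable lebesgue {0..t} (\<lambda>s. (\<alpha> * G s 0 - solution s 0 * G s 0) + (\<beta> * G s 1 - solution s 1 * G s 1))"
    by (intro set_integral_add(1) set_integral_diff(1) set_integrable_mult_right bi(1,2) z1) auto
  then have i2: "set_integrable lebesgue {0..t} Y2" unfolding Y2_def by (simp add: algebra_simps)
  obtain B where B: "B > 0" "\<And>s q. s \<in> {0..T} \<Longrightarrow> q \<in> {0..1} \<Longrightarrow> \<bar>G s q\<bar> \<le> B \<and> \<bar>Gq s q\<bar> \<le> B \<and> \<bar>source s q\<bar> \<le> B"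
    using test_bounded by metis
  have prod: "\<bar>x * y\<bar> \<le> M * B" if "\<bar>x\<bar> \<le> M" "\<bar>y\<bar> \<le> B" for x y M :: real
    unfolding abs_mult using that B(1) by (intro mult_mono) auto
  have prod': "\<bar>y * x\<bar> \<le> M * B" if "\<bar>x\<bar> \<le> M" "\<bar>y\<bar> \<le> B" for x y M :: real
    using prod[OF that] by (simp add: mult.commute)
  have "heat_terms g solution G Gt Gqq t = (LINT s:{0..t}|lebesgue. (- 1 / 2) * Y1 s + b / 2 * Y2 s)"
  proof (rule solution_weak_identity[OF range t, where K = "B + \<bar>b\<bar> * ((\<bar>\<alpha>\<bar> + 1 + \<bar>\<beta>\<bar> + 1) * B)"])
    fix s assume s: "s \<in> {0<..t}"
    have "flow' s 0 = b * (flow s 0 - \<alpha>)" "flow' s 1 = b * (\<beta> - flow s 1)"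
      using flow_bc[of s] s ab by auto
    moreover have "(- 1 / 2) * (x1 * q1 - x0 * q0) + b / 2 * (g0 * (\<alpha> - x0) + g1 * (\<beta> - x1)) =
      1 / 2 * (b * (\<beta> - x1) * g1 - x1 * q1 - b * (x0 - \<alpha>) * g0 + x0 * q0)" for x0 x1 q0 q1 g0 g1
      by (simp add: field_simps)
    moreover have "solution s = flow s" using s by (simp add: solution_def)
    ultimately show "(- 1 / 2) * Y1 s + b / 2 * Y2 s = flux (flow s) (flow' s) s"
      unfolding Y1_def Y2_def flux_def by (simp only:)
  next
    fix s assume s: "s \<in> {0..t}"
    then have s': "s \<in> {0..T}" using t by auto
    have r: "\<bar>solution s 0\<bar> \<le> 1" "\<bar>solution s 1\<bar> \<le> 1" using range[of s 0] range[of s 1] s by auto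
    note BG = B(2)[OF s' z1(1)] B(2)[OF s' z1(2)]
    have "\<bar>Y1 s\<bar> \<le> 1 * B + 1 * B"
      unfolding Y1_def using prod[OF r(2), of "Gq s 1"] prod[OF r(1), of "Gq s 0"] BG by linarith
    then have y1: "\<bar>(- 1 / 2) * Y1 s\<bar> \<le> B" by simp
    have "\<bar>\<alpha> - solution s 0\<bar> \<le> \<bar>\<alpha>\<bar> + 1" "\<bar>\<beta> - solution s 1\<bar> \<le> \<bar>\<beta>\<bar> + 1" using r by linarith+
    then have "\<bar>Y2 s\<bar> \<le> (\<bar>\<alpha>\<bar> + 1) * B + (\<bar>\<beta>\<bar> + 1) * B"
      unfolding Y2_def using BG by (intro order_trans[OF abs_triangle_ineq add_mono] prod') auto
    also have "(\<bar>\<alpha>\<bar> + 1) * B + (\<bar>\<beta>\<bar> + 1) * B = (\<bar>\<alpha>\<bar> + 1 + \<bar>\<beta>\<bar> + 1) * B"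
      by (simp only: distrib_right add.assoc)
    finally have "\<bar>b / 2\<bar> * \<bar>Y2 s\<bar> \<le> \<bar>b\<bar> * ((\<bar>\<alpha>\<bar> + 1 + \<bar>\<beta>\<bar> + 1) * B)"
      by (intro mult_mono) auto
    then show "\<bar>(- 1 / 2) * Y1 s + b / 2 * Y2 s\<bar> \<le> B + \<bar>b\<bar> * ((\<bar>\<alpha>\<bar> + 1 + \<bar>\<beta>\<bar> + 1) * B)"
      using y1 abs_mult[of "b / 2" "Y2 s"] by linarith
  qed
  also have "\<dots> = (- 1 / 2) * (LINT s:{0..t}|lebesgue. Y1 s) + b / 2 * (LINT s:{0..t}|lebesgue. Y2 s)"
  proof -
    have "(LINT s:{0..t}|lebesgue. (- 1 / 2) * Y1 s + b / 2 * Y2 s) =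
        (LINT s:{0..t}|lebesgue. (- 1 / 2) * Y1 s) + (LINT s:{0..t}|lebesgue. b / 2 * Y2 s)"
      by (intro set_integral_add(2) set_integrable_mult_right i1 i2)
    moreover have "(LINT s:{0..t}|lebesgue. c * Y s) = c * (LINT s:{0..t}|lebesgue. Y s)" for c and Y :: "real \<Rightarrow> real"
      by (rule set_integral_mult_right)
    ultimately show ?thesis by (simp only:)
  qed
  finally show ?thesis unfolding Y1_def Y2_def by simp
qed

text \<open>Boundary derivatives of the flow are multiplied by boundary values of \<open>G\<close>,
  which are 0, and the boundary values of the flow are \<alpha> and \<beta>.\<close>

lemma solution_weak_Dir:
  assumes range: "\<And>s q. s \<ge> 0 \<Longrightarrow> q \<in> {0..1} \<Longrightarrow> solution s q \<in> {0..1}"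
    and t: "t \<in> {0..T}" and ab: "a = 0" and G0: "vanishes_at_boundary T G"
  shows "heat_terms g solution G Gt Gqq t + (LINT s:{0..t}|lebesgue. \<beta> / 2 * Gq s 1 - \<alpha> / 2 * Gq s 0) = 0"
proof -
  have z1: "(0::real) \<in> {0..1}" "(1::real) \<in> {0..1}" by auto
  have b0: "b \<noteq> 0" using ab ab_pos by simp
  obtain B where B: "B > 0" "\<And>s q. s \<in> {0..T} \<Longrightarrow> q \<in> {0..1} \<Longrightarrow> \<bar>G s q\<bar> \<le> B \<and> \<bar>Gq s q\<bar> \<le> B \<and> \<bar>source s q\<bar> \<le> B"
    using test_bounded by metis
  have prod: "\<bar>x * y\<bar> \<le> \<bar>x\<bar> * B" if "\<bar>y\<bar> \<le> B" for x y :: real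
    unfolding abs_mult using that by (intro mult_left_mono) auto
  have "heat_terms g solution G Gt Gqq t = (LINT s:{0..t}|lebesgue. - (\<beta> / 2 * Gq s 1 - \<alpha> / 2 * Gq s 0))"
  proof (rule solution_weak_identity[OF range t, where K = "\<bar>\<beta> / 2\<bar> * B + \<bar>\<alpha> / 2\<bar> * B"])
    fix s assume s: "s \<in> {0<..t}"
    have "flow s 0 = \<alpha>" "flow s 1 = \<beta>" using flow_bc[of s] s ab b0 by auto
    moreover have "G s 0 = 0" "G s 1 = 0" using G0 s t by (auto simp: vanishes_at_boundary_def)
    ultimately show "- (\<beta> / 2 * Gq s 1 - \<alpha> / 2 * Gq s 0) = flux (flow s) (flow' s) s"
      by (simp add: flux_def)
  next
    fix s assume s: "s \<in> {0..t}"
    then have s': "s \<in> {0..T}" using t by auto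
    show "\<bar>- (\<beta> / 2 * Gq s 1 - \<alpha> / 2 * Gq s 0)\<bar> \<le> \<bar>\<beta> / 2\<bar> * B + \<bar>\<alpha> / 2\<bar> * B"
    proof -
      have "\<bar>- (x - y)\<bar> \<le> \<bar>x\<bar> + \<bar>y\<bar>" for x y :: real by linarith
      from order_trans[OF this add_mono] show ?thesis
        using B(2)[OF s' z1(1)] B(2)[OF s' z1(2)] prod by blast
    qed
  qed
  also have "\<dots> = - (LINT s:{0..t}|lebesgue. \<beta> / 2 * Gq s 1 - \<alpha> / 2 * Gq s 0)"
    unfolding set_lebesgue_integral_def scaleR_minus_right by (rule Bochner_Integration.integral_minus)
  finally show ?thesis by simp
qed

end

subsection \<open>Sobolev regularity of the limiting density\<close>

lemma LINT_lebesgue_on: "(LINT q:{s..t}|lebesgue. f q) = integral\<^sup>L (lebesgue_on {s..t}) (f :: real \<Rightarrow> real)"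
  by (simp add: integral_restrict_space set_lebesgue_integral_def)

lemma set_integrable_lebesgue_on: "set_integrable lebesgue {s..t} (f :: real \<Rightarrow> real) \<longleftrightarrow> integrable (lebesgue_on {s..t}) f"
  by (simp add: integrable_restrict_space set_integrable_def)

lemma AE_lebesgue_on: "(AE q in lebesgue_on {s..t::real}. P q) \<longleftrightarrow> (AE q in lebesgue. q \<in> {s..t} \<longrightarrow> P q)"
  by (simp add: AE_restrict_space_iff)

text \<open>Testing against a bounded continuous approximation of \<open>sgn z\<close> gives \<open>\<integral> \<bar>z\<bar> = 0\<close>.\<close>

lemma orthogonal_continuous_AE_zero:
  fixes z :: "real \<Rightarrow> real"
  assumes z: "set_integrable lebesgue {0..1} z"
    and orth: "\<And>h. cont01 h \<Longrightarrow> (LINT q:{0..1}|lebesgue. h q * z q) = 0"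
  shows "AE q in lebesgue_on {0..1}. z q = 0"
proof -
  define Z where "Z q = indicator {0..1} q *\<^sub>R z q" for q :: real
  have Zi: "integrable lebesgue Z" using z unfolding set_integrable_def Z_def .
  have Zm: "Z \<in> borel_measurable lebesgue" by (rule borel_measurable_integrable[OF Zi])
  define u where "u q = (if Z q > 0 then 1 else if Z q < 0 then - 1 else 0 :: real)" for q
  have um: "u \<in> borel_measurable lebesgue" unfolding u_def using Zm by measurable
  then have "u measurable_on UNIV" by (rule lebesgue_measurable_imp_measurable_on_real) simp
  then obtain N gg where N: "negligible N" "\<And>n. continuous_on UNIV (gg n)" "\<And>x. x \<notin> N \<Longrightarrow> (\<lambda>n. gg n x) \<longlonglongrightarrow> u x"
    unfolding measurable_on_def by auto
  define h where "h n q = max (- 1) (min 1 (gg n q))" for n :: nat and q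
  have hc: "continuous_on UNIV (h n)" for n unfolding h_def by (intro continuous_intros N(2))
  have hb: "\<bar>h n q\<bar> \<le> 1" for n q by (auto simp: h_def)
  have hl: "(\<lambda>n. h n q) \<longlonglongrightarrow> u q" if "q \<notin> N" for q
  proof -
    have "(\<lambda>n. h n q) \<longlonglongrightarrow> max (- 1) (min 1 (u q))" unfolding h_def by (intro tendsto_intros N(3) that)
    moreover have "max (- 1) (min 1 (u q)) = u q" by (simp add: u_def)
    ultimately show ?thesis by simp
  qed
  have AEN: "AE q in lebesgue. q \<notin> N" using N(1) by (simp add: negligible_iff_null_sets AE_not_in)
  have "(\<lambda>n. \<integral>q. h n q * Z q \<partial>lebesgue) \<longlonglongrightarrow> (\<integral>q. u q * Z q \<partial>lebesgue)"
  proof (rule integral_dominated_convergence[where w = "\<lambda>q. \<bar>Z q\<bar>"])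
    show "(\<lambda>q. u q * Z q) \<in> borel_measurable lebesgue" by (intro borel_measurable_times um Zm)
    show "(\<lambda>q. h n q * Z q) \<in> borel_measurable lebesgue" for n
    proof -
      have "h n \<in> borel_measurable borel" by (rule borel_measurable_continuous_onI[OF hc])
      then have "h n \<in> borel_measurable lebesgue" by (intro measurable_completion) simp
      then show ?thesis by (intro borel_measurable_times Zm)
    qed
    show "integrable lebesgue (\<lambda>q. \<bar>Z q\<bar>)" by (intro integrable_abs Zi)
    show "AE q in lebesgue. (\<lambda>n. h n q * Z q) \<longlonglongrightarrow> u q * Z q"
      using AEN by eventually_elim (intro tendsto_intros hl)
    show "AE q in lebesgue. norm (h n q * Z q) \<le> \<bar>Z q\<bar>" for n
      using hb mult_right_mono[OF hb abs_ge_zero] by (auto simp: abs_mult)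
  qed
  moreover have "(\<integral>q. h n q * Z q \<partial>lebesgue) = 0" for n
  proof -
    have "(\<integral>q. h n q * Z q \<partial>lebesgue) = (LINT q:{0..1}|lebesgue. h n q * z q)"
      unfolding set_lebesgue_integral_def Z_def by (simp add: mult_ac)
    also have "\<dots> = 0" by (rule orth) (rule continuous_on_subset[OF hc], simp)
    finally show ?thesis .
  qed
  ultimately have "(\<integral>q. u q * Z q \<partial>lebesgue) = 0" using LIMSEQ_unique[OF _ tendsto_const] by simp
  moreover have "u q * Z q = \<bar>Z q\<bar>" for q by (simp add: u_def)
  ultimately have "(\<integral>q. \<bar>Z q\<bar> \<partial>lebesgue) = 0" by simp
  then have "AE q in lebesgue. \<bar>Z q\<bar> = 0"
    using integral_nonneg_eq_0_iff_AE[OF integrable_abs[OF Zi]] by simp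
  then show ?thesis unfolding AE_lebesgue_on by eventually_elim (simp add: Z_def indicator_def)
qed

section \<open>Smooth cutoffs\<close>

lemma max_power_derivative:
  "((\<lambda>x. max 0 x ^ Suc (Suc n)) has_real_derivative real (Suc (Suc n)) * max 0 x ^ Suc n) (at x)" for x :: real
proof -
  consider "x < 0" | "x > 0" | "x = 0" by linarith
  then show ?thesis
  proof cases
    case 1
    have "((\<lambda>x. max 0 x ^ Suc (Suc n)) has_real_derivative 0) (at x)"
      by (rule has_field_derivative_transform_within_open[OF DERIV_const[of 0], of "{..<0}"]) (use 1 in auto)
    moreover have "real (Suc (Suc n)) * max 0 x ^ Suc n = 0" using 1 by simp
    ultimately show ?thesis by (simp only:)
  next
    case 2
    have "((\<lambda>x. x ^ Suc (Suc n)) has_real_derivative real (Suc (Suc n)) * x ^ Suc n) (at x)"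
      using DERIV_pow[of "Suc (Suc n)" x UNIV] by simp
    then have "((\<lambda>x. max 0 x ^ Suc (Suc n)) has_real_derivative real (Suc (Suc n)) * x ^ Suc n) (at x)"
      by (rule has_field_derivative_transform_within_open[of _ _ _ "{0<..}"]) (use 2 in simp_all)
    moreover have "max 0 x = x" using 2 by simp
    ultimately show ?thesis by (simp only:)
  next
    case 3
    have "(\<lambda>y. max 0 y ^ Suc (Suc n) / y) \<midarrow>0\<rightarrow> (0::real)"
    proof (rule Lim_null_comparison)
      show "\<forall>\<^sub>F y in at 0. norm (max 0 y ^ Suc (Suc n) / y) \<le> \<bar>max 0 y ^ Suc n\<bar>"
        by (auto simp: eventually_at_filter max_def power_abs abs_mult)
      have "((\<lambda>y. \<bar>max 0 y ^ Suc n\<bar>) \<longlongrightarrow> \<bar>max 0 0 ^ Suc n\<bar>) (at (0::real))" by (intro tendsto_intros)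
      then show "((\<lambda>y. \<bar>max 0 y ^ Suc n\<bar>) \<longlongrightarrow> 0) (at (0::real))" by simp
    qed
    then show ?thesis using 3 by (simp add: has_field_derivative_iff)
  qed
qed

text \<open>On \<open>[0,1]\<close> the \<open>C\<^sup>2\<close> step is the polynomial \<open>1 - (1 - x\<^sup>3)\<^sup>3\<close>, whose first two derivatives vanish at
  both ends.\<close>

definition cube :: "real \<Rightarrow> real" where "cube x = max 0 x ^ 3"
definition cube' :: "real \<Rightarrow> real" where "cube' x = 3 * max 0 x ^ 2"
definition cube'' :: "real \<Rightarrow> real" where "cube'' x = 6 * max 0 x"
definition step :: "real \<Rightarrow> real" where "step x = 1 - cube (1 - cube x)"
definition step' :: "real \<Rightarrow> real" where "step' x = cube' (1 - cube x) * cube' x"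
definition step'' :: "real \<Rightarrow> real" where
  "step'' x = - (cube'' (1 - cube x) * cube' x * cube' x) + cube' (1 - cube x) * cube'' x"

lemma cube_derivatives:
  "(cube has_real_derivative cube' x) (at x)" "(cube' has_real_derivative cube'' x) (at x)"
proof -
  show "(cube has_real_derivative cube' x) (at x)"
    using max_power_derivative[of 1 x] by (simp add: cube_def[abs_def] cube'_def numeral_3_eq_3 numeral_2_eq_2)
  have "((\<lambda>x. max 0 x ^ 2) has_real_derivative 2 * max 0 x) (at x)"
    using max_power_derivative[of 0 x] by (simp add: numeral_2_eq_2)
  from DERIV_cmult[OF this, of 3] show "(cube' has_real_derivative cube'' x) (at x)"
    by (simp add: cube'_def[abs_def] cube''_def)
qed

lemma step_derivatives:
  "(step has_real_derivative step' x) (at x)" "(step' has_real_derivative step'' x) (at x)"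
proof -
  have inner: "((\<lambda>x. 1 - cube x) has_real_derivative - cube' x) (at x)"
    using DERIV_diff[OF DERIV_const[of 1] cube_derivatives(1)[of x]] by simp
  have c1: "((\<lambda>x. cube (1 - cube x)) has_real_derivative cube' (1 - cube x) * - cube' x) (at x)"
    by (rule DERIV_chain2[OF cube_derivatives(1) inner])
  have c2: "((\<lambda>x. cube' (1 - cube x)) has_real_derivative cube'' (1 - cube x) * - cube' x) (at x)"
    by (rule DERIV_chain2[OF cube_derivatives(2) inner])
  show "(step has_real_derivative step' x) (at x)"
    using DERIV_diff[OF DERIV_const[of 1] c1] by (simp add: step_def[abs_def] step'_def)
  show "(step' has_real_derivative step'' x) (at x)"
    using DERIV_mult[OF c2 cube_derivatives(2)] by (simp add: step'_def[abs_def] step''_def mult_ac)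
qed

lemma step_values:
  "x \<le> 0 \<Longrightarrow> step x = 0" "x \<ge> 1 \<Longrightarrow> step x = 1" "0 \<le> step x" "step x \<le> 1"
  "x \<ge> 1 \<Longrightarrow> step' x = 0" "0 \<le> step' x" "step' x \<le> 9"
proof -
  have c0: "cube x \<ge> 0" "cube' x \<ge> 0" for x by (auto simp: cube_def cube'_def)
  have c1: "cube x \<le> 1" if "x \<le> 1" for x unfolding cube_def using that by (intro power_le_one) auto
  have c1': "cube' x \<le> 3" if "x \<le> 1" for x
    unfolding cube'_def using that power_le_one[of "max 0 x" 2] by auto
  have c2: "cube x \<ge> 1" if "x \<ge> 1" for x unfolding cube_def using that by (simp add: one_le_power)
  show "x \<le> 0 \<Longrightarrow> step x = 0" by (simp add: step_def cube_def)
  show one: "x \<ge> 1 \<Longrightarrow> step x = 1" using c2[of x] by (simp add: step_def cube_def[of "1 - cube x"])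
  show "0 \<le> step x" using c1[of "1 - cube x"] c0[of x] by (simp add: step_def)
  show "step x \<le> 1" using c0[of "1 - cube x"] by (simp add: step_def)
  show z: "x \<ge> 1 \<Longrightarrow> step' x = 0" using c2[of x] by (simp add: step'_def cube'_def[of "1 - cube x"])
  show "0 \<le> step' x" unfolding step'_def using c0 by simp
  show "step' x \<le> 9"
  proof (cases "x \<ge> 1")
    case False
    have "step' x \<le> 3 * 3"
      unfolding step'_def using c0 c1' False by (intro mult_mono) auto
    then show ?thesis by simp
  qed (simp add: z)
qed

lemma step_continuous: "continuous_on S step" "continuous_on S step'" "continuous_on S step''"
proof -
  have cc: "continuous_on S cube" "continuous_on S cube'" "continuous_on S cube''" for S
    unfolding cube_def cube'_def cube''_def by (intro continuous_intros)+
  note comp = continuous_on_compose2[OF cc(1)[of UNIV]] continuous_on_compose2[OF cc(2)[of UNIV]] continuous_on_compose2[OF cc(3)[of UNIV]]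
  show "continuous_on S step" "continuous_on S step'" "continuous_on S step''"
    unfolding step_def step'_def step''_def by (intro continuous_intros comp cc; simp)+
qed

text \<open>A product of two steps, one for each end: 0 within distance \<open>1 / k\<close> of the
  boundary, 1 from distance \<open>2 / k\<close> on.\<close>

definition cutoff :: "nat \<Rightarrow> real \<Rightarrow> real" where
  "cutoff k q = step (real k * q - 1) * step (real k * (1 - q) - 1)"
definition cutoff' :: "nat \<Rightarrow> real \<Rightarrow> real" where
  "cutoff' k q = step' (real k * q - 1) * real k * step (real k * (1 - q) - 1)
    - step (real k * q - 1) * (step' (real k * (1 - q) - 1) * real k)"
definition cutoff'' :: "nat \<Rightarrow> real \<Rightarrow> real" where
  "cutoff'' k q = step'' (real k * q - 1) * real k * real k * step (real k * (1 - q) - 1)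
    - 2 * (step' (real k * q - 1) * real k * (step' (real k * (1 - q) - 1) * real k))
    + step (real k * q - 1) * (step'' (real k * (1 - q) - 1) * real k * real k)"

lemma cutoff_derivatives:
  "(cutoff k has_real_derivative cutoff' k q) (at q)" "(cutoff' k has_real_derivative cutoff'' k q) (at q)"
proof -
  have l: "((\<lambda>q. real k * q - 1) has_real_derivative real k) (at q)"
    and r: "((\<lambda>q. real k * (1 - q) - 1) has_real_derivative - real k) (at q)"
    by (auto intro!: derivative_eq_intros)
  note L1 = DERIV_chain2[OF step_derivatives(1) l] and L2 = DERIV_chain2[OF step_derivatives(2) l]
    and R1 = DERIV_chain2[OF step_derivatives(1) r] and R2 = DERIV_chain2[OF step_derivatives(2) r]
  show "(cutoff k has_real_derivative cutoff' k q) (at q)"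
    unfolding cutoff_def cutoff'_def by (rule DERIV_cong[OF DERIV_mult[OF L1 R1]]) simp
  show "(cutoff' k has_real_derivative cutoff'' k q) (at q)"
    unfolding cutoff'_def cutoff''_def
    by (rule DERIV_cong[OF DERIV_diff[OF DERIV_mult[OF DERIV_cmult_right[OF L2] R1]
        DERIV_mult[OF L1 DERIV_cmult_right[OF R2]]]]) (simp add: algebra_simps)
qed

lemma cutoff_continuous: "continuous_on S (cutoff k)" "continuous_on S (cutoff' k)" "continuous_on S (cutoff'' k)"
proof -
  note comp = continuous_on_compose2[OF step_continuous(1)[of UNIV]] continuous_on_compose2[OF step_continuous(2)[of UNIV]]
    continuous_on_compose2[OF step_continuous(3)[of UNIV]]
  show "continuous_on S (cutoff k)" "continuous_on S (cutoff' k)" "continuous_on S (cutoff'' k)"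
    unfolding cutoff_def cutoff'_def cutoff''_def by (intro continuous_intros comp; simp)+
qed

text \<open>The constant 18 is twice the bound \<open>3 * 3\<close> on the derivative of the step,
  once for each of the two factors.\<close>

lemma cutoff_values:
  "0 \<le> cutoff k q" "cutoff k q \<le> 1" "\<bar>cutoff' k q\<bar> \<le> 18 * real k"
  "q \<notin> {1 / real k .. 1 - 1 / real k} \<Longrightarrow> k > 0 \<Longrightarrow> cutoff k q = 0 \<and> cutoff' k q = 0"
  "q \<in> {2 / real k .. 1 - 2 / real k} \<Longrightarrow> k > 0 \<Longrightarrow> cutoff k q = 1 \<and> cutoff' k q = 0"
proof -
  show "0 \<le> cutoff k q" unfolding cutoff_def by (intro mult_nonneg_nonneg step_values)
  show "cutoff k q \<le> 1" unfolding cutoff_def using step_values(3,4) by (intro mult_le_one) auto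
  have b1: "\<bar>step' x * real k * step y\<bar> \<le> 9 * real k * 1" for x y
    unfolding abs_mult using step_values(3,4)[of y] step_values(6,7)[of x] by (intro mult_mono) auto
  have b2: "\<bar>step y * (step' x * real k)\<bar> \<le> 1 * (9 * real k)" for x y
    unfolding abs_mult using step_values(3,4)[of y] step_values(6,7)[of x] by (intro mult_mono) auto
  show "\<bar>cutoff' k q\<bar> \<le> 18 * real k"
    unfolding cutoff'_def using b1[of "real k * q - 1" "real k * (1 - q) - 1"] b2[of "real k * q - 1" "real k * (1 - q) - 1"] by linarith
  have s'0: "step' x = 0" if "x \<le> 0" for x using that by (simp add: step'_def cube'_def[of x])
  show "cutoff k q = 0 \<and> cutoff' k q = 0" if "q \<notin> {1 / real k .. 1 - 1 / real k}" "k > 0"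
  proof -
    have "real k * q - 1 \<le> 0 \<or> real k * (1 - q) - 1 \<le> 0" using that by (auto simp: field_simps)
    then show ?thesis unfolding cutoff_def cutoff'_def using step_values(1) s'0 by auto
  qed
  show "cutoff k q = 1 \<and> cutoff' k q = 0" if "q \<in> {2 / real k .. 1 - 2 / real k}" "k > 0"
  proof -
    have "real k * q - 1 \<ge> 1" "real k * (1 - q) - 1 \<ge> 1" using that by (auto simp: field_simps)
    then show ?thesis unfolding cutoff_def cutoff'_def using step_values(2,5) by auto
  qed
qed

lemma cutoff_tendsto_1:
  assumes "0 < q" "q < 1"
  shows "(\<lambda>k. cutoff k q) \<longlonglongrightarrow> 1"
proof -
  have "(\<lambda>k. 2 / real k) \<longlonglongrightarrow> 0" by real_asymp
  then have "\<forall>\<^sub>F k in sequentially. 2 / real k < min q (1 - q)"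
    using assms by (intro order_tendstoD) auto
  then have "\<forall>\<^sub>F k in sequentially. 1 = cutoff k q"
    using eventually_gt_at_top[of 0] by eventually_elim (use cutoff_values(5)[of q] in auto)
  then show ?thesis by (rule Lim_transform_eventually[OF tendsto_const])
qed

lemma closure_support_cutoff:
  assumes "k > 0" "\<And>q. q \<notin> {1 / real k .. 1 - 1 / real k} \<Longrightarrow> f q = 0"
  shows "closure {q \<in> S. f q \<noteq> 0} \<subseteq> {0<..<1::real}"
proof -
  have "closure {q \<in> S. f q \<noteq> 0} \<subseteq> {1 / real k .. 1 - 1 / real k}"
  proof (rule closure_minimal)
    show "{q \<in> S. f q \<noteq> 0} \<subseteq> {1 / real k .. 1 - 1 / real k}" using assms(2) by blast
  qed simp
  also have "\<dots> \<subseteq> {0<..<1}"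
  proof
    fix q assume "q \<in> {1 / real k .. 1 - 1 / real k}"
    moreover have "1 / real k > 0" using assms(1) by simp
    ultimately show "q \<in> {0<..<1}" unfolding atLeastAtMost_iff greaterThanLessThan_iff by linarith
  qed
  finally show ?thesis .
qed

section \<open>Weak derivatives on the unit interval\<close>

lemma L2_integrable:
  assumes "L2 v"
  shows "set_integrable lebesgue {0..1} v"
  unfolding set_integrable_lebesgue_on
proof (rule Bochner_Integration.integrable_bound[of _ "\<lambda>q. 1 + (v q)\<^sup>2"])
  show "integrable (lebesgue_on {0..1}) (\<lambda>q. 1 + (v q)\<^sup>2)"
    using assms unfolding L2_def by (intro Bochner_Integration.integrable_add finite_measure.integrable_const finite_measure_lebesgue_on) auto
  show "AE q in lebesgue_on {0..1}. norm (v q) \<le> norm (1 + (v q)\<^sup>2)"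
  proof (rule AE_I2)
    fix q
    have "0 \<le> (\<bar>v q\<bar> - 1)\<^sup>2" by simp
    then have "2 * \<bar>v q\<bar> \<le> 1 + (v q)\<^sup>2" by (simp add: power2_eq_square algebra_simps)
    then show "norm (v q) \<le> norm (1 + (v q)\<^sup>2)" by simp
  qed
qed (use assms in \<open>simp add: L2_def\<close>)

lemma continuous_times_integrable:
  assumes z: "set_integrable lebesgue {0..1} z" and h: "cont01 h"
  shows "set_integrable lebesgue {0..1} (\<lambda>q. h q * z q)"
proof -
  obtain B where B: "B > 0" "\<And>x. x \<in> {0..1} \<Longrightarrow> \<bar>h x\<bar> \<le> B" using cont01_bounded[OF h] by blast
  have zi: "integrable (lebesgue_on {0..1}) z" using z by (simp add: set_integrable_lebesgue_on)
  show ?thesis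
    unfolding set_integrable_lebesgue_on
  proof (rule Bochner_Integration.integrable_bound[of _ "\<lambda>q. B * z q"])
    show "integrable (lebesgue_on {0..1}) (\<lambda>q. B * z q)" using zi by simp
    show "(\<lambda>q. h q * z q) \<in> borel_measurable (lebesgue_on {0..1})"
      by (intro borel_measurable_times cont01_measurable h borel_measurable_integrable[OF zi])
    show "AE q in lebesgue_on {0..1}. norm (h q * z q) \<le> norm (B * z q)"
    proof (rule AE_I2)
      fix q assume "q \<in> space (lebesgue_on {0..1::real})"
      then have "\<bar>h q\<bar> \<le> B" using B(2) by simp
      then show "norm (h q * z q) \<le> norm (B * z q)" using B(1) by (simp add: abs_mult mult_right_mono)
    qed
  qed
qed

lemma cutoff_LINT_tendsto:
  assumes z: "set_integrable lebesgue {0..1} z"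
  shows "(\<lambda>k. LINT q:{0..1}|lebesgue. cutoff k q * z q) \<longlonglongrightarrow> (LINT q:{0..1}|lebesgue. z q)"
  unfolding LINT_lebesgue_on
proof (rule integral_dominated_convergence[where w = "\<lambda>q. \<bar>z q\<bar>"])
  have zi: "integrable (lebesgue_on {0..1}) z" using z by (simp add: set_integrable_lebesgue_on)
  then show zm: "z \<in> borel_measurable (lebesgue_on {0..1})" by (rule borel_measurable_integrable)
  show "(\<lambda>q. cutoff k q * z q) \<in> borel_measurable (lebesgue_on {0..1})" for k
    by (rule borel_measurable_times[OF cont01_measurable[OF cutoff_continuous(1)] zm])
  show "integrable (lebesgue_on {0..1}) (\<lambda>q. \<bar>z q\<bar>)" using zi by simp
  have "AE q in lebesgue. q \<noteq> (0::real)" "AE q in lebesgue. q \<noteq> (1::real)"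
    by (auto intro: AE_completion AE_lborel_singleton)
  then have "AE q in lebesgue. q \<in> {0..1} \<longrightarrow> (\<lambda>k. cutoff k q * z q) \<longlonglongrightarrow> z q"
  proof eventually_elim
    case (elim q)
    show ?case
    proof
      assume "q \<in> {0..1}"
      then have "(\<lambda>k. cutoff k q * z q) \<longlonglongrightarrow> 1 * z q"
        using elim by (intro tendsto_intros cutoff_tendsto_1) auto
      then show "(\<lambda>k. cutoff k q * z q) \<longlonglongrightarrow> z q" by simp
    qed
  qed
  then show "AE q in lebesgue_on {0..1}. (\<lambda>k. cutoff k q * z q) \<longlonglongrightarrow> z q" by (simp add: AE_lebesgue_on)
  show "AE q in lebesgue_on {0..1}. norm (cutoff k q * z q) \<le> \<bar>z q\<bar>" for k
  proof (rule AE_I2)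
    fix q
    have "\<bar>cutoff k q\<bar> \<le> 1" using cutoff_values(1,2)[of k q] by simp
    then show "norm (cutoff k q * z q) \<le> \<bar>z q\<bar>" using mult_right_mono[of "\<bar>cutoff k q\<bar>" 1 "\<bar>z q\<bar>"] by (simp add: abs_mult)
  qed
qed

text \<open>The fundamental lemma of the calculus of variations. A polynomial times a cutoff is an
  admissible test function; the cutoff is removed by dominated convergence, and polynomials are
  uniformly dense among continuous functions.\<close>

lemma orthogonal_test_functions_AE_zero:
  assumes z: "set_integrable lebesgue {0..1} z"
    and orth: "\<And>f f'. (\<And>q. (f has_real_derivative f' q) (at q)) \<Longrightarrow> continuous_on UNIV f' \<Longrightarrow>
      closure {q. f q \<noteq> 0} \<subseteq> {0<..<1} \<Longrightarrow> (LINT q:{0..1}|lebesgue. z q * f q) = 0"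
  shows "AE q in lebesgue_on {0..1}. z q = 0"
proof (rule orthogonal_continuous_AE_zero[OF z])
  have poly: "(LINT q:{0..1}|lebesgue. p q * z q) = 0" if p: "real_polynomial_function p" for p
  proof -
    obtain p' where p': "real_polynomial_function p'" "\<And>q. (p has_real_derivative p' q) (at q)"
      using has_real_derivative_polynomial_function[OF p] by auto
    have pc: "continuous_on S p" "continuous_on S p'" for S
      using p p'(1) by (auto intro: continuous_on_polymonial_function simp: real_polynomial_function_eq)
    have "(LINT q:{0..1}|lebesgue. cutoff k q * (p q * z q)) = 0" if k: "k > 0" for k
    proof -
      have "(LINT q:{0..1}|lebesgue. z q * (p q * cutoff k q)) = 0"
      proof (rule orth)
        show "((\<lambda>q. p q * cutoff k q) has_real_derivative p' q * cutoff k q + cutoff' k q * p q) (at q)" for q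
          by (rule DERIV_mult[OF p'(2) cutoff_derivatives(1)])
        show "continuous_on UNIV (\<lambda>q. p' q * cutoff k q + cutoff' k q * p q)"
          by (intro continuous_intros pc cutoff_continuous)
        show "closure {q. p q * cutoff k q \<noteq> 0} \<subseteq> {0<..<1}"
          using closure_support_cutoff[OF k, of "\<lambda>q. p q * cutoff k q" UNIV] cutoff_values(4)[OF _ k] by simp
      qed
      then show ?thesis by (simp add: mult_ac)
    qed
    then have "\<forall>\<^sub>F k in sequentially. 0 = (LINT q:{0..1}|lebesgue. cutoff k q * (p q * z q))"
      by (intro eventually_mono[OF eventually_gt_at_top[of 0]]) simp
    then have "(\<lambda>k. LINT q:{0..1}|lebesgue. cutoff k q * (p q * z q)) \<longlonglongrightarrow> 0"
      by (rule Lim_transform_eventually[OF tendsto_const])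
    with cutoff_LINT_tendsto[OF continuous_times_integrable[OF z pc(1)]] show ?thesis by (rule LIMSEQ_unique)
  qed
  fix h assume h: "cont01 h"
  define I where "I = (LINT q:{0..1}|lebesgue. \<bar>z q\<bar>)"
  have zi: "integrable (lebesgue_on {0..1}) z" using z by (simp add: set_integrable_lebesgue_on)
  have I0: "I \<ge> 0" unfolding I_def LINT_lebesgue_on by simp
  have "\<bar>LINT q:{0..1}|lebesgue. h q * z q\<bar> \<le> e * I" if e: "e > 0" for e
  proof -
    obtain p where p: "real_polynomial_function p" "\<And>x. x \<in> {0..1} \<Longrightarrow> \<bar>h x - p x\<bar> < e"
      using Stone_Weierstrass_real_polynomial_function[of "{0..1}" h e] h e by auto
    have pc: "cont01 p" using p(1) by (simp add: continuous_on_polymonial_function real_polynomial_function_eq)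
    have hp: "cont01 (\<lambda>q. h q - p q)" by (intro continuous_intros h pc)
    note i = continuous_times_integrable[OF z]
    have "(LINT q:{0..1}|lebesgue. h q * z q) = (LINT q:{0..1}|lebesgue. (h q - p q) * z q + p q * z q)"
      by (simp add: algebra_simps)
    also have "\<dots> = (LINT q:{0..1}|lebesgue. (h q - p q) * z q)"
      using set_integral_add(2)[OF i[OF hp] i[OF pc]] poly[OF p(1)] by simp
    finally have "\<bar>LINT q:{0..1}|lebesgue. h q * z q\<bar> \<le> integral\<^sup>L (lebesgue_on {0..1}) (\<lambda>q. e * \<bar>z q\<bar>)"
      unfolding LINT_lebesgue_on
    proof (simp only:, intro order_trans[OF integral_abs_bound integral_mono_AE])
      show "integrable (lebesgue_on {0..1}) (\<lambda>q. \<bar>(h q - p q) * z q\<bar>)"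
        using i[OF hp] unfolding set_integrable_lebesgue_on by (rule integrable_abs)
      show "integrable (lebesgue_on {0..1}) (\<lambda>q. e * \<bar>z q\<bar>)" using zi by simp
      show "AE q in lebesgue_on {0..1}. \<bar>(h q - p q) * z q\<bar> \<le> e * \<bar>z q\<bar>"
      proof (rule AE_I2)
        fix q assume "q \<in> space (lebesgue_on {0..1::real})"
        then have "\<bar>h q - p q\<bar> \<le> e" using p(2)[of q] by simp
        then show "\<bar>(h q - p q) * z q\<bar> \<le> e * \<bar>z q\<bar>" by (simp add: abs_mult mult_right_mono)
      qed
    qed
    then show ?thesis by (simp add: I_def LINT_lebesgue_on)
  qed
  note small = this
  have "\<bar>LINT q:{0..1}|lebesgue. h q * z q\<bar> \<le> 0"
  proof (rule field_le_epsilon)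
    fix e :: real assume "e > 0"
    then have "e / (I + 1) > 0" using I0 by simp
    from small[OF this] have "\<bar>LINT q:{0..1}|lebesgue. h q * z q\<bar> \<le> e * (I / (I + 1))" by simp
    also have "\<dots> \<le> e * 1" using \<open>e > 0\<close> I0 by (intro mult_left_mono) auto
    finally show "\<bar>LINT q:{0..1}|lebesgue. h q * z q\<bar> \<le> 0 + e" by simp
  qed
  then show "(LINT q:{0..1}|lebesgue. h q * z q) = 0" by simp
qed

text \<open>\<open>H1_norm\<close> is defined through a choice of weak derivative; this makes its
  value independent of the choice and therefore computable from a classical derivative.\<close>

lemma weak_derivative_unique:
  assumes "weak_derivative u v" "weak_derivative u w"
  shows "AE q in lebesgue_on {0..1}. v q = w q"
proof -
  have iv: "set_integrable lebesgue {0..1} v" "set_integrable lebesgue {0..1} w"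
    using assms L2_integrable unfolding weak_derivative_def by auto
  have "AE q in lebesgue_on {0..1}. v q - w q = 0"
  proof (rule orthogonal_test_functions_AE_zero)
    show "set_integrable lebesgue {0..1} (\<lambda>q. v q - w q)" by (rule set_integral_diff(1)[OF iv])
    fix f f' :: "real \<Rightarrow> real"
    assume f: "\<And>q. (f has_real_derivative f' q) (at q)" "continuous_on UNIV f'" "closure {q. f q \<noteq> 0} \<subseteq> {0<..<1}"
    have fc: "cont01 f" by (rule DERIV_continuous_on) (rule has_field_derivative_at_within[OF f(1)])
    have "(LINT q:{0..1}|lebesgue. v q * f q) = (LINT q:{0..1}|lebesgue. w q * f q)"
    proof -
      have "(LINT q:{0..1}|lebesgue. u q * f' q) = - (LINT q:{0..1}|lebesgue. v q * f q)"
        "(LINT q:{0..1}|lebesgue. u q * f' q) = - (LINT q:{0..1}|lebesgue. w q * f q)"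
        using assms f unfolding weak_derivative_def by blast+
      then show ?thesis by linarith
    qed
    moreover have "(LINT q:{0..1}|lebesgue. v q * f q - w q * f q) = (LINT q:{0..1}|lebesgue. v q * f q) - (LINT q:{0..1}|lebesgue. w q * f q)"
      using set_integral_diff(2)[OF continuous_times_integrable[OF iv(1) fc] continuous_times_integrable[OF iv(2) fc]]
      by (simp add: mult.commute)
    ultimately show "(LINT q:{0..1}|lebesgue. (v q - w q) * f q) = 0" by (simp add: left_diff_distrib)
  qed
  then show ?thesis by simp
qed

lemma L2_continuous: "cont01 v \<Longrightarrow> L2 v"
  unfolding L2_def set_integrable_lebesgue_on[symmetric]
  by (intro conjI cont01_measurable absolutely_integrable_continuous_real continuous_intros)

lemma C1_weak_derivative:
  assumes u: "\<And>q. q \<in> {0..1} \<Longrightarrow> (u has_real_derivative u' q) (at q within {0..1})" and u': "cont01 u'"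
  shows "weak_derivative u u'"
  unfolding weak_derivative_def
proof (intro conjI allI impI L2_continuous u')
  fix f f' :: "real \<Rightarrow> real"
  assume f: "\<forall>q. (f has_real_derivative f' q) (at q)" "continuous_on UNIV f'" "closure {q. f q \<noteq> 0} \<subseteq> {0<..<1}"
  have f0: "f 0 = 0" "f 1 = 0"
    using f(3) closure_subset[of "{q. f q \<noteq> 0}"] by fastforce+
  have fd: "(f has_real_derivative f' q) (at q within {0..1})" for q by (rule has_field_derivative_at_within) (use f in auto)
  have fc: "cont01 f" "cont01 f'" "cont01 u"
    using DERIV_continuous_on[OF fd] DERIV_continuous_on[OF u] continuous_on_subset[OF f(2)] by auto
  have "ip u' f = - ip u f'"
    using ip_by_parts[OF u fd u' fc(2)] f0 by simp
  then show "(LINT q:{0..1}|lebesgue. u q * f' q) = - (LINT q:{0..1}|lebesgue. u' q * f q)"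
    by (simp add: LINT_times_continuous fc u')
qed

lemma H1_norm_C1:
  assumes u: "\<And>q. q \<in> {0..1} \<Longrightarrow> (u has_real_derivative u' q) (at q within {0..1})" and u': "cont01 u'"
  shows "(H1_norm u)\<^sup>2 = ip u u + ip u' u'"
proof -
  have wd: "weak_derivative u u'" by (rule C1_weak_derivative[OF u u'])
  then have "weak_derivative u (SOME v. weak_derivative u v)" by (rule someI[where P = "weak_derivative u"])
  from weak_derivative_unique[OF this wd]
  have ae: "AE q in lebesgue_on {0..1}. (SOME v. weak_derivative u v) q = u' q" .
  have uc: "cont01 u" by (rule DERIV_continuous_on[OF u])
  have "(LINT q:{0..1}|lebesgue. ((SOME v. weak_derivative u v) q)\<^sup>2) = (LINT q:{0..1}|lebesgue. (u' q)\<^sup>2)"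
    unfolding LINT_lebesgue_on
  proof (rule integral_cong_AE)
    show "(\<lambda>q. ((SOME v. weak_derivative u v) q)\<^sup>2) \<in> borel_measurable (lebesgue_on {0..1})"
      using \<open>weak_derivative u (SOME v. weak_derivative u v)\<close> unfolding weak_derivative_def L2_def
      by (intro borel_measurable_power) auto
    show "(\<lambda>q. (u' q)\<^sup>2) \<in> borel_measurable (lebesgue_on {0..1})"
      by (intro borel_measurable_power cont01_measurable u')
    show "AE q in lebesgue_on {0..1}. ((SOME v. weak_derivative u v) q)\<^sup>2 = (u' q)\<^sup>2"
      using ae by eventually_elim simp
  qed
  moreover have "(LINT q:{0..1}|lebesgue. (u' q)\<^sup>2) = ip u' u'" "(LINT q:{0..1}|lebesgue. (u q)\<^sup>2) = ip u u"
    by (simp_all add: LINT_times_continuous[symmetric] uc u' power2_eq_square)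
  ultimately show ?thesis unfolding H1_norm_def using ip_nonneg[of u] ip_nonneg[of u'] by simp
qed

lemma ip_self_tendsto:
  assumes "uniform_limit {0..1} F f sequentially" "\<And>n. cont01 (F n)"
  shows "(\<lambda>n. ip (F n) (F n)) \<longlonglongrightarrow> ip f f"
proof -
  have fc: "cont01 f" using uniform_limit_theorem[OF always_eventually assms(1)] assms(2) by auto
  have "bounded (f ` {0..1})" by (intro compact_imp_bounded compact_continuous_image fc) auto
  then have ul: "uniform_limit {0..1} (\<lambda>n q. F n q * F n q) (\<lambda>q. f q * f q) sequentially"
    by (intro uniform_lim_mult assms)
  obtain I J where I: "\<And>n. ((\<lambda>q. F n q * F n q) has_integral I n) {0..1}" "((\<lambda>q. f q * f q) has_integral J) {0..1}" "I \<longlonglongrightarrow> J"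
    by (rule uniform_limit_integral[OF ul]) (auto intro!: continuous_intros assms)
  then have "I = (\<lambda>n. ip (F n) (F n))" "J = ip f f" unfolding ip_def by (auto intro!: integral_unique[symmetric])
  with I(3) show ?thesis by simp
qed

section \<open>Regularity of the flow in space and time\<close>

context heat_flow
begin

lemma flow_H1: "s > 0 \<Longrightarrow> flow s \<in> H1"
  unfolding H1_def using flow_section_continuous C1_weak_derivative[OF flow_derivative flow_section_continuous(2)] by blast

lemma flow_H1_norm: "s > 0 \<Longrightarrow> (H1_norm (flow s))\<^sup>2 = ip (flow s) (flow s) + ip (flow' s) (flow' s)"
  by (rule H1_norm_C1[OF flow_derivative flow_section_continuous(2)])

text \<open>Joint continuity of the flow and of its space derivative away from time 0. It makes
  preimages of open subsets of \<open>H1\<close> open, whence measurability into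
  \<open>H1_borel\<close>.\<close>

lemma flow_H1_continuous:
  fixes s :: real
  assumes s: "s > 0"
  shows "((\<lambda>r::real. H1_norm (\<lambda>q. flow r q - flow s q)) \<longlongrightarrow> 0) (at s)"
proof -
  have D: "continuous_on ({s / 2..} \<times> {0..1}) (\<lambda>(r, q). flow r q - flow s q)"
    "continuous_on ({s / 2..} \<times> {0..1}) (\<lambda>(r, q). flow' r q - flow' s q)"
    using flow_continuous[of "s / 2"] s
    by (auto simp: case_prod_beta' intro!: continuous_intros continuous_on_compose2[OF flow_section_continuous(1)[OF s]]
        continuous_on_compose2[OF flow_section_continuous(2)[OF s]])
  have "continuous_on {s / 2..} (\<lambda>r. ip (\<lambda>q. flow r q - flow s q) (\<lambda>q. flow r q - flow s q)
      + ip (\<lambda>q. flow' r q - flow' s q) (\<lambda>q. flow' r q - flow' s q))" (is "continuous_on _ ?N")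
    by (intro continuous_on_add ip_continuous_param D)
  then have "continuous_on {s / 2<..} ?N" by (rule continuous_on_subset) auto
  then have "isCont ?N s" using s by (simp add: continuous_on_eq_continuous_at)
  then have "(?N \<longlongrightarrow> ?N s) (at s)" by (simp add: isCont_def)
  then have "(?N \<longlongrightarrow> 0) (at s)" by (simp add: ip_def)
  then have "((\<lambda>r. sqrt (?N r)) \<longlongrightarrow> sqrt 0) (at s)" by (rule tendsto_real_sqrt)
  moreover have "\<forall>\<^sub>F r in at s. sqrt (?N r) = H1_norm (\<lambda>q. flow r q - flow s q)"
  proof (rule eventually_mono[OF eventually_at_in_open'[of "{0<..}" s]])
    fix r :: real assume "r \<in> {0<..}"
    then have r: "r > 0" by simp
    have "(H1_norm (\<lambda>q. flow r q - flow s q))\<^sup>2 = ?N r"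
      by (rule H1_norm_C1) (intro DERIV_diff flow_derivative continuous_intros flow_section_continuous r s; simp)+
    moreover have "H1_norm (\<lambda>q. flow r q - flow s q) \<ge> 0"
      unfolding H1_norm_def by (intro real_sqrt_ge_zero add_nonneg_nonneg) (simp_all add: LINT_lebesgue_on)
    ultimately show "sqrt (?N r) = H1_norm (\<lambda>q. flow r q - flow s q)" by (metis real_sqrt_abs abs_of_nonneg)
  qed (use s in auto)
  ultimately show ?thesis by (simp add: tendsto_cong)
qed

text \<open>For partial sums, integration by parts bounds the Dirichlet energy by the pairing with
  the second derivative, which orthogonality evaluates as a sum of squares; the boundary terms have
  the right sign. The affine profile does not satisfy the homogeneous condition and is split off at
  the price of a factor 2.\<close>

lemma flow_energy:
  assumes s: "s > 0"
  shows "ip (flow' s) (flow' s) \<le> 2 * slope\<^sup>2 + 2 * (\<Sum>i. 2 * lam i * (coef i * exp (- lam i * s))\<^sup>2)"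
    and "summable (\<lambda>i. 2 * lam i * (coef i * exp (- lam i * s))\<^sup>2)"
proof -
  define a' where "a' i = coef i * exp (- lam i * s)" for i
  have summand: "2 * lam i * (a' i)\<^sup>2 \<le> 1 / s * (coef i)\<^sup>2" for i
  proof -
    \<comment> \<open>The inequality \<open>x \<le> exp x\<close> trades the eigenvalue for
      \<open>1 / s\<close>, which is harmless at a fixed positive time.\<close>
    have "2 * lam i * s \<le> exp (2 * lam i * s)" using exp_ge_add_one_self[of "2 * lam i * s"] by linarith
    then have "2 * lam i \<le> 1 / s * exp (2 * lam i * s)" using s by (simp add: field_simps)
    then have "2 * lam i * exp (- (2 * lam i * s)) \<le> 1 / s * exp (2 * lam i * s) * exp (- (2 * lam i * s))"
      by (intro mult_right_mono) auto
    also have "\<dots> = 1 / s" by (simp add: exp_minus)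
    finally have "2 * lam i * exp (- (2 * lam i * s)) * (coef i)\<^sup>2 \<le> 1 / s * (coef i)\<^sup>2" by (intro mult_right_mono) auto
    moreover have "(exp (- lam i * s))\<^sup>2 = exp (- (2 * lam i * s))" by (simp add: exp_double[symmetric] algebra_simps)
    ultimately show ?thesis by (simp add: a'_def power_mult_distrib mult_ac)
  qed
  have sm: "summable (\<lambda>i. 2 * lam i * (a' i)\<^sup>2)"
    by (rule summable_comparison_test'[OF summable_mult[OF coef_square_summable, of "1 / s"], of 0])
      (use summand lam_nonneg in \<open>auto simp: abs_mult\<close>)
  then show "summable (\<lambda>i. 2 * lam i * (coef i * exp (- lam i * s))\<^sup>2)" by (simp add: a'_def)
  define F where "F n q = (\<Sum>i<n. a' i * \<phi> i q)" for n q
  define F' where "F' n q = (\<Sum>i<n. a' i * \<phi>' i q)" for n q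
  have Fc: "cont01 (F n)" "cont01 (F' n)" for n
    unfolding F_def F'_def by (intro continuous_intros phi_continuous phi'_continuous)+
  have bound: "ip (F' n) (F' n) \<le> (\<Sum>i. 2 * lam i * (a' i)\<^sup>2)" for n
  proof -
    define F'' where "F'' q = (\<Sum>i<n. (a' i * (- 2 * lam i)) * \<phi> i q)" for q
    have d1: "(F n has_real_derivative F' n q) (at q within {0..1})" if "q \<in> {0..1}" for q
      unfolding F_def F'_def by (intro DERIV_sum DERIV_cmult phi_derivative that)
    have d2: "(F' n has_real_derivative F'' q) (at q within {0..1})" if "q \<in> {0..1}" for q
    proof -
      have "(F' n has_real_derivative (\<Sum>i<n. a' i * (- 2 * lam i * \<phi> i q))) (at q within {0..1})"
        unfolding F'_def by (intro DERIV_sum DERIV_cmult phi'_derivative that)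
      then show ?thesis by (simp add: F''_def mult_ac)
    qed
    have F''c: "cont01 F''" unfolding F''_def by (intro continuous_intros phi_continuous)
    have bc: "satisfies_bc (F n) (F' n)"
    proof -
      have bc: "a * \<phi>' i 0 = b * \<phi> i 0" "a * \<phi>' i 1 = - b * \<phi> i 1" for i
        using phi_bc[of i] by (auto simp: satisfies_bc_def)
      have "a * (a' i * \<phi>' i 0) = a' i * (a * \<phi>' i 0)" "a * (a' i * \<phi>' i 1) = a' i * (a * \<phi>' i 1)" for i by simp_all
      then have "a * (a' i * \<phi>' i 0) = b * (a' i * \<phi> i 0)" "a * (a' i * \<phi>' i 1) = - b * (a' i * \<phi> i 1)" for i
        unfolding bc by simp_all
      then show ?thesis unfolding satisfies_bc_def F_def F'_def sum_distrib_left by (intro conjI sum.cong refl)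
    qed
    have "ip F'' (F n) = (\<Sum>i<n. (a' i * (- 2 * lam i)) * a' i * ip (\<phi> i) (\<phi> i))"
      unfolding F''_def F_def by (rule ip_orthogonal_sum[OF phi_continuous phi_orthogonal])
    also have "\<dots> = - (\<Sum>i<n. 2 * lam i * (a' i)\<^sup>2 * ip (\<phi> i) (\<phi> i))"
      by (simp add: sum_negf[symmetric] power2_eq_square mult_ac)
    finally have "ip (F' n) (F' n) \<le> (\<Sum>i<n. 2 * lam i * (a' i)\<^sup>2 * ip (\<phi> i) (\<phi> i))"
      using bc_second_derivative_nonpos[OF d1 d2 F''c bc] by linarith
    also have "\<dots> \<le> (\<Sum>i<n. 2 * lam i * (a' i)\<^sup>2)"
    proof (rule sum_mono)
      fix i
      have "ip (\<phi> i) (\<phi> i) \<le> 1" using phi_norm[of i] by (auto simp: ip_def)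
      then show "2 * lam i * (a' i)\<^sup>2 * ip (\<phi> i) (\<phi> i) \<le> 2 * lam i * (a' i)\<^sup>2"
        using lam_nonneg[of i] by (intro mult_left_le) auto
    qed
    also have "\<dots> \<le> (\<Sum>i. 2 * lam i * (a' i)\<^sup>2)" using lam_nonneg by (intro sum_le_suminf sm) auto
    finally show ?thesis .
  qed
  have "ip (partial' n s) (partial' n s) \<le> 2 * slope\<^sup>2 + 2 * (\<Sum>i. 2 * lam i * (a' i)\<^sup>2)" for n
  proof -
    have "ip (partial' n s) (partial' n s) = ip (\<lambda>q. slope + F' n q) (\<lambda>q. slope + F' n q)"
      by (simp add: partial'_def[abs_def] F'_def a'_def)
    also have "\<dots> \<le> 2 * ip (\<lambda>_. slope) (\<lambda>_. slope) + 2 * ip (F' n) (F' n)"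
      by (rule ip_square_le[OF continuous_on_const Fc(2)])
    finally show ?thesis using bound[of n] by (simp add: ip_def power2_eq_square)
  qed
  then show "ip (flow' s) (flow' s) \<le> 2 * slope\<^sup>2 + 2 * (\<Sum>i. 2 * lam i * (coef i * exp (- lam i * s))\<^sup>2)"
    unfolding a'_def[symmetric]
    by (intro LIMSEQ_le_const2[OF ip_self_tendsto[OF partial_section_uniform_limit(2)[OF s] partial_section_continuous(2)]]) blast
qed

text \<open>The pointwise bound of order \<open>1 / s\<close> is not integrable at 0, so each term
  is integrated in time first: \<open>2 * lam * exp (- 2 * lam * s)\<close> has integral at most 1,
  and the squared coefficients are summable.\<close>

lemma energy_integrable:
  assumes T: "T > 0"
  shows "integrable (lebesgue_on {0..T}) (\<lambda>s. \<Sum>i. 2 * lam i * (coef i * exp (- lam i * s))\<^sup>2)"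
proof (rule integrable_suminf)
  define e where "e i s = 2 * lam i * (coef i * exp (- lam i * s))\<^sup>2" for i s
  have ec: "continuous_on {0..T} (e i)" for i unfolding e_def by (intro continuous_intros)
  have e0: "e i s \<ge> 0" for i s unfolding e_def using lam_nonneg by simp
  show "integrable (lebesgue_on {0..T}) (\<lambda>s. 2 * lam i * (coef i * exp (- lam i * s))\<^sup>2)" for i
    using absolutely_integrable_continuous_real[OF ec[of i]] unfolding set_integrable_lebesgue_on e_def .
  have "AE s in lebesgue. s \<noteq> (0::real)" by (intro AE_completion AE_lborel_singleton)
  then show "AE s in lebesgue_on {0..T}. summable (\<lambda>i. norm (2 * lam i * (coef i * exp (- lam i * s))\<^sup>2))"
    unfolding AE_lebesgue_on
  proof eventually_elim
    case (elim s)
    show ?case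
    proof
      assume "s \<in> {0..T}"
      then have s: "s > 0" using elim by simp
      have "norm (2 * lam i * (coef i * exp (- lam i * s))\<^sup>2) = 2 * lam i * (coef i * exp (- lam i * s))\<^sup>2" for i
        using e0[of i s] by (simp only: e_def real_norm_def abs_of_nonneg)
      then show "summable (\<lambda>i. norm (2 * lam i * (coef i * exp (- lam i * s))\<^sup>2))"
        using flow_energy(2)[OF s] by simp
    qed
  qed
  have "(\<integral>s. norm (e i s) \<partial>lebesgue_on {0..T}) \<le> (coef i)\<^sup>2" for i
  proof -
    have "(e i has_integral (- (coef i)\<^sup>2 * exp (- 2 * lam i * T)) - (- (coef i)\<^sup>2 * exp (- 2 * lam i * 0))) {0..T}"
    proof (rule fundamental_theorem_of_calculus)
      fix s assume "s \<in> {0..T}"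
      have "((\<lambda>s. - (coef i)\<^sup>2 * exp (- 2 * lam i * s)) has_real_derivative - (coef i)\<^sup>2 * (exp (- 2 * lam i * s) * (- 2 * lam i))) (at s within {0..T})"
        by (intro DERIV_cmult DERIV_fun_exp) (auto intro!: derivative_eq_intros)
      moreover have "- (coef i)\<^sup>2 * (exp (- 2 * lam i * s) * (- 2 * lam i)) = e i s"
        by (simp add: e_def power_mult_distrib exp_double[symmetric] mult_ac)
      ultimately show "((\<lambda>s. - (coef i)\<^sup>2 * exp (- 2 * lam i * s)) has_vector_derivative e i s) (at s within {0..T})"
        by (simp add: has_real_derivative_iff_has_vector_derivative)
    qed (use T in simp)
    then have "integral {0..T} (e i) \<le> (coef i)\<^sup>2" by (simp add: integral_unique)
    moreover have "(\<integral>s. norm (e i s) \<partial>lebesgue_on {0..T}) = integral {0..T} (e i)"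
      using LINT_continuous[OF ec[of i]] e0 by (simp add: LINT_lebesgue_on)
    ultimately show ?thesis by simp
  qed
  then show "summable (\<lambda>i. \<integral>s. norm (2 * lam i * (coef i * exp (- lam i * s))\<^sup>2) \<partial>lebesgue_on {0..T})"
    unfolding e_def by (intro summable_comparison_test'[OF coef_square_summable, of 0]) simp
qed

theorem solution_L2_H1:
  assumes range: "\<And>s q. s \<ge> 0 \<Longrightarrow> q \<in> {0..1} \<Longrightarrow> solution s q \<in> {0..1}" and T: "T > 0"
  shows "solution \<in> L2_H1 T"
proof -
  \<comment> \<open>The initial profile need not belong to \<open>H1\<close>; at time 0 the
    representative is the zero function, which changes it on a null set of times only.\<close>
  define f where "f s = (if s > 0 then flow s else (\<lambda>_. 0))" for s
  have zH: "(\<lambda>_. 0) \<in> H1"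
    unfolding H1_def using C1_weak_derivative[of "\<lambda>_. 0" "\<lambda>_. 0"] by auto
  have fH: "f s \<in> H1" for s using flow_H1 zH by (simp add: f_def)
  have meas: "f \<in> measurable (lebesgue_on {0..T}) H1_borel"
    unfolding H1_borel_def
  proof (rule measurable_measure_of)
    show "{U. H1_open U} \<subseteq> Pow H1" by (auto simp: H1_open_def)
    show "f \<in> space (lebesgue_on {0..T}) \<rightarrow> H1" using fH by auto
    fix U assume U: "U \<in> {U. H1_open U}"
    define A where "A = {s. s > 0 \<and> flow s \<in> U}"
    have "open A"
      unfolding open_contains_ball
    proof
      fix s assume "s \<in> A"
      then have s: "s > 0" "flow s \<in> U" by (auto simp: A_def)
      then obtain r where r: "r > 0" "\<And>v. v \<in> H1 \<Longrightarrow> H1_norm (\<lambda>q. v q - flow s q) < r \<Longrightarrow> v \<in> U"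
        using U by (auto simp: H1_open_def)
      have "\<forall>\<^sub>F r' in at s. H1_norm (\<lambda>q. flow r' q - flow s q) < r"
        by (rule order_tendstoD(2)[OF flow_H1_continuous[OF s(1)] r(1)])
      then obtain d where d: "d > 0" "\<And>r'. r' \<noteq> s \<Longrightarrow> dist r' s < d \<Longrightarrow> H1_norm (\<lambda>q. flow r' q - flow s q) < r"
        unfolding eventually_at by auto
      have "ball s (min d s) \<subseteq> A"
      proof
        fix r' assume "r' \<in> ball s (min d s)"
        then have r': "dist r' s < d" "r' > 0" by (auto simp: dist_real_def)
        show "r' \<in> A"
        proof (cases "r' = s")
          case False
          then show ?thesis unfolding A_def using r(2)[OF flow_H1[OF r'(2)] d(2)[OF False r'(1)]] r'(2) by simp
        qed (use \<open>s \<in> A\<close> in simp)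
      qed
      then show "\<exists>e>0. ball s e \<subseteq> A" using d(1) s(1) by (intro exI[of _ "min d s"]) auto
    qed
    then have "A \<in> sets lebesgue" by simp
    then have A': "A \<inter> {0..T} \<in> sets (lebesgue_on {0..T})" by (simp add: sets_restrict_space) blast
    have z': "{0} \<in> sets (lebesgue_on {0..T})" using T by (simp add: sets_restrict_space image_iff) (auto intro!: bexI[of _ "{0}"])
    have "f -` U \<inter> space (lebesgue_on {0..T}) = (A \<inter> {0..T}) \<union> (if (\<lambda>_. 0) \<in> U then {0} else {})"
      using T by (auto simp: f_def A_def split: if_splits)
    then show "f -` U \<inter> space (lebesgue_on {0..T}) \<in> sets (lebesgue_on {0..T})"
      by (simp only:) (rule sets.Un[OF A'], simp add: z')
  qed
  have ae: "AE s in lebesgue_on {0..T}. \<forall>q\<in>{0..1}. solution s q = f s q"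
  proof -
    have "AE s in lebesgue. s \<noteq> (0::real)" by (intro AE_completion AE_lborel_singleton)
    then show ?thesis unfolding AE_lebesgue_on by eventually_elim (auto simp: solution_def f_def)
  qed
  define N where "N s = (if s > 0 then ip (flow s) (flow s) + ip (flow' s) (flow' s) else (H1_norm (\<lambda>_. 0))\<^sup>2)" for s
  have Nf: "(H1_norm (f s))\<^sup>2 = N s" for s unfolding N_def f_def using flow_H1_norm by simp
  have "integrable (lebesgue_on {0..T}) N"
  proof (rule Bochner_Integration.integrable_bound)
    let ?E = "\<lambda>s. \<Sum>i. 2 * lam i * (coef i * exp (- lam i * s))\<^sup>2"
    show "integrable (lebesgue_on {0..T}) (\<lambda>s. (1 + 2 * slope\<^sup>2) + 2 * ?E s)"
      by (intro Bochner_Integration.integrable_add integrable_mult_right energy_integrable T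
          finite_measure.integrable_const finite_measure_lebesgue_on) simp
    \<comment> \<open>The norm may blow up at time 0, so measurability is obtained through
      truncations, which are bounded.\<close>
    have "set_integrable lebesgue {0..T} (\<lambda>s. min (N s) K)" for K
    proof (rule bounded_continuous_integrable)
      fix \<epsilon> :: real assume e: "0 < \<epsilon>"
      have "continuous_on {\<epsilon>..T} (\<lambda>s. ip (flow s) (flow s) + ip (flow' s) (flow' s))"
        by (intro continuous_on_add ip_continuous_param continuous_on_subset[OF flow_continuous(1)[OF e]]
            continuous_on_subset[OF flow_continuous(2)[OF e]]) auto
      then have "continuous_on {\<epsilon>..T} (\<lambda>s. min (ip (flow s) (flow s) + ip (flow' s) (flow' s)) K)"
        by (rule continuous_on_min[OF _ continuous_on_const])
      then show "continuous_on {\<epsilon>..T} (\<lambda>s. min (N s) K)"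
        by (rule continuous_on_eq) (use e in \<open>auto simp: N_def\<close>)
    next
      fix s :: real
      have "N s \<ge> 0" unfolding N_def using ip_nonneg[of "flow s"] ip_nonneg[of "flow' s"] by auto
      then show "\<bar>min (N s) K\<bar> \<le> \<bar>K\<bar>" by auto
    qed
    then have mm: "(\<lambda>s. min (N s) (real k)) \<in> borel_measurable (lebesgue_on {0..T})" for k
      unfolding set_integrable_lebesgue_on by (rule borel_measurable_integrable)
    show "N \<in> borel_measurable (lebesgue_on {0..T})"
    proof (rule borel_measurable_LIMSEQ_real[OF _ mm])
      fix s
      obtain k0 where "N s \<le> real k0" using real_arch_simple by blast
      then have "\<forall>\<^sub>F k in sequentially. N s = min (N s) (real k)"
        by (intro eventually_mono[OF eventually_ge_at_top[of k0]]) auto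
      then show "(\<lambda>k. min (N s) (real k)) \<longlonglongrightarrow> N s" by (rule Lim_transform_eventually[OF tendsto_const])
    qed
    have "AE s in lebesgue. s \<noteq> (0::real)" by (intro AE_completion AE_lborel_singleton)
    then show "AE s in lebesgue_on {0..T}. norm (N s) \<le> norm ((1 + 2 * slope\<^sup>2) + 2 * ?E s)"
      unfolding AE_lebesgue_on
    proof eventually_elim
      case (elim s)
      show ?case
      proof
        assume "s \<in> {0..T}"
        then have s: "s > 0" using elim by simp
        have "ip (flow s) (flow s) \<le> 1\<^sup>2"
        proof (rule ip_le_bound[OF flow_section_continuous(1)[OF s]])
          show "\<bar>flow s q\<bar> \<le> 1" if "q \<in> {0..1}" for q
            using range[of s q] s that by (simp add: solution_def)
        qed
        then have "N s \<le> (1 + 2 * slope\<^sup>2) + 2 * ?E s"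
          using flow_energy(1)[OF s] s unfolding N_def by simp
        moreover have "0 \<le> N s" unfolding N_def using ip_nonneg[of "flow s"] ip_nonneg[of "flow' s"] by auto
        ultimately show "norm (N s) \<le> norm ((1 + 2 * slope\<^sup>2) + 2 * ?E s)" by simp
      qed
    qed
  qed
  then have "integrable (lebesgue_on {0..T}) (\<lambda>s. (H1_norm (f s))\<^sup>2)" by (simp add: Nf)
  then show ?thesis unfolding L2_H1_def using meas ae by blast
qed

end

subsection \<open>Measurability in time\<close>

lemma AE_equal_measurable:
  fixes u w :: "real \<Rightarrow> real"
  assumes "u \<in> borel_measurable (lebesgue_on {s..t})" "AE r in lebesgue_on {s..t}. u r = w r"
  shows "w \<in> borel_measurable (lebesgue_on {s..t})"
proof -
  have "(\<lambda>r. indicator {s..t} r *\<^sub>R u r) \<in> borel_measurable lebesgue"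
    using assms(1) by (simp add: borel_measurable_restrict_space_iff)
  then have "(\<lambda>r. indicator {s..t} r *\<^sub>R w r) \<in> borel_measurable lebesgue"
  proof (rule borel_measurable_AE)
    show "AE r in lebesgue. indicator {s..t} r *\<^sub>R u r = indicator {s..t} r *\<^sub>R w r"
      using assms(2) unfolding AE_lebesgue_on by eventually_elim (auto simp: indicator_def)
  qed
  then show ?thesis by (simp add: borel_measurable_restrict_space_iff)
qed

lemma H1_norm_bounds:
  assumes u: "cont01 u"
  shows "(H1_norm u)\<^sup>2 = ip u u + (LINT q:{0..1}|lebesgue. ((SOME v. weak_derivative u v) q)\<^sup>2)"
    and "ip u u \<le> (H1_norm u)\<^sup>2" and "0 \<le> H1_norm u"
proof -
  have W: "0 \<le> (LINT q:{0..1}|lebesgue. ((SOME v. weak_derivative u v) q)\<^sup>2)" by (simp add: LINT_lebesgue_on)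
  have U: "(LINT q:{0..1}|lebesgue. (u q)\<^sup>2) = ip u u"
    using LINT_times_continuous[OF u u] by (simp add: power2_eq_square)
  show 1: "(H1_norm u)\<^sup>2 = ip u u + (LINT q:{0..1}|lebesgue. ((SOME v. weak_derivative u v) q)\<^sup>2)"
    unfolding H1_norm_def U using W ip_nonneg[of u] by simp
  show "ip u u \<le> (H1_norm u)\<^sup>2" unfolding 1 using W by simp
  show "0 \<le> H1_norm u" unfolding H1_norm_def U using W ip_nonneg[of u] by simp
qed

text \<open>Superlevel sets of a functional that is Lipschitz for the norm of \<open>H1\<close> are
  open, and \<open>H1_borel\<close> is generated by open sets. This gives measurability in time of
  scalar quantities of an element of \<open>L2_H1 T\<close>.\<close>

lemma H1_functional_measurable:
  assumes f: "f \<in> measurable X H1_borel" and B: "B > 0"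
    and lipschitz: "\<And>u v. u \<in> H1 \<Longrightarrow> v \<in> H1 \<Longrightarrow> \<bar>F v - F u\<bar> \<le> B * H1_norm (\<lambda>q. v q - u q)"
  shows "(\<lambda>s. F (f s) :: real) \<in> borel_measurable X"
proof -
  have sH: "space H1_borel = H1" by (simp add: H1_borel_def space_measure_of_conv)
  have "F \<in> borel_measurable H1_borel"
    unfolding borel_measurable_iff_greater
  proof
    fix c
    have "H1_open {u \<in> H1. c < F u}"
      unfolding H1_open_def
    proof (intro conjI ballI)
      show "{u \<in> H1. c < F u} \<subseteq> H1" by blast
      fix u assume "u \<in> {u \<in> H1. c < F u}"
      then have u: "u \<in> H1" "c < F u" by auto
      show "\<exists>r>0. \<forall>v\<in>H1. H1_norm (\<lambda>q. v q - u q) < r \<longrightarrow> v \<in> {u \<in> H1. c < F u}"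
      proof (intro exI[of _ "(F u - c) / B"] conjI ballI impI)
        show "(F u - c) / B > 0" using u B by simp
        fix v assume v: "v \<in> H1" "H1_norm (\<lambda>q. v q - u q) < (F u - c) / B"
        then have "B * H1_norm (\<lambda>q. v q - u q) < F u - c" using B by (simp add: field_simps)
        then have "c < F v" using lipschitz[OF u(1) v(1)] by linarith
        then show "v \<in> {u \<in> H1. c < F u}" using v by simp
      qed
    qed
    then have "{u \<in> H1. c < F u} \<in> sets H1_borel"
      unfolding H1_borel_def by (subst sets_measure_of) (auto simp: H1_open_def)
    then show "{w \<in> space H1_borel. c < F w} \<in> sets H1_borel" by (simp add: sH)
  qed
  from measurable_compose[OF f this] show ?thesis .
qed

text \<open>The summand 1 makes the Lipschitz constant positive, as
  \<open>H1_functional_measurable\<close> demands.\<close>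

lemma H1_ip_bound:
  assumes w: "cont01 w" and h: "cont01 h"
  shows "\<bar>ip w h\<bar> \<le> (sqrt (ip h h) + 1) * H1_norm w"
proof -
  have "(ip w h)\<^sup>2 \<le> (H1_norm w)\<^sup>2 * ip h h"
    using ip_Cauchy_Schwarz[OF w h] mult_right_mono[OF H1_norm_bounds(2)[OF w] ip_nonneg[of h]] by (rule order_trans)
  then have "sqrt ((ip w h)\<^sup>2) \<le> sqrt ((H1_norm w)\<^sup>2 * ip h h)" by (rule real_sqrt_le_mono)
  then have "\<bar>ip w h\<bar> \<le> sqrt (ip h h) * H1_norm w"
    using H1_norm_bounds(3)[OF w] by (simp add: real_sqrt_mult mult.commute)
  then show ?thesis using H1_norm_bounds(3)[OF w] by (simp add: distrib_right)
qed

lemma H1_integral_bound: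
  assumes w: "cont01 w" and x: "x \<in> {0..1}"
  shows "\<bar>integral {0..x} w\<bar> \<le> H1_norm w"
proof -
  have c: "cont01 (\<lambda>q. \<bar>w q\<bar>)" by (intro continuous_intros w)
  have sub: "{0..x} \<subseteq> {0..1}" using x by auto
  have i: "w integrable_on {0..x}" "(\<lambda>q. \<bar>w q\<bar>) integrable_on {0..x}" "(\<lambda>q. \<bar>w q\<bar>) integrable_on {0..1}"
    by (intro integrable_continuous_real continuous_on_subset[OF w] continuous_on_subset[OF c] sub order_refl)+
  have "\<bar>integral {0..x} w\<bar> \<le> integral {0..x} (\<lambda>q. \<bar>w q\<bar>)"
    using integral_norm_bound_integral[OF i(1,2)] by simp
  also have "\<dots> \<le> integral {0..1} (\<lambda>q. \<bar>w q\<bar>)" by (rule integral_subset_le[OF sub i(2,3)]) simp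
  also have "\<dots> = ip (\<lambda>q. \<bar>w q\<bar>) (\<lambda>_. 1)" by (simp add: ip_def)
  also have "\<dots> \<le> H1_norm w"
  proof (rule power2_le_imp_le)
    have "(ip (\<lambda>q. \<bar>w q\<bar>) (\<lambda>_. 1))\<^sup>2 \<le> ip (\<lambda>q. \<bar>w q\<bar>) (\<lambda>q. \<bar>w q\<bar>) * ip (\<lambda>_. 1) (\<lambda>_. 1)"
      by (rule ip_Cauchy_Schwarz[OF c continuous_on_const])
    also have "\<dots> = ip w w" by (simp add: ip_def)
    also have "\<dots> \<le> (H1_norm w)\<^sup>2" by (rule H1_norm_bounds(2)[OF w])
    finally show "(ip (\<lambda>q. \<bar>w q\<bar>) (\<lambda>_. 1))\<^sup>2 \<le> (H1_norm w)\<^sup>2" .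
  qed (rule H1_norm_bounds(3)[OF w])
  finally show ?thesis .
qed

lemma H1_continuous: "u \<in> H1 \<Longrightarrow> cont01 u"
  by (simp add: H1_def)

lemma L2_H1_representative:
  assumes "\<rho> \<in> L2_H1 T"
  obtains f where "f \<in> measurable (lebesgue_on {0..T}) H1_borel"
    "AE s in lebesgue_on {0..T}. f s \<in> H1 \<and> (\<forall>q\<in>{0..1}. \<rho> s q = f s q)"
    "integrable (lebesgue_on {0..T}) (\<lambda>s. (H1_norm (f s))\<^sup>2)" "\<And>s. s \<in> {0..T} \<Longrightarrow> f s \<in> H1"
proof -
  obtain f where f: "f \<in> measurable (lebesgue_on {0..T}) H1_borel"
    "AE s in lebesgue_on {0..T}. \<forall>q\<in>{0..1}. \<rho> s q = f s q"
    "integrable (lebesgue_on {0..T}) (\<lambda>s. (H1_norm (f s))\<^sup>2)"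
    using assms unfolding L2_H1_def by blast
  have sH: "space H1_borel = H1" by (simp add: H1_borel_def space_measure_of_conv)
  have H: "f s \<in> H1" if "s \<in> {0..T}" for s
    using measurable_space[OF f(1), of s] that by (simp add: sH)
  have "AE s in lebesgue_on {0..T}. f s \<in> H1 \<and> (\<forall>q\<in>{0..1}. \<rho> s q = f s q)"
    using f(2) AE_space
  proof eventually_elim
    case (elim s)
    then show ?case using H[of s] by simp
  qed
  then show ?thesis by (rule that[OF f(1) _ f(3) H])
qed

lemma L2_H1_LINT_measurable:
  assumes rho: "\<rho> \<in> L2_H1 T" and h: "cont01 h"
  shows "(\<lambda>s. LINT q:{0..1}|lebesgue. \<rho> s q * h q) \<in> borel_measurable (lebesgue_on {0..T})"
proof (rule L2_H1_representative[OF rho])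
  fix f assume f: "f \<in> measurable (lebesgue_on {0..T}) H1_borel"
    "AE s in lebesgue_on {0..T}. f s \<in> H1 \<and> (\<forall>q\<in>{0..1}. \<rho> s q = f s q)"
  have "(\<lambda>s. ip (f s) h) \<in> borel_measurable (lebesgue_on {0..T})"
  proof (rule H1_functional_measurable[OF f(1)])
    show "sqrt (ip h h) + 1 > 0" using ip_nonneg[of h] by (simp add: add_nonneg_pos)
    fix u v assume "u \<in> H1" "v \<in> H1"
    then have c: "cont01 u" "cont01 v" "cont01 (\<lambda>q. v q - u q)"
      by (auto simp: H1_continuous intro!: continuous_intros)
    show "\<bar>ip v h - ip u h\<bar> \<le> (sqrt (ip h h) + 1) * H1_norm (\<lambda>q. v q - u q)"
      using H1_ip_bound[OF c(3) h] ip_diff_left[OF c(2,1) h] by simp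
  qed
  then show ?thesis
  proof (rule AE_equal_measurable)
    show "AE s in lebesgue_on {0..T}. ip (f s) h = (LINT q:{0..1}|lebesgue. \<rho> s q * h q)"
      using f(2)
    proof eventually_elim
      case (elim s)
      then have "(LINT q:{0..1}|lebesgue. f s q * h q) = ip (f s) h"
        by (intro LINT_times_continuous h H1_continuous) simp
      moreover have "(LINT q:{0..1}|lebesgue. \<rho> s q * h q) = (LINT q:{0..1}|lebesgue. f s q * h q)"
        by (rule set_lebesgue_integral_cong) (use elim in auto)
      ultimately show ?case by simp
    qed
  qed
qed

text \<open>Point evaluations are limits of the averages \<open>\<integral>\<^sub>x\<^sup>y u / (y - x)\<close>.\<close>

lemma L2_H1_value_measurable:
  assumes rho: "\<rho> \<in> L2_H1 T" and x: "x \<in> {0..1}"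
  shows "(\<lambda>s. \<rho> s x) \<in> borel_measurable (lebesgue_on {0..T})"
proof (rule L2_H1_representative[OF rho])
  fix f assume f: "f \<in> measurable (lebesgue_on {0..T}) H1_borel"
    "AE s in lebesgue_on {0..T}. f s \<in> H1 \<and> (\<forall>q\<in>{0..1}. \<rho> s q = f s q)"
    and fH: "\<And>s. s \<in> {0..T} \<Longrightarrow> f s \<in> H1"
  have "x islimpt {0..1}" using x by (intro connected_imp_perfect) (auto simp: is_interval_connected)
  then obtain y where y: "\<And>n::nat. y n \<in> {0..1} - {x}" "y \<longlonglongrightarrow> x"
    unfolding islimpt_sequential by blast
  have I: "(\<lambda>s. integral {0..z} (f s)) \<in> borel_measurable (lebesgue_on {0..T})" if z: "z \<in> {0..1}" for z
  proof (rule H1_functional_measurable[OF f(1), of 1])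
    fix u v assume "u \<in> H1" "v \<in> H1"
    then have c: "cont01 u" "cont01 v" "cont01 (\<lambda>q. v q - u q)"
      by (auto simp: H1_continuous intro!: continuous_intros)
    have i: "u integrable_on {0..z}" "v integrable_on {0..z}"
      by (intro integrable_continuous_real continuous_on_subset[OF c(1)] continuous_on_subset[OF c(2)]; use z in auto)+
    show "\<bar>integral {0..z} v - integral {0..z} u\<bar> \<le> 1 * H1_norm (\<lambda>q. v q - u q)"
      using H1_integral_bound[OF c(3) z] integral_diff[OF i(2,1)] by simp
  qed simp
  have "(\<lambda>s. f s x) \<in> borel_measurable (lebesgue_on {0..T})"
  proof (rule borel_measurable_LIMSEQ_real)
    show "(\<lambda>s. (integral {0..y n} (f s) - integral {0..x} (f s)) / (y n - x)) \<in> borel_measurable (lebesgue_on {0..T})" for n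
      by (intro borel_measurable_divide borel_measurable_diff I x borel_measurable_const) (use y(1)[of n] in simp)
    fix s assume "s \<in> space (lebesgue_on {0..T})"
    then have c: "cont01 (f s)" using fH[of s] by (simp add: H1_continuous)
    from integral_has_real_derivative[OF c x]
    have "((\<lambda>z. (integral {0..z} (f s) - integral {0..x} (f s)) / (z - x)) \<longlongrightarrow> f s x) (at x within {0..1})"
      by (simp add: has_field_derivative_iff)
    moreover have "filterlim y (at x within {0..1}) sequentially"
      unfolding filterlim_at using y by auto
    ultimately show "(\<lambda>n. (integral {0..y n} (f s) - integral {0..x} (f s)) / (y n - x)) \<longlonglongrightarrow> f s x"
      by (rule filterlim_compose)
  qed
  then show ?thesis
  proof (rule AE_equal_measurable)
    show "AE s in lebesgue_on {0..T}. f s x = \<rho> s x" using f(2) by eventually_elim (use x in auto)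
  qed
qed

subsection \<open>Uniqueness through the Fourier modes\<close>

text \<open>The integral equation upgrades \<open>d\<close> from measurable to continuous. The
  primitive \<open>D\<close> then satisfies \<open>D' = - l * D\<close>, so
  \<open>exp (l * t) * D t\<close> is constant and equal to its value 0 at time 0.\<close>

lemma exponential_decay_zero:
  fixes d :: "real \<Rightarrow> real"
  assumes m: "d \<in> borel_measurable (lebesgue_on {0..T})" and B: "\<And>s. s \<in> {0..T} \<Longrightarrow> \<bar>d s\<bar> \<le> B"
    and eq: "\<And>t. t \<in> {0..T} \<Longrightarrow> d t = - l * (LINT s:{0..t}|lebesgue. d s)"
    and t: "t \<in> {0..T}"
  shows "d t = 0"
proof -
  have i: "set_integrable lebesgue {0..T} d" by (rule bounded_measurable_absolutely_integrable[OF m B])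
  define D where "D t = integral {0..t} d" for t
  have LD: "(LINT s:{0..t}|lebesgue. d s) = D t" if "t \<in> {0..T}" for t
    unfolding D_def
    by (rule set_lebesgue_integral_eq_integral(2)) (rule set_integrable_subset[OF i]; use that in auto)
  have dD: "d t = - l * D t" if "t \<in> {0..T}" for t using eq[OF that] LD[OF that] by simp
  have Dc: "continuous_on {0..T} D"
    unfolding D_def by (rule indefinite_integral_continuous_1) (rule set_lebesgue_integral_eq_integral(1)[OF i])
  have "continuous_on {0..T} (\<lambda>t. - l * D t)" by (intro continuous_intros Dc)
  then have dc: "continuous_on {0..T} d" by (rule continuous_on_eq) (use dD in simp)
  have "((\<lambda>t. exp (l * t) * D t) has_real_derivative 0) (at t within {0..T})" if t: "t \<in> {0..T}" for t
  proof -
    have der: "(D has_real_derivative d t) (at t within {0..T})"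
      unfolding D_def by (rule integral_has_real_derivative[OF dc t])
    have "((\<lambda>t. exp (l * t)) has_real_derivative exp (l * t) * l) (at t within {0..T})"
      by (auto intro!: derivative_eq_intros)
    from DERIV_mult[OF this der] show ?thesis by (simp add: dD[OF t] mult_ac)
  qed
  then obtain c where c: "\<And>t. t \<in> {0..T} \<Longrightarrow> exp (l * t) * D t = c"
    using has_field_derivative_zero_constant[of "{0..T}" "\<lambda>t. exp (l * t) * D t"] by auto
  have "c = 0" using c[of 0] t by (simp add: D_def)
  then have "D t = 0" using c[OF t] by simp
  then show ?thesis using dD[OF t] by simp
qed

lemma abs_le_1_plus_square: "\<bar>x\<bar> \<le> 1 + x\<^sup>2" for x :: real
  using sum_squares_bound[of 1 "\<bar>x\<bar>"] by simp

lemma density_path_bound: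
  assumes "density_path T \<rho>" "s \<in> {0..T}" "cont01 h"
  shows "\<bar>LINT q:{0..1}|lebesgue. \<rho> s q * h q\<bar> \<le> 1 + ip h h"
proof -
  have "(LINT q:{0..1}|lebesgue. h q * \<rho> s q)\<^sup>2 \<le> 1\<^sup>2 * ip h h"
    using assms by (intro LINT_times_bound) (auto simp: density_path_def)
  then show ?thesis
    using abs_le_1_plus_square[of "LINT q:{0..1}|lebesgue. \<rho> s q * h q"] by (simp add: mult.commute)
qed

context heat_flow
begin

text \<open>The common form of all weak formulations after testing with the modes: the regime
  survives only in the source \<open>K n\<close>, so that one uniqueness argument serves every
  case.\<close>

definition spectral_identity :: "real \<Rightarrow> (nat \<Rightarrow> real) \<Rightarrow> (real \<Rightarrow> real \<Rightarrow> real) \<Rightarrow> bool" where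
  "spectral_identity T K \<rho> \<longleftrightarrow> (\<forall>n. \<forall>t\<in>{0..T}.
    (LINT q:{0..1}|lebesgue. \<rho> t q * \<phi> n q) - (LINT q:{0..1}|lebesgue. g q * \<phi> n q)
      + lam n * (LINT s:{0..t}|lebesgue. (LINT q:{0..1}|lebesgue. \<rho> s q * \<phi> n q)) = K n * t)"

text \<open>The sources cancel in the difference, so its modes obey a homogeneous linear equation
  and vanish. Density of the modes then annihilates the pairing with every continuous
  function.\<close>

lemma spectral_identity_unique:
  assumes r: "density_path T \<rho>" "\<rho> \<in> L2_H1 T" "spectral_identity T K \<rho>"
    and r': "density_path T \<rho>'" "\<rho>' \<in> L2_H1 T" "spectral_identity T K \<rho>'"
    and t: "t \<in> {0..T}"
  shows "AE q in lebesgue_on {0..1}. \<rho>' t q = \<rho> t q"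
proof -
  define m where "m r n s = (LINT q:{0..1}|lebesgue. r s q * \<phi> n q)" for r n and s :: real
  have zm: "(\<lambda>q. \<rho>' t q - \<rho> t q) \<in> borel_measurable (lebesgue_on {0..1})"
    using r(1) r'(1) t unfolding density_path_def by (intro borel_measurable_diff) auto
  have zb: "\<bar>\<rho>' t q - \<rho> t q\<bar> \<le> 1" if q: "q \<in> {0..1}" for q
  proof -
    have "\<rho>' t q \<in> {0..1}" "\<rho> t q \<in> {0..1}" using r(1) r'(1) t q by (auto simp: density_path_def)
    then show ?thesis by (simp add: abs_le_iff)
  qed
  have mode_zero: "m \<rho>' n t - m \<rho> n t = 0" for n
  proof (rule exponential_decay_zero[of "\<lambda>s. m \<rho>' n s - m \<rho> n s", OF _ _ _ t])
    have mm: "m \<rho> n \<in> borel_measurable (lebesgue_on {0..T})" "m \<rho>' n \<in> borel_measurable (lebesgue_on {0..T})"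
      unfolding m_def by (intro L2_H1_LINT_measurable r(2) r'(2) phi_continuous)+
    have bd: "\<bar>m \<rho> n s\<bar> \<le> 1 + ip (\<phi> n) (\<phi> n)" "\<bar>m \<rho>' n s\<bar> \<le> 1 + ip (\<phi> n) (\<phi> n)" if "s \<in> {0..T}" for s
      unfolding m_def by (intro density_path_bound[OF r(1)] density_path_bound[OF r'(1)] that phi_continuous)+
    show "(\<lambda>s. m \<rho>' n s - m \<rho> n s) \<in> borel_measurable (lebesgue_on {0..T})"
      by (intro borel_measurable_diff mm)
    show "\<bar>m \<rho>' n s - m \<rho> n s\<bar> \<le> (1 + ip (\<phi> n) (\<phi> n)) + (1 + ip (\<phi> n) (\<phi> n))" if "s \<in> {0..T}" for s
      using abs_triangle_ineq4 add_mono[OF bd(2)[OF that] bd(1)[OF that]] by (rule order_trans)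
    show "m \<rho>' n t - m \<rho> n t = - lam n * (LINT s:{0..t}|lebesgue. m \<rho>' n s - m \<rho> n s)" if t: "t \<in> {0..T}" for t
    proof -
      have sub: "{0..t} \<subseteq> {0..T}" using t by auto
      have i: "set_integrable lebesgue {0..t} (m \<rho> n)" "set_integrable lebesgue {0..t} (m \<rho>' n)"
        by (rule set_integrable_subset[OF bounded_measurable_absolutely_integrable[OF mm(1) bd(1)] _ sub], simp_all)
          (rule set_integrable_subset[OF bounded_measurable_absolutely_integrable[OF mm(2) bd(2)] _ sub], simp_all)
      have "m r n t = (LINT q:{0..1}|lebesgue. g q * \<phi> n q) - lam n * (LINT s:{0..t}|lebesgue. m r n s) + K n * t"
        if "spectral_identity T K r" for r
      proof -
        have "m r n t - (LINT q:{0..1}|lebesgue. g q * \<phi> n q) + lam n * (LINT s:{0..t}|lebesgue. m r n s) = K n * t"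
          using that t unfolding spectral_identity_def m_def by blast
        then show ?thesis by (simp add: algebra_simps)
      qed
      from this[OF r(3)] this[OF r'(3)] show ?thesis
        unfolding set_integral_diff(2)[OF i(2,1)] by (simp add: algebra_simps)
    qed
  qed
  have zi: "set_integrable lebesgue {0..1} (\<lambda>q. h q * (\<rho>' t q - \<rho> t q))" if "cont01 h" for h
    by (rule times_continuous_absolutely_integrable[OF zm zb that])
  have mode0: "(LINT q:{0..1}|lebesgue. \<phi> n q * (\<rho>' t q - \<rho> t q)) = 0" for n
  proof -
    have i: "set_integrable lebesgue {0..1} (\<lambda>q. \<phi> n q * \<rho>' t q)" "set_integrable lebesgue {0..1} (\<lambda>q. \<phi> n q * \<rho> t q)"
      using r(1) r'(1) t unfolding density_path_def
      by (auto intro!: times_continuous_absolutely_integrable[where R = 1] phi_continuous)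
    show ?thesis
      using mode_zero[of n] set_integral_diff(2)[OF i] by (simp add: m_def right_diff_distrib mult.commute)
  qed
  have "AE q in lebesgue_on {0..1}. \<rho>' t q - \<rho> t q = 0"
  proof (rule orthogonal_continuous_AE_zero)
    show "set_integrable lebesgue {0..1} (\<lambda>q. \<rho>' t q - \<rho> t q)"
      by (rule bounded_measurable_absolutely_integrable[OF zm zb])
    fix h assume h: "cont01 h"
    let ?I = "LINT q:{0..1}|lebesgue. h q * (\<rho>' t q - \<rho> t q)"
    have "?I\<^sup>2 \<le> e" if e: "e > 0" for e
    proof -
      obtain n c where nc: "ip (\<lambda>x. h x - (\<Sum>i<n. c i * \<phi> i x)) (\<lambda>x. h x - (\<Sum>i<n. c i * \<phi> i x)) < e"
        using phi_dense[OF h e] by blast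
      let ?S = "\<lambda>q. \<Sum>i<n. c i * \<phi> i q"
      have Sc: "cont01 ?S" by (intro continuous_intros phi_continuous)
      have "(LINT q:{0..1}|lebesgue. ?S q * (\<rho>' t q - \<rho> t q))
          = (\<Sum>i<n. c i * (LINT q:{0..1}|lebesgue. \<phi> i q * (\<rho>' t q - \<rho> t q)))"
        by (rule LINT_sum_times[OF zm zb phi_continuous])
      then have "?I = (LINT q:{0..1}|lebesgue. (h q - ?S q) * (\<rho>' t q - \<rho> t q))"
        using set_integral_diff(2)[OF zi[OF h] zi[OF Sc]] by (simp add: mode0 left_diff_distrib)
      moreover have "(LINT q:{0..1}|lebesgue. (h q - ?S q) * (\<rho>' t q - \<rho> t q))\<^sup>2 \<le> 1\<^sup>2 * ip (\<lambda>x. h x - ?S x) (\<lambda>x. h x - ?S x)"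
        by (intro LINT_times_bound[OF zm zb] continuous_intros h phi_continuous)
      ultimately show ?thesis using nc by simp
    qed
    then have "?I\<^sup>2 \<le> 0" by (rule field_le_epsilon[of _ 0, simplified])
    then show "?I = 0" by simp
  qed
  then show ?thesis by simp
qed

end

subsection \<open>Test functions cut off near the boundary\<close>

lemma cutoff''_zero:
  assumes "q \<notin> {1 / real k .. 1 - 1 / real k}" "k > 0"
  shows "cutoff'' k q = 0"
proof -
  have "(cutoff' k has_real_derivative 0) (at q)"
    by (rule has_field_derivative_transform_within_open[OF DERIV_const[of 0], of "- {1 / real k .. 1 - 1 / real k}"])
      (use assms cutoff_values(4) in auto)
  then show ?thesis using DERIV_unique cutoff_derivatives(2) by blast
qed

text \<open>The derivative of the cutoff lives on two strips of width at most \<open>2 / k\<close>,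
  where it is at most \<open>18 * k\<close>; each strip contributes at most \<open>36 * e\<close>.
  For \<open>k \<ge> 5\<close> the strips are disjoint.\<close>

lemma ip_cutoff'_bound:
  assumes u: "cont01 u" and k: "k \<ge> 5"
    and e: "\<And>q. q \<in> {0..1} \<Longrightarrow> q \<le> 2 / real k \<or> 1 - 2 / real k \<le> q \<Longrightarrow> \<bar>u q\<bar> \<le> e"
  shows "\<bar>ip u (cutoff' k)\<bar> \<le> 72 * e"
proof -
  define c where "c = 2 / real k"
  have c: "0 < c" "c < 1 - c" "real k * c = 2" using k by (auto simp: c_def field_simps)
  let ?f = "\<lambda>q. u q * cutoff' k q"
  have fc: "cont01 ?f" by (intro continuous_intros u cutoff_continuous)
  have fcs: "continuous_on {x..y} ?f" if "0 \<le> x" "y \<le> 1" for x y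
    by (rule continuous_on_subset[OF fc]) (use that in auto)
  have fi: "?f integrable_on {x..y}" if "0 \<le> x" "y \<le> 1" for x y
    by (rule integrable_continuous_real[OF fcs[OF that]])
  have split: "ip u (cutoff' k) = integral {0..c} ?f + integral {c..1 - c} ?f + integral {1 - c..1} ?f"
    unfolding ip_def
    using Henstock_Kurzweil_Integration.integral_combine[of 0 "1 - c" 1 ?f]
      Henstock_Kurzweil_Integration.integral_combine[of 0 c "1 - c" ?f] c fi[of 0 1] fi[of 0 "1 - c"] by simp
  have e0: "e \<ge> 0" using e[of 0] k by fastforce
  have bound: "\<bar>?f q\<bar> \<le> e * (18 * real k)" if "q \<in> {0..1}" "q \<le> c \<or> 1 - c \<le> q" for q
    unfolding abs_mult using e[of q] that cutoff_values(3)[of k q] e0 by (intro mult_mono) (auto simp: c_def)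
  have "norm (integral {0..c} ?f) \<le> e * (18 * real k) * (c - 0)"
    by (rule integral_bound) (use c bound fcs in auto)
  moreover have "norm (integral {1 - c..1} ?f) \<le> e * (18 * real k) * (1 - (1 - c))"
    by (rule integral_bound) (use c bound fcs in auto)
  moreover have "norm (integral {c..1 - c} ?f) \<le> 0 * (1 - c - c)"
    by (rule integral_bound) (use c fcs k cutoff_values(5)[of _ k] in \<open>auto simp: c_def\<close>)
  moreover have "e * (18 * real k) * c = 36 * e" using c(3) by (simp add: mult.assoc)
  ultimately show ?thesis unfolding split by simp
qed

text \<open>The derivative of the cutoff tends to the point mass at 0 minus the one at 1. After
  subtraction of the affine interpolant, \<open>w\<close> is small on the strips; for the
  interpolant, integration by parts leaves its slope times the integral of the cutoff.\<close>

lemma ip_cutoff'_tendsto: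
  assumes w: "cont01 w"
  shows "(\<lambda>k. ip w (cutoff' k)) \<longlonglongrightarrow> w 0 - w 1"
proof -
  define l where "l q = w 0 + q * (w 1 - w 0)" for q
  have lc: "cont01 l" unfolding l_def by (intro continuous_intros)
  have dc: "cont01 (\<lambda>q. w q - l q)" by (intro continuous_intros w lc)
  have "(\<lambda>k. ip (\<lambda>q. w q - l q) (cutoff' k)) \<longlonglongrightarrow> 0"
  proof (rule LIMSEQ_I)
    fix r :: real assume r: "r > 0"
    \<comment> \<open>The divisor 100 exceeds the constant 72 of
      \<open>ip_cutoff'_bound\<close>.\<close>
    have near: "\<exists>d>0. \<forall>q\<in>{0..1}. dist q x < d \<longrightarrow> \<bar>w q - l q\<bar> < r / 100" if x: "x \<in> {0, 1}" for x
    proof -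
      have "w x - l x = 0" using x by (auto simp: l_def)
      moreover have "\<exists>d>0. \<forall>q\<in>{0..1}. dist q x < d \<longrightarrow> dist (w q - l q) (w x - l x) < r / 100"
        using dc[unfolded continuous_on_iff, rule_format, of x "r / 100"] x r by auto
      ultimately show ?thesis by (simp only: dist_real_def diff_zero)
    qed
    obtain d0 d1 where d: "d0 > 0" "d1 > 0" "\<And>q. q \<in> {0..1} \<Longrightarrow> dist q 0 < d0 \<Longrightarrow> \<bar>w q - l q\<bar> < r / 100"
      "\<And>q. q \<in> {0..1} \<Longrightarrow> dist q 1 < d1 \<Longrightarrow> \<bar>w q - l q\<bar> < r / 100"
      using near[of 0] near[of 1] by auto
    have "(\<lambda>k. 2 / real k) \<longlonglongrightarrow> 0" by real_asymp
    then have "\<forall>\<^sub>F k in sequentially. 2 / real k < min d0 d1" using d by (intro order_tendstoD) auto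
    then have "\<forall>\<^sub>F k in sequentially. norm (ip (\<lambda>q. w q - l q) (cutoff' k) - 0) < r"
      using eventually_ge_at_top[of 5]
    proof eventually_elim
      case (elim k)
      have "\<bar>ip (\<lambda>q. w q - l q) (cutoff' k)\<bar> \<le> 72 * (r / 100)"
      proof (rule ip_cutoff'_bound[OF dc elim(2)])
        fix q :: real assume q: "q \<in> {0..1}" "q \<le> 2 / real k \<or> 1 - 2 / real k \<le> q"
        then have "dist q 0 < d0 \<or> dist q 1 < d1" using elim(1) by (auto simp: dist_real_def)
        then show "\<bar>w q - l q\<bar> \<le> r / 100" using d(3,4)[OF q(1)] by fastforce
      qed
      also have "\<dots> < r" using r by simp
      finally show ?case by simp
    qed
    then show "\<exists>n0. \<forall>k\<ge>n0. norm (ip (\<lambda>q. w q - l q) (cutoff' k) - 0) < r" by (simp add: eventually_sequentially)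
  qed
  moreover have "(\<lambda>k. ip l (cutoff' k)) \<longlonglongrightarrow> - (w 1 - w 0) * 1"
  proof -
    have "(\<lambda>k. ip (cutoff k) (\<lambda>_. 1)) \<longlonglongrightarrow> (LINT q:{0..1::real}|lebesgue. 1)"
      using cutoff_LINT_tendsto[of "\<lambda>_. 1"] absolutely_integrable_continuous_real[OF continuous_on_const]
      by (subst LINT_times_continuous[symmetric]) (auto intro: cutoff_continuous)
    moreover have "(LINT q:{0..1::real}|lebesgue. 1) = (1::real)" by (subst LINT_continuous) auto
    ultimately have "(\<lambda>k. ip (cutoff k) (\<lambda>_. 1)) \<longlonglongrightarrow> 1" by simp
    then have "(\<lambda>k. - (w 1 - w 0) * ip (cutoff k) (\<lambda>_. 1)) \<longlonglongrightarrow> - (w 1 - w 0) * 1" by (rule tendsto_mult_left)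
    moreover have "\<forall>\<^sub>F k in sequentially. - (w 1 - w 0) * ip (cutoff k) (\<lambda>_. 1) = ip l (cutoff' k)"
      using eventually_gt_at_top[of 0]
    proof eventually_elim
      case (elim k)
      have "ip (cutoff' k) l = cutoff k 1 * l 1 - cutoff k 0 * l 0 - ip (cutoff k) (\<lambda>_. w 1 - w 0)"
        by (rule ip_by_parts)
          (auto simp: l_def[abs_def] intro!: derivative_eq_intros has_field_derivative_at_within[OF cutoff_derivatives(1)] cutoff_continuous)
      moreover have "cutoff k 0 = 0" "cutoff k 1 = 0" using cutoff_values(4)[of 0 k] cutoff_values(4)[of 1 k] elim by auto
      moreover have "ip (cutoff k) (\<lambda>_. w 1 - w 0) = (w 1 - w 0) * ip (cutoff k) (\<lambda>_. 1)"
        using ip_scale_right[of "cutoff k" "w 1 - w 0" "\<lambda>_. 1"] by simp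
      ultimately show ?case by (simp add: ip_commute[of l] left_diff_distrib)
    qed
    ultimately show ?thesis by (rule Lim_transform_eventually)
  qed
  ultimately have "(\<lambda>k. ip (\<lambda>q. w q - l q) (cutoff' k) + ip l (cutoff' k)) \<longlonglongrightarrow> 0 + - (w 1 - w 0) * 1"
    by (rule tendsto_add)
  then show ?thesis using ip_diff_left[OF w lc cutoff_continuous(2)] by simp
qed

text \<open>The free weight \<open>d\<close> lets a small mean square of \<open>w\<close> pay for a
  weak derivative \<open>v\<close> that is merely square integrable.\<close>

lemma LINT_Young:
  assumes v: "L2 v" and w: "cont01 w" and d: "d > 0"
  shows "\<bar>LINT q:{0..1}|lebesgue. v q * w q\<bar> \<le> d * (LINT q:{0..1}|lebesgue. (v q)\<^sup>2) + ip w w / d"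
proof -
  have pointwise: "\<bar>x * y\<bar> \<le> d * x\<^sup>2 + 1 / d * (y * y)" for x y :: real
  proof -
    have "0 \<le> (d * \<bar>x\<bar> - \<bar>y\<bar>)\<^sup>2" by simp
    then have "2 * d * (\<bar>x\<bar> * \<bar>y\<bar>) \<le> d\<^sup>2 * x\<^sup>2 + y * y"
      by (simp add: power2_diff power_mult_distrib power2_eq_square[of y] mult_ac)
    moreover have "d * (\<bar>x\<bar> * \<bar>y\<bar>) \<ge> 0" using d by simp
    ultimately have "d * (\<bar>x\<bar> * \<bar>y\<bar>) \<le> d\<^sup>2 * x\<^sup>2 + y * y" by linarith
    then have "1 / d * (d * (\<bar>x\<bar> * \<bar>y\<bar>)) \<le> 1 / d * (d\<^sup>2 * x\<^sup>2 + y * y)" using d by (intro mult_left_mono) auto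
    then show ?thesis using d by (simp add: abs_mult power2_eq_square distrib_left)
  qed
  have vi: "integrable (lebesgue_on {0..1}) (\<lambda>q. (v q)\<^sup>2)" using v by (simp add: L2_def)
  have wi: "integrable (lebesgue_on {0..1}) (\<lambda>q. w q * w q)"
    unfolding set_integrable_lebesgue_on[symmetric]
    by (intro absolutely_integrable_continuous_real continuous_intros w)
  have "\<bar>LINT q|lebesgue_on {0..1}. v q * w q\<bar> \<le> (LINT q|lebesgue_on {0..1}. \<bar>v q * w q\<bar>)"
    by (rule integral_abs_bound)
  also have "\<dots> \<le> (LINT q|lebesgue_on {0..1}. d * (v q)\<^sup>2 + 1 / d * (w q * w q))"
    by (rule integral_mono_AE') (use pointwise vi wi d in \<open>auto intro!: AE_I2 add_nonneg_nonneg\<close>)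
  also have "\<dots> = d * (LINT q|lebesgue_on {0..1}. (v q)\<^sup>2) + 1 / d * (LINT q|lebesgue_on {0..1}. w q * w q)"
    using vi wi by (subst Bochner_Integration.integral_add) auto
  finally show ?thesis unfolding LINT_lebesgue_on LINT_times_continuous[OF w w, unfolded LINT_lebesgue_on] by simp
qed

section \<open>Modes multiplied by a cutoff\<close>

context heat_basis
begin

definition cut_mode' :: "nat \<Rightarrow> nat \<Rightarrow> real \<Rightarrow> real" where
  "cut_mode' n k q = \<phi>' n q * cutoff k q + \<phi> n q * cutoff' k q"

definition cut_mode'' :: "nat \<Rightarrow> nat \<Rightarrow> real \<Rightarrow> real" where
  "cut_mode'' n k q = (- 2 * lam n * \<phi> n q) * cutoff k q + 2 * (\<phi>' n q * cutoff' k q) + \<phi> n q * cutoff'' k q"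

lemma cut_mode_derivatives:
  assumes "q \<in> {0..1}"
  shows "((\<lambda>q. \<phi> n q * cutoff k q) has_real_derivative cut_mode' n k q) (at q within {0..1})"
    "(cut_mode' n k has_real_derivative cut_mode'' n k q) (at q within {0..1})"
proof -
  note c = has_field_derivative_at_within[OF cutoff_derivatives(1)[of k q], of "{0..1}"]
    has_field_derivative_at_within[OF cutoff_derivatives(2)[of k q], of "{0..1}"]
  show "((\<lambda>q. \<phi> n q * cutoff k q) has_real_derivative cut_mode' n k q) (at q within {0..1})"
    using DERIV_mult[OF phi_derivative[OF assms] c(1)] by (simp add: cut_mode'_def mult_ac)
  show "(cut_mode' n k has_real_derivative cut_mode'' n k q) (at q within {0..1})"
    unfolding cut_mode'_def[abs_def]
    by (rule DERIV_cong[OF DERIV_add[OF DERIV_mult[OF phi'_derivative[OF assms] c(1)] DERIV_mult[OF phi_derivative[OF assms] c(2)]]])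
      (simp add: cut_mode''_def algebra_simps)
qed

lemma cut_mode''_continuous: "cont01 (cut_mode'' n k)"
  unfolding cut_mode''_def[abs_def] by (intro continuous_intros phi_continuous phi'_continuous cutoff_continuous)

lemma dirichlet_mode: "a = 0 \<Longrightarrow> \<phi> n 0 = 0 \<and> \<phi> n 1 = 0"
  using phi_bc[of n, unfolded satisfies_bc_def] ab_pos by simp

text \<open>Nothing is known about the mode outside \<open>[0,1]\<close>, but the factor
  \<open>cutoff' k\<close> vanishes there, so the product is a \<open>C\<^sup>1\<close> function on
  the whole line. Its derivative is checked on an open cover by the open interval and the complement
  of the support interval.\<close>

lemma mode_test_function:
  assumes u: "weak_derivative u v" and k: "k > 0"
  shows "(LINT q:{0..1}|lebesgue. u q * (\<phi>' n q * cutoff' k q + \<phi> n q * cutoff'' k q))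
    = - (LINT q:{0..1}|lebesgue. v q * (\<phi> n q * cutoff' k q))"
proof -
  let ?f = "\<lambda>q. \<phi> n q * cutoff' k q" and ?f' = "\<lambda>q. \<phi>' n q * cutoff' k q + \<phi> n q * cutoff'' k q"
  let ?J = "{1 / real k .. 1 - 1 / real k}"
  have k1: "1 / real k > 0" using k by simp
  have J: "q \<in> {0<..<1} \<or> q \<in> - ?J" for q
    using k1 unfolding Compl_iff atLeastAtMost_iff greaterThanLessThan_iff by linarith
  have zero: "?f q = 0" "?f' q = 0" if "q \<in> - ?J" for q
    using that cutoff_values(4)[of q k] cutoff''_zero[of q k] k by auto
  have deriv: "(?f has_real_derivative ?f' q) (at q)" for q
    using J[of q]
  proof
    assume q: "q \<in> {0<..<1}"
    then have "(\<phi> n has_real_derivative \<phi>' n q) (at q)"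
      using phi_derivative[of q n] by (simp add: at_within_Icc_at)
    from DERIV_mult[OF this cutoff_derivatives(2)] show ?thesis by (simp add: mult_ac)
  next
    assume q: "q \<in> - ?J"
    have "(?f has_real_derivative 0) (at q)"
      by (rule has_field_derivative_transform_within_open[OF DERIV_const[of 0], of "- ?J"])
        (use q zero(1) in \<open>auto simp: open_Compl\<close>)
    then show ?thesis by (simp only: zero(2)[OF q])
  qed
  have cont: "continuous_on UNIV ?f'"
  proof -
    have "continuous_on {0<..<1} ?f'"
    proof (rule continuous_on_subset)
      show "cont01 ?f'" by (intro continuous_intros phi_continuous phi'_continuous cutoff_continuous)
    qed auto
    moreover have "continuous_on (- ?J) ?f'"
      by (rule continuous_on_eq[OF continuous_on_const[of _ 0]]) (simp only: zero)
    ultimately have "continuous_on ({0<..<1} \<union> - ?J) ?f'" by (intro continuous_on_open_Un) (auto simp: open_Compl)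
    moreover have "{0<..<1} \<union> - ?J = UNIV" using J by blast
    ultimately show ?thesis by (simp only:)
  qed
  have "closure {q. ?f q \<noteq> 0} \<subseteq> {0<..<1}"
    using closure_support_cutoff[OF k, of ?f UNIV] zero(1) by simp
  with deriv cont show ?thesis
    by (rule u[unfolded weak_derivative_def, THEN conjunct2, rule_format, of ?f ?f'])
qed

text \<open>The second derivative of the cutoff is of order \<open>k^2\<close> and cannot be
  estimated directly. One of the two mixed terms is joined with it to form the derivative of
  \<open>\<phi> n q * cutoff' k q\<close>, which the weak derivative of \<open>u\<close> absorbs;
  the other mixed term will produce the boundary values of \<open>u\<close>.\<close>

lemma cut_mode_decomposition:
  assumes u: "u \<in> H1" and k: "k > 0"
  shows "ip u (\<lambda>q. 1 / 2 * cut_mode'' n k q) = - lam n * ip u (\<lambda>q. \<phi> n q * cutoff k q)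
    + 1 / 2 * ip (\<lambda>q. u q * \<phi>' n q) (cutoff' k)
    - 1 / 2 * (LINT q:{0..1}|lebesgue. (SOME v. weak_derivative u v) q * (\<phi> n q * cutoff' k q))"
proof -
  have uc: "cont01 u" using u by (rule H1_continuous)
  have wd: "weak_derivative u (SOME v. weak_derivative u v)" using u someI_ex[of "weak_derivative u"] unfolding H1_def by blast
  let ?f' = "\<lambda>q. \<phi>' n q * cutoff' k q + \<phi> n q * cutoff'' k q"
  have c: "cont01 (\<lambda>q. - lam n * (\<phi> n q * cutoff k q))" "cont01 (\<lambda>q. 1 / 2 * (\<phi>' n q * cutoff' k q))" "cont01 ?f'" "cont01 (\<lambda>q. 1 / 2 * ?f' q)"
    "cont01 (\<lambda>q. 1 / 2 * (\<phi>' n q * cutoff' k q) + 1 / 2 * ?f' q)"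
    by (intro continuous_intros phi_continuous phi'_continuous cutoff_continuous)+
  have "ip u ?f' = - (LINT q:{0..1}|lebesgue. (SOME v. weak_derivative u v) q * (\<phi> n q * cutoff' k q))"
    using mode_test_function[OF wd k] LINT_times_continuous[OF uc c(3)] by simp
  moreover have "ip u (\<lambda>q. 1 / 2 * cut_mode'' n k q)
      = ip u (\<lambda>q. - lam n * (\<phi> n q * cutoff k q) + (1 / 2 * (\<phi>' n q * cutoff' k q) + 1 / 2 * ?f' q))"
    by (rule arg_cong[of _ _ "ip u"]) (auto simp: cut_mode''_def algebra_simps)
  moreover have "\<dots> = - lam n * ip u (\<lambda>q. \<phi> n q * cutoff k q) + (1 / 2 * ip u (\<lambda>q. \<phi>' n q * cutoff' k q) + 1 / 2 * ip u ?f')"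
    unfolding ip_add_right[OF c(1) c(5) uc] ip_add_right[OF c(2) c(4) uc] ip_scale_right by (rule refl)
  moreover have "ip u (\<lambda>q. \<phi>' n q * cutoff' k q) = ip (\<lambda>q. u q * \<phi>' n q) (cutoff' k)"
    by (simp add: ip_def mult.assoc)
  ultimately show ?thesis by simp
qed

lemma dirichlet_linear_bound:
  assumes "a = 0"
  obtains L where "L > 0" "\<And>q. q \<in> {0..1} \<Longrightarrow> \<bar>\<phi>' n q\<bar> \<le> L" "\<And>q. q \<in> {0..1} \<Longrightarrow> \<bar>\<phi> n q\<bar> \<le> L * q"
    "\<And>q. q \<in> {0..1} \<Longrightarrow> \<bar>\<phi> n q\<bar> \<le> L * (1 - q)"
proof -
  obtain L where L: "L > 0" "\<And>q. q \<in> {0..1} \<Longrightarrow> \<bar>\<phi>' n q\<bar> \<le> L" using cont01_bounded[OF phi'_continuous] by blast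
  have lip: "norm (\<phi> n q - \<phi> n r) \<le> L * norm (q - r)" if "q \<in> {0..1}" "r \<in> {0..1}" for q r
    by (rule field_differentiable_bound[of "{0..1}" "\<phi> n" "\<phi>' n"]) (use that phi_derivative L in auto)
  show ?thesis
  proof (rule that[OF L])
    show "\<bar>\<phi> n q\<bar> \<le> L * q" if "q \<in> {0..1}" for q using lip[OF that, of 0] dirichlet_mode[OF assms, of n] that by simp
    show "\<bar>\<phi> n q\<bar> \<le> L * (1 - q)" if "q \<in> {0..1}" for q using lip[OF that, of 1] dirichlet_mode[OF assms, of n] that by simp
  qed
qed

text \<open>On the strips the mode is at most \<open>2 * L / k\<close>, so its square times
  \<open>cutoff'\<close> is at most \<open>72 * L\<^sup>2 / k\<close>. With
  \<open>ip_cutoff'_bound\<close> the squared norm of the product is at most \<open>D / k\<close>,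
  where \<open>5184 = 72 * 72\<close>, and Young's inequality with weight \<open>1 / sqrt k\<close>
  balances the two terms.\<close>

lemma cut_mode_remainder:
  assumes a0: "a = 0"
  obtains D where "D \<ge> 0" "\<And>v k. L2 v \<Longrightarrow> k \<ge> 5 \<Longrightarrow> \<bar>LINT q:{0..1}|lebesgue. v q * (\<phi> n q * cutoff' k q)\<bar>
    \<le> 1 / sqrt (real k) * ((LINT q:{0..1}|lebesgue. (v q)\<^sup>2) + D)"
proof -
  obtain L where L: "L > 0" "\<And>q. q \<in> {0..1} \<Longrightarrow> \<bar>\<phi> n q\<bar> \<le> L * q" "\<And>q. q \<in> {0..1} \<Longrightarrow> \<bar>\<phi> n q\<bar> \<le> L * (1 - q)"
    by (rule dirichlet_linear_bound[OF a0, of n]) (rule that)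
  define D where "D = 5184 * L\<^sup>2"
  have "\<bar>LINT q:{0..1}|lebesgue. v q * (\<phi> n q * cutoff' k q)\<bar>
      \<le> 1 / sqrt (real k) * ((LINT q:{0..1}|lebesgue. (v q)\<^sup>2) + D)" if v: "L2 v" and k: "k \<ge> 5" for v k
  proof -
    let ?w = "\<lambda>q. \<phi> n q * cutoff' k q"
    have kp: "real k > 0" using k by simp
    have "\<bar>ip (\<lambda>q. \<phi> n q * \<phi> n q * cutoff' k q) (cutoff' k)\<bar> \<le> 72 * (72 * L\<^sup>2 / real k)"
    proof (rule ip_cutoff'_bound[OF _ k])
      show "cont01 (\<lambda>q. \<phi> n q * \<phi> n q * cutoff' k q)" by (intro continuous_intros phi_continuous cutoff_continuous)
      fix q :: real assume q: "q \<in> {0..1}" "q \<le> 2 / real k \<or> 1 - 2 / real k \<le> q"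
      have "\<bar>\<phi> n q\<bar> \<le> L * (2 / real k)"
        using q(2)
      proof
        assume "q \<le> 2 / real k"
        then have "L * q \<le> L * (2 / real k)" using L(1) by (intro mult_left_mono) auto
        then show ?thesis using L(2)[OF q(1)] by linarith
      next
        assume "1 - 2 / real k \<le> q"
        then have "L * (1 - q) \<le> L * (2 / real k)" using L(1) by (intro mult_left_mono) auto
        then show ?thesis using L(3)[OF q(1)] by linarith
      qed
      then have "\<bar>\<phi> n q\<bar> * \<bar>\<phi> n q\<bar> * \<bar>cutoff' k q\<bar> \<le> (L * (2 / real k)) * (L * (2 / real k)) * (18 * real k)"
        using cutoff_values(3)[of k q] L(1) by (intro mult_mono) auto
      also have "\<dots> = 72 * L\<^sup>2 / real k" using kp by (simp add: field_simps power2_eq_square)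
      finally show "\<bar>\<phi> n q * \<phi> n q * cutoff' k q\<bar> \<le> 72 * L\<^sup>2 / real k" by (simp only: abs_mult)
    qed
    moreover have "ip ?w ?w = ip (\<lambda>q. \<phi> n q * \<phi> n q * cutoff' k q) (cutoff' k)" by (simp add: ip_def mult_ac)
    ultimately have w: "ip ?w ?w \<le> D / real k" by (simp add: D_def)
    have s: "sqrt (real k) > 0" "sqrt (real k) * sqrt (real k) = real k" using kp by auto
    have "\<bar>LINT q:{0..1}|lebesgue. v q * ?w q\<bar> \<le> 1 / sqrt (real k) * (LINT q:{0..1}|lebesgue. (v q)\<^sup>2) + ip ?w ?w / (1 / sqrt (real k))"
      by (rule LINT_Young[OF v]) (use s in \<open>auto intro!: continuous_intros phi_continuous cutoff_continuous\<close>)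
    also have "ip ?w ?w / (1 / sqrt (real k)) \<le> D / real k / (1 / sqrt (real k))"
      using w s(1) by (intro divide_right_mono) auto
    also have "D / real k / (1 / sqrt (real k)) = 1 / sqrt (real k) * D"
    proof -
      have "D / real k / (1 / sqrt (real k)) = D * sqrt (real k) / (sqrt (real k) * sqrt (real k))" unfolding s(2) by simp
      moreover have "x > 0 \<Longrightarrow> D * x / (x * x) = 1 / x * D" for x by (simp add: field_simps)
      from this[OF s(1)] have "D * sqrt (real k) / (sqrt (real k) * sqrt (real k)) = 1 / sqrt (real k) * D" .
      ultimately show ?thesis by (rule trans)
    qed
    finally show ?thesis by (simp add: distrib_left)
  qed
  moreover have "D \<ge> 0" by (simp add: D_def)
  ultimately show ?thesis by (rule that[rotated])
qed

text \<open>The boundary values of \<open>u\<close> come from the concentration of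
  \<open>cutoff'\<close> at the two ends. The shift by 5 keeps the index in the range where the
  estimates on the strips hold.\<close>

lemma cut_mode_limit:
  assumes a0: "a = 0" and u: "u \<in> H1"
  shows "(\<lambda>k. ip u (\<lambda>q. 1 / 2 * cut_mode'' n (k + 5) q)) \<longlonglongrightarrow> - lam n * ip u (\<phi> n) + (u 0 * \<phi>' n 0 - u 1 * \<phi>' n 1) / 2"
proof -
  have uc: "cont01 u" using u by (rule H1_continuous)
  let ?v = "SOME v. weak_derivative u v"
  have v: "L2 ?v" using u someI_ex[of "weak_derivative u"] unfolding H1_def weak_derivative_def by blast
  obtain D where D: "\<And>k. k \<ge> 5 \<Longrightarrow> \<bar>LINT q:{0..1}|lebesgue. ?v q * (\<phi> n q * cutoff' k q)\<bar>
    \<le> 1 / sqrt (real k) * ((LINT q:{0..1}|lebesgue. (?v q)\<^sup>2) + D)"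
    by (rule cut_mode_remainder[OF a0, of n]) (use v that in blast)
  have A: "(\<lambda>k. ip u (\<lambda>q. \<phi> n q * cutoff k q)) \<longlonglongrightarrow> ip u (\<phi> n)"
  proof -
    have c: "cont01 (\<lambda>q. u q * \<phi> n q)" by (intro continuous_intros uc phi_continuous)
    have "(\<lambda>k. LINT q:{0..1}|lebesgue. cutoff k q * (u q * \<phi> n q)) \<longlonglongrightarrow> (LINT q:{0..1}|lebesgue. u q * \<phi> n q)"
      by (rule cutoff_LINT_tendsto[OF absolutely_integrable_continuous_real[OF c]])
    moreover have "(LINT q:{0..1}|lebesgue. cutoff k q * (u q * \<phi> n q)) = ip u (\<lambda>q. \<phi> n q * cutoff k q)" for k
      unfolding LINT_times_continuous[OF cutoff_continuous(1) c] by (simp add: ip_def mult_ac)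
    ultimately show ?thesis by (simp add: LINT_times_continuous[OF uc phi_continuous])
  qed
  have B: "(\<lambda>k. ip (\<lambda>q. u q * \<phi>' n q) (cutoff' k)) \<longlonglongrightarrow> u 0 * \<phi>' n 0 - u 1 * \<phi>' n 1"
    by (rule ip_cutoff'_tendsto[of "\<lambda>q. u q * \<phi>' n q"]) (intro continuous_intros uc phi'_continuous)
  have E: "(\<lambda>k. LINT q:{0..1}|lebesgue. ?v q * (\<phi> n q * cutoff' k q)) \<longlonglongrightarrow> 0"
  proof (rule Lim_null_comparison)
    show "\<forall>\<^sub>F k in sequentially. norm (LINT q:{0..1}|lebesgue. ?v q * (\<phi> n q * cutoff' k q))
        \<le> 1 / sqrt (real k) * ((LINT q:{0..1}|lebesgue. (?v q)\<^sup>2) + D)"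
      using eventually_ge_at_top[of 5] by eventually_elim (use D in simp)
    have "(\<lambda>k. 1 / sqrt (real k)) \<longlonglongrightarrow> 0" by real_asymp
    from tendsto_mult_right[OF this, of "(LINT q:{0..1}|lebesgue. (?v q)\<^sup>2) + D"]
    show "(\<lambda>k. 1 / sqrt (real k) * ((LINT q:{0..1}|lebesgue. (?v q)\<^sup>2) + D)) \<longlonglongrightarrow> 0" by simp
  qed
  have "(\<lambda>k. - lam n * ip u (\<lambda>q. \<phi> n q * cutoff k q) + 1 / 2 * ip (\<lambda>q. u q * \<phi>' n q) (cutoff' k)
      - 1 / 2 * (LINT q:{0..1}|lebesgue. ?v q * (\<phi> n q * cutoff' k q)))
    \<longlonglongrightarrow> - lam n * ip u (\<phi> n) + 1 / 2 * (u 0 * \<phi>' n 0 - u 1 * \<phi>' n 1) - 1 / 2 * 0"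
    by (intro tendsto_intros A B E)
  from LIMSEQ_ignore_initial_segment[OF this, of 5] show ?thesis
    by (subst cut_mode_decomposition[OF u]) simp_all
qed

text \<open>The same three terms bounded uniformly in \<open>k\<close> by a quantity that is
  integrable in time along a path in \<open>L2_H1 T\<close>: the dominating function for the limit
  under the time integral.\<close>

lemma cut_mode_bound:
  assumes a0: "a = 0"
  obtains D where "\<And>u k. u \<in> H1 \<Longrightarrow> (\<And>q. q \<in> {0..1} \<Longrightarrow> \<bar>u q\<bar> \<le> 1) \<Longrightarrow> k \<ge> 5 \<Longrightarrow>
    \<bar>ip u (\<lambda>q. 1 / 2 * cut_mode'' n k q)\<bar> \<le> D + (H1_norm u)\<^sup>2"
proof -
  obtain L where L: "L > 0" "\<And>q. q \<in> {0..1} \<Longrightarrow> \<bar>\<phi>' n q\<bar> \<le> L"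
    "\<And>q. q \<in> {0..1} \<Longrightarrow> \<bar>\<phi> n q\<bar> \<le> L * q"
    by (rule dirichlet_linear_bound[OF a0, of n]) (rule that)
  obtain D where D: "D \<ge> 0" "\<And>v k. L2 v \<Longrightarrow> k \<ge> 5 \<Longrightarrow> \<bar>LINT q:{0..1}|lebesgue. v q * (\<phi> n q * cutoff' k q)\<bar>
    \<le> 1 / sqrt (real k) * ((LINT q:{0..1}|lebesgue. (v q)\<^sup>2) + D)"
    by (rule cut_mode_remainder[OF a0, of n]) (rule that)
  show ?thesis
  proof (rule that[of "lam n * (1 + L\<^sup>2) + 36 * L + D"])
    fix u and k :: nat
    assume u: "u \<in> H1" "\<And>q. q \<in> {0..1} \<Longrightarrow> \<bar>u q\<bar> \<le> 1" and k: "k \<ge> 5"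
    have uc: "cont01 u" using u(1) by (rule H1_continuous)
    let ?v = "SOME v. weak_derivative u v"
    let ?V = "LINT q:{0..1}|lebesgue. (?v q)\<^sup>2"
    let ?A = "ip u (\<lambda>q. \<phi> n q * cutoff k q)" and ?B = "ip (\<lambda>q. u q * \<phi>' n q) (cutoff' k)"
    let ?E = "LINT q:{0..1}|lebesgue. ?v q * (\<phi> n q * cutoff' k q)"
    have v: "L2 ?v" using u(1) someI_ex[of "weak_derivative u"] unfolding H1_def weak_derivative_def by blast
    have "\<bar>?A\<bar> \<le> 1 + L\<^sup>2"
    proof -
      have pc: "cont01 (\<lambda>q. \<phi> n q * cutoff k q)" by (intro continuous_intros phi_continuous cutoff_continuous)
      have "?A\<^sup>2 \<le> ip u u * ip (\<lambda>q. \<phi> n q * cutoff k q) (\<lambda>q. \<phi> n q * cutoff k q)"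
        by (rule ip_Cauchy_Schwarz[OF uc pc])
      also have "\<dots> \<le> 1\<^sup>2 * L\<^sup>2"
      proof (intro mult_mono ip_le_bound uc pc u(2))
        fix q :: real assume q: "q \<in> {0..1}"
        have "\<bar>\<phi> n q\<bar> * \<bar>cutoff k q\<bar> \<le> (L * q) * 1"
          using L(3)[OF q] cutoff_values(1,2)[of k q] q L(1) by (intro mult_mono) auto
        also have "\<dots> \<le> L * 1" using q L(1) by auto
        finally show "\<bar>\<phi> n q * cutoff k q\<bar> \<le> L" by (simp add: abs_mult)
      qed (auto intro: ip_nonneg)
      finally show ?thesis using abs_le_1_plus_square[of ?A] by simp
    qed
    then have A: "lam n * \<bar>?A\<bar> \<le> lam n * (1 + L\<^sup>2)" by (rule mult_left_mono) (rule lam_nonneg)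
    have B: "\<bar>?B\<bar> \<le> 72 * L"
    proof (rule ip_cutoff'_bound[OF _ k])
      show "cont01 (\<lambda>q. u q * \<phi>' n q)" by (intro continuous_intros uc phi'_continuous)
      show "\<bar>u q * \<phi>' n q\<bar> \<le> L" if "q \<in> {0..1}" for q
        using mult_mono[OF u(2)[OF that] L(2)[OF that]] by (simp add: abs_mult)
    qed
    have V: "?V \<le> (H1_norm u)\<^sup>2" "?V \<ge> 0"
      using H1_norm_bounds(1)[OF uc] ip_nonneg[of u] by (auto simp: LINT_lebesgue_on)
    have "1 / sqrt (real k) \<le> 1" using k by simp
    then have "1 / sqrt (real k) * (?V + D) \<le> 1 * (?V + D)" using V D(1) by (intro mult_right_mono) auto
    with D(2)[OF v k] have "\<bar>?E\<bar> \<le> 1 * (?V + D)" by (rule order_trans)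
    then have E: "\<bar>?E\<bar> \<le> (H1_norm u)\<^sup>2 + D" using V(1) by simp
    have "\<bar>- lam n * ?A + 1 / 2 * ?B - 1 / 2 * ?E\<bar> \<le> lam n * \<bar>?A\<bar> + 1 / 2 * \<bar>?B\<bar> + \<bar>?E\<bar>"
    proof -
      have "\<bar>- lam n * ?A\<bar> = lam n * \<bar>?A\<bar>" using lam_nonneg[of n] by (simp add: abs_mult)
      then show ?thesis by linarith
    qed
    then show "\<bar>ip u (\<lambda>q. 1 / 2 * cut_mode'' n k q)\<bar> \<le> lam n * (1 + L\<^sup>2) + 36 * L + D + (H1_norm u)\<^sup>2"
      using A B E k by (subst cut_mode_decomposition[OF u(1)]) linarith+
  qed
qed

end

subsection \<open>Every weak solution satisfies the spectral identity\<close>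

lemma C12_static:
  assumes d: "\<And>q. q \<in> {0..1} \<Longrightarrow> (h has_real_derivative h' q) (at q within {0..1})"
    "\<And>q. q \<in> {0..1} \<Longrightarrow> (h' has_real_derivative h'' q) (at q within {0..1})" and c: "cont01 h''"
  shows "C12 T (\<lambda>_. h) (\<lambda>_ _. 0) (\<lambda>_. h') (\<lambda>_. h'')"
proof -
  have h: "cont01 h" "cont01 h'" using d DERIV_continuous_on by blast+
  have "continuous_on ({0..T} \<times> {0..1}) (\<lambda>(s, q). f q)" if "cont01 f" for f :: "real \<Rightarrow> real"
    unfolding case_prod_beta' by (rule continuous_on_compose2[OF that continuous_on_snd[OF continuous_on_id]]) auto
  then show ?thesis using d c h unfolding C12_def by (auto simp: case_prod_beta')
qed

lemma LINT_const: "t \<ge> 0 \<Longrightarrow> (LINT s:{0..t}|lebesgue. c) = (c * t :: real)"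
  by (subst LINT_continuous) (auto simp: mult.commute)

lemma lebesgue_on_subset:
  fixes f :: "real \<Rightarrow> real"
  assumes "t \<in> {0..T}"
  shows "integrable (lebesgue_on {0..T}) f \<Longrightarrow> integrable (lebesgue_on {0..t}) f"
    and "f \<in> borel_measurable (lebesgue_on {0..T}) \<Longrightarrow> f \<in> borel_measurable (lebesgue_on {0..t})"
    and "(AE s in lebesgue_on {0..T}. P s) \<Longrightarrow> AE s in lebesgue_on {0..t}. P s"
proof -
  have sub: "{0..t} \<subseteq> {0..T}" using assms by auto
  show "integrable (lebesgue_on {0..T}) f \<Longrightarrow> integrable (lebesgue_on {0..t}) f"
    unfolding set_integrable_lebesgue_on[symmetric] by (erule set_integrable_subset) (use sub in auto)
  show "f \<in> borel_measurable (lebesgue_on {0..T}) \<Longrightarrow> f \<in> borel_measurable (lebesgue_on {0..t})"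
    by (rule measurable_restrict_mono[OF _ sub])
  show "(AE s in lebesgue_on {0..T}. P s) \<Longrightarrow> AE s in lebesgue_on {0..t}. P s"
    unfolding AE_lebesgue_on by (erule eventually_mono) (use sub in auto)
qed

lemma density_path_integrable:
  assumes r: "density_path T \<rho>" and rho: "\<rho> \<in> L2_H1 T" and t: "t \<in> {0..T}" and h: "cont01 h"
  shows "set_integrable lebesgue {0..t} (\<lambda>s. LINT q:{0..1}|lebesgue. \<rho> s q * h q)"
  unfolding set_integrable_lebesgue_on
  by (rule lebesgue_on_subset(1)[OF t], unfold set_integrable_lebesgue_on[symmetric])
    (rule bounded_measurable_absolutely_integrable[OF L2_H1_LINT_measurable[OF rho h] density_path_bound[OF r _ h]])

context heat_flow
begin

lemma heat_terms_mode:
  "heat_terms g \<rho> (\<lambda>_. \<phi> n) (\<lambda>_ _. 0) (\<lambda>_ q. - 2 * lam n * \<phi> n q) t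
    = (LINT q:{0..1}|lebesgue. \<rho> t q * \<phi> n q) - (LINT q:{0..1}|lebesgue. g q * \<phi> n q)
      + lam n * (LINT s:{0..t}|lebesgue. (LINT q:{0..1}|lebesgue. \<rho> s q * \<phi> n q))"
proof -
  have "\<rho> s q * (1 / 2 * (- 2 * lam n * \<phi> n q) + 0) = - lam n * (\<rho> s q * \<phi> n q)" for s q by simp
  then show ?thesis unfolding heat_terms_def by (simp only: set_integral_mult_right)
qed

lemma C12_mode: "C12 T (\<lambda>_. \<phi> n) (\<lambda>_ _. 0) (\<lambda>_. \<phi>' n) (\<lambda>_ q. - 2 * lam n * \<phi> n q)"
  by (intro C12_static phi_derivative phi'_derivative continuous_intros phi_continuous)

lemma Dir0_spectral_identity:
  assumes a0: "a = 0" and sol: "weak_solution_Dir0 T \<alpha> \<beta> g \<rho>"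
  shows "spectral_identity T (\<lambda>n. (\<alpha> * \<phi>' n 0 - \<beta> * \<phi>' n 1) / 2) \<rho>"
  unfolding spectral_identity_def
proof (intro allI ballI)
  fix n t assume t: "t \<in> {0..T}"
  have "vanishes_at_boundary T (\<lambda>_. \<phi> n)" using dirichlet_mode[OF a0] by (simp add: vanishes_at_boundary_def)
  then have "heat_terms g \<rho> (\<lambda>_. \<phi> n) (\<lambda>_ _. 0) (\<lambda>_ q. - 2 * lam n * \<phi> n q) t
      + (LINT s:{0..t}|lebesgue. \<beta> / 2 * \<phi>' n 1 - \<alpha> / 2 * \<phi>' n 0) = 0"
    using sol t C12_mode[of T n] unfolding weak_solution_Dir0_def by blast
  moreover have "(LINT s:{0..t}|lebesgue. \<beta> / 2 * \<phi>' n 1 - \<alpha> / 2 * \<phi>' n 0)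
      = - ((\<alpha> * \<phi>' n 0 - \<beta> * \<phi>' n 1) / 2 * t)"
    using t by (subst LINT_const) (auto simp: algebra_simps diff_divide_distrib)
  ultimately show "(LINT q:{0..1}|lebesgue. \<rho> t q * \<phi> n q) - (LINT q:{0..1}|lebesgue. g q * \<phi> n q)
      + lam n * (LINT s:{0..t}|lebesgue. (LINT q:{0..1}|lebesgue. \<rho> s q * \<phi> n q))
    = (\<alpha> * \<phi>' n 0 - \<beta> * \<phi>' n 1) / 2 * t"
    unfolding heat_terms_mode by linarith
qed

text \<open>The boundary condition of the mode makes the two boundary integrals combine: the unknown
  boundary values of \<rho> occur in both with opposite signs, and only the reservoir densities
  remain. Splitting the integrals requires these boundary values to be integrable in time, hence
  \<open>L2_H1_value_measurable\<close>.\<close>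

lemma Rob_spectral_identity:
  assumes a1: "a = 1" and sol: "weak_solution_Rob T \<alpha> \<beta> b g \<rho>"
  shows "spectral_identity T (\<lambda>n. b / 2 * (\<alpha> * \<phi> n 0 + \<beta> * \<phi> n 1)) \<rho>"
  unfolding spectral_identity_def
proof (intro allI ballI)
  fix n t assume t: "t \<in> {0..T}"
  have r: "density_path T \<rho>" "\<rho> \<in> L2_H1 T" using sol by (auto simp: weak_solution_Rob_def)
  have bc: "\<phi>' n 0 = b * \<phi> n 0" "\<phi>' n 1 = - b * \<phi> n 1"
    using phi_bc[of n, unfolded satisfies_bc_def] a1 by auto
  define w where "w s = \<rho> s 0 * \<phi> n 0 + \<rho> s 1 * \<phi> n 1" for s
  define c where "c = \<alpha> * \<phi> n 0 + \<beta> * \<phi> n 1"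
  have eq: "heat_terms g \<rho> (\<lambda>_. \<phi> n) (\<lambda>_ _. 0) (\<lambda>_ q. - 2 * lam n * \<phi> n q) t
      + 1 / 2 * (LINT s:{0..t}|lebesgue. \<rho> s 1 * \<phi>' n 1 - \<rho> s 0 * \<phi>' n 0)
      - b / 2 * (LINT s:{0..t}|lebesgue. \<phi> n 0 * (\<alpha> - \<rho> s 0) + \<phi> n 1 * (\<beta> - \<rho> s 1)) = 0"
    using sol t C12_mode[of T n] unfolding weak_solution_Rob_def by blast
  have wi: "set_integrable lebesgue {0..t} w"
    unfolding set_integrable_lebesgue_on
  proof (rule lebesgue_on_subset(1)[OF t], unfold set_integrable_lebesgue_on[symmetric],
      rule bounded_measurable_absolutely_integrable)
    show "w \<in> borel_measurable (lebesgue_on {0..T})"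
      unfolding w_def by (intro borel_measurable_add borel_measurable_times borel_measurable_const L2_H1_value_measurable[OF r(2)]) auto
    show "\<bar>w s\<bar> \<le> 1 * \<bar>\<phi> n 0\<bar> + 1 * \<bar>\<phi> n 1\<bar>" if "s \<in> {0..T}" for s
    proof -
      have "\<bar>\<rho> s 0\<bar> \<le> 1" "\<bar>\<rho> s 1\<bar> \<le> 1" using r(1) that by (auto simp: density_path_def)
      then have "\<bar>\<rho> s 0\<bar> * \<bar>\<phi> n 0\<bar> + \<bar>\<rho> s 1\<bar> * \<bar>\<phi> n 1\<bar> \<le> 1 * \<bar>\<phi> n 0\<bar> + 1 * \<bar>\<phi> n 1\<bar>"
        by (intro add_mono mult_right_mono) auto
      then show ?thesis unfolding w_def using abs_triangle_ineq[of "\<rho> s 0 * \<phi> n 0" "\<rho> s 1 * \<phi> n 1"] by (simp only: abs_mult)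
    qed
  qed
  have "\<rho> s 1 * \<phi>' n 1 - \<rho> s 0 * \<phi>' n 0 = - b * w s" for s unfolding bc w_def by (simp add: algebra_simps)
  then have 1: "(LINT s:{0..t}|lebesgue. \<rho> s 1 * \<phi>' n 1 - \<rho> s 0 * \<phi>' n 0) = - b * (LINT s:{0..t}|lebesgue. w s)"
    by (simp only: set_integral_mult_right)
  have ci: "set_integrable lebesgue {0..t} (\<lambda>_. c)" by (rule absolutely_integrable_continuous_real[OF continuous_on_const])
  have "\<phi> n 0 * (\<alpha> - \<rho> s 0) + \<phi> n 1 * (\<beta> - \<rho> s 1) = c - w s" for s unfolding c_def w_def by (simp add: algebra_simps)
  then have 2: "(LINT s:{0..t}|lebesgue. \<phi> n 0 * (\<alpha> - \<rho> s 0) + \<phi> n 1 * (\<beta> - \<rho> s 1)) = c * t - (LINT s:{0..t}|lebesgue. w s)"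
    using set_integral_diff(2)[OF ci wi] t by (simp add: LINT_const)
  show "(LINT q:{0..1}|lebesgue. \<rho> t q * \<phi> n q) - (LINT q:{0..1}|lebesgue. g q * \<phi> n q)
      + lam n * (LINT s:{0..t}|lebesgue. (LINT q:{0..1}|lebesgue. \<rho> s q * \<phi> n q))
    = b / 2 * (\<alpha> * \<phi> n 0 + \<beta> * \<phi> n 1) * t"
    using eq unfolding 1 2 heat_terms_mode c_def[symmetric] by (simp add: algebra_simps)
qed

text \<open>The modes themselves are not compactly supported, so cut modes are used. The boundary
  terms absent from this formulation reappear in the limit through the prescribed boundary values;
  the limit under the time integral is dominated by means of \<open>cut_mode_bound\<close>.\<close>

lemma Dirc_spectral_identity:
  assumes a0: "a = 0" and sol: "weak_solution_Dirc T \<alpha> \<beta> g \<rho>"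
  shows "spectral_identity T (\<lambda>n. (\<alpha> * \<phi>' n 0 - \<beta> * \<phi>' n 1) / 2) \<rho>"
  unfolding spectral_identity_def
proof (intro allI ballI)
  fix n t assume t: "t \<in> {0..T}"
  have r: "density_path T \<rho>" "\<rho> \<in> L2_H1 T" "\<And>s. s \<in> {0<..T} \<Longrightarrow> \<rho> s 0 = \<alpha> \<and> \<rho> s 1 = \<beta>"
    using sol by (auto simp: weak_solution_Dirc_def)
  define c where "c = (\<alpha> * \<phi>' n 0 - \<beta> * \<phi>' n 1) / 2"
  define m where "m s = (LINT q:{0..1}|lebesgue. \<rho> s q * \<phi> n q)" for s
  define V where "V k s = (LINT q:{0..1}|lebesgue. \<rho> s q * (1 / 2 * cut_mode'' n (k + 5) q))" for k s
  have Wc: "cont01 (\<lambda>q. 1 / 2 * cut_mode'' n k q)" for k by (intro continuous_intros cut_mode''_continuous)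
  have eq: "(LINT q:{0..1}|lebesgue. \<rho> t q * (\<phi> n q * cutoff (k + 5) q))
      - (LINT q:{0..1}|lebesgue. g q * (\<phi> n q * cutoff (k + 5) q)) - (LINT s:{0..t}|lebesgue. V k s) = 0" for k
  proof -
    have "C12 T (\<lambda>_ q. \<phi> n q * cutoff (k + 5) q) (\<lambda>_ _. 0) (\<lambda>_. cut_mode' n (k + 5)) (\<lambda>_. cut_mode'' n (k + 5))"
      by (intro C12_static cut_mode_derivatives cut_mode''_continuous)
    moreover have "closure {q \<in> {0..1}. \<phi> n q * cutoff (k + 5) q \<noteq> 0} \<subseteq> {0<..<1}"
      by (rule closure_support_cutoff[of "k + 5"]) (use cutoff_values(4)[of _ "k + 5"] in auto)
    then have "compactly_supported T (\<lambda>_ q. \<phi> n q * cutoff (k + 5) q)" by (simp add: compactly_supported_def)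
    ultimately have "heat_terms g \<rho> (\<lambda>_ q. \<phi> n q * cutoff (k + 5) q) (\<lambda>_ _. 0) (\<lambda>_. cut_mode'' n (k + 5)) t = 0"
      using sol t unfolding weak_solution_Dirc_def by blast
    then show ?thesis unfolding heat_terms_def V_def by simp
  qed
  have initial: "(\<lambda>k. LINT q:{0..1}|lebesgue. u q * (\<phi> n q * cutoff (k + 5) q)) \<longlonglongrightarrow> (LINT q:{0..1}|lebesgue. u q * \<phi> n q)"
    if "u \<in> borel_measurable (lebesgue_on {0..1})" "\<And>q. q \<in> {0..1} \<Longrightarrow> u q \<in> {0..1}" for u
  proof -
    have "set_integrable lebesgue {0..1} (\<lambda>q. \<phi> n q * u q)"
      by (rule times_continuous_absolutely_integrable[OF that(1) _ phi_continuous, of 1]) (use that(2) in auto)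
    from LIMSEQ_ignore_initial_segment[OF cutoff_LINT_tendsto[OF this], of 5] show ?thesis
      by (simp add: mult_ac)
  qed
  have "(\<lambda>k. LINT s:{0..t}|lebesgue. V k s) \<longlonglongrightarrow> (LINT s:{0..t}|lebesgue. - lam n * m s + c)"
  proof (rule L2_H1_representative[OF r(2)])
    fix f assume f: "AE s in lebesgue_on {0..T}. f s \<in> H1 \<and> (\<forall>q\<in>{0..1}. \<rho> s q = f s q)"
      "integrable (lebesgue_on {0..T}) (\<lambda>s. (H1_norm (f s))\<^sup>2)"
    obtain D where D: "\<And>u k. u \<in> H1 \<Longrightarrow> (\<And>q. q \<in> {0..1} \<Longrightarrow> \<bar>u q\<bar> \<le> 1) \<Longrightarrow> k \<ge> 5 \<Longrightarrow>
        \<bar>ip u (\<lambda>q. 1 / 2 * cut_mode'' n k q)\<bar> \<le> D + (H1_norm u)\<^sup>2"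
      by (rule cut_mode_bound[OF a0, of n]) (erule that)
    have "AE s in lebesgue. s \<noteq> (0::real)" by (intro AE_completion AE_lborel_singleton)
    then have "AE s in lebesgue_on {0..T}. s \<in> {0<..T}"
      unfolding AE_lebesgue_on by eventually_elim auto
    then have good: "AE s in lebesgue_on {0..t}. s \<in> {0<..T} \<and> f s \<in> H1 \<and> (\<forall>q\<in>{0..1}. \<rho> s q = f s q)"
      using f(1) by (intro lebesgue_on_subset(3)[OF t]) (rule AE_conjI)
    have LV: "(LINT q:{0..1}|lebesgue. \<rho> s q * h q) = ip (f s) h"
      if "f s \<in> H1" "\<forall>q\<in>{0..1}. \<rho> s q = f s q" "cont01 h" for s h
    proof -
      have "(LINT q:{0..1}|lebesgue. \<rho> s q * h q) = (LINT q:{0..1}|lebesgue. f s q * h q)"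
        by (rule set_lebesgue_integral_cong) (use that in auto)
      then show ?thesis by (simp add: LINT_times_continuous[OF H1_continuous[OF that(1)] that(3)])
    qed
    show ?thesis
      unfolding LINT_lebesgue_on
    proof (rule integral_dominated_convergence[where w = "\<lambda>s. D + (H1_norm (f s))\<^sup>2"])
      show "(\<lambda>s. - lam n * m s + c) \<in> borel_measurable (lebesgue_on {0..t})"
        unfolding m_def
        by (intro lebesgue_on_subset(2)[OF t] borel_measurable_add borel_measurable_times borel_measurable_const
            L2_H1_LINT_measurable[OF r(2)] phi_continuous)
      show "V k \<in> borel_measurable (lebesgue_on {0..t})" for k
        unfolding V_def by (intro lebesgue_on_subset(2)[OF t] L2_H1_LINT_measurable[OF r(2) Wc])
      show "integrable (lebesgue_on {0..t}) (\<lambda>s. D + (H1_norm (f s))\<^sup>2)"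
        by (intro Bochner_Integration.integrable_add lebesgue_on_subset(1)[OF t f(2)]
            finite_measure.integrable_const finite_measure_lebesgue_on) simp
      show "AE s in lebesgue_on {0..t}. (\<lambda>k. V k s) \<longlonglongrightarrow> - lam n * m s + c"
        using good
      proof eventually_elim
        case (elim s)
        then have fs: "f s \<in> H1" "\<forall>q\<in>{0..1}. \<rho> s q = f s q" and s: "s \<in> {0<..T}" by auto
        have "f s 0 = \<alpha>" "f s 1 = \<beta>" using r(3)[OF s] fs(2) by auto
        with cut_mode_limit[OF a0 fs(1), of n] show ?case
          unfolding V_def m_def c_def LV[OF fs Wc] LV[OF fs phi_continuous] by simp
      qed
      show "AE s in lebesgue_on {0..t}. norm (V k s) \<le> D + (H1_norm (f s))\<^sup>2" for k
        using good
      proof eventually_elim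
        case (elim s)
        then have fs: "f s \<in> H1" "\<forall>q\<in>{0..1}. \<rho> s q = f s q" and s: "s \<in> {0..T}" by auto
        have "\<bar>ip (f s) (\<lambda>q. 1 / 2 * cut_mode'' n (k + 5) q)\<bar> \<le> D + (H1_norm (f s))\<^sup>2"
        proof (rule D[OF fs(1)])
          fix q :: real assume q: "q \<in> {0..1}"
          then have "\<rho> s q \<in> {0..1}" using r(1) s by (simp add: density_path_def)
          then show "\<bar>f s q\<bar> \<le> 1" using fs(2) q by simp
        qed simp
        then show ?case unfolding V_def LV[OF fs Wc] by simp
      qed
    qed
  qed
  moreover have "(LINT s:{0..t}|lebesgue. - lam n * m s + c) = - lam n * (LINT s:{0..t}|lebesgue. m s) + c * t"
  proof -
    have mi: "set_integrable lebesgue {0..t} (\<lambda>s. - lam n * m s)"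
      using density_path_integrable[OF r(1,2) t phi_continuous] unfolding m_def by (rule set_integrable_mult_right)
    have "set_integrable lebesgue {0..t} (\<lambda>_. c)" by (rule absolutely_integrable_continuous_real[OF continuous_on_const])
    from set_integral_add(2)[OF mi this] show ?thesis
      unfolding set_integral_mult_right using t by (simp add: LINT_const)
  qed
  ultimately have V: "(\<lambda>k. LINT s:{0..t}|lebesgue. V k s) \<longlonglongrightarrow> - lam n * (LINT s:{0..t}|lebesgue. m s) + c * t" by simp
  have "(\<lambda>k. (LINT q:{0..1}|lebesgue. \<rho> t q * (\<phi> n q * cutoff (k + 5) q))
      - (LINT q:{0..1}|lebesgue. g q * (\<phi> n q * cutoff (k + 5) q)) - (LINT s:{0..t}|lebesgue. V k s))
    \<longlonglongrightarrow> (LINT q:{0..1}|lebesgue. \<rho> t q * \<phi> n q) - (LINT q:{0..1}|lebesgue. g q * \<phi> n q)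
      - (- lam n * (LINT s:{0..t}|lebesgue. m s) + c * t)"
    using r(1) t initial_range
    by (intro tendsto_diff V initial initial_measurable) (auto simp: density_path_def)
  then have "(LINT q:{0..1}|lebesgue. \<rho> t q * \<phi> n q) - (LINT q:{0..1}|lebesgue. g q * \<phi> n q)
      - (- lam n * (LINT s:{0..t}|lebesgue. m s) + c * t) = 0"
    unfolding eq by (simp add: LIMSEQ_const_iff)
  then show "(LINT q:{0..1}|lebesgue. \<rho> t q * \<phi> n q) - (LINT q:{0..1}|lebesgue. g q * \<phi> n q)
      + lam n * (LINT s:{0..t}|lebesgue. (LINT q:{0..1}|lebesgue. \<rho> s q * \<phi> n q))
    = (\<alpha> * \<phi>' n 0 - \<beta> * \<phi>' n 1) / 2 * t"
    unfolding m_def c_def by simp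
qed

end

subsection \<open>Existence and the hydrodynamic limit\<close>

text \<open>The support is closed and avoids the endpoints, so the function vanishes near them and
  so does its one-sided derivative. Compactly supported test functions thus become a special case of
  those vanishing at the boundary.\<close>

lemma compactly_supported_boundary:
  assumes C: "C12 T G Gt Gq Gqq" and supp: "compactly_supported T G" and s: "s \<in> {0..T}" and x: "x \<in> {0, 1}"
  shows "G s x = 0 \<and> Gq s x = 0"
proof -
  have "x \<notin> closure {q \<in> {0..1}. G s q \<noteq> 0}" using supp s x unfolding compactly_supported_def by fastforce
  then obtain d where d: "d > 0" "\<And>q. q \<in> {0..1} \<Longrightarrow> dist q x < d \<Longrightarrow> G s q = 0"
    unfolding closure_approachable by auto
  have x1: "x \<in> {0..1}" using x by auto
  have "((\<lambda>_. 0::real) has_real_derivative 0) (at x within {0..1})" by (rule DERIV_const)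
  then have "(G s has_real_derivative 0) (at x within {0..1})"
    by (rule has_field_derivative_transform_within[OF _ d(1) x1]) (use d(2) in auto)
  moreover have "(G s has_real_derivative Gq s x) (at x within {0..1})" using C s x1 unfolding C12_def by blast
  ultimately have "Gq s x = 0"
    using vector_derivative_unique_within_closed_interval[of 0 1 x "G s" "Gq s x" 0] x1
    by (simp add: has_real_derivative_iff_has_vector_derivative)
  moreover have "G s x = 0" using d x1 by simp
  ultimately show ?thesis by simp
qed

context heat_flow
begin

context
  fixes T :: real
  assumes range: "\<And>s q. s \<ge> 0 \<Longrightarrow> q \<in> {0..1} \<Longrightarrow> solution s q \<in> {0..1}" and T: "T > 0"
begin

lemma solution_density_path: "density_path T solution"
  using range solution_measurable by (simp add: density_path_def)

lemma solution_Rob: "a = 1 \<Longrightarrow> weak_solution_Rob T \<alpha> \<beta> b g solution"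
  unfolding weak_solution_Rob_def
  using solution_density_path solution_L2_H1[OF range T]
    tested_flow.solution_weak_Rob[OF tested_flow.intro[OF heat_flow_axioms test_function.intro] range] by blast

lemma solution_Dir0: "a = 0 \<Longrightarrow> weak_solution_Dir0 T \<alpha> \<beta> g solution"
  unfolding weak_solution_Dir0_def
  using solution_density_path solution_L2_H1[OF range T]
    tested_flow.solution_weak_Dir[OF tested_flow.intro[OF heat_flow_axioms test_function.intro] range] by blast

lemma solution_Dirc:
  assumes a0: "a = 0"
  shows "weak_solution_Dirc T \<alpha> \<beta> g solution"
  unfolding weak_solution_Dirc_def
proof (intro conjI ballI allI impI)
  show "density_path T solution" by (rule solution_density_path)
  show "solution \<in> L2_H1 T" by (rule solution_L2_H1[OF range T])
  fix t assume t: "t \<in> {0<..T}"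
  have b: "b > 0" using ab_pos a0 by simp
  have s: "solution t = flow t" and t0: "t > 0" using t by (auto simp: solution_def)
  have az: "a * x = 0" for x using a0 by simp
  have "b * (flow t 0 - \<alpha>) = 0" "b * (\<beta> - flow t 1) = 0"
    using flow_bc[OF t0] az[of "flow' t 0"] az[of "flow' t 1"] by linarith+
  then show "solution t 0 = \<alpha>" "solution t 1 = \<beta>" using b unfolding s by simp_all
next
  fix t G Gt Gq Gqq assume t: "t \<in> {0..T}" and C: "C12 T G Gt Gq Gqq" and supp: "compactly_supported T G"
  note z = compactly_supported_boundary[OF C supp]
  have "vanishes_at_boundary T G" using z by (simp add: vanishes_at_boundary_def)
  then have "heat_terms g solution G Gt Gqq t + (LINT s:{0..t}|lebesgue. \<beta> / 2 * Gq s 1 - \<alpha> / 2 * Gq s 0) = 0"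
    using solution_Dir0[OF a0] t C unfolding weak_solution_Dir0_def by blast
  moreover have "(LINT s:{0..t}|lebesgue. \<beta> / 2 * Gq s 1 - \<alpha> / 2 * Gq s 0) = (LINT s:{0..t}|lebesgue. 0)"
    by (rule set_lebesgue_integral_cong) (use z t in auto)
  ultimately show "heat_terms g solution G Gt Gqq t = 0" by simp
qed

end

end

text \<open>\<open>solution\<close> is itself a weak solution of its regime, so it satisfies the
  spectral identity with the same source as any competitor, and the two can be compared mode by
  mode.\<close>

lemma (in hydrodynamic_limit) hydrodynamic_solution_unique:
  assumes T: "T > 0"
  shows "hydrodynamic_solution T \<alpha> \<beta> \<kappa> \<theta> g solution"
    and "hydrodynamic_solution T \<alpha> \<beta> \<kappa> \<theta> g \<rho> \<Longrightarrow> t \<in> {0..T} \<Longrightarrow> AE q in lebesgue_on {0..1}. \<rho> t q = solution t q"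
proof -
  have unique: "AE q in lebesgue_on {0..1}. \<rho> t q = solution t q"
    if "density_path T \<rho>" "\<rho> \<in> L2_H1 T" "spectral_identity T K \<rho>" "spectral_identity T K solution" "t \<in> {0..T}" for K
  proof -
    have "density_path T solution" by (rule solution_density_path[OF _ T]) (rule solution_range)
    moreover have "solution \<in> L2_H1 T" by (rule solution_L2_H1[OF _ T]) (rule solution_range)
    ultimately show ?thesis by (rule spectral_identity_unique[OF _ _ that(4) that(1,2,3,5)])
  qed
  have ab: "\<theta> < 1 \<Longrightarrow> a = 0" "\<theta> = 1 \<Longrightarrow> a = 1 \<and> b = \<kappa>" "\<theta> > 1 \<Longrightarrow> a = 1 \<and> b = 0"
    using boundary_regime by auto
  have ex: "a = 0 \<Longrightarrow> weak_solution_Dirc T \<alpha> \<beta> g solution" "a = 0 \<Longrightarrow> weak_solution_Dir0 T \<alpha> \<beta> g solution"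
    "a = 1 \<Longrightarrow> weak_solution_Rob T \<alpha> \<beta> b g solution"
    by (rule solution_Dirc[OF _ T] solution_Dir0[OF _ T] solution_Rob[OF _ T], rule solution_range; assumption)+
  consider "\<theta> < 0" | "\<theta> \<ge> 0" "\<theta> < 1" | "\<theta> = 1" | "\<theta> > 1" by linarith
  then have "hydrodynamic_solution T \<alpha> \<beta> \<kappa> \<theta> g solution \<and>
    (hydrodynamic_solution T \<alpha> \<beta> \<kappa> \<theta> g \<rho> \<longrightarrow> t \<in> {0..T} \<longrightarrow> (AE q in lebesgue_on {0..1}. \<rho> t q = solution t q))"
  proof cases
    case 1
    then have a0: "a = 0" using ab by simp
    from 1 show ?thesis unfolding hydrodynamic_solution_def
      using ex(1)[OF a0] unique[OF _ _ Dirc_spectral_identity[OF a0] Dirc_spectral_identity[OF a0 ex(1)[OF a0]]]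
      by (auto simp: weak_solution_Dirc_def)
  next
    case 2
    then have a0: "a = 0" using ab by simp
    from 2 show ?thesis unfolding hydrodynamic_solution_def
      using ex(2)[OF a0] unique[OF _ _ Dir0_spectral_identity[OF a0] Dir0_spectral_identity[OF a0 ex(2)[OF a0]]]
      by (auto simp: weak_solution_Dir0_def)
  next
    case 3
    then have a1: "a = 1" and b: "b = \<kappa>" using ab by auto
    from 3 show ?thesis unfolding hydrodynamic_solution_def b[symmetric]
      using ex(3)[OF a1] unique[OF _ _ Rob_spectral_identity[OF a1] Rob_spectral_identity[OF a1 ex(3)[OF a1]]]
      by (auto simp: weak_solution_Rob_def)
  next
    case 4
    then have a1: "a = 1" and b: "b = 0" using ab by auto
    from 4 have "hydrodynamic_solution T \<alpha> \<beta> \<kappa> \<theta> g = weak_solution_Rob T \<alpha> \<beta> b g"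
      by (simp add: hydrodynamic_solution_def[abs_def] b)
    then show ?thesis
      using ex(3)[OF a1] unique[OF _ _ Rob_spectral_identity[OF a1] Rob_spectral_identity[OF a1 ex(3)[OF a1]]]
      by (auto simp: weak_solution_Rob_def)
  qed
  then show "hydrodynamic_solution T \<alpha> \<beta> \<kappa> \<theta> g solution"
    "hydrodynamic_solution T \<alpha> \<beta> \<kappa> \<theta> g \<rho> \<Longrightarrow> t \<in> {0..T} \<Longrightarrow> AE q in lebesgue_on {0..1}. \<rho> t q = solution t q"
    by blast+
qed

theorem theorem1:
  fixes T \<alpha> \<beta> \<kappa> \<theta> :: real
    and g :: "real \<Rightarrow> real"
    and \<mu> :: "nat \<Rightarrow> config measure"
    and M :: "nat \<Rightarrow> 'a measure"
    and \<eta> :: "nat \<Rightarrow> real \<Rightarrow> 'a \<Rightarrow> config"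
  assumes "T > 0"
    and "\<alpha> \<in> {0..1}" and "\<beta> \<in> {0..1}"
    and "\<kappa> > 0"
    and "g \<in> borel_measurable (lebesgue_on {0..1})" and "g \<in> {0..1} \<rightarrow> {0..1}"
    and "\<And>N. N \<ge> 1 \<Longrightarrow> prob_space (\<mu> N)"
    and "\<And>N. N \<ge> 1 \<Longrightarrow> sets (\<mu> N) = sets (count_space (configs N))"
    and "associated \<mu> g"
    and "\<And>N. N \<ge> 3 \<Longrightarrow> markov_process (M N) (\<eta> N) (configs N)
           (\<lambda>f \<xi>. (real N)\<^sup>2 * exclusion_generator \<alpha> \<beta> \<kappa> \<theta> N f \<xi>) (\<mu> N)"
  shows "\<exists>\<rho>. hydrodynamic_solution T \<alpha> \<beta> \<kappa> \<theta> g \<rho> \<and>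
    (\<forall>\<rho>'. hydrodynamic_solution T \<alpha> \<beta> \<kappa> \<theta> g \<rho>' \<longrightarrow>
      (\<forall>t\<in>{0..T}. AE q in lebesgue_on {0..1}. \<rho>' t q = \<rho> t q)) \<and>
    (\<forall>t\<in>{0..T}. \<forall>G \<delta>. continuous_on {0..1} G \<longrightarrow> \<delta> > 0 \<longrightarrow>
      (\<lambda>N. measure (M N) {\<omega> \<in> space (M N).
        \<bar>empirical N G (\<eta> N t \<omega>) - (LINT q:{0..1}|lebesgue. G q * \<rho> t q)\<bar> > \<delta>}) \<longlonglongrightarrow> 0)"
proof -
  \<comment> \<open>The regimes \<theta> < 0 and 0 \<le> \<theta> < 1 share the Dirichlet basis and
    the same limiting density; they differ in the weak formulation that characterises it.\<close>
  define a where "a = (if \<theta> < 1 then 0 else 1 :: real)"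
  define b where "b = (if \<theta> < 1 then 1 else if \<theta> = 1 then \<kappa> else 0)"
  interpret boundary_pair a b
    by unfold_locales (use assms(4) in \<open>auto simp: a_def b_def\<close>)
  obtain \<phi> \<phi>' lam C where basis: "heat_basis a b \<phi> \<phi>' lam C" using heat_basis_exists by blast
  interpret hydrodynamic_limit a b \<phi> \<phi>' lam C \<alpha> \<beta> \<kappa> \<theta> g \<mu> M \<eta>
  proof (rule hydrodynamic_limit.intro[OF basis hydrodynamic_limit_axioms.intro])
    show "(\<theta> < 1 \<and> a = 0 \<and> b = 1) \<or> (\<theta> = 1 \<and> a = 1 \<and> b = \<kappa>) \<or> (\<theta> > 1 \<and> a = 1 \<and> b = 0)"
      by (auto simp: a_def b_def)
  qed (fact assms)+
  show ?thesis
  proof (intro exI[of _ solution] conjI allI ballI impI)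
    show "hydrodynamic_solution T \<alpha> \<beta> \<kappa> \<theta> g solution" by (rule hydrodynamic_solution_unique(1)[OF assms(1)])
  next
    fix \<rho>' t assume "hydrodynamic_solution T \<alpha> \<beta> \<kappa> \<theta> g \<rho>'" "t \<in> {0..T}"
    then show "AE q in lebesgue_on {0..1}. \<rho>' t q = solution t q" by (rule hydrodynamic_solution_unique(2)[OF assms(1)])
  next
    fix t G and \<delta> :: real assume t: "t \<in> {0..T}" and G: "cont01 G" and \<delta>: "\<delta> > 0"
    then have "t \<ge> 0" by simp
    then show "(\<lambda>N. measure (M N) {\<omega> \<in> space (M N).
        \<bar>empirical N G (\<eta> N t \<omega>) - (LINT q:{0..1}|lebesgue. G q * solution t q)\<bar> > \<delta>}) \<longlonglongrightarrow> 0"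
      by (intro mean_square_imp_probability empirical_mean_square G \<delta>)
  qed
qed

end
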